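(* (Double shuffle relations for RSMZVs.) We have \begin{itemize} \item $Z^{RS}(u\sqcup\!\sqcup v)=2\pi iZ^{RS}(u)Z^{RS}(v)$ for $u,v\in\mathfrak{h}$, \item $Z^{RS}(u*v)=Z^{RS}(u)Z^{RS}(v)$ for $u,v\in\mathfrak{h}^{0}$. \end{itemize}
   Context: Let $\mathfrak{h}=e_{0}\mathbb{Q}\langle e_{0},e_{1}\rangle\oplus e_{1}\mathbb{Q}\langle e_{0},e_{1}\rangle$ (non-constant part of the free algebra) and $\mathfrak{h}^{0}=e_{1}\mathbb{Q}\oplus e_{1}\mathbb{Q}\langle e_{0},e_{1}\rangle e_{1}$. For an index put $w(k_{1},\dots,k_{d})=(-1)^{d}e_{1}e_{0}^{k_{1}-1}e_{1}\cdots e_{1}e_{0}^{k_{d}-1}e_{1}$ (so $w(\emptyset)=e_1$); these form a basis of $\mathfrak{h}^0$. Regularized iterated integrals: $I_{\Gamma}(x;a_{1},\dots,a_{n};y)$ is the constant term $c_0$ of the expansion $\int_{t<t_{1}<\cdots<t_{n}<1-t}\prod_{j}\frac{d\gamma(t_{j})}{\gamma(t_{j})-a_{j}}=\sum_{k}c_{k}(\log t)^{k}+O(t\log^{n+1}t)$, $t\to0$, for a path $\gamma$ in class $\Gamma$. With $0'$ the tangential base point at $0$ with tangent $1$, $1'$ at $1$ with tangent $-1$, ${\rm dch}$ the straight path $0'\to1'$, $\alpha$ the loop at $1'$ circling $1$ once counterclockwise, $\beta={\rm dch}\cdot\alpha\cdot{\rm dch}^{-1}$, define the linear map $Z^{RS}:\mathfrak{h}\to\mathbb{C}$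 by $Z^{RS}(e_{a_{1}}\cdots e_{a_{k}})=\frac{1}{2\pi i}I_{\beta}(0';a_{1},\dots,a_{k};0')$. The shuffle product is defined by $u\sqcup\!\sqcup1=1\sqcup\!\sqcup u=u$, $e_{a}u\sqcup\!\sqcup e_{b}u'=e_{a}(u\sqcup\!\sqcup e_{b}u')+e_{b}(e_{a}u\sqcup\!\sqcup u')$. The harmonic product $*$ on $\mathfrak{h}^0$ is defined by $e_{1}*u=u*e_{1}=u$ and $w(k_{1},\dots,k_{a})*w(l_{1},\dots,l_{b})=-e_{1}e_{0}^{k_{1}-1}(w(k_{2},\dots,k_{a})*w(l_{1},\dots,l_{b}))-e_{1}e_{0}^{l_{1}-1}(w(k_{1},\dots,k_{a})*w(l_{2},\dots,l_{b}))+e_{1}e_{0}^{k_{1}+l_{1}-1}(w(k_{2},\dots,k_{a})*w(l_{2},\dots,l_{b}))$.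
   Formalization: In the recursion for the harmonic product the third term is taken with a minus sign, −e₁e₀^{k₁+l₁−1}(…), instead of the printed plus sign, since with plus the second relation fails for u=v=w(1) (−5π²/3 instead of −π²). *)

theory Defs
  imports "HOL-Analysis.Analysis" "HOL-Library.Landau_Symbols" "HOL-Library.Poly_Mapping"
begin

section \<open>The free algebra on two generators\<close>

datatype letter = E0 | E1

text \<open>Words form the free monoid under concatenation, so \<open>letter list \<Rightarrow>\<^sub>0 rat\<close> with the
  convolution product of \<^theory>\<open>HOL-Library.Poly_Mapping\<close> is the free algebra.\<close>

instantiation list :: (type) monoid_add
begin
definition zero_list :: "'a list" where "zero_list = []"
definition plus_list :: "'a list \<Rightarrow> 'a list \<Rightarrow> 'a list" where "plus_list = (@)"
instance by standard (simp_all add: zero_list_def plus_list_def)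
end

type_synonym ncpoly = "letter list \<Rightarrow>\<^sub>0 rat"

definition gen :: "letter \<Rightarrow> ncpoly"
  where "gen a = Poly_Mapping.single [a] 1"

definition scal :: "rat \<Rightarrow> ncpoly \<Rightarrow> ncpoly"
  where "scal c p = Poly_Mapping.single [] c * p"

definition hh :: "ncpoly set"
  where "hh = {gen E0 * p + gen E1 * q | p q. True}"

definition hh0 :: "ncpoly set"
  where "hh0 = {scal c (gen E1) + gen E1 * p * gen E1 | c p. True}"

section \<open>Shuffle product\<close>

fun shuffle_word :: "letter list \<Rightarrow> letter list \<Rightarrow> ncpoly" where
  "shuffle_word [] v = Poly_Mapping.single v 1"
| "shuffle_word (a # u) [] = Poly_Mapping.single (a # u) 1"
| "shuffle_word (a # u) (b # v) =
     gen a * shuffle_word u (b # v) + gen b * shuffle_word (a # u) v"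

definition shuffle_prod :: "ncpoly \<Rightarrow> ncpoly \<Rightarrow> ncpoly" where
  "shuffle_prod p q =
     (\<Sum>u\<in>Poly_Mapping.keys p. \<Sum>v\<in>Poly_Mapping.keys q.
        scal (Poly_Mapping.lookup p u * Poly_Mapping.lookup q v) (shuffle_word u v))"

section \<open>Harmonic product\<close>

definition is_index :: "nat list \<Rightarrow> bool"
  where "is_index ks \<longleftrightarrow> (\<forall>k\<in>set ks. 1 \<le> k)"

definition w :: "nat list \<Rightarrow> ncpoly"
  where "w ks = (- 1) ^ length ks * prod_list (map (\<lambda>k. gen E1 * gen E0 ^ (k - 1)) ks) * gen E1"

text \<open>The only word occurring in \<open>w ks\<close> (see \<open>w_eq_scal\<close> below).\<close>

definition index_word :: "nat list \<Rightarrow> letter list"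
  where "index_word ks = concat (map (\<lambda>k. E1 # replicate (k - 1) E0) ks) @ [E1]"

text \<open>The last term must carry a minus sign. With a plus sign the product would not be
  compatible with the integrals below: for \<open>w [1] * w [1]\<close> one needs
  \<open>2 * w [1,1] + w [2] = 2 e1 e1 e1 - e1 e0 e1\<close>, since the three words \<open>e1 e1\<close>, \<open>e1 e1 e1\<close>,
  \<open>e1 e0 e1\<close> are mapped to \<open>pi i\<close>, \<open>- 2 pi^2 / 3\<close>, \<open>- pi^2 / 3\<close>.\<close>

fun harmonic_index :: "nat list \<Rightarrow> nat list \<Rightarrow> ncpoly" where
  "harmonic_index [] ls = w ls"
| "harmonic_index (k # ks) [] = w (k # ks)"
| "harmonic_index (k # ks) (l # ls) =
     - (gen E1 * gen E0 ^ (k - 1) * harmonic_index ks (l # ls))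
     - gen E1 * gen E0 ^ (l - 1) * harmonic_index (k # ks) ls
     - gen E1 * gen E0 ^ (k + l - 1) * harmonic_index ks ls"

definition index_support :: "ncpoly \<Rightarrow> nat list set"
  where "index_support p = {ks. is_index ks \<and> index_word ks \<in> Poly_Mapping.keys p}"

definition index_coeff :: "ncpoly \<Rightarrow> nat list \<Rightarrow> rat"
  where "index_coeff p ks = (- 1) ^ length ks * Poly_Mapping.lookup p (index_word ks)"

text \<open>Bilinear extension from the basis \<open>w ks\<close> of \<open>hh0\<close>; meaningful for arguments
  in \<open>hh0\<close> only.\<close>

definition harmonic_prod :: "ncpoly \<Rightarrow> ncpoly \<Rightarrow> ncpoly" where
  "harmonic_prod p q =
     (\<Sum>ks\<in>index_support p. \<Sum>ls\<in>index_support q.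
        scal (index_coeff p ks * index_coeff q ls) (harmonic_index ks ls))"

section \<open>Paths between tangential base points\<close>

text \<open>A tangential base point is a pair (point, tangent vector).\<close>

type_synonym tbp = "complex \<times> complex"

definition tbp0 :: tbp where "tbp0 = (0, 1)"
definition tbp1 :: tbp where "tbp1 = (1, - 1)"

definition smooth_on_segment :: "(real \<Rightarrow> complex) \<Rightarrow> real \<Rightarrow> real \<Rightarrow> bool" where
  "smooth_on_segment g a b \<longleftrightarrow>
     (\<exists>D :: nat \<Rightarrow> real \<Rightarrow> complex. (\<forall>t\<in>{a..b}. D 0 t = g t) \<and>
        (\<forall>n. \<forall>t\<in>{a..b}. (D n has_vector_derivative D (Suc n) t) (at t within {a..b})))"

definition piecewise_smooth :: "(real \<Rightarrow> complex) \<Rightarrow> bool" where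
  "piecewise_smooth g \<longleftrightarrow> path g \<and>
     (\<exists>S. finite S \<and> {0, 1} \<subseteq> S \<and> S \<subseteq> {0..1} \<and>
        (\<forall>a\<in>S. \<forall>b\<in>S. a < b \<and> S \<inter> {a<..<b} = {} \<longrightarrow> smooth_on_segment g a b))"

definition tpath :: "tbp \<Rightarrow> tbp \<Rightarrow> (real \<Rightarrow> complex) \<Rightarrow> bool" where
  "tpath x y g \<longleftrightarrow> piecewise_smooth g \<and>
     g 0 = fst x \<and> (g has_vector_derivative snd x) (at 0 within {0..1}) \<and>
     g 1 = fst y \<and> (g has_vector_derivative - snd y) (at 1 within {0..1}) \<and>
     (\<forall>t\<in>{0<..<1}. g t \<notin> {0, 1})"

text \<open>Homotopies in the complement of \<open>{0, 1}\<close>. The paths of the family must leave the first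
  base point and reach the second one in the prescribed directions, uniformly in the
  deformation parameter: if this were only required of each path separately, a turn around
  the base point could be shrunk into it and the homotopy classes would collapse.\<close>

definition thomotopic :: "tbp \<Rightarrow> tbp \<Rightarrow> (real \<Rightarrow> complex) \<Rightarrow> (real \<Rightarrow> complex) \<Rightarrow> bool" where
  "thomotopic x y p q \<longleftrightarrow>
     (\<exists>H :: real \<times> real \<Rightarrow> complex.
        continuous_on ({0..1} \<times> {0..1}) H \<and>
        (\<forall>t\<in>{0..1}. H (0, t) = p t \<and> H (1, t) = q t) \<and>
        (\<forall>s\<in>{0..1}. H (s, 0) = fst x \<and> H (s, 1) = fst y \<and>
           (\<forall>t\<in>{0<..<1}. H (s, t) \<notin> {0, 1})) \<and>
        uniform_limit {0..1} (\<lambda>t s. sgn (H (s, t) - fst x)) (\<lambda>s. sgn (snd x)) (at_right 0) \<and>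
        uniform_limit {0..1} (\<lambda>t s. sgn (H (s, t) - fst y)) (\<lambda>s. sgn (snd y)) (at_left 1))"

text \<open>Composition at a tangential base point: the corner is cut off at distance about \<open>\<epsilon>\<close>. Up to
  \<open>thomotopic\<close>, which ignores the speed at the end points, the result does not depend on \<open>\<epsilon>\<close> as
  long as \<open>\<epsilon>\<close> is small.\<close>

definition tjoin :: "real \<Rightarrow> (real \<Rightarrow> complex) \<Rightarrow> (real \<Rightarrow> complex) \<Rightarrow> real \<Rightarrow> complex" where
  "tjoin \<epsilon> p q =
     subpath 0 (1 - \<epsilon>) p +++ (linepath (p (1 - \<epsilon>)) (q \<epsilon>) +++ subpath \<epsilon> 1 q)"

definition dch :: "real \<Rightarrow> complex"
  where "dch = linepath 0 1"

definition alpha :: "real \<Rightarrow> complex" where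
  "alpha t = (if t \<le> 1/3 then 1 - of_real t
              else if t \<le> 2/3 then 1 - exp (2 * of_real pi * \<i> * of_real (3 * t - 1)) / 3
              else of_real t)"

definition beta_class :: "(real \<Rightarrow> complex) set" where
  "beta_class = {g. tpath tbp0 tbp0 g \<and>
     (\<forall>\<^sub>F \<epsilon> in at_right 0.
        thomotopic tbp0 tbp0 g (tjoin \<epsilon> (tjoin \<epsilon> dch alpha) (reversepath dch)))}"

section \<open>Regularized iterated integrals\<close>

text \<open>\<open>iterint g [a\<^sub>1, \<dots>, a\<^sub>n] r s\<close> is the integral over \<open>r < t\<^sub>1 < \<dots> < t\<^sub>n < s\<close>.\<close>

fun iterint :: "(real \<Rightarrow> complex) \<Rightarrow> complex list \<Rightarrow> real \<Rightarrow> real \<Rightarrow> complex" where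
  "iterint g [] r s = 1"
| "iterint g (a # as) r s =
     integral {r..s} (\<lambda>t. vector_derivative g (at t) / (g t - a) * iterint g as t s)"

definition has_reg_value :: "(real \<Rightarrow> complex) \<Rightarrow> complex list \<Rightarrow> complex \<Rightarrow> bool" where
  "has_reg_value g as c \<longleftrightarrow>
     (\<exists>cs :: nat \<Rightarrow> complex. cs 0 = c \<and>
        (\<lambda>t. iterint g as t (1 - t) - (\<Sum>k\<le>length as. cs k * of_real (ln t) ^ k))
          \<in> O[at_right 0](\<lambda>t. of_real (t * ln t ^ (length as + 1))))"

definition reg_int :: "(real \<Rightarrow> complex) set \<Rightarrow> complex list \<Rightarrow> complex"
  where "reg_int \<Gamma> as = (THE c. \<forall>g\<in>\<Gamma>. has_reg_value g as c)"

fun letter_point :: "letter \<Rightarrow> complex" where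
  "letter_point E0 = 0"
| "letter_point E1 = 1"

definition Z_RS :: "ncpoly \<Rightarrow> complex" where
  "Z_RS p = (\<Sum>u\<in>Poly_Mapping.keys p. of_rat (Poly_Mapping.lookup p u) *
     (1 / (2 * of_real pi * \<i>) * reg_int beta_class (map letter_point u)))"

section \<open>Sanity checks\<close>

lemma gen_power: "gen a ^ n = Poly_Mapping.single (replicate n a) 1"
  by (induction n) (simp_all add: gen_def mult_single plus_list_def zero_list_def flip: single_one)

lemma w_Nil: "w [] = gen E1"
  by (simp add: w_def)

lemma neg_one_power_mult: "(- 1) ^ n * p = scal ((- 1) ^ n) (p :: ncpoly)"
proof (cases "even n")
  case True
  then show ?thesis by (simp add: scal_def flip: zero_list_def)
next
  case False
  have "scal (- 1) p = - p"
    by (simp add: scal_def single_uminus flip: zero_list_def)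
  with False show ?thesis by simp
qed

lemma w_eq_scal: "w ks = scal ((- 1) ^ length ks) (Poly_Mapping.single (index_word ks) 1)"
proof -
  have "prod_list (map (\<lambda>k. gen E1 * gen E0 ^ (k - 1)) ks) * gen E1 =
      Poly_Mapping.single (index_word ks) 1"
  proof (induction ks)
    case Nil
    then show ?case by (simp add: gen_def index_word_def)
  next
    case (Cons k ks)
    then show ?case
      by (simp add: mult.assoc gen_power)
         (simp add: gen_def mult_single plus_list_def index_word_def)
  qed
  then show ?thesis
    unfolding w_def mult.assoc neg_one_power_mult[of _ "_ * gen E1"] by simp
qed

lemma shuffle_prod_single:
  "shuffle_prod (Poly_Mapping.single u 1) (Poly_Mapping.single v 1) = shuffle_word u v"
  by (simp add: shuffle_prod_def scal_def flip: zero_list_def)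

lemma index_word_inj:
  "is_index ks \<Longrightarrow> is_index ls \<Longrightarrow> index_word ks = index_word ls \<Longrightarrow> ks = ls"
proof (induction ks arbitrary: ls)
  case Nil
  then show ?case by (cases ls) (auto simp: index_word_def)
next
  case (Cons k ks)
  obtain l ls' where ls: "ls = l # ls'"
    using Cons.prems(3) by (cases ls) (auto simp: index_word_def)
  have tail: "\<exists>v. index_word js = E1 # v" for js
    by (cases js) (auto simp: index_word_def)
  have rep: "m = n \<and> u = v"
    if "replicate m E0 @ E1 # u = replicate n E0 @ E1 # v" for m n u v
    using that
  proof (induction m arbitrary: n)
    case 0
    then show ?case by (cases n) auto
  next
    case (Suc m)
    then show ?case by (cases n) auto
  qed
  have eq: "replicate (k - 1) E0 @ index_word ks = replicate (l - 1) E0 @ index_word ls'"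
    using Cons.prems(3) by (simp add: ls index_word_def)
  obtain u v where uv: "index_word ks = E1 # u" "index_word ls' = E1 # v"
    using tail by blast
  have "k - 1 = l - 1 \<and> u = v"
    using rep eq unfolding uv by blast
  moreover have "1 \<le> k" "1 \<le> l" "is_index ks" "is_index ls'"
    using Cons.prems(1,2) by (auto simp: ls is_index_def)
  ultimately show ?case
    using Cons.IH[of ls'] uv by (auto simp: ls)
qed

lemma harmonic_prod_w:
  assumes "is_index ks" "is_index ls"
  shows "harmonic_prod (w ks) (w ls) = harmonic_index ks ls"
proof -
  have w: "w js = Poly_Mapping.single (index_word js) ((- 1) ^ length js)" for js
    by (simp add: w_eq_scal scal_def mult_single flip: zero_list_def)
  have supp: "index_support (w js) = {js}" if "is_index js" for js
    using that index_word_inj by (auto simp: index_support_def w)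
  have coeff: "index_coeff (w js) js = 1" for js
    by (cases "even (length js)") (simp_all add: index_coeff_def w)
  show ?thesis
    using assms by (simp add: harmonic_prod_def supp coeff scal_def flip: zero_list_def)
qed

lemma index_word_surj: "\<exists>ks. is_index ks \<and> E1 # v @ [E1] = index_word ks"
proof (induction v)
  case Nil
  show ?case by (rule exI[of _ "[1]"]) (simp add: is_index_def index_word_def)
next
  case (Cons a v)
  then obtain ks where ks: "is_index ks" "E1 # v @ [E1] = index_word ks" by blast
  show ?case
  proof (cases a)
    case E0
    obtain k ks' where "ks = k # ks'" "1 \<le> k"
      using ks by (cases ks) (auto simp: index_word_def is_index_def)
    then show ?thesis
      using ks E0
      by (intro exI[of _ "Suc k # ks'"])
         (cases k; simp add: index_word_def is_index_def)
  next
    case E1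
    then show ?thesis
      using ks by (intro exI[of _ "1 # ks"]) (simp add: index_word_def is_index_def)
  qed
qed

lemma keys_hh0:
  assumes "p \<in> hh0" "u \<in> Poly_Mapping.keys p"
  shows "\<exists>ks. is_index ks \<and> u = index_word ks"
proof -
  obtain c q where p: "p = scal c (gen E1) + gen E1 * q * gen E1"
    using assms(1) by (auto simp: hh0_def)
  have "u \<in> Poly_Mapping.keys (scal c (gen E1)) \<or> u \<in> Poly_Mapping.keys (gen E1 * q * gen E1)"
    using assms(2) Poly_Mapping.keys_add[of "scal c (gen E1)" "gen E1 * q * gen E1"]
    by (auto simp: p)
  then show ?thesis
  proof
    assume "u \<in> Poly_Mapping.keys (scal c (gen E1))"
    then have "u = index_word []"
      by (auto simp: scal_def gen_def mult_single plus_list_def index_word_def split: if_splits)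
    then show ?thesis by (intro exI[of _ "[]"]) (simp add: is_index_def)
  next
    assume "u \<in> Poly_Mapping.keys (gen E1 * q * gen E1)"
    then obtain x where x: "x \<in> Poly_Mapping.keys (gen E1 * q)" "u = x @ [E1]"
      using keys_mult[of "gen E1 * q" "gen E1"] by (auto simp: gen_def plus_list_def)
    obtain v where "x = E1 # v"
      using x(1) keys_mult[of "gen E1" q] by (auto simp: gen_def plus_list_def)
    with x(2) have "\<exists>v. u = E1 # v @ [E1]" by simp
    then show ?thesis using index_word_surj by blast
  qed
qed

end

theory Submission
  imports Defs "HOL-Complex_Analysis.Complex_Analysis" "HOL-Real_Asymp.Real_Asymp"
begin

text \<open>By homotopy invariance of iterated integrals and Chen's composition formula, the regularized
  integrals over the class of \<open>\<beta>\<close> are those of one explicit loop. Both sides of the shuffle relation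
  for this loop satisfy the same differential equation in the lower end point.

  For the harmonic relation substitute \<open>z = 1 - exp l\<close>. The loop becomes a path in the half plane
  \<open>Re l < 0\<close> from \<open>- 2 pi i\<close> to \<open>0\<close>, and the value at \<open>w ks\<close> becomes, up to a sign, the integral \<open>a ks 0\<close>
  of a polylogarithm, where \<open>a ks N\<close> has the additional factor \<open>(1 - exp l) ^ N\<close> in the integrand.
  Integration by parts gives
  \<open>a (k # ks) N = a (k # ks) (N + 1) + (- 1 / (N + 1)) ^ k * a ks (N + 1)\<close>, and
  therefore the defect \<open>a ks N * a ls N - a (ks * ls) N\<close> does not depend on \<open>N\<close>. It tends to 0: for large \<open>N\<close> only
  the behaviour of the polylogarithm for \<open>Re l \<rightarrow> - \<infinity>\<close> matters, which is polynomial in \<open>l\<close> with the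
  coefficients that express the harmonic sum \<open>h ks N\<close> by those of the indices \<open>(1, \<dots>, 1)\<close>.
  For the latter indices the product formula for the sine applies, and the result is
  \<open>a ks N = \<Sum>i. (pi i) ^ i / fact i * h (d ^ i ks) N + o(1)\<close> with a derivation \<open>d\<close> of the harmonic product,
  so that the right-hand side inherits multiplicativity from the harmonic sums.\<close>

section \<open>Iterated integrals and transport along segments\<close>

text \<open>Harmonic sums whose index starts with 1 diverge, so the harmonic relation cannot be read
  off from limits: only differences between integrals and sums truncated at \<open>N\<close> are
  small. Hence every asymptotic statement carries a rate. Harmonic sums are O(N^(1/8)), the errors
  are O(N^(-1/4)), and a product of the two still vanishes. The exponential of \<open>d\<close> has
  its origin at \<open>N = 0\<close>: for the indices (1, ..., 1) the generating function of the
  integrals is (exp (2 pi i z) - 1) / (2 pi i z), which is exp (pi i z) times sin (pi z) / (pi z).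
  The sine is used up by its product formula and leaves the product of the 1 + z / k, the generating
  function of the sums. The factor exp (pi i z) stays, and multiplication by it is exp (pi i d) on
  these indices. For the paths the obstacle is the tangential base point: cut off at parameter
  \<open>t\<close>, two paths of one class have different end points. These differ by O(t^2) while
  the forms have size 1 / t, so the transport between them is 1 + O(t) and leaves the constant term
  alone.\<close>

type_synonym series = "letter list \<Rightarrow> complex"

text \<open>The product of noncommutative power series: the sum of \<open>F v * G w\<close> over all
  splittings of \<open>u\<close> into \<open>v @ w\<close>. The recursion removes first letters, on
  which the equation \<open>flat\<close> acts.\<close>

fun conv :: "series \<Rightarrow> series \<Rightarrow> series" where
  "conv F G [] = F [] * G []"
| "conv F G (a # u) = F [] * G (a # u) + conv (\<lambda>v. F (a # v)) G u"

definition eps :: series where "eps u = (if u = [] then 1 else 0)"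

lemma eps_simps [simp]: "eps [] = 1" "eps (a # u) = 0"
  by (simp_all add: eps_def)

lemma conv_zero_left [simp]: "conv (\<lambda>v. 0) G u = 0"
  by (induction u) auto

lemma conv_scale_left: "conv (\<lambda>v. c * F v) G u = c * conv F G u"
  by (induction u arbitrary: F) (auto simp: algebra_simps)

lemma conv_add_left: "conv (\<lambda>v. F v + F' v) G u = conv F G u + conv F' G u"
  by (induction u arbitrary: F F') (auto simp: algebra_simps)

lemma conv_eps_left [simp]: "conv eps G = G"
proof
  fix u show "conv eps G u = G u" by (cases u) auto
qed

lemma conv_eps_right [simp]: "conv F eps = F"
proof
  fix u show "conv F eps u = F u" by (induction u arbitrary: F) auto
qed

lemma conv_assoc: "conv (conv F G) H = conv F (conv G H)"
proof
  fix u show "conv (conv F G) H u = conv F (conv G H) u"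
  proof (induction u arbitrary: F)
    case (Cons a u)
    then show ?case
      by (simp add: conv_add_left conv_scale_left algebra_simps)
  qed simp
qed

lemma has_vector_derivative_conv_left:
  assumes "\<And>v. ((\<lambda>t. F t v) has_vector_derivative F' v) (at t)"
  shows "((\<lambda>t. conv (F t) G u) has_vector_derivative conv F' G u) (at t)"
  using assms
proof (induction u arbitrary: F F')
  case Nil
  then show ?case by (auto intro!: derivative_eq_intros)
next
  case (Cons a u)
  have "((\<lambda>t. conv (\<lambda>v. F t (a # v)) G u) has_vector_derivative conv (\<lambda>v. F' (a # v)) G u) (at t)"
    by (rule Cons.IH[of "\<lambda>t v. F t (a # v)"]) (rule Cons.prems)
  then show ?case
    using Cons.prems[of "[]"] by (auto intro!: derivative_eq_intros)
qed

lemma has_field_derivative_conv_left: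
  fixes F :: "complex \<Rightarrow> series"
  assumes "\<And>v. ((\<lambda>t. F t v) has_field_derivative F' v) (at t)"
  shows "((\<lambda>t. conv (F t) G u) has_field_derivative conv F' G u) (at t)"
  using assms
proof (induction u arbitrary: F F')
  case Nil
  then show ?case by (auto intro!: derivative_eq_intros)
next
  case (Cons a u)
  have "((\<lambda>t. conv (\<lambda>v. F t (a # v)) G u) has_field_derivative conv (\<lambda>v. F' (a # v)) G u) (at t)"
    by (rule Cons.IH[of "\<lambda>t v. F t (a # v)"]) (rule Cons.prems)
  then show ?case
    using Cons.prems[of "[]"] by (auto intro!: derivative_eq_intros)
qed

lemma continuous_on_conv_left:
  assumes "\<And>v. continuous_on S (\<lambda>t. F t v)"
  shows "continuous_on S (\<lambda>t. conv (F t) G u)"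
  using assms by (induction u arbitrary: F) (auto intro!: continuous_intros)

section \<open>The differential equation satisfied by iterated integrals\<close>

definition form :: "(real \<Rightarrow> complex) \<Rightarrow> letter \<Rightarrow> real \<Rightarrow> complex" where
  "form g a t = vector_derivative g (at t) / (g t - letter_point a)"

text \<open>The equation \<open>d \<Phi> = - (\<Sum>a. form a * e a) * \<Phi>\<close> along \<open>g\<close>; iterated integrals solve it in their lower
  limit, see \<open>flat_word_int\<close>.\<close>

definition flat :: "(real \<Rightarrow> complex) \<Rightarrow> real \<Rightarrow> real \<Rightarrow> (real \<Rightarrow> series) \<Rightarrow> bool" where
  "flat g c d \<Phi> \<longleftrightarrow> (\<forall>u. continuous_on {c..d} (\<lambda>t. \<Phi> t u)) \<and> (\<forall>t\<in>{c..d}. \<Phi> t [] = \<Phi> d []) \<and>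
     (\<exists>S. finite S \<and> (\<forall>t\<in>{c<..<d} - S. \<forall>a u.
        ((\<lambda>t. \<Phi> t (a # u)) has_vector_derivative - (form g a t * \<Phi> t u)) (at t)))"

definition word_int :: "(real \<Rightarrow> complex) \<Rightarrow> real \<Rightarrow> real \<Rightarrow> series" where
  "word_int g c d u = iterint g (map letter_point u) c d"

lemma word_int_Nil [simp]: "word_int g c d [] = 1"
  by (simp add: word_int_def)

lemma word_int_Cons: "word_int g c d (a # u) = integral {c..d} (\<lambda>t. form g a t * word_int g t d u)"
  by (simp add: word_int_def form_def)

lemma flatD_cont: "flat g c d \<Phi> \<Longrightarrow> continuous_on {c..d} (\<lambda>t. \<Phi> t u)"
  and flatD_Nil: "flat g c d \<Phi> \<Longrightarrow> t \<in> {c..d} \<Longrightarrow> \<Phi> t [] = \<Phi> d []"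
  unfolding flat_def by blast+

lemma flatE:
  assumes "flat g c d \<Phi>"
  obtains S where "finite S" "\<And>t a u. t \<in> {c<..<d} - S \<Longrightarrow>
    ((\<lambda>t. \<Phi> t (a # u)) has_vector_derivative - (form g a t * \<Phi> t u)) (at t)"
  using assms unfolding flat_def by blast

text \<open>The equation is linear and acts on the first letter, so multiplication by a constant
  series on the right preserves it.\<close>

lemma flat_conv:
  assumes "flat g c d \<Phi>"
  shows "flat g c d (\<lambda>t. conv (\<Phi> t) G)"
proof -
  obtain S where S: "finite S" "\<And>t a u. t \<in> {c<..<d} - S \<Longrightarrow>
    ((\<lambda>t. \<Phi> t (a # u)) has_vector_derivative - (form g a t * \<Phi> t u)) (at t)"
    using assms(1) by (rule flatE) (rule that)
  show ?thesis
    unfolding flat_def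
  proof (intro conjI allI exI[of _ S] ballI)
    fix u show "continuous_on {c..d} (\<lambda>t. conv (\<Phi> t) G u)"
      by (intro continuous_on_conv_left flatD_cont[OF assms])
  next
    fix t assume "t \<in> {c..d}"
    then show "conv (\<Phi> t) G [] = conv (\<Phi> d) G []"
      using flatD_Nil[OF assms(1), of t] by simp
  next
    fix t a u assume t: "t \<in> {c<..<d} - S"
    define F' where "F' v = (case v of [] \<Rightarrow> 0 | b # v' \<Rightarrow> - (form g b t * \<Phi> t v'))" for v
    have 0: "((\<lambda>t. \<Phi> t []) has_vector_derivative 0) (at t)"
    proof (rule has_vector_derivative_transform_within_open[of "\<lambda>_. \<Phi> d []" _ _ "{c<..<d}"])
      show "\<And>x. x \<in> {c<..<d} \<Longrightarrow> \<Phi> d [] = \<Phi> x []"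
        using flatD_Nil[OF assms(1)] by (metis atLeastAtMost_iff greaterThanLessThan_iff less_eq_real_def)
    qed (use t in auto)
    have "((\<lambda>t. \<Phi> t v) has_vector_derivative F' v) (at t)" for v
      using 0 S(2)[OF t] by (cases v) (auto simp: F'_def)
    then have "((\<lambda>t. conv (\<Phi> t) G (a # u)) has_vector_derivative conv F' G (a # u)) (at t)"
      by (rule has_vector_derivative_conv_left)
    moreover have "conv F' G (a # u) = - (form g a t * conv (\<Phi> t) G u)"
      using conv_scale_left[of "- form g a t" "\<Phi> t" G u] by (simp add: F'_def)
    ultimately show "((\<lambda>t. conv (\<Phi> t) G (a # u)) has_vector_derivative
        - (form g a t * conv (\<Phi> t) G u)) (at t)"
      by simp
  qed (rule S(1))
qed

text \<open>Induction on the word: once the entries at \<open>u\<close> agree, those at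
  \<open>a # u\<close> have the same derivative off a finite set and the same value at
  \<open>d\<close>.\<close>

lemma flat_unique:
  assumes "flat g c d \<Phi>" "flat g c d \<Psi>" "\<Phi> d = \<Psi> d" "t \<in> {c..d}"
  shows "\<Phi> t = \<Psi> t"
proof
  obtain S where S: "finite S" "\<And>t a u. t \<in> {c<..<d} - S \<Longrightarrow>
    ((\<lambda>t. \<Phi> t (a # u)) has_vector_derivative - (form g a t * \<Phi> t u)) (at t)"
    using assms(1) by (rule flatE) (rule that)
  obtain S' where S': "finite S'" "\<And>t a u. t \<in> {c<..<d} - S' \<Longrightarrow>
    ((\<lambda>t. \<Psi> t (a # u)) has_vector_derivative - (form g a t * \<Psi> t u)) (at t)"
    using assms(2) by (rule flatE) (rule that)
  fix u show "\<Phi> t u = \<Psi> t u"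
    using assms(4)
  proof (induction u arbitrary: t)
    case Nil
    then show ?case
      by (metis flatD_Nil[OF assms(1)] flatD_Nil[OF assms(2)] assms(3))
  next
    case (Cons a u)
    have "((\<lambda>x. 0) has_integral ((\<Phi> d (a # u) - \<Psi> d (a # u)) - (\<Phi> t (a # u) - \<Psi> t (a # u)))) {t..d}"
    proof (rule fundamental_theorem_of_calculus_interior_strong[of "S \<union> S'"])
      fix x assume x: "x \<in> {t<..<d} - (S \<union> S')"
      then have "((\<lambda>t. \<Phi> t (a # u) - \<Psi> t (a # u)) has_vector_derivative
         (- (form g a x * \<Phi> x u)) - (- (form g a x * \<Psi> x u))) (at x)"
        using Cons.prems by (intro has_vector_derivative_diff S(2) S'(2)) auto
      moreover have "\<Phi> x u = \<Psi> x u"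
        using x Cons.prems by (intro Cons.IH) auto
      ultimately show "((\<lambda>t. \<Phi> t (a # u) - \<Psi> t (a # u)) has_vector_derivative 0) (at x)"
        by simp
    next
      show "continuous_on {t..d} (\<lambda>t. \<Phi> t (a # u) - \<Psi> t (a # u))"
        using Cons.prems
        by (intro continuous_on_diff continuous_on_subset[OF flatD_cont[OF assms(1)]]
            continuous_on_subset[OF flatD_cont[OF assms(2)]]) auto
    qed (use S(1) S'(1) Cons.prems in auto)
    then have "(\<Phi> d (a # u) - \<Psi> d (a # u)) - (\<Phi> t (a # u) - \<Psi> t (a # u)) = 0"
      using has_integral_0_eq by blast
    then show ?case using assms(3) by simp
  qed
qed

text \<open>Integrability is not presupposed. \<open>integral\<close> has a default value on
  non-integrable functions, and it is the given solution that serves as a primitive and shows that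
  the default never occurs.\<close>

lemma word_int_eq_flat:
  assumes "flat g c d \<Phi>" "\<Phi> d = eps" "t \<in> {c..d}"
  shows "word_int g t d = \<Phi> t"
proof
  obtain S where S: "finite S" "\<And>t a u. t \<in> {c<..<d} - S \<Longrightarrow>
    ((\<lambda>t. \<Phi> t (a # u)) has_vector_derivative - (form g a t * \<Phi> t u)) (at t)"
    using assms(1) by (rule flatE) (rule that)
  fix u show "word_int g t d u = \<Phi> t u"
    using assms(3)
  proof (induction u arbitrary: t)
    case Nil
    then show ?case
      using flatD_Nil[OF assms(1), of t] assms(2) by simp
  next
    case (Cons a u)
    have "word_int g t d (a # u) = integral {t..d} (\<lambda>x. form g a x * \<Phi> x u)"
      unfolding word_int_Cons by (intro integral_cong) (use Cons in auto)
    moreover have "((\<lambda>x. - (form g a x * \<Phi> x u)) has_integral (\<Phi> d (a # u) - \<Phi> t (a # u))) {t..d}"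
    proof (rule fundamental_theorem_of_calculus_interior_strong[OF S(1)])
      fix x assume "x \<in> {t<..<d} - S"
      then have "x \<in> {c<..<d} - S" using Cons.prems by auto
      then show "((\<lambda>t. \<Phi> t (a # u)) has_vector_derivative - (form g a x * \<Phi> x u)) (at x)"
        by (rule S(2))
    qed (use Cons.prems in \<open>auto intro!: continuous_on_subset[OF flatD_cont[OF assms(1)]]\<close>)
    from has_integral_neg[OF this] have "((\<lambda>x. form g a x * \<Phi> x u) has_integral \<Phi> t (a # u)) {t..d}"
      by (simp add: assms(2))
    ultimately show ?case
      by (simp add: integral_unique)
  qed
qed

lemma flat_cong:
  assumes "flat g c d \<Phi>" "\<And>t. t \<in> {c..d} \<Longrightarrow> \<Psi> t = \<Phi> t" "c \<le> d"
  shows "flat g c d \<Psi>"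
proof -
  obtain S where S: "finite S" "\<And>t a u. t \<in> {c<..<d} - S \<Longrightarrow>
    ((\<lambda>t. \<Phi> t (a # u)) has_vector_derivative - (form g a t * \<Phi> t u)) (at t)"
    using assms(1) by (rule flatE) (rule that)
  show ?thesis
    unfolding flat_def
  proof (intro conjI allI exI[of _ S] ballI)
    fix u show "continuous_on {c..d} (\<lambda>t. \<Psi> t u)"
      using flatD_cont[OF assms(1), of u] by (rule continuous_on_eq) (use assms in auto)
  next
    fix t assume "t \<in> {c..d}"
    then show "\<Psi> t [] = \<Psi> d []"
      using flatD_Nil[OF assms(1), of t] assms(2)[of t] assms(2)[of d] assms(3) by simp
  next
    fix t a u assume t: "t \<in> {c<..<d} - S"
    have "((\<lambda>t. \<Psi> t (a # u)) has_vector_derivative - (form g a t * \<Phi> t u)) (at t)"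
      by (rule has_vector_derivative_transform_within_open[OF S(2)[OF t], where S = "{c<..<d}"])
         (use t assms in auto)
    then show "((\<lambda>t. \<Psi> t (a # u)) has_vector_derivative - (form g a t * \<Psi> t u)) (at t)"
      using assms(2)[of t] t by simp
  qed (rule S(1))
qed

lemma flat_word_int:
  assumes "flat g c d \<Phi>" "\<Phi> d = eps" "c \<le> d"
  shows "flat g c d (\<lambda>t. word_int g t d)"
  using flat_cong[OF assms(1) word_int_eq_flat[OF assms(1,2)]] assms(3) by blast

lemma word_int_refl: "word_int g d d = eps"
proof
  fix u show "word_int g d d u = eps u" by (cases u) (auto simp: word_int_Cons)
qed

text \<open>The iterated integrals are the fundamental solution, normalized at the upper
  limit.\<close>

lemma flat_eq_conv_word_int:
  assumes "flat g c d (\<lambda>t. word_int g t d)" "flat g c d \<Phi>" "t \<in> {c..d}"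
  shows "\<Phi> t = conv (word_int g t d) (\<Phi> d)"
  by (rule flat_unique[OF assms(2) flat_conv[OF assms(1)] _ assms(3)]) (simp add: word_int_refl)

text \<open>Chen's formula by gluing: the solution on the right interval is continued beyond
  \<open>m\<close> by convolution with its value at \<open>m\<close>, and uniqueness identifies the
  result with the iterated integrals.\<close>

lemma chen:
  assumes "flat g c m (\<lambda>t. word_int g t m)" "flat g m d (\<lambda>t. word_int g t d)" "c \<le> m" "m \<le> d"
  shows flat_chen: "flat g c d (\<lambda>t. word_int g t d)"
    and word_int_chen: "word_int g c d = conv (word_int g c m) (word_int g m d)"
proof -
  define L where "L t = conv (word_int g t m) (word_int g m d)" for t
  define \<Phi> where "\<Phi> t = (if t \<le> m then L t else word_int g t d)" for t
  have fL: "flat g c m L" unfolding L_def by (rule flat_conv) fact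
  have Lm: "L m = word_int g m d" by (simp add: L_def word_int_refl)
  obtain S where S: "finite S" "\<And>t a u. t \<in> {c<..<m} - S \<Longrightarrow>
    ((\<lambda>t. L t (a # u)) has_vector_derivative - (form g a t * L t u)) (at t)"
    using fL by (rule flatE) (rule that)
  obtain S' where S': "finite S'" "\<And>t a u. t \<in> {m<..<d} - S' \<Longrightarrow>
    ((\<lambda>t. word_int g t d (a # u)) has_vector_derivative - (form g a t * word_int g t d u)) (at t)"
    using assms(2) by (rule flatE) (rule that)
  \<comment> \<open>The exceptional set absorbs \<open>m\<close>, where the glued function may have
    a kink.\<close>
  have "flat g c d \<Phi>"
    unfolding flat_def
  proof (intro conjI allI exI[of _ "insert m (S \<union> S')"] ballI)
    fix u
    have "continuous_on ({c..m} \<union> {m..d}) (\<lambda>t. if t \<le> m then L t u else word_int g t d u)"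
      by (rule continuous_on_cases) (use flatD_cont[OF fL] flatD_cont[OF assms(2)] Lm in auto)
    moreover have "(\<lambda>t. \<Phi> t u) = (\<lambda>t. if t \<le> m then L t u else word_int g t d u)"
      by (auto simp: \<Phi>_def)
    moreover have "{c..m} \<union> {m..d} = {c..d}" using assms(3,4) by auto
    ultimately show "continuous_on {c..d} (\<lambda>t. \<Phi> t u)" by (simp only:)
  next
    fix t assume "t \<in> {c..d}"
    show "\<Phi> t [] = \<Phi> d []" by (simp add: \<Phi>_def L_def)
  next
    fix t a u assume t: "t \<in> {c<..<d} - insert m (S \<union> S')"
    show "((\<lambda>t. \<Phi> t (a # u)) has_vector_derivative - (form g a t * \<Phi> t u)) (at t)"
    proof (cases "t < m")
      case True
      have "((\<lambda>t. \<Phi> t (a # u)) has_vector_derivative - (form g a t * L t u)) (at t)"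
        by (rule has_vector_derivative_transform_within_open[OF S(2), where S = "{c<..<m}"])
           (use t True in \<open>auto simp: \<Phi>_def\<close>)
      then show ?thesis using True by (simp add: \<Phi>_def)
    next
      case False
      then have "m < t" using t by auto
      have "((\<lambda>t. \<Phi> t (a # u)) has_vector_derivative - (form g a t * word_int g t d u)) (at t)"
        by (rule has_vector_derivative_transform_within_open[OF S'(2), where S = "{m<..<d}"])
           (use t \<open>m < t\<close> in \<open>auto simp: \<Phi>_def\<close>)
      then show ?thesis using \<open>m < t\<close> by (simp add: \<Phi>_def)
    qed
  qed (use S(1) S'(1) in auto)
  moreover have "\<Phi> d = eps" using Lm assms by (auto simp: \<Phi>_def word_int_refl)
  ultimately have *: "word_int g t d = \<Phi> t" if "t \<in> {c..d}" for t using that by (rule word_int_eq_flat)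
  show "word_int g c d = conv (word_int g c m) (word_int g m d)"
    using *[of c] assms by (simp add: \<Phi>_def L_def)
  show "flat g c d (\<lambda>t. word_int g t d)"
    using flat_word_int[OF \<open>flat g c d \<Phi>\<close> \<open>\<Phi> d = eps\<close>] assms by simp
qed

section \<open>Transport along straight segments, holomorphic in the starting point\<close>

fun transport :: "complex \<Rightarrow> complex \<Rightarrow> series" where
  "transport x y [] = 1"
| "transport x y (a # u) = contour_integral (linepath x y) (\<lambda>z. transport z y u / (z - letter_point a))"

lemma transport_refl [simp]: "transport x x = eps"
proof
  fix u show "transport x x u = eps u" by (cases u) auto
qed

text \<open>Openness and convexity give holomorphic primitives of both forms and keep all segments
  inside.\<close>

definition simple_domain :: "complex set \<Rightarrow> bool" where
  "simple_domain V \<longleftrightarrow> open V \<and> convex V \<and> V \<inter> {0, 1} = {}"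

lemma simple_domain_letter_point: "simple_domain V \<Longrightarrow> x \<in> V \<Longrightarrow> x - letter_point a \<noteq> 0"
  by (cases a) (auto simp: simple_domain_def)

lemma primitive_linepath:
  assumes "open V" "convex V" "f holomorphic_on V" "x \<in> V" "y \<in> V"
  shows "((\<lambda>x. contour_integral (linepath x y) f) has_field_derivative - f x) (at x)"
    and "((\<lambda>x. contour_integral (linepath y x) f) has_field_derivative f x) (at x)"
    and "f contour_integrable_on (linepath x y)"
proof -
  obtain h where h: "\<And>x. x \<in> V \<Longrightarrow> (h has_field_derivative f x) (at x within V)"
    by (rule holomorphic_convex_primitive'[OF assms(2,1,3)]) (rule that)
  have int: "(f has_contour_integral (h b - h a)) (linepath a b)" if "a \<in> V" "b \<in> V" for a b
    using contour_integral_primitive[OF h valid_path_linepath, of a b] that assms(2)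
    by (simp add: closed_segment_subset)
  have hx: "(h has_field_derivative f x) (at x)"
    using h[OF assms(4)] unfolding at_within_open[OF assms(4,1)] .
  have ci: "contour_integral (linepath a b) f = h b - h a" if "a \<in> V" "b \<in> V" for a b
    by (rule contour_integral_unique[OF int[OF that]])
  show "((\<lambda>x. contour_integral (linepath x y) f) has_field_derivative - f x) (at x)"
  proof (rule has_field_derivative_transform_within_open[of "\<lambda>x. h y - h x" _ _ V])
    show "((\<lambda>x. h y - h x) has_field_derivative - f x) (at x)"
      using hx by (auto intro!: derivative_eq_intros)
  qed (use ci assms(1,4,5) in auto)
  show "((\<lambda>x. contour_integral (linepath y x) f) has_field_derivative f x) (at x)"
  proof (rule has_field_derivative_transform_within_open[of "\<lambda>x. h x - h y" _ _ V])
    show "((\<lambda>x. h x - h y) has_field_derivative f x) (at x)"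
      using hx by (auto intro!: derivative_eq_intros)
  qed (use ci assms(1,4,5) in auto)
  show "f contour_integrable_on (linepath x y)"
    using int[OF assms(4,5)] unfolding contour_integrable_on_def by blast
qed

lemma transport_deriv:
  assumes "simple_domain V" "y \<in> V"
  shows "(\<lambda>x. transport x y u) holomorphic_on V"
    and "x \<in> V \<Longrightarrow> ((\<lambda>x. transport x y (a # u)) has_field_derivative
           - (transport x y u / (x - letter_point a))) (at x)"
    and "x \<in> V \<Longrightarrow> (\<lambda>z. transport z y u / (z - letter_point a)) contour_integrable_on (linepath x y)"
proof -
  have V: "open V" "convex V" using assms by (auto simp: simple_domain_def)
  have *: "(\<lambda>x. transport x y u / (x - letter_point a)) holomorphic_on V"
    if "(\<lambda>x. transport x y u) holomorphic_on V" for a u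
    using that simple_domain_letter_point[OF assms(1)] by (auto intro!: holomorphic_intros)
  have D: "((\<lambda>x. transport x y (a # u)) has_field_derivative
           - (transport x y u / (x - letter_point a))) (at x)"
    if "(\<lambda>x. transport x y u) holomorphic_on V" "x \<in> V" for a u x
    using primitive_linepath(1)[OF V *[OF that(1)] that(2) assms(2)] by simp
  show hol: "(\<lambda>x. transport x y u) holomorphic_on V" for u
  proof (induction u)
    case Nil
    then show ?case by simp
  next
    case (Cons b u)
    show ?case
    proof (rule holomorphic_onI)
      fix x assume "x \<in> V"
      from has_field_derivative_at_within[OF D[OF Cons this]]
      show "(\<lambda>x. transport x y (b # u)) field_differentiable (at x within V)"
        unfolding field_differentiable_def by blast
    qed
  qed
  show "((\<lambda>x. transport x y (a # u)) has_field_derivative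
           - (transport x y u / (x - letter_point a))) (at x)" if "x \<in> V" for x
    by (rule D[OF hol that])
  show "(\<lambda>z. transport z y u / (z - letter_point a)) contour_integrable_on (linepath x y)"
    if "x \<in> V" for x
    by (rule primitive_linepath(3)[OF V *[OF hol] that assms(2)])
qed

lemma has_field_derivative_zero_const:
  fixes f :: "complex \<Rightarrow> complex"
  assumes "convex V" "open V" "\<And>x. x \<in> V \<Longrightarrow> (f has_field_derivative 0) (at x)" "x \<in> V" "y \<in> V"
  shows "f x = f y"
proof -
  have "\<exists>c. \<forall>x\<in>V. f x = c"
    by (rule has_field_derivative_zero_constant[OF assms(1) has_field_derivative_at_within[OF assms(3)]])
  then show ?thesis using assms(4,5) by metis
qed

text \<open>As functions of \<open>x\<close> both sides have the same derivative, and they agree at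
  \<open>x = y\<close>. Transport in such a domain is thus independent of the route.\<close>

lemma transport_conv:
  assumes "simple_domain V" "x \<in> V" "y \<in> V" "z \<in> V"
  shows "conv (transport x y) (transport y z) = transport x z"
proof
  have V: "open V" "convex V" using assms by (auto simp: simple_domain_def)
  fix u show "conv (transport x y) (transport y z) u = transport x z u"
    using assms(2)
  proof (induction u arbitrary: x)
    case Nil
    then show ?case by simp
  next
    case (Cons a u)
    define f where "f x = conv (transport x y) (transport y z) (a # u) - transport x z (a # u)" for x
    have "(f has_field_derivative 0) (at x)" if x: "x \<in> V" for x
    proof -
      define F' where "F' v = (case v of [] \<Rightarrow> 0 | b # v' \<Rightarrow> - (transport x y v' / (x - letter_point b)))" for v
      have "((\<lambda>t. transport t y v) has_field_derivative F' v) (at x)" for v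
      proof (cases v)
        case (Cons b v')
        show ?thesis
          unfolding Cons F'_def list.case by (rule transport_deriv(2)[OF assms(1,3) x])
      qed (simp add: F'_def)
      then have 1: "((\<lambda>t. conv (transport t y) (transport y z) (a # u)) has_field_derivative
          conv F' (transport y z) (a # u)) (at x)"
        by (rule has_field_derivative_conv_left)
      have 2: "conv F' (transport y z) (a # u) = - (transport x z u / (x - letter_point a))"
        using conv_scale_left[of "- 1 / (x - letter_point a)" "transport x y" "transport y z" u] Cons.IH[OF x]
        by (simp add: F'_def)
      show ?thesis
        unfolding f_def
        using DERIV_diff[OF 1[unfolded 2] transport_deriv(2)[OF assms(1,4) x, of a u]] by simp
    qed
    then have "f x = f y"
      by (rule has_field_derivative_zero_const[OF V(2,1)]) (use Cons assms in auto)
    also have "f y = 0" by (simp add: f_def del: transport.simps(2) conv.simps(2))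
    finally show ?case by (simp add: f_def)
  qed
qed

text \<open>Each letter contributes one integral over a segment of length at most
  \<open>norm (y - x)\<close> of a form bounded by \<open>1 / \<rho>\<close>.\<close>

lemma norm_transport_le:
  assumes "simple_domain V" "x \<in> V" "y \<in> V" "\<rho> > 0"
    and "\<And>z b. z \<in> closed_segment x y \<Longrightarrow> \<rho> \<le> norm (z - letter_point b)"
  shows "norm (transport x y u) \<le> (norm (y - x) / \<rho>) ^ length u"
  using assms(2,5)
proof (induction u arbitrary: x)
  case Nil
  then show ?case by simp
next
  case (Cons a u)
  let ?B = "(norm (y - x) / \<rho>) ^ length u / \<rho>"
  have "norm (contour_integral (linepath x y) (\<lambda>z. transport z y u / (z - letter_point a))) \<le> ?B * norm (y - x)"
  proof (rule contour_integral_bound_linepath)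
    show "(\<lambda>z. transport z y u / (z - letter_point a)) contour_integrable_on (linepath x y)"
      by (rule transport_deriv(3)[OF assms(1,3) Cons.prems(1)])
    show "0 \<le> ?B" using assms by auto
    fix z assume z: "z \<in> closed_segment x y"
    have sub: "closed_segment z y \<subseteq> closed_segment x y"
      using z by (simp add: closed_segment_subset)
    have "norm (transport z y u) \<le> (norm (y - z) / \<rho>) ^ length u"
    proof (rule Cons.IH)
      show "z \<in> V"
        using closed_segment_subset[of x V y] Cons.prems(1) assms(1,3) z by (auto simp: simple_domain_def)
      show "\<rho> \<le> norm (z' - letter_point b)" if "z' \<in> closed_segment z y" for z' b
        by (rule Cons.prems(2)) (use that sub in blast)
    qed
    also have "\<dots> \<le> (norm (y - x) / \<rho>) ^ length u"
      using segment_bound[OF z] assms by (intro power_mono divide_right_mono) (auto simp: norm_minus_commute)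
    finally show "norm (transport z y u / (z - letter_point a)) \<le> ?B"
      using Cons.prems(2)[OF z, of a] assms by (auto simp: norm_divide intro!: frac_le)
  qed
  then show ?case by (simp add: mult.commute)
qed

lemma flat_transport:
  assumes "simple_domain V" "g ` {c..d} \<subseteq> V" "continuous_on {c..d} g" "finite S" "c \<le> d"
    and diff: "\<And>t. t \<in> {c<..<d} - S \<Longrightarrow> g differentiable (at t)"
  shows "flat g c d (\<lambda>t. transport (g t) (g d))"
  unfolding flat_def
proof (intro conjI allI exI[of _ S] ballI)
  fix u
  have gd: "g d \<in> V" using assms by auto
  show "continuous_on {c..d} (\<lambda>t. transport (g t) (g d) u)"
    using continuous_on_compose2[OF holomorphic_on_imp_continuous_on[OF transport_deriv(1)[OF assms(1) gd]]]
      assms by auto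
  fix t a assume t: "t \<in> {c<..<d} - S"
  have "(g has_vector_derivative vector_derivative g (at t)) (at t)"
    using diff[OF t] by (simp add: vector_derivative_works)
  moreover have "((\<lambda>x. transport x (g d) (a # u)) has_field_derivative
     - (transport (g t) (g d) u / (g t - letter_point a))) (at (g t))"
    by (rule transport_deriv[OF assms(1) gd]) (use t assms in auto)
  ultimately have "(((\<lambda>x. transport x (g d) (a # u)) \<circ> g) has_vector_derivative
      vector_derivative g (at t) * - (transport (g t) (g d) u / (g t - letter_point a))) (at t)"
    by (rule field_vector_diff_chain_at)
  then show "((\<lambda>t. transport (g t) (g d) (a # u)) has_vector_derivative
          - (form g a t * transport (g t) (g d) u)) (at t)"
    by (simp add: form_def o_def del: transport.simps(2))
qed (use assms in auto)

lemma word_int_transport: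
  assumes "simple_domain V" "g ` {c..d} \<subseteq> V" "continuous_on {c..d} g" "finite S" "c \<le> d"
    and diff: "\<And>t. t \<in> {c<..<d} - S \<Longrightarrow> g differentiable (at t)"
  shows "word_int g c d = transport (g c) (g d)" "flat g c d (\<lambda>t. word_int g t d)"
proof -
  have c: "c \<in> {c..d}" using assms(5) by simp
  show "word_int g c d = transport (g c) (g d)"
    by (rule word_int_eq_flat[OF flat_transport[OF assms] _ c]) auto
  show "flat g c d (\<lambda>t. word_int g t d)"
    by (rule flat_word_int[OF flat_transport[OF assms] _ assms(5)]) auto
qed

lemma simple_domain_ball:
  assumes "x \<notin> {0, 1}"
  shows "\<exists>r>0. simple_domain (ball x r)"
proof -
  have "open (- {0, 1 :: complex})" by (auto intro: open_Compl)
  then obtain r where "r > 0" "ball x r \<subseteq> - {0, 1}"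
    using assms openE[of "- {0,1}" x] by blast
  have "simple_domain (ball x r)"
    unfolding simple_domain_def using \<open>ball x r \<subseteq> - {0, 1}\<close> by (intro conjI open_ball convex_ball) blast
  then show ?thesis using \<open>r > 0\<close> by blast
qed

text \<open>Bisection reduces the claim to short intervals, which \<open>g\<close> maps into a disc
  without singular points; there transport provides the solution, and Chen's formula joins adjacent
  intervals.\<close>

lemma flat_path:
  assumes "continuous_on {c..d} g" "g ` {c..d} \<inter> {0, 1} = {}" "finite S" "c \<le> d"
    and diff: "\<And>t. t \<in> {c<..<d} - S \<Longrightarrow> g differentiable (at t)"
  shows "flat g c d (\<lambda>t. word_int g t d)"
proof -
  have "c \<le> c \<and> d \<le> d \<longrightarrow> flat g c d (\<lambda>t. word_int g t d)"
    using \<open>c \<le> d\<close>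
  proof (induction rule: Bolzano[where P = "\<lambda>a b. c \<le> a \<and> b \<le> d \<longrightarrow> flat g a b (\<lambda>t. word_int g t b)"])
    case (trans x y z)
    show ?case
    proof
      assume xz: "c \<le> x \<and> z \<le> d"
      then have "c \<le> x \<and> y \<le> d" "c \<le> y \<and> z \<le> d" using trans(3,4) by linarith+
      then show "flat g x z (\<lambda>t. word_int g t z)"
        using flat_chen[OF trans(1)[THEN mp] trans(2)[THEN mp] trans(3,4)] by blast
    qed
  next
    case (local x)
    then have "x \<in> {c..d}" by simp
    then have "g x \<in> g ` {c..d}" by (rule imageI)
    then have "g x \<notin> {0, 1}" using assms(2) by blast
    then obtain r where r: "r > 0" "simple_domain (ball (g x) r)" using simple_domain_ball by blast
    have "x \<in> {c..d}" using local by simp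
    from assms(1)[unfolded continuous_on_iff, THEN bspec, OF this, THEN spec, THEN mp, OF r(1)]
    obtain \<delta> where \<delta>: "\<delta> > 0" "\<forall>t\<in>{c..d}. dist t x < \<delta> \<longrightarrow> dist (g t) (g x) < r"
      by blast
    show ?case
    proof (intro exI[of _ \<delta>] conjI allI impI \<open>\<delta> > 0\<close>)
      fix a b :: real assume ab: "a \<le> x \<and> x \<le> b \<and> b - a < \<delta>" "c \<le> a \<and> b \<le> d"
      show "flat g a b (\<lambda>t. word_int g t b)"
      proof (rule word_int_transport(2)[OF r(2) _ _ \<open>finite S\<close>])
        show "g ` {a..b} \<subseteq> ball (g x) r"
        proof clarify
          fix t assume "t \<in> {a..b}"
          then have "t \<in> {c..d}" "dist t x < \<delta>" using ab by (auto simp: dist_real_def)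
          then show "g t \<in> ball (g x) r" using \<delta>(2) by (simp add: dist_commute)
        qed
        show "continuous_on {a..b} g"
          by (rule continuous_on_subset[OF assms(1)]) (use ab in auto)
        show "\<And>t. t \<in> {a<..<b} - S \<Longrightarrow> g differentiable at t"
          by (rule diff) (use ab in auto)
      qed (use ab in auto)
    qed
  qed
  then show ?thesis by simp
qed

section \<open>Homotopy invariance\<close>

text \<open>The series of the polygon with the given vertices. It replaces paths by finitely many
  points, so that homotopies become grids.\<close>

fun chain :: "(nat \<Rightarrow> complex) \<Rightarrow> nat \<Rightarrow> series" where
  "chain p 0 = eps"
| "chain p (Suc n) = conv (chain p n) (transport (p n) (p (Suc n)))"

text \<open>A ladder of small quadrilaterals: both ways around one of them give the transport
  between opposite corners, which moves the rung one step further.\<close>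

lemma chain_swap:
  assumes "\<And>j. j < m \<Longrightarrow> \<exists>V. simple_domain V \<and> {p j, p (Suc j), q j, q (Suc j)} \<subseteq> V"
    and "\<exists>V. simple_domain V \<and> {p 0, q 0} \<subseteq> V"
  shows "conv (chain p m) (transport (p m) (q m)) = conv (transport (p 0) (q 0)) (chain q m)"
  using assms(1)
proof (induction m)
  case 0
  then show ?case by simp
next
  case (Suc m)
  obtain V where V: "simple_domain V" "p m \<in> V" "p (Suc m) \<in> V" "q m \<in> V" "q (Suc m) \<in> V"
    using Suc.prems[of m] by auto
  have "conv (chain p (Suc m)) (transport (p (Suc m)) (q (Suc m))) =
      conv (chain p m) (conv (transport (p m) (p (Suc m))) (transport (p (Suc m)) (q (Suc m))))"
    by (simp add: conv_assoc)
  also have "conv (transport (p m) (p (Suc m))) (transport (p (Suc m)) (q (Suc m))) =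
      conv (transport (p m) (q m)) (transport (q m) (q (Suc m)))"
    by (simp only: transport_conv[OF V(1)] V)
  also have "conv (chain p m) \<dots> = conv (conv (transport (p 0) (q 0)) (chain q m)) (transport (q m) (q (Suc m)))"
    using Suc.IH Suc.prems by (simp add: conv_assoc[symmetric])
  finally show ?case by (simp add: conv_assoc)
qed

text \<open>Ladders are stacked on each other; the two ways around the boundary of the grid give the
  same series.\<close>

lemma chain_grid:
  assumes "\<And>i j. i < n \<Longrightarrow> j < m \<Longrightarrow>
      \<exists>V. simple_domain V \<and> {h i j, h i (Suc j), h (Suc i) j, h (Suc i) (Suc j)} \<subseteq> V" "0 < m"
  shows "conv (chain (h 0) m) (chain (\<lambda>i. h i m) n) = conv (chain (\<lambda>i. h i 0) n) (chain (h n) m)"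
  using assms(1)
proof (induction n)
  case 0
  then show ?case by simp
next
  case (Suc n)
  have sw: "conv (chain (h n) m) (transport (h n m) (h (Suc n) m)) =
      conv (transport (h n 0) (h (Suc n) 0)) (chain (h (Suc n)) m)"
  proof (rule chain_swap)
    show "\<exists>V. simple_domain V \<and> {h n 0, h (Suc n) 0} \<subseteq> V"
      using Suc.prems[of n 0] assms(2) by auto
  qed (use Suc.prems[of n] in auto)
  have "conv (chain (h 0) m) (chain (\<lambda>i. h i m) (Suc n)) =
      conv (conv (chain (h 0) m) (chain (\<lambda>i. h i m) n)) (transport (h n m) (h (Suc n) m))"
    by (simp add: conv_assoc)
  also have "conv (chain (h 0) m) (chain (\<lambda>i. h i m) n) = conv (chain (\<lambda>i. h i 0) n) (chain (h n) m)"
    using Suc by auto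
  also have "conv \<dots> (transport (h n m) (h (Suc n) m)) = conv (chain (\<lambda>i. h i 0) (Suc n)) (chain (h (Suc n)) m)"
    by (simp add: conv_assoc sw)
  finally show ?case .
qed

lemma chain_trans:
  assumes "simple_domain V" "\<And>i. i \<le> n \<Longrightarrow> p i \<in> V"
  shows "chain p n = transport (p 0) (p n)"
  using assms(2)
proof (induction n)
  case (Suc n)
  then show ?case using transport_conv[OF assms(1)] by simp
qed simp

lemma chain_word_int:
  assumes "\<And>j. j < n \<Longrightarrow> \<tau> j \<le> \<tau> (Suc j)"
    and "\<And>j. j < n \<Longrightarrow> \<exists>V. simple_domain V \<and> g ` {\<tau> j..\<tau> (Suc j)} \<subseteq> V"
    and "continuous_on {\<tau> 0..\<tau> n} g" "finite S"
    and diff: "\<And>t. t \<in> {\<tau> 0<..<\<tau> n} - S \<Longrightarrow> g differentiable (at t)"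
  shows "chain (\<lambda>j. g (\<tau> j)) n = word_int g (\<tau> 0) (\<tau> n) \<and> flat g (\<tau> 0) (\<tau> n) (\<lambda>t. word_int g t (\<tau> n)) \<and> \<tau> 0 \<le> \<tau> n"
  using assms(1,2,3,5)
proof (induction n)
  case 0
  have "flat g (\<tau> 0) (\<tau> 0) (\<lambda>t. eps)"
    by (auto simp: flat_def)
  then have "flat g (\<tau> 0) (\<tau> 0) (\<lambda>t. word_int g t (\<tau> 0))"
    by (rule flat_cong) (auto simp: word_int_refl)
  then show ?case by (simp add: word_int_refl)
next
  case (Suc n)
  have mono: "\<tau> n \<le> \<tau> (Suc n)" using Suc.prems(1) by simp
  have IH: "chain (\<lambda>j. g (\<tau> j)) n = word_int g (\<tau> 0) (\<tau> n) \<and> flat g (\<tau> 0) (\<tau> n) (\<lambda>t. word_int g t (\<tau> n)) \<and> \<tau> 0 \<le> \<tau> n"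
  proof (rule Suc.IH)
    show "continuous_on {\<tau> 0..\<tau> n} g"
      by (rule continuous_on_subset[OF Suc.prems(3)]) (use mono in auto)
    show "\<And>t. t \<in> {\<tau> 0<..<\<tau> n} - S \<Longrightarrow> g differentiable at t"
      by (rule Suc.prems(4)) (use mono in auto)
  qed (use Suc.prems(1,2) in auto)
  obtain V where V: "simple_domain V" "g ` {\<tau> n..\<tau> (Suc n)} \<subseteq> V"
    using Suc.prems(2) by blast
  have le: "\<tau> 0 \<le> \<tau> n" using IH by simp
  have c: "continuous_on {\<tau> n..\<tau> (Suc n)} g"
    by (rule continuous_on_subset[OF Suc.prems(3)]) (use le in auto)
  have d: "\<And>t. t \<in> {\<tau> n<..<\<tau> (Suc n)} - S \<Longrightarrow> g differentiable at t"
    by (rule Suc.prems(4)) (use le in auto)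
  note loc = word_int_transport[OF V c \<open>finite S\<close> mono d]
  note ch = flat_chen[of g "\<tau> 0" "\<tau> n" "\<tau> (Suc n)"] word_int_chen[of g "\<tau> 0" "\<tau> n" "\<tau> (Suc n)"]
  show ?case
    using ch loc IH le mono by simp
qed

text \<open>The ends of the intermediate paths may move inside simple domains \<open>V\<close> and
  \<open>W\<close>, and only the transports between the extreme end points survive. Tangential base
  points require this form, because cutting the homotopy off at \<open>t\<close> and
  \<open>1 - t\<close> leaves moving ends.\<close>

lemma homotopy_word_int:
  fixes H :: "real \<times> real \<Rightarrow> complex"
  assumes cont: "continuous_on ({0..1} \<times> {c..d}) H"
    and avoid: "\<And>s t. s \<in> {0..1} \<Longrightarrow> t \<in> {c..d} \<Longrightarrow> H (s, t) \<notin> {0, 1}"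
    and pq: "\<And>t. t \<in> {c..d} \<Longrightarrow> H (0, t) = p t" "\<And>t. t \<in> {c..d} \<Longrightarrow> H (1, t) = q t"
    and cd: "0 \<le> c" "c < d" "d \<le> 1"
    and S: "finite S" "\<And>t. t \<in> {c<..<d} - S \<Longrightarrow> p differentiable (at t)"
      "\<And>t. t \<in> {c<..<d} - S \<Longrightarrow> q differentiable (at t)"
    and V: "simple_domain V" "\<And>s. s \<in> {0..1} \<Longrightarrow> H (s, c) \<in> V"
    and W: "simple_domain W" "\<And>s. s \<in> {0..1} \<Longrightarrow> H (s, d) \<in> W"
  shows "word_int p c d = conv (transport (p c) (q c)) (conv (word_int q c d) (transport (q d) (p d)))"
proof -
  let ?K = "{0..1} \<times> {c..d} :: (real \<times> real) set"
  have comp: "compact ?K" by (intro compact_Times) auto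
  have "compact (H ` ?K)" by (rule compact_continuous_image[OF cont comp])
  moreover have "closed {0, 1 :: complex}" by (intro finite_imp_closed) auto
  moreover have "H ` ?K \<inter> {0, 1} = {}" using avoid by auto
  \<comment> \<open>A uniform radius: discs of radius \<open>\<rho>\<close> around points of the
    compact image avoid 0 and 1.\<close>
  ultimately obtain \<rho> where \<rho>: "\<rho> > 0" "\<And>x y. x \<in> H ` ?K \<Longrightarrow> y \<in> {0, 1} \<Longrightarrow> \<rho> \<le> dist x y"
    using separate_compact_closed by metis
  have gb: "simple_domain (ball (H x) \<rho>)" if "x \<in> ?K" for x
  proof -
    have "ball (H x) \<rho> \<inter> {0, 1} = {}"
    proof (rule ccontr)
      assume "ball (H x) \<rho> \<inter> {0, 1} \<noteq> {}"
      then obtain y where "y \<in> {0, 1}" "y \<in> ball (H x) \<rho>" by blast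
      with \<rho>(2)[of "H x" y] that show False by auto
    qed
    then show ?thesis unfolding simple_domain_def by (intro conjI open_ball convex_ball)
  qed
  have "uniformly_continuous_on ?K H"
    by (rule compact_uniformly_continuous[OF cont comp])
  then obtain \<delta> where \<delta>: "\<delta> > 0"
    "\<And>x x'. x \<in> ?K \<Longrightarrow> x' \<in> ?K \<Longrightarrow> dist x' x < \<delta> \<Longrightarrow> dist (H x') (H x) < \<rho>"
    unfolding uniformly_continuous_on_def using \<rho>(1) by metis
  \<comment> \<open>The corners of a grid cell are at distance at most 2 / n in the parameters,
    hence in one common disc.\<close>
  obtain n where n: "2 / \<delta> < real n" using reals_Archimedean2 by blast
  have n0: "0 < n" using n \<delta>(1) by (cases n) (auto simp: field_simps)
  then have n\<delta>: "2 / real n < \<delta>" using n \<delta>(1) by (simp add: field_simps)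
  define \<sigma> where "\<sigma> i = real i / real n" for i
  define \<tau> where "\<tau> j = c + (d - c) * (real j / real n)" for j
  have \<sigma>: "\<sigma> i \<in> {0..1}" if "i \<le> n" for i using that n0 by (auto simp: \<sigma>_def)
  have \<tau>: "\<tau> j \<in> {c..d}" if "j \<le> n" for j
  proof -
    have "real j / real n \<in> {0..1}" using that n0 by auto
    then have "(d - c) * (real j / real n) \<le> (d - c) * 1" "0 \<le> (d - c) * (real j / real n)"
      using cd by (intro mult_left_mono mult_nonneg_nonneg; simp)+
    then show ?thesis by (simp add: \<tau>_def)
  qed
  have step\<sigma>: "\<sigma> (Suc i) = \<sigma> i + 1 / real n" for i by (simp add: \<sigma>_def add_divide_distrib)
  have step\<tau>: "\<tau> (Suc j) = \<tau> j + (d - c) / real n" for j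
    by (simp add: \<tau>_def add_divide_distrib algebra_simps)
  have dc: "0 \<le> (d - c) / real n" "(d - c) / real n \<le> 1 / real n"
    using cd n0 by (auto intro!: divide_right_mono)
  have close: "H (s', t') \<in> ball (H (s, t)) \<rho>"
    if "(s, t) \<in> ?K" "(s', t') \<in> ?K" "\<bar>s' - s\<bar> \<le> 1 / real n" "\<bar>t' - t\<bar> \<le> 1 / real n" for s t s' t'
  proof -
    have "dist (s', t') (s, t) \<le> \<bar>s' - s\<bar> + \<bar>t' - t\<bar>"
      unfolding dist_Pair_Pair dist_real_def by (rule sqrt_sum_squares_le_sum) auto
    also have "\<dots> < \<delta>" using that(3,4) n\<delta> by simp
    finally show ?thesis using \<delta>(2)[OF that(1,2)] by (simp add: dist_commute)
  qed
  define h where "h i j = H (\<sigma> i, \<tau> j)" for i j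
  have cell: "\<exists>V. simple_domain V \<and> {h i j, h i (Suc j), h (Suc i) j, h (Suc i) (Suc j)} \<subseteq> V"
    if "i < n" "j < n" for i j
  proof (intro exI conjI)
    have K: "(\<sigma> i, \<tau> j) \<in> ?K" "(\<sigma> i, \<tau> (Suc j)) \<in> ?K" "(\<sigma> (Suc i), \<tau> j) \<in> ?K"
      "(\<sigma> (Suc i), \<tau> (Suc j)) \<in> ?K"
      using that \<sigma>[of i] \<sigma>[of "Suc i"] \<tau>[of j] \<tau>[of "Suc j"] by auto
    show "simple_domain (ball (H (\<sigma> i, \<tau> j)) \<rho>)" by (rule gb[OF K(1)])
    show "{h i j, h i (Suc j), h (Suc i) j, h (Suc i) (Suc j)} \<subseteq> ball (H (\<sigma> i, \<tau> j)) \<rho>"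
      unfolding h_def
      by (intro insert_subsetI empty_subsetI close[OF K(1) K(1)] close[OF K(1) K(2)] close[OF K(1) K(3)]
            close[OF K(1) K(4)])
         (use dc in \<open>auto simp: step\<sigma> step\<tau>\<close>)
  qed
  have grid: "conv (chain (h 0) n) (chain (\<lambda>i. h i n) n) = conv (chain (\<lambda>i. h i 0) n) (chain (h n) n)"
    by (rule chain_grid[of n n h]) (use cell n0 in blast)+
  have \<tau>0: "\<tau> 0 = c" and \<tau>n: "\<tau> n = d" and \<sigma>0: "\<sigma> 0 = 0" and \<sigma>n: "\<sigma> n = 1"
    using n0 by (auto simp: \<tau>_def \<sigma>_def)
  have row: "chain (\<lambda>j. g (\<tau> j)) n = word_int g c d"
    if Hg: "\<And>t. t \<in> {c..d} \<Longrightarrow> H (s, t) = g t" and s01: "s \<in> {0..1}"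
      and dg: "\<And>t. t \<in> {c<..<d} - S \<Longrightarrow> g differentiable (at t)" for g s
  proof -
    have "continuous_on {c..d} (H \<circ> (\<lambda>t. (s, t)))"
      by (intro continuous_on_compose continuous_intros continuous_on_subset[OF cont]) (use s01 in auto)
    then have cg: "continuous_on {c..d} g"
      by (rule continuous_on_eq) (use Hg in auto)
    have mono: "\<tau> j \<le> \<tau> (Suc j)" for j using dc by (simp add: step\<tau>)
    have loc: "\<exists>V. simple_domain V \<and> g ` {\<tau> j..\<tau> (Suc j)} \<subseteq> V" if j: "j < n" for j
    proof (intro exI conjI)
      have tj: "\<tau> j \<in> {c..d}" "\<tau> (Suc j) \<in> {c..d}" using \<tau>[of j] \<tau>[of "Suc j"] j by auto
      then have K: "(s, \<tau> j) \<in> ?K" using s01 by auto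
      show "simple_domain (ball (H (s, \<tau> j)) \<rho>)" by (rule gb[OF K])
      show "g ` {\<tau> j..\<tau> (Suc j)} \<subseteq> ball (H (s, \<tau> j)) \<rho>"
      proof clarify
        fix t assume t: "t \<in> {\<tau> j..\<tau> (Suc j)}"
        then have tc: "t \<in> {c..d}" using tj by auto
        have "H (s, t) \<in> ball (H (s, \<tau> j)) \<rho>"
          by (rule close[OF K]) (use t tc s01 dc in \<open>auto simp: step\<tau>\<close>)
        then show "g t \<in> ball (H (s, \<tau> j)) \<rho>" using Hg[OF tc] by simp
      qed
    qed
    have "chain (\<lambda>j. g (\<tau> j)) n = word_int g (\<tau> 0) (\<tau> n)"
      by (rule conjunct1[OF chain_word_int[where \<tau> = \<tau> and n = n and g = g, OF mono loc _ S(1)]]) (use cg dg in \<open>auto simp: \<tau>0 \<tau>n\<close>)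
    then show ?thesis by (simp add: \<tau>0 \<tau>n)
  qed
  have \<tau>le: "\<tau> j \<in> {c..d}" if "j \<le> n" for j using \<tau> that by blast
  have chain_cong: "chain a m = chain b m" if "\<And>j. j \<le> m \<Longrightarrow> a j = b j" for a b m
    using that by (induction m) auto
  have c1: "chain (h 0) n = word_int p c d"
  proof -
    have "chain (h 0) n = chain (\<lambda>j. p (\<tau> j)) n"
    proof (rule chain_cong)
      fix j assume "j \<le> n"
      show "h 0 j = p (\<tau> j)" unfolding h_def \<sigma>0 by (rule pq(1)[OF \<tau>[OF \<open>j \<le> n\<close>]])
    qed
    also have "\<dots> = word_int p c d" by (rule row[OF pq(1)]) (use S(2) in auto)
    finally show ?thesis .
  qed
  have c2: "chain (h n) n = word_int q c d"
  proof -
    have "chain (h n) n = chain (\<lambda>j. q (\<tau> j)) n"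
    proof (rule chain_cong)
      fix j assume "j \<le> n"
      show "h n j = q (\<tau> j)" unfolding h_def \<sigma>n by (rule pq(2)[OF \<tau>[OF \<open>j \<le> n\<close>]])
    qed
    also have "\<dots> = word_int q c d" by (rule row[OF pq(2)]) (use S(3) in auto)
    finally show ?thesis .
  qed
  have c3: "chain (\<lambda>i. h i 0) n = transport (p c) (q c)"
    using chain_trans[OF V(1), of n "\<lambda>i. h i 0"] V(2)[OF \<sigma>] cd pq[of c]
    by (simp add: h_def \<tau>0 \<sigma>0 \<sigma>n)
  have c4: "chain (\<lambda>i. h i n) n = transport (p d) (q d)"
    using chain_trans[OF W(1), of n "\<lambda>i. h i n"] W(2)[OF \<sigma>] cd pq[of d]
    by (simp add: h_def \<tau>n \<sigma>0 \<sigma>n)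
  have pW: "p d \<in> W" "q d \<in> W" using W(2)[of 0] W(2)[of 1] pq[of d] cd by auto
  \<comment> \<open>The transport inside \<open>W\<close> is invertible, which brings the right edge
    of the grid to the other side.\<close>
  have "word_int p c d = conv (word_int p c d) (conv (transport (p d) (q d)) (transport (q d) (p d)))"
    by (simp add: transport_conv[OF W(1) pW(1) pW(2) pW(1)])
  also have "\<dots> = conv (conv (word_int p c d) (transport (p d) (q d))) (transport (q d) (p d))"
    by (simp add: conv_assoc)
  also have "conv (word_int p c d) (transport (p d) (q d)) = conv (transport (p c) (q c)) (word_int q c d)"
    using grid by (simp add: c1 c2 c3 c4)
  finally show ?thesis by (simp add: conv_assoc)
qed

section \<open>Expansions in powers of the logarithm\<close>

text \<open>Letting \<open>a\<close> run to the limit in the Cauchy estimate turns it into a rate of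
  convergence; the later uses depend on this rate.\<close>

lemma cauchy_lim:
  fixes F :: "'a \<Rightarrow> complex"
  assumes "G \<noteq> bot" "eventually (\<lambda>b. eventually (\<lambda>a. dist (F a) (F b) \<le> \<psi> b) G) G" "(\<psi> \<longlongrightarrow> 0) G"
  obtains c where "(F \<longlongrightarrow> c) G" "eventually (\<lambda>b. dist c (F b) \<le> \<psi> b) G"
proof -
  have "cauchy_filter (filtermap F G)"
    unfolding cauchy_filter_metric_filtermap
  proof (intro allI impI)
    fix e :: real assume "e > 0"
    then have "eventually (\<lambda>b. \<psi> b < e / 2) G"
      using order_tendstoD(2)[OF assms(3), of "e / 2"] by simp
    with assms(2) have "eventually (\<lambda>b. eventually (\<lambda>a. dist (F a) (F b) < e / 2) G) G"
    proof eventually_elim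
      case (elim b)
      from elim(1) show ?case by eventually_elim (use elim(2) in linarith)
    qed
    then obtain b where b: "eventually (\<lambda>a. dist (F a) (F b) < e / 2) G"
      using assms(1) eventually_happens' by blast
    show "\<exists>P. eventually P G \<and> (\<forall>x y. P x \<and> P y \<longrightarrow> dist (F x) (F y) < e)"
      by (rule exI[of _ "\<lambda>a. dist (F a) (F b) < e / 2"]) (use b dist_triangle_half_l in blast)
  qed
  moreover have "filtermap F G \<noteq> bot" using assms(1) by (simp add: filtermap_bot_iff)
  moreover have "complete (UNIV :: complex set)" by (rule complete_UNIV)
  ultimately obtain c where "filtermap F G \<le> nhds c"
    using cauchy_filter_complete_converges[of "filtermap F G" UNIV] by auto
  then have c: "(F \<longlongrightarrow> c) G" by (simp add: filterlim_def)
  have "eventually (\<lambda>b. dist c (F b) \<le> \<psi> b) G"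
    using assms(2)
  proof eventually_elim
    case (elim b)
    have "((\<lambda>a. dist (F a) (F b)) \<longlongrightarrow> dist c (F b)) G"
      by (intro tendsto_intros c)
    then show ?case using tendsto_upperbound elim assms(1) by blast
  qed
  with c show ?thesis by (rule that)
qed

text \<open>The expansion of \<open>has_reg_value\<close>, with a polynomial in the logarithm in
  place of a sequence of coefficients so that expansions can be multiplied and integrated.\<close>

definition log_poly :: "nat \<Rightarrow> (real \<Rightarrow> complex) \<Rightarrow> complex \<Rightarrow> bool" where
  "log_poly n f c \<longleftrightarrow> (\<exists>p. degree p \<le> n \<and> coeff p 0 = c \<and>
     (\<lambda>t. f t - poly p (of_real (ln t))) \<in> O[at_right 0](\<lambda>t. of_real (t * ln t ^ (n + 1))))"

lemma poly_eq_sum_le: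
  fixes p :: "complex poly"
  assumes "degree p \<le> n"
  shows "poly p x = (\<Sum>k\<le>n. coeff p k * x ^ k)"
  unfolding poly_altdef by (rule sum.mono_neutral_left) (use assms in \<open>auto simp: coeff_eq_0\<close>)

lemma has_reg_value_iff_log_poly:
  "has_reg_value g as c \<longleftrightarrow> log_poly (length as) (\<lambda>t. iterint g as t (1 - t)) c"
proof
  assume "has_reg_value g as c"
  then obtain cs where cs: "cs 0 = c"
    "(\<lambda>t. iterint g as t (1 - t) - (\<Sum>k\<le>length as. cs k * of_real (ln t) ^ k))
          \<in> O[at_right 0](\<lambda>t. of_real (t * ln t ^ (length as + 1)))"
    unfolding has_reg_value_def by blast
  define p where "p = (\<Sum>k\<le>length as. monom (cs k) k)"
  have "degree p \<le> length as"
    unfolding p_def by (intro degree_sum_le) (auto intro: order.trans[OF degree_monom_le])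
  moreover have "coeff p 0 = c"
    by (simp add: p_def coeff_sum cs(1))
  moreover have "poly p x = (\<Sum>k\<le>length as. cs k * x ^ k)" for x
    by (simp add: p_def poly_sum poly_monom)
  ultimately show "log_poly (length as) (\<lambda>t. iterint g as t (1 - t)) c"
    unfolding log_poly_def using cs(2) by (intro exI[of _ p]) simp
next
  assume "log_poly (length as) (\<lambda>t. iterint g as t (1 - t)) c"
  then obtain p where "degree p \<le> length as" "coeff p 0 = c"
     "(\<lambda>t. iterint g as t (1 - t) - poly p (of_real (ln t)))
        \<in> O[at_right 0](\<lambda>t. of_real (t * ln t ^ (length as + 1)))"
    unfolding log_poly_def by blast
  then show "has_reg_value g as c"
    unfolding has_reg_value_def by (intro exI[of _ "coeff p"]) (simp add: poly_eq_sum_le)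
qed

lemma ln_bigo_mono:
  assumes "n \<le> m"
  shows "(\<lambda>t. of_real (ln t ^ n) :: complex) \<in> O[at_right 0](\<lambda>t. of_real (ln t ^ m))"
proof (rule bigoI[where c = 1])
  have "eventually (\<lambda>t::real. t < exp (-1)) (at_right 0)" "eventually (\<lambda>t::real. 0 < t) (at_right 0)"
    by (auto intro!: eventually_at_right_less eventually_at_rightI[of 0 "exp (-1)"])
  then show "eventually (\<lambda>t. norm (of_real (ln t ^ n) :: complex) \<le> 1 * norm (of_real (ln t ^ m) :: complex)) (at_right 0)"
  proof eventually_elim
    case (elim t)
    then have "ln t < -1" using ln_less_cancel_iff[of t "exp (-1)"] by simp
    then have "1 \<le> \<bar>ln t\<bar>" by simp
    then show ?case using assms by (simp add: norm_power power_increasing)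
  qed
qed

lemma t_ln_tendsto: "(\<lambda>t. of_real (t * ln t ^ n) :: complex) \<in> O[at_right 0](\<lambda>t. 1)"
proof -
  have "((\<lambda>t::real. t * ln t ^ n) \<longlongrightarrow> 0) (at_right 0)" by real_asymp
  then have "((\<lambda>t. of_real (t * ln t ^ n) :: complex) \<longlongrightarrow> of_real 0) (at_right 0)"
    by (rule tendsto_of_real)
  then have "(\<lambda>t. of_real (t * ln t ^ n) :: complex) \<in> o[at_right 0](\<lambda>t. 1)"
    by (intro smalloI_tendsto) auto
  then show ?thesis by (rule landau_o.small_imp_big)
qed

lemma t_ln_bigo_mono:
  assumes "n \<le> m"
  shows "(\<lambda>t. of_real (t * ln t ^ n) :: complex) \<in> O[at_right 0](\<lambda>t. of_real (t * ln t ^ m))"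
  using landau_o.big.mult[OF landau_o.big_refl[of "\<lambda>t. of_real t :: complex"] ln_bigo_mono[OF assms]]
  by simp

lemma poly_ln_bigo:
  assumes "degree p \<le> n"
  shows "(\<lambda>t. poly p (of_real (ln t)) :: complex) \<in> O[at_right 0](\<lambda>t. of_real (ln t ^ n))"
  unfolding poly_altdef
proof (rule big_sum_in_bigo)
  fix k assume "k \<in> {..degree p}"
  then have "k \<le> n" using assms by auto
  have "(\<lambda>t. coeff p k * of_real (ln t ^ k)) \<in> O[at_right 0](\<lambda>t. of_real (ln t ^ k))"
    by (cases "coeff p k = 0") auto
  then show "(\<lambda>t. coeff p k * of_real (ln t) ^ k) \<in> O[at_right 0](\<lambda>t. of_real (ln t ^ n))"
    using landau_o.big_trans[OF _ ln_bigo_mono[OF \<open>k \<le> n\<close>]] by simp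
qed

lemma log_poly_bigo:
  assumes "f \<in> O[at_right 0](\<lambda>t. of_real t)"
  shows "log_poly n f 0"
proof -
  have "f \<in> O[at_right 0](\<lambda>t. of_real (t * ln t ^ (n + 1)))"
    using landau_o.big_trans[OF assms] t_ln_bigo_mono[of 0 "n + 1"] by simp
  then show ?thesis unfolding log_poly_def by (intro exI[of _ 0]) simp
qed

lemma log_poly_const: "log_poly n (\<lambda>t. c) c"
  unfolding log_poly_def by (intro exI[of _ "[:c:]"]) simp

lemma log_poly_cong:
  assumes "log_poly n f c" "eventually (\<lambda>t. f t = g t) (at_right 0)"
  shows "log_poly n g c"
proof -
  obtain p where p: "degree p \<le> n" "coeff p 0 = c"
     "(\<lambda>t. f t - poly p (of_real (ln t))) \<in> O[at_right 0](\<lambda>t. of_real (t * ln t ^ (n + 1)))"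
    using assms(1) unfolding log_poly_def by blast
  have "eventually (\<lambda>t. f t - poly p (of_real (ln t)) = g t - poly p (of_real (ln t))) (at_right 0)"
    using assms(2) by eventually_elim simp
  from landau_o.big.in_cong[OF this] p show ?thesis
    unfolding log_poly_def by blast
qed

lemma log_poly_add:
  assumes "log_poly n f c" "log_poly n g d"
  shows "log_poly n (\<lambda>t. f t + g t) (c + d)"
proof -
  obtain p q where p: "degree p \<le> n" "coeff p 0 = c"
     "(\<lambda>t. f t - poly p (of_real (ln t))) \<in> O[at_right 0](\<lambda>t. of_real (t * ln t ^ (n + 1)))"
    and q: "degree q \<le> n" "coeff q 0 = d"
     "(\<lambda>t. g t - poly q (of_real (ln t))) \<in> O[at_right 0](\<lambda>t. of_real (t * ln t ^ (n + 1)))"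
    using assms unfolding log_poly_def by blast
  have "(\<lambda>t. f t + g t - poly (p + q) (of_real (ln t))) \<in> O[at_right 0](\<lambda>t. of_real (t * ln t ^ (n + 1)))"
    using sum_in_bigo(1)[OF p(3) q(3)] by (simp add: algebra_simps)
  then show ?thesis unfolding log_poly_def
    using p q by (intro exI[of _ "p + q"]) (auto intro: degree_add_le)
qed

lemma log_poly_cmult:
  assumes "log_poly n f c"
  shows "log_poly n (\<lambda>t. a * f t) (a * c)"
proof -
  obtain p where p: "degree p \<le> n" "coeff p 0 = c"
     "(\<lambda>t. f t - poly p (of_real (ln t))) \<in> O[at_right 0](\<lambda>t. of_real (t * ln t ^ (n + 1)))"
    using assms unfolding log_poly_def by blast
  have "(\<lambda>t. a * (f t - poly p (of_real (ln t)))) \<in> O[at_right 0](\<lambda>t. of_real (t * ln t ^ (n + 1)))"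
    using p(3) by (cases "a = 0") auto
  then have "(\<lambda>t. a * f t - poly (smult a p) (of_real (ln t))) \<in> O[at_right 0](\<lambda>t. of_real (t * ln t ^ (n + 1)))"
    by (simp add: algebra_simps)
  then show ?thesis unfolding log_poly_def
    using p by (intro exI[of _ "smult a p"]) (auto intro: order.trans[OF degree_smult_le])
qed

lemma log_poly_mult:
  assumes "log_poly n f c" "log_poly m g d"
  shows "log_poly (n + m) (\<lambda>t. f t * g t) (c * d)"
proof -
  obtain p q where p: "degree p \<le> n" "coeff p 0 = c"
     "(\<lambda>t. f t - poly p (of_real (ln t))) \<in> O[at_right 0](\<lambda>t. of_real (t * ln t ^ (n + 1)))"
    and q: "degree q \<le> m" "coeff q 0 = d"
     "(\<lambda>t. g t - poly q (of_real (ln t))) \<in> O[at_right 0](\<lambda>t. of_real (t * ln t ^ (m + 1)))"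
    using assms unfolding log_poly_def by blast
  define P where "P t = poly p (of_real (ln t))" for t
  define Q where "Q t = poly q (of_real (ln t))" for t
  define E where "E t = f t - P t" for t
  define E' where "E' t = g t - Q t" for t
  have E: "E \<in> O[at_right 0](\<lambda>t. of_real (t * ln t ^ (n + 1)))"
    and E': "E' \<in> O[at_right 0](\<lambda>t. of_real (t * ln t ^ (m + 1)))"
    using p(3) q(3) by (simp_all add: E_def[abs_def] E'_def[abs_def] P_def Q_def)
  have P: "P \<in> O[at_right 0](\<lambda>t. of_real (ln t ^ n))" and Q: "Q \<in> O[at_right 0](\<lambda>t. of_real (ln t ^ m))"
    unfolding P_def Q_def using poly_ln_bigo p q by auto
  have 1: "(\<lambda>t. P t * E' t) \<in> O[at_right 0](\<lambda>t. of_real (t * ln t ^ (n + m + 1)))"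
    using landau_o.big.mult[OF P E'] by (simp add: power_add mult_ac)
  have 2: "(\<lambda>t. E t * Q t) \<in> O[at_right 0](\<lambda>t. of_real (t * ln t ^ (n + m + 1)))"
    using landau_o.big.mult[OF E Q] by (simp add: power_add mult_ac)
  \<comment> \<open>In the product of the two errors one factor is weakened to O(1); the other still
    supplies the factor \<open>t\<close>.\<close>
  have E'1: "E' \<in> O[at_right 0](\<lambda>t. 1)"
    using landau_o.big_trans[OF E' t_ln_tendsto] .
  have "(\<lambda>t. E t * E' t) \<in> O[at_right 0](\<lambda>t. of_real (t * ln t ^ (n + 1)) * 1)"
    by (rule landau_o.big.mult[OF E E'1])
  then have 3: "(\<lambda>t. E t * E' t) \<in> O[at_right 0](\<lambda>t. of_real (t * ln t ^ (n + m + 1)))"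
    using landau_o.big_trans[OF _ t_ln_bigo_mono[of "n + 1" "n + m + 1"]] by simp
  have "(\<lambda>t. P t * E' t + E t * Q t + E t * E' t) \<in> O[at_right 0](\<lambda>t. of_real (t * ln t ^ (n + m + 1)))"
    by (intro sum_in_bigo 1 2 3)
  moreover have "P t * E' t + E t * Q t + E t * E' t = f t * g t - poly (p * q) (of_real (ln t))" for t
    by (simp add: E_def E'_def P_def Q_def algebra_simps)
  ultimately show ?thesis unfolding log_poly_def
    using p q by (intro exI[of _ "p * q"])
      (auto simp: coeff_mult intro: order.trans[OF degree_mult_le])
qed

text \<open>The offset \<open>m\<close> carries the induction: passing to
  \<open>\<lambda>v. F t (a # v)\<close> shifts all lengths by one.\<close>

lemma log_poly_conv:
  assumes "\<And>v. log_poly (m + length v) (\<lambda>t. F t v) (M v)"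
    "\<And>v. length v \<le> length u \<Longrightarrow> log_poly (length v) (\<lambda>t. G t v) (N v)"
  shows "log_poly (m + length u) (\<lambda>t. conv (F t) (G t) u) (conv M N u)"
  using assms
proof (induction u arbitrary: F M m)
  case Nil
  then show ?case using log_poly_mult[OF Nil(1)[of "[]"] Nil(2)[of "[]"]] by simp
next
  case (Cons a u)
  have "log_poly (Suc m + length u) (\<lambda>t. conv (\<lambda>v. F t (a # v)) (G t) u) (conv (\<lambda>v. M (a # v)) N u)"
    by (rule Cons.IH) (use Cons.prems(1)[of "a # _"] Cons.prems(2) in simp_all)
  moreover have "log_poly (m + length (a # u)) (\<lambda>t. F t [] * G t (a # u)) (M [] * N (a # u))"
    using log_poly_mult[OF Cons.prems(1)[of "[]"] Cons.prems(2)[of "a # u"]] by simp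
  ultimately show ?case using log_poly_add by simp
qed

text \<open>Division by the unbounded logarithm shows that the polynomial without its lowest
  coefficient, divided by the variable, also tends to 0.\<close>

lemma poly_tendsto_0_imp_0:
  fixes p :: "complex poly"
  assumes "((\<lambda>t. poly p (of_real (ln t))) \<longlongrightarrow> 0) (at_right 0)"
  shows "p = 0"
  using assms
proof (induction p)
  case 0
  then show ?case by simp
next
  case (pCons a q)
  have inf: "filterlim (\<lambda>t::real. of_real (ln t) :: complex) at_infinity (at_right 0)"
  proof (rule filterlim_norm_at_top_imp_at_infinity)
    have "filterlim (\<lambda>t::real. \<bar>ln t\<bar>) at_top (at_right 0)" by real_asymp
    then show "filterlim (\<lambda>t::real. norm (of_real (ln t) :: complex)) at_top (at_right 0)" by simp
  qed
  have "((\<lambda>t. (poly (pCons a q) (of_real (ln t)) - a) * inverse (of_real (ln t))) \<longlongrightarrow> (0 - a) * 0) (at_right 0)"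
    by (intro tendsto_intros pCons filterlim_compose[OF tendsto_inverse_0 inf])
  moreover have "eventually (\<lambda>t::real. t < 1) (at_right 0)" "eventually (\<lambda>t::real. 0 < t) (at_right 0)"
    by (auto intro!: eventually_at_right_less eventually_at_rightI[of 0 1])
  then have "eventually (\<lambda>t. (poly (pCons a q) (of_real (ln t)) - a) * inverse (of_real (ln t)) = poly q (of_real (ln t)))
      (at_right 0)"
    by eventually_elim (simp add: field_simps)
  ultimately have "((\<lambda>t. poly q (of_real (ln t))) \<longlongrightarrow> 0) (at_right 0)"
    using Lim_transform_eventually by fastforce
  then have "q = 0" by (rule pCons.IH)
  then have "a = 0" using pCons.prems by (simp add: tendsto_const_iff)
  then show ?case using \<open>q = 0\<close> by simp
qed

lemma log_poly_unique:
  assumes "log_poly n f c" "log_poly n f d"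
  shows "c = d"
proof -
  obtain p q where p: "degree p \<le> n" "coeff p 0 = c"
     "(\<lambda>t. f t - poly p (of_real (ln t))) \<in> O[at_right 0](\<lambda>t. of_real (t * ln t ^ (n + 1)))"
    and q: "degree q \<le> n" "coeff q 0 = d"
     "(\<lambda>t. f t - poly q (of_real (ln t))) \<in> O[at_right 0](\<lambda>t. of_real (t * ln t ^ (n + 1)))"
    using assms unfolding log_poly_def by blast
  have "(\<lambda>t. poly (q - p) (of_real (ln t))) \<in> O[at_right 0](\<lambda>t. of_real (t * ln t ^ (n + 1)))"
    using sum_in_bigo(2)[OF p(3) q(3)] by simp
  moreover have "((\<lambda>t::real. t * ln t ^ (n + 1)) \<longlongrightarrow> 0) (at_right 0)" by real_asymp
  then have "((\<lambda>t. of_real (t * ln t ^ (n + 1)) :: complex) \<longlongrightarrow> of_real 0) (at_right 0)"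
    by (rule tendsto_of_real)
  then have "(\<lambda>t. of_real (t * ln t ^ (n + 1)) :: complex) \<in> o[at_right 0](\<lambda>t. 1)"
    by (intro smalloI_tendsto) auto
  ultimately have "(\<lambda>t. poly (q - p) (of_real (ln t))) \<in> o[at_right 0](\<lambda>t. 1)"
    by (rule landau_o.big_small_trans)
  then have "((\<lambda>t. poly (q - p) (of_real (ln t)) / 1) \<longlongrightarrow> 0) (at_right 0)"
    by (rule smalloD_tendsto)
  then have "q - p = 0" by (intro poly_tendsto_0_imp_0) simp
  then show ?thesis using p q by simp
qed

text \<open>Powers of the logarithm are integrable at 0, and \<open>\<phi>\<close> is an explicit
  majorant for the primitive.\<close>

lemma log_int:
  fixes F :: "real \<Rightarrow> complex"
  assumes "b > 0" "\<And>t. 0 < t \<Longrightarrow> t < b \<Longrightarrow> (F has_vector_derivative F' t) (at t)"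
    and "F' \<in> O[at_right 0](\<lambda>t. of_real (ln t ^ m))"
  obtains c where "(\<lambda>t. F t - c) \<in> O[at_right 0](\<lambda>t. of_real (t * ln t ^ m))"
proof -
  obtain C where C: "C > 0" "eventually (\<lambda>t. norm (F' t) \<le> C * norm (of_real (ln t ^ m) :: complex)) (at_right 0)"
    using landau_o.bigE[OF assms(3)] by blast
  then obtain b1 where b1: "b1 > 0" "\<And>t. 0 < t \<Longrightarrow> t < b1 \<Longrightarrow> norm (F' t) \<le> C * \<bar>ln t\<bar> ^ m"
    unfolding eventually_at_right_field by (auto simp: norm_power power_abs)
  \<comment> \<open>Below exp (- 2 m - 1) one has - ln t > 2 m + 1, so the second term of
    \<open>\<phi>'\<close> is at most half the first; the factor 2 in \<open>\<phi>\<close>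
    compensates for this.\<close>
  define B where "B = min b (min b1 (exp (- 2 * real m - 1)))"
  have B: "B > 0" using assms(1) b1(1) by (simp add: B_def)
  define \<phi> where "\<phi> t = 2 * C * (t * (- ln t) ^ m)" for t
  define \<phi>' where "\<phi>' t = 2 * C * ((- ln t) ^ m - real m * (- ln t) ^ (m - 1))" for t
  have \<phi>D: "(\<phi> has_vector_derivative \<phi>' t) (at t)" if "t > 0" for t
    unfolding \<phi>_def \<phi>'_def has_real_derivative_iff_has_vector_derivative[symmetric]
    using that by (auto intro!: derivative_eq_intros simp: algebra_simps)
  have lnB: "2 * real m + 1 < - ln t" if "0 < t" "t < B" for t
  proof -
    have "t < exp (- 2 * real m - 1)" using that by (simp add: B_def)
    then have "ln t < - 2 * real m - 1" using that ln_less_cancel_iff[of t "exp (- 2 * real m - 1)"] by simp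
    then show ?thesis by simp
  qed
  have \<phi>pos: "0 \<le> \<phi> t" if t: "0 < t" "t < B" for t
  proof -
    have "0 \<le> - ln t" using lnB[OF t] by linarith
    from zero_le_power[OF this, of m] show ?thesis using C t by (simp add: \<phi>_def)
  qed
  have \<phi>'ge: "C * \<bar>ln t\<bar> ^ m \<le> \<phi>' t" if t: "0 < t" "t < B" for t
  proof (cases m)
    case 0
    then show ?thesis using C by (simp add: \<phi>'_def)
  next
    case (Suc k)
    let ?L = "- ln t"
    have L: "2 * real m + 1 < ?L" by (rule lnB[OF t])
    have "2 * real m * ?L ^ k \<le> ?L * ?L ^ k" using L by (intro mult_right_mono) auto
    then have "2 * (real m * ?L ^ (m - 1)) \<le> ?L ^ m" by (simp add: Suc algebra_simps)
    then have "real m * ?L ^ (m - 1) \<le> ?L ^ m / 2" by linarith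
    then have "C * ?L ^ m \<le> \<phi>' t" using C by (simp add: \<phi>'_def algebra_simps)
    moreover have "\<bar>ln t\<bar> = ?L" using L by simp
    ultimately show ?thesis by simp
  qed
  have bnd: "dist (F x) (F y) \<le> \<phi> y" if xy: "0 < x" "x \<le> y" "y < B" for x y
  proof (cases "x = y")
    case True
    have "0 \<le> \<phi> y" using xy by (intro \<phi>pos) auto
    then show ?thesis using True by simp
  next
    case False
    have cF: "continuous_on {x..y} F"
    proof (rule continuous_at_imp_continuous_on, rule ballI)
      fix t assume "t \<in> {x..y}"
      then show "isCont F t"
        using xy by (intro has_vector_derivative_continuous[OF assms(2)]) (auto simp: B_def)
    qed
    have c\<phi>: "continuous_on {x..y} \<phi>"
    proof (rule continuous_at_imp_continuous_on, rule ballI)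
      fix t assume "t \<in> {x..y}"
      then show "isCont \<phi> t"
        using xy by (intro has_vector_derivative_continuous[OF \<phi>D]) auto
    qed
    have "norm (F y - F x) \<le> \<phi> y - \<phi> x"
    proof (rule differentiable_bound_general[OF _ cF c\<phi>])
      show "x < y" using False xy by simp
      fix t assume t: "x < t" "t < y"
      show "(F has_vector_derivative F' t) (at t)"
        by (rule assms(2)) (use t xy in \<open>auto simp: B_def\<close>)
      show "(\<phi> has_vector_derivative \<phi>' t) (at t)"
        by (rule \<phi>D) (use t xy in auto)
      have "norm (F' t) \<le> C * \<bar>ln t\<bar> ^ m" by (rule b1(2)) (use t xy in \<open>auto simp: B_def\<close>)
      also have "\<dots> \<le> \<phi>' t" by (rule \<phi>'ge) (use t xy in auto)
      finally show "norm (F' t) \<le> \<phi>' t" .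
    qed
    moreover have "0 \<le> \<phi> x" using xy by (intro \<phi>pos) auto
    ultimately show ?thesis by (simp add: dist_norm norm_minus_commute)
  qed
  have linear_ext: "eventually (\<lambda>y. 0 < y \<and> y < B) (at_right 0)"
    using B eventually_at_right_real by fastforce
  obtain c where c: "eventually (\<lambda>y. dist c (F y) \<le> \<phi> y) (at_right 0)"
  proof (rule cauchy_lim[of "at_right 0" F \<phi>])
    show "eventually (\<lambda>y. eventually (\<lambda>x. dist (F x) (F y) \<le> \<phi> y) (at_right 0)) (at_right 0)"
      using linear_ext
    proof eventually_elim
      case (elim y)
      then have "eventually (\<lambda>x. 0 < x \<and> x < y) (at_right 0)"
        using eventually_at_right_real by fastforce
      then show ?case by eventually_elim (use bnd elim in auto)
    qed
    show "(\<phi> \<longlongrightarrow> 0) (at_right 0)"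
      unfolding \<phi>_def by real_asymp
  qed (auto intro: that)
  have "(\<lambda>t. F t - c) \<in> O[at_right 0](\<lambda>t. of_real (t * ln t ^ m))"
  proof (rule bigoI[where c = "2 * C"])
    show "eventually (\<lambda>t. norm (F t - c) \<le> 2 * C * norm (of_real (t * ln t ^ m) :: complex)) (at_right 0)"
      using c linear_ext
    proof eventually_elim
      case (elim t)
      have "\<phi> t \<le> \<bar>\<phi> t\<bar>" by simp
      also have "\<dots> = 2 * C * norm (of_real (t * ln t ^ m) :: complex)"
        using C by (simp add: \<phi>_def abs_mult power_abs norm_mult norm_power)
      finally show ?case using elim(1) by (simp add: dist_norm norm_minus_commute)
    qed
  qed
  then show ?thesis by (rule that)
qed

section \<open>Expansions of transports that start near the base point 0\<close>

definition sector :: "complex set" where "sector = {z. Re z > 0} \<inter> ball 0 1"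

lemma simple_domain_sector: "simple_domain sector"
  unfolding simple_domain_def sector_def
  by (intro conjI open_Int convex_Int open_halfspace_Re_gt convex_halfspace_Re_gt open_ball convex_ball) auto

lemma poly_antiderivative:
  fixes p :: "complex poly"
  assumes "degree p \<le> n"
  obtains Q where "pderiv Q = p" "degree Q \<le> Suc n" "coeff Q 0 = 0"
proof -
  define Q where "Q = (\<Sum>k\<le>n. monom (coeff p k / of_nat (Suc k)) (Suc k))"
  have "pderiv Q = (\<Sum>k\<le>n. monom (coeff p k) k)"
    unfolding Q_def by (simp add: higher_pderiv_sum[where n = 1, simplified] pderiv_monom del: of_nat_Suc)
  also have "\<dots> = p" by (rule poly_as_sum_of_monoms'[OF assms])
  finally have "pderiv Q = p" .
  moreover have "degree Q \<le> Suc n"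
    unfolding Q_def by (intro degree_sum_le) (auto intro: order.trans[OF degree_monom_le])
  moreover have "coeff Q 0 = 0" by (simp add: Q_def coeff_sum)
  ultimately show ?thesis by (rule that)
qed

lemma of_real_hvd: "(of_real has_vector_derivative (1::complex)) (at t within S)"
  using has_vector_derivative_of_real[OF DERIV_ident] by simp

lemma poly_ln_hvd:
  assumes "t > 0"
  shows "((\<lambda>t. poly Q (of_real (ln t)) :: complex) has_vector_derivative
            poly (pderiv Q) (of_real (ln t)) / of_real t) (at t)"
proof -
  have "((\<lambda>t. of_real (ln t) :: complex) has_vector_derivative of_real (inverse t)) (at t)"
    by (rule has_vector_derivative_of_real) (use DERIV_ln[OF assms] in simp)
  from field_vector_diff_chain_at[OF this poly_DERIV, of Q]
  show ?thesis by (simp add: o_def field_simps of_real_inverse)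
qed

lemma eventually_in_01: "b > 0 \<Longrightarrow> eventually (\<lambda>t::real. 0 < t \<and> t < b) (at_right 0)"
  using eventually_at_right_real by fastforce

text \<open>Existence of the regularization at the lower end. The end point 1/3 is where the
  representative \<open>gref\<close> leaves the real axis.\<close>

lemma log_poly_transport_third: "\<exists>c. log_poly (length u) (\<lambda>t. transport (of_real t) (1/3) u) c"
proof (induction u)
  case Nil
  show ?case using log_poly_const[of 0 1] by auto
next
  case (Cons a u)
  define f where "f t = transport (of_real t) (1/3) u" for t :: real
  define F where "F t = transport (of_real t) (1/3) (a # u)" for t :: real
  define n where "n = length u"
  from Cons obtain p where p: "degree p \<le> n"
     "(\<lambda>t. f t - poly p (of_real (ln t))) \<in> O[at_right 0](\<lambda>t. of_real (t * ln t ^ (n + 1)))"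
    unfolding log_poly_def f_def n_def by blast
  have F': "(F has_vector_derivative - (f t / (of_real t - letter_point a))) (at t)" if "0 < t" "t < 1" for t
  proof -
    have "1/3 \<in> sector" "of_real t \<in> sector" using that by (auto simp: sector_def norm_divide)
    from field_vector_diff_chain_at[OF of_real_hvd transport_deriv(2)[OF simple_domain_sector this]]
    show ?thesis by (simp add: o_def F_def[abs_def] f_def del: transport.simps(2))
  qed
  have P: "(\<lambda>t. poly p (of_real (ln t)) :: complex) \<in> O[at_right 0](\<lambda>t. of_real (ln t ^ (n + 1)))"
    using poly_ln_bigo[of p "n + 1"] p(1) by simp
  have t1: "(\<lambda>t. of_real t :: complex) \<in> O[at_right 0](\<lambda>t. 1)"
    using t_ln_tendsto[of 0] by simp
  have E: "(\<lambda>t. f t - poly p (of_real (ln t))) \<in> O[at_right 0](\<lambda>t. of_real (ln t ^ (n + 1)))"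
    using landau_o.big_trans[OF p(2)] landau_o.big.mult[OF t1 landau_o.big_refl[of "\<lambda>t. of_real (ln t ^ (n + 1))"]]
    by simp
  have "\<exists>c. log_poly (Suc n) F c"
  proof (cases a)
    \<comment> \<open>The form of this letter is regular at 0, so the integral converges and no
      power of the logarithm is gained.\<close>
    case E1
    have f: "f \<in> O[at_right 0](\<lambda>t. of_real (ln t ^ (n + 1)))"
      using sum_in_bigo(1)[OF P E] by simp
    have inv: "(\<lambda>t. - 1 / (of_real t - 1) :: complex) \<in> O[at_right 0](\<lambda>t. 1)"
    proof (rule bigoI[where c = 2])
      show "eventually (\<lambda>t. norm (- 1 / (of_real t - 1) :: complex) \<le> 2 * norm (1::complex)) (at_right 0)"
        using eventually_in_01[OF half_gt_zero[OF zero_less_one]]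
      proof eventually_elim
        case (elim t)
        have "norm (of_real t - 1 :: complex) = \<bar>t - 1\<bar>"
          by (metis norm_of_real of_real_1 of_real_diff)
        then show ?case using elim by (simp add: norm_divide field_simps)
      qed
    qed
    have "(\<lambda>t. - 1 / (of_real t - 1) * f t) \<in> O[at_right 0](\<lambda>t. 1 * of_real (ln t ^ (n + 1)))"
      by (rule landau_o.big.mult[OF inv f])
    then have fO: "(\<lambda>t. - (f t / (of_real t - letter_point a))) \<in> O[at_right 0](\<lambda>t. of_real (ln t ^ (n + 1)))"
      by (simp add: E1)
    obtain c where "(\<lambda>t. F t - c) \<in> O[at_right 0](\<lambda>t. of_real (t * ln t ^ (n + 1)))"
      by (rule log_int[OF zero_less_one F' fO]) (assumption | rule that)+
    then have "(\<lambda>t. F t - c) \<in> O[at_right 0](\<lambda>t. of_real (t * ln t ^ (Suc n + 1)))"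
      using landau_o.big_trans[OF _ t_ln_bigo_mono[of "n + 1" "Suc n + 1"]] by simp
    then have "log_poly (Suc n) F c"
      unfolding log_poly_def by (intro exI[of _ "[:c:]"]) simp
    then show ?thesis by blast
  next
    \<comment> \<open>The polynomial part is integrated exactly: \<open>Q\<close> evaluated at ln t
      has derivative p (ln t) / t. What remains of the derivative is an error that has lost its
      factor \<open>t\<close> and is still integrable.\<close>
    case E0
    obtain Q where Q: "pderiv Q = p" "degree Q \<le> Suc n" "coeff Q 0 = 0"
      using poly_antiderivative[OF p(1)] .
    define G where "G t = F t + poly Q (of_real (ln t))" for t
    define G' where "G' t = - (f t / of_real t) + poly p (of_real (ln t)) / of_real t" for t
    have GD: "(G has_vector_derivative G' t) (at t)" if "0 < t" "t < 1" for t
      unfolding G_def G'_def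
      using has_vector_derivative_add[OF F'[OF that] poly_ln_hvd[OF that(1), of Q]] by (simp add: E0 Q(1))
    have "(\<lambda>t. inverse (of_real t) * - (f t - poly p (of_real (ln t)))) \<in>
        O[at_right 0](\<lambda>t. inverse (of_real t) * of_real (t * ln t ^ (n + 1)))"
      using p(2)[folded landau_o.big.uminus_in_iff[of "\<lambda>t. f t - poly p (of_real (ln t))"]]
      by (rule landau_o.big.mult[OF landau_o.big_refl])
    also have "(\<lambda>t. inverse (of_real t) * - (f t - poly p (of_real (ln t)))) = G'"
      by (rule ext) (simp add: G'_def divide_inverse algebra_simps)
    finally have G'1: "G' \<in> O[at_right 0](\<lambda>t. inverse (of_real t) * of_real (t * ln t ^ (n + 1)))" .
    have linear_ext: "eventually (\<lambda>t. inverse (of_real t) * of_real (t * ln t ^ (n + 1)) = (of_real (ln t ^ (n + 1)) :: complex))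
        (at_right 0)"
      using eventually_in_01[OF zero_less_one] by eventually_elim simp
    have GO: "G' \<in> O[at_right 0](\<lambda>t. of_real (ln t ^ (n + 1)))"
      using G'1 unfolding landau_o.big.cong[OF linear_ext] .
    obtain c where "(\<lambda>t. G t - c) \<in> O[at_right 0](\<lambda>t. of_real (t * ln t ^ (n + 1)))"
      by (rule log_int[OF zero_less_one GD GO]) (assumption | rule that)+
    then have "(\<lambda>t. G t - c) \<in> O[at_right 0](\<lambda>t. of_real (t * ln t ^ (Suc n + 1)))"
      using landau_o.big_trans[OF _ t_ln_bigo_mono[of "n + 1" "Suc n + 1"]] by simp
    moreover have "G t - c = F t - poly ([:c:] - Q) (of_real (ln t))" for t
      by (simp add: G_def)
    moreover have "degree ([:c:] - Q) \<le> Suc n" using Q(2) by (intro degree_diff_le) auto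
    ultimately have "log_poly (Suc n) F c"
      unfolding log_poly_def using Q(3) by (intro exI[of _ "[:c:] - Q"]) simp
    then show ?thesis by blast
  qed
  then show ?case by (simp add: F_def[abs_def] n_def del: transport.simps(2))
qed

text \<open>The points are within C t^2 of \<open>t\<close>, and the forms are bounded by 2 / t on
  the segment between them; each letter therefore contributes O(t).\<close>

lemma transport_near:
  fixes x y :: complex and t :: real
  assumes t: "0 < t" "t \<le> 1/4" "C * t \<le> 1/4"
    and xy: "norm (x - of_real t) \<le> C * t\<^sup>2" "norm (y - of_real t) \<le> C * t\<^sup>2"
  shows "x \<in> sector" "y \<in> sector" "norm (transport x y u) \<le> (4 * C * t) ^ length u"
proof -
  have Ct: "C * t\<^sup>2 \<le> t / 4"
    using mult_right_mono[OF t(3), of t] t(1) by (simp add: power2_eq_square mult.assoc)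
  have sec: "z \<in> sector \<and> t / 2 \<le> norm z \<and> t / 2 \<le> norm (z - 1)" if "norm (z - of_real t) \<le> C * t\<^sup>2" for z
  proof -
    have 1: "norm (z - of_real t) \<le> t / 4" using that Ct by linarith
    have "\<bar>Re z - t\<bar> \<le> t / 4" using abs_Re_le_cmod[of "z - of_real t"] 1 by simp
    then have Re: "Re z \<ge> 3 * t / 4" "Re z \<le> 5 * t / 4" by linarith+
    have "norm z \<le> norm (z - of_real t) + norm (of_real t :: complex)"
      using norm_triangle_ineq[of "z - of_real t" "of_real t"] by simp
    then have "norm z < 1" using 1 t by simp
    moreover have "t / 2 \<le> norm z" using complex_Re_le_cmod[of z] Re t by linarith
    moreover have "t / 2 \<le> norm (z - 1)"
      using abs_Re_le_cmod[of "z - 1"] Re t by simp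
    ultimately show ?thesis using Re t by (simp add: sector_def)
  qed
  show xs: "x \<in> sector" and ys: "y \<in> sector" using sec xy by auto
  have "norm (transport x y u) \<le> (norm (y - x) / (t / 2)) ^ length u"
  proof (rule norm_transport_le[OF simple_domain_sector xs ys])
    fix z b assume "z \<in> closed_segment x y"
    moreover have "closed_segment x y \<subseteq> cball (of_real t) (C * t\<^sup>2)"
      using xy by (intro closed_segment_subset) (auto simp: dist_norm norm_minus_commute)
    ultimately have "norm (z - of_real t) \<le> C * t\<^sup>2" by (auto simp: dist_norm norm_minus_commute)
    from sec[OF this] show "t / 2 \<le> norm (z - letter_point b)" by (cases b) auto
  qed (use t in auto)
  also have "\<dots> \<le> (4 * C * t) ^ length u"
  proof (rule power_mono)
    have "norm (y - x) \<le> norm (y - of_real t) + norm (x - of_real t)"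
      by (metis dist_norm dist_triangle2)
    then have "norm (y - x) \<le> 2 * (C * t\<^sup>2)" using xy by linarith
    then show "norm (y - x) / (t / 2) \<le> 4 * C * t"
      using t(1) by (simp add: field_simps power2_eq_square)
  qed (use t in auto)
  finally show "norm (transport x y u) \<le> (4 * C * t) ^ length u" .
qed

lemma log_poly_transport_near:
  assumes "b > 0" "\<And>t. 0 < t \<Longrightarrow> t < b \<Longrightarrow> norm (x t - of_real t) \<le> C * t\<^sup>2"
    "\<And>t. 0 < t \<Longrightarrow> t < b \<Longrightarrow> norm (y t - of_real t) \<le> C * t\<^sup>2" "C > 0"
  shows "log_poly (length u) (\<lambda>t. transport (x t) (y t) u) (eps u)"
proof (cases u)
  case Nil
  then show ?thesis using log_poly_const[of 0 1] by simp
next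
  case (Cons a v)
  have linear_ext: "eventually (\<lambda>t. 0 < t \<and> t < min b (min (1/4) (1 / (4 * C)))) (at_right 0)"
    using assms by (intro eventually_in_01) auto
  have "(\<lambda>t. transport (x t) (y t) u) \<in> O[at_right 0](\<lambda>t. of_real t)"
  proof (rule bigoI[where c = "4 * C"])
    show "eventually (\<lambda>t. norm (transport (x t) (y t) u) \<le> 4 * C * norm (of_real t :: complex)) (at_right 0)"
      using linear_ext
    proof eventually_elim
      case (elim t)
      have Ct: "C * t \<le> 1/4" using elim assms(4) by (simp add: field_simps)
      have "norm (transport (x t) (y t) u) \<le> (4 * C * t) ^ length u"
        by (rule transport_near[where C = C]) (use elim assms Ct in auto)
      also have "\<dots> \<le> (4 * C * t) ^ 1"
        using elim Ct assms(4) by (intro power_decreasing) (auto simp: Cons)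
      finally show ?case using elim by simp
    qed
  qed
  then show ?thesis using log_poly_bigo by (simp add: Cons)
qed

text \<open>Taylor's formula with quadratic remainder, from two applications of the mean value
  inequality. It is applied to the first and to the reversed last smooth piece of a path.\<close>

lemma hvd_quadratic:
  fixes f f1 f2 :: "real \<Rightarrow> complex"
  assumes b: "b > 0"
    and f: "\<And>t. t \<in> {0..b} \<Longrightarrow> (f has_vector_derivative f1 t) (at t within {0..b})"
    and f1: "\<And>t. t \<in> {0..b} \<Longrightarrow> (f1 has_vector_derivative f2 t) (at t within {0..b})"
    and f2: "continuous_on {0..b} f2"
    and 0: "f 0 = 0" "f1 0 = 1"
  obtains C where "C > 0" "\<And>t. 0 < t \<Longrightarrow> t < b \<Longrightarrow> norm (f t - of_real t) \<le> C * t\<^sup>2"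
proof -
  have "bounded (f2 ` {0..b})"
    by (intro compact_imp_bounded compact_continuous_image f2) auto
  then obtain B where B: "B > 0" "\<And>t. t \<in> {0..b} \<Longrightarrow> norm (f2 t) \<le> B"
    unfolding bounded_pos by blast
  have cf: "continuous_on {0..b} f" "continuous_on {0..b} f1"
    using f f1 continuous_on_vector_derivative by blast+
  have at: "(f has_vector_derivative f1 t) (at t)" "(f1 has_vector_derivative f2 t) (at t)"
    if "0 < t" "t < b" for t
    using f[of t] f1[of t] that by (simp_all add: at_within_Icc_at)
  have d1: "norm (f1 t - 1) \<le> B * t" if t: "0 < t" "t < b" for t
  proof -
    have "norm (f1 t - f1 0) \<le> B * t - B * 0"
    proof (rule differentiable_bound_general[of 0 t])
      show "continuous_on {0..t} f1" by (rule continuous_on_subset[OF cf(2)]) (use t in auto)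
      fix x assume x: "0 < x" "x < t"
      show "(f1 has_vector_derivative f2 x) (at x)" by (rule at) (use x t in auto)
      show "((\<lambda>x. B * x) has_vector_derivative B) (at x)"
        unfolding has_real_derivative_iff_has_vector_derivative[symmetric]
        by (auto intro!: derivative_eq_intros)
      show "norm (f2 x) \<le> B" by (rule B) (use x t in auto)
    qed (use t in \<open>auto intro!: continuous_intros\<close>)
    then show ?thesis by (simp add: 0)
  qed
  have "norm (f t - of_real t) \<le> (B / 2) * t\<^sup>2" if t: "0 < t" "t < b" for t
  proof -
    have "norm ((f t - of_real t) - (f 0 - of_real 0)) \<le> (B / 2) * t\<^sup>2 - (B / 2) * 0\<^sup>2"
    proof (rule differentiable_bound_general[of 0 t])
      show "continuous_on {0..t} (\<lambda>t. f t - of_real t)"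
        by (intro continuous_intros continuous_on_subset[OF cf(1)]) (use t in auto)
      fix x assume x: "0 < x" "x < t"
      show "((\<lambda>t. f t - of_real t) has_vector_derivative (f1 x - 1)) (at x)"
        by (intro has_vector_derivative_diff at of_real_hvd) (use x t in auto)
      show "((\<lambda>x. (B / 2) * x\<^sup>2) has_vector_derivative (B * x)) (at x)"
        unfolding has_real_derivative_iff_has_vector_derivative[symmetric]
        by (auto intro!: derivative_eq_intros)
      show "norm (f1 x - 1) \<le> B * x" by (rule d1) (use x t in auto)
    qed (use t in \<open>auto intro!: continuous_intros\<close>)
    then show ?thesis by (simp add: 0)
  qed
  with B(1) show ?thesis by (intro that[of "B / 2"]) auto
qed

section \<open>Piecewise smooth paths near their end points\<close>

lemma piecewise_smoothE:
  assumes "piecewise_smooth g"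
  obtains S where "finite S" "{0, 1} \<subseteq> S" "S \<subseteq> {0..1}"
    "\<And>a b. a \<in> S \<Longrightarrow> b \<in> S \<Longrightarrow> a < b \<Longrightarrow> S \<inter> {a<..<b} = {} \<Longrightarrow> smooth_on_segment g a b"
proof -
  obtain S where S: "finite S" "{0, 1} \<subseteq> S" "S \<subseteq> {0..1}"
    "\<forall>a\<in>S. \<forall>b\<in>S. a < b \<and> S \<inter> {a<..<b} = {} \<longrightarrow> smooth_on_segment g a b"
    using assms unfolding piecewise_smooth_def by (elim conjE exE)
  show ?thesis
    by (rule that[OF S(1-3)]) (use S(4) in simp)
qed

lemma smooth_on_segmentE:
  assumes "smooth_on_segment g a b"
  obtains D where "\<And>t. t \<in> {a..b} \<Longrightarrow> D 0 t = g t"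
    "\<And>n t. t \<in> {a..b} \<Longrightarrow> (D n has_vector_derivative D (Suc n) t) (at t within {a..b})"
proof -
  obtain D where D: "\<forall>t\<in>{a..b}. D 0 t = g t"
    "\<forall>n. \<forall>t\<in>{a..b}. (D n has_vector_derivative D (Suc n) t) (at t within {a..b})"
    using assms unfolding smooth_on_segment_def by (elim conjE exE)
  show ?thesis
    by (rule that[of D]) (use D in simp_all)
qed

lemma piecewise_smooth_differentiable:
  assumes "piecewise_smooth g"
  obtains S where "finite S" "\<And>t. t \<in> {0<..<1} - S \<Longrightarrow> g differentiable (at t)"
proof -
  obtain S where S: "finite S" "{0, 1} \<subseteq> S" "S \<subseteq> {0..1}"
    and seg: "\<And>a b. a \<in> S \<Longrightarrow> b \<in> S \<Longrightarrow> a < b \<Longrightarrow> S \<inter> {a<..<b} = {} \<Longrightarrow> smooth_on_segment g a b"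
    by (rule piecewise_smoothE[OF assms]) (rule that)
  have "g differentiable (at t)" if t: "t \<in> {0<..<1} - S" for t
  proof -
    define A where "A = {s\<in>S. s < t}"
    define B where "B = {s\<in>S. t < s}"
    have fin: "finite A" "finite B" "A \<noteq> {}" "B \<noteq> {}" using S t by (auto simp: A_def B_def)
    define a where "a = Max A"
    define b where "b = Min B"
    have ab: "a \<in> A" "b \<in> B" using Max_in Min_in fin by (auto simp: a_def b_def)
    have le: "\<And>s. s \<in> A \<Longrightarrow> s \<le> a" "\<And>s. s \<in> B \<Longrightarrow> b \<le> s"
      using Max_ge Min_le fin by (auto simp: a_def b_def)
    have "S \<inter> {a<..<b} = {}"
    proof (rule ccontr)
      assume "S \<inter> {a<..<b} \<noteq> {}"
      then obtain s where s: "s \<in> S" "a < s" "s < b" by auto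
      have "s \<noteq> t" using s t by auto
      then have "s \<in> A \<or> s \<in> B" using s by (auto simp: A_def B_def)
      then show False using le[of s] s by auto
    qed
    moreover have abt: "a \<in> S" "b \<in> S" "a < t" "t < b" using ab by (auto simp: A_def B_def)
    ultimately have "smooth_on_segment g a b" by (intro seg) auto
    then obtain D where D: "\<And>t. t \<in> {a..b} \<Longrightarrow> D 0 t = g t"
      "\<And>n t. t \<in> {a..b} \<Longrightarrow> (D n has_vector_derivative D (Suc n) t) (at t within {a..b})"
      by (rule smooth_on_segmentE) (rule that)
    have "(D 0 has_vector_derivative D (Suc 0) t) (at t)"
      using D(2)[of t 0] abt by (simp add: at_within_Icc_at)
    then have "(g has_vector_derivative D (Suc 0) t) (at t)"
      by (rule has_vector_derivative_transform_within_open[where S = "{a<..<b}"]) (use abt D(1) in auto)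
    then show ?thesis by (rule differentiableI_vector)
  qed
  with S(1) show ?thesis by (rule that)
qed

lemma piecewise_smooth_first_segment:
  assumes "piecewise_smooth g"
  obtains b where "0 < b" "b \<le> 1" "smooth_on_segment g 0 b"
proof -
  obtain S where S: "finite S" "{0, 1} \<subseteq> S" "S \<subseteq> {0..1}"
    and seg: "\<And>a b. a \<in> S \<Longrightarrow> b \<in> S \<Longrightarrow> a < b \<Longrightarrow> S \<inter> {a<..<b} = {} \<Longrightarrow> smooth_on_segment g a b"
    by (rule piecewise_smoothE[OF assms]) (rule that)
  define b where "b = Min {s\<in>S. 0 < s}"
  have fin: "finite {s\<in>S. 0 < s}" "{s\<in>S. 0 < s} \<noteq> {}" using S by auto
  have b: "b \<in> S" "0 < b" using Min_in[OF fin] by (auto simp: b_def)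
  have "S \<inter> {0<..<b} = {}" using Min_le[OF fin(1)] by (force simp: b_def)
  then have "smooth_on_segment g 0 b" using b S by (intro seg) auto
  moreover have "b \<le> 1" using b S by auto
  ultimately show ?thesis using b that by blast
qed

lemma piecewise_smooth_last_segment:
  assumes "piecewise_smooth g"
  obtains a where "0 \<le> a" "a < 1" "smooth_on_segment g a 1"
proof -
  obtain S where S: "finite S" "{0, 1} \<subseteq> S" "S \<subseteq> {0..1}"
    and seg: "\<And>a b. a \<in> S \<Longrightarrow> b \<in> S \<Longrightarrow> a < b \<Longrightarrow> S \<inter> {a<..<b} = {} \<Longrightarrow> smooth_on_segment g a b"
    by (rule piecewise_smoothE[OF assms]) (rule that)
  define a where "a = Max {s\<in>S. s < 1}"
  have fin: "finite {s\<in>S. s < 1}" "{s\<in>S. s < 1} \<noteq> {}" using S by auto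
  have a: "a \<in> S" "a < 1" using Max_in[OF fin] by (auto simp: a_def)
  have "S \<inter> {a<..<1} = {}" using Max_ge[OF fin(1)] by (force simp: a_def)
  then have "smooth_on_segment g a 1" using a S by (intro seg) auto
  moreover have "0 \<le> a" using a S by auto
  ultimately show ?thesis using a that by blast
qed

lemma tpath_start:
  assumes "tpath tbp0 tbp0 g"
  obtains b C where "0 < b" "C > 0" "\<And>t. 0 < t \<Longrightarrow> t < b \<Longrightarrow> norm (g t - of_real t) \<le> C * t\<^sup>2"
proof -
  have g: "piecewise_smooth g" "g 0 = 0" "(g has_vector_derivative 1) (at 0 within {0..1})"
    using assms by (auto simp: tpath_def tbp0_def)
  obtain b where b: "0 < b" "b \<le> 1" "smooth_on_segment g 0 b"
    using piecewise_smooth_first_segment[OF g(1)] .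
  obtain D where D: "\<And>t. t \<in> {0..b} \<Longrightarrow> D 0 t = g t"
      "\<And>n t. t \<in> {0..b} \<Longrightarrow> (D n has_vector_derivative D (Suc n) t) (at t within {0..b})"
    by (rule smooth_on_segmentE[OF b(3)]) (rule that)
  have "(g has_vector_derivative D (Suc 0) 0) (at 0 within {0..b})"
    by (rule has_vector_derivative_transform[OF _ _ D(2)]) (use b D(1) in auto)
  moreover have "(g has_vector_derivative 1) (at 0 within {0..b})"
    by (rule has_vector_derivative_within_subset[OF g(3)]) (use b in auto)
  ultimately have D1: "D (Suc 0) 0 = 1"
    using b(1) by (intro vector_derivative_unique_within[of 0 "{0..b}" g]) (auto simp: trivial_limit_within)
  obtain C where C: "C > 0" "\<And>t. 0 < t \<Longrightarrow> t < b \<Longrightarrow> norm (D 0 t - of_real t) \<le> C * t\<^sup>2"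
  proof (rule hvd_quadratic[of b "D 0" "D (Suc 0)" "D (Suc (Suc 0))"])
    show "continuous_on {0..b} (D (Suc (Suc 0)))"
      using D(2) continuous_on_vector_derivative by blast
  qed (use b D D1 g(2) in auto)
  show ?thesis
    by (rule that[OF b(1) C(1)]) (use C(2) D(1) in auto)
qed

lemma tpath_end:
  assumes "tpath tbp0 tbp0 g"
  obtains b C where "0 < b" "C > 0" "\<And>t. 0 < t \<Longrightarrow> t < b \<Longrightarrow> norm (g (1 - t) - of_real t) \<le> C * t\<^sup>2"
proof -
  have g: "piecewise_smooth g" "g 1 = 0" "(g has_vector_derivative - 1) (at 1 within {0..1})"
    using assms by (auto simp: tpath_def tbp0_def)
  obtain a where a: "0 \<le> a" "a < 1" "smooth_on_segment g a 1"
    using piecewise_smooth_last_segment[OF g(1)] .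
  obtain D where D: "\<And>t. t \<in> {a..1} \<Longrightarrow> D 0 t = g t"
      "\<And>n t. t \<in> {a..1} \<Longrightarrow> (D n has_vector_derivative D (Suc n) t) (at t within {a..1})"
    by (rule smooth_on_segmentE[OF a(3)]) (rule that)
  have "(g has_vector_derivative D (Suc 0) 1) (at 1 within {a..1})"
    by (rule has_vector_derivative_transform[OF _ _ D(2)]) (use a D(1) in auto)
  moreover have "(g has_vector_derivative - 1) (at 1 within {a..1})"
    by (rule has_vector_derivative_within_subset[OF g(3)]) (use a in auto)
  ultimately have D1: "D (Suc 0) 1 = - 1"
    using a(2) by (intro vector_derivative_unique_within[of 1 "{a..1}" g]) (auto simp: trivial_limit_within)
  have img: "(\<lambda>t. 1 - t) ` {0..1 - a} = {a..1}"
    by (auto simp: image_iff intro!: bexI[of _ "1 - _"])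
  have rev: "((\<lambda>t. D n (1 - t)) has_vector_derivative - D (Suc n) (1 - t)) (at t within {0..1 - a})"
    if "t \<in> {0..1 - a}" for n t
  proof -
    have "((\<lambda>t::real. 1 - t) has_vector_derivative - 1) (at t within {0..1 - a})"
      by (auto intro!: derivative_eq_intros)
    moreover have "(D n has_vector_derivative D (Suc n) (1 - t)) (at (1 - t) within (\<lambda>t. 1 - t) ` {0..1 - a})"
      unfolding img by (rule D(2)) (use that in auto)
    ultimately show ?thesis
      using vector_diff_chain_within[of "\<lambda>t. 1 - t" "- 1" t "{0..1 - a}" "D n"] by (simp add: o_def)
  qed
  have rev': "((\<lambda>t. - D n (1 - t)) has_vector_derivative D (Suc n) (1 - t)) (at t within {0..1 - a})"
    if "t \<in> {0..1 - a}" for n t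
    using has_vector_derivative_minus[OF rev[OF that, of n]] by simp
  obtain C where C: "C > 0" "\<And>t. 0 < t \<Longrightarrow> t < 1 - a \<Longrightarrow> norm (D 0 (1 - t) - of_real t) \<le> C * t\<^sup>2"
  proof (rule hvd_quadratic[of "1 - a" "\<lambda>t. D 0 (1 - t)" "\<lambda>t. - D (Suc 0) (1 - t)" "\<lambda>t. D (Suc (Suc 0)) (1 - t)"])
    show "0 < 1 - a" using a by simp
    show "\<And>t. t \<in> {0..1 - a} \<Longrightarrow>
        ((\<lambda>t. D 0 (1 - t)) has_vector_derivative - D (Suc 0) (1 - t)) (at t within {0..1 - a})"
      by (rule rev)
    show "\<And>t. t \<in> {0..1 - a} \<Longrightarrow>
        ((\<lambda>t. - D (Suc 0) (1 - t)) has_vector_derivative D (Suc (Suc 0)) (1 - t)) (at t within {0..1 - a})"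
      by (rule rev')
    show "continuous_on {0..1 - a} (\<lambda>t. D (Suc (Suc 0)) (1 - t))"
      by (rule continuous_on_vector_derivative[OF rev])
    show "D 0 (1 - 0) = 0" using D(1)[of 1] g(2) a by simp
    show "- D (Suc 0) (1 - 0) = 1" using D1 by simp
  qed (rule that)
  show ?thesis
    by (rule that[of "1 - a" C]) (use C D(1) a in auto)
qed

section \<open>Homotopy invariance of the regularized integrals\<close>

lemma eventually_at_left_1_iff:
  "eventually P (at_left (1::real)) \<longleftrightarrow> eventually (\<lambda>t. P (1 - t)) (at_right 0)"
proof -
  have "at_left (1::real) = filtermap (\<lambda>t. 1 - t) (at_right 0)"
    using filtermap_nhds_shift[of "-1" 0] at_left_minus[of 1] at_right_to_0[of "-1"]
    by (simp add: filtermap_filtermap o_def add.commute)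
  then show ?thesis by (simp add: eventually_filtermap)
qed

lemma sgn_near_one:
  assumes "dist (sgn z) 1 < 1 / 2"
  shows "Re z > 0"
proof -
  have "\<bar>Re (sgn z - 1)\<bar> < 1/2"
    using abs_Re_le_cmod[of "sgn z - 1"] assms unfolding dist_norm by linarith
  then have "Re (sgn z) > 0" unfolding minus_complex.sel one_complex.sel by linarith
  then have "Re z / norm z > 0" by (simp add: Re_sgn)
  then show ?thesis using norm_ge_zero[of z] by (simp add: zero_less_divide_iff)
qed

text \<open>Uniformity of the direction condition places all points \<open>H (s, t)\<close> with
  small \<open>t\<close> in one half disc \<open>sector\<close>. So the moving ends stay in a simple
  domain and cannot turn around 0.\<close>

lemma thomotopic_word_int:
  assumes "thomotopic tbp0 tbp0 p q" "piecewise_smooth p" "piecewise_smooth q"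
  shows "eventually (\<lambda>t. word_int p t (1 - t) =
     conv (transport (p t) (q t)) (conv (word_int q t (1 - t)) (transport (q (1 - t)) (p (1 - t))))) (at_right 0)"
proof -
  obtain S1 where S1: "finite S1" "\<And>t. t \<in> {0<..<1} - S1 \<Longrightarrow> p differentiable (at t)"
    by (rule piecewise_smooth_differentiable[OF assms(2)]) (rule that)
  obtain S2 where S2: "finite S2" "\<And>t. t \<in> {0<..<1} - S2 \<Longrightarrow> q differentiable (at t)"
    by (rule piecewise_smooth_differentiable[OF assms(3)]) (rule that)
  obtain H :: "real \<times> real \<Rightarrow> complex" where H: "continuous_on ({0..1} \<times> {0..1}) H"
    "\<And>t. t \<in> {0..1} \<Longrightarrow> H (0, t) = p t" "\<And>t. t \<in> {0..1} \<Longrightarrow> H (1, t) = q t"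
    "\<And>s. s \<in> {0..1} \<Longrightarrow> H (s, 0) = 0" "\<And>s. s \<in> {0..1} \<Longrightarrow> H (s, 1) = 0"
    "\<And>s t. s \<in> {0..1} \<Longrightarrow> t \<in> {0<..<1} \<Longrightarrow> H (s, t) \<notin> {0, 1}"
    "uniform_limit {0..1} (\<lambda>t s. sgn (H (s, t))) (\<lambda>s. 1) (at_right 0)"
    "uniform_limit {0..1} (\<lambda>t s. sgn (H (s, t))) (\<lambda>s. 1) (at_left 1)"
    using assms(1) unfolding thomotopic_def tbp0_def by (auto simp: sgn_one)
  have "eventually (\<lambda>t. \<forall>s\<in>{0..1}. dist (sgn (H (s, t))) 1 < 1 / 2) (at_right 0)"
    using uniform_limitD[OF H(7), of "1/2"] by simp
  then have R0: "eventually (\<lambda>t. \<forall>s\<in>{0..1}. Re (H (s, t)) > 0) (at_right 0)"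
    by eventually_elim (use sgn_near_one in blast)
  have "eventually (\<lambda>t. \<forall>s\<in>{0..1}. dist (sgn (H (s, t))) 1 < 1 / 2) (at_left 1)"
    using uniform_limitD[OF H(8), of "1/2"] by simp
  then have "eventually (\<lambda>t. \<forall>s\<in>{0..1}. Re (H (s, t)) > 0) (at_left 1)"
    by eventually_elim (use sgn_near_one in blast)
  then have R1: "eventually (\<lambda>t. \<forall>s\<in>{0..1}. Re (H (s, 1 - t)) > 0) (at_right 0)"
    unfolding eventually_at_left_1_iff .
  have "uniformly_continuous_on ({0..1} \<times> {0..1}) H"
    by (intro compact_uniformly_continuous[OF H(1)] compact_Times) auto
  then obtain \<delta> where \<delta>: "\<delta> > 0" "\<And>x x'. x \<in> {0..1} \<times> {0..1} \<Longrightarrow> x' \<in> {0..1} \<times> {0..1} \<Longrightarrow>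
      dist x' x < \<delta> \<Longrightarrow> dist (H x') (H x) < 1"
    unfolding uniformly_continuous_on_def using zero_less_one by metis
  have "eventually (\<lambda>t. 0 < t \<and> t < min (1/2) \<delta>) (at_right 0)"
    using \<delta>(1) by (intro eventually_in_01) auto
  with R0 R1 show ?thesis
  proof eventually_elim
    case (elim t)
    have n0: "norm (H (s, t)) < 1" "norm (H (s, 1 - t)) < 1" if "s \<in> {0..1}" for s
      using \<delta>(2)[of "(s, 0)" "(s, t)"] \<delta>(2)[of "(s, 1)" "(s, 1 - t)"] that elim H(4,5)
      by (auto simp: dist_Pair_Pair dist_real_def)
    show ?case
    proof (rule homotopy_word_int[of t "1 - t" H p q "S1 \<union> S2" sector sector])
      show "continuous_on ({0..1} \<times> {t..1 - t}) H"
        by (rule continuous_on_subset[OF H(1)]) (use elim in auto)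
      show "\<And>s t'. s \<in> {0..1} \<Longrightarrow> t' \<in> {t..1 - t} \<Longrightarrow> H (s, t') \<notin> {0, 1}"
        by (rule H(6)) (use elim in auto)
      show "\<And>t'. t' \<in> {t..1 - t} \<Longrightarrow> H (0, t') = p t'" by (rule H(2)) (use elim in auto)
      show "\<And>t'. t' \<in> {t..1 - t} \<Longrightarrow> H (1, t') = q t'" by (rule H(3)) (use elim in auto)
      show "\<And>t'. t' \<in> {t<..<1 - t} - (S1 \<union> S2) \<Longrightarrow> p differentiable at t'"
        by (rule S1(2)) (use elim in auto)
      show "\<And>t'. t' \<in> {t<..<1 - t} - (S1 \<union> S2) \<Longrightarrow> q differentiable at t'"
        by (rule S2(2)) (use elim in auto)
    qed (use elim S1(1) S2(1) simple_domain_sector n0 in \<open>auto simp: sector_def\<close>)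
  qed
qed

text \<open>By the quadratic estimates at both ends the correction factors have the constant terms
  of \<open>eps\<close>, and convolution with them does not change constant terms.\<close>

lemma thomotopic_log_poly:
  assumes "thomotopic tbp0 tbp0 p q" "tpath tbp0 tbp0 p" "tpath tbp0 tbp0 q"
    and q: "\<And>u. log_poly (length u) (\<lambda>t. word_int q t (1 - t) u) (M u)"
  shows "log_poly (length u) (\<lambda>t. word_int p t (1 - t) u) (M u)"
proof -
  have ps: "piecewise_smooth p" "piecewise_smooth q" using assms by (auto simp: tpath_def)
  have near: "\<exists>b C. b > 0 \<and> C > 0 \<and> (\<forall>t. 0 < t \<and> t < b \<longrightarrow> norm (g t - of_real t) \<le> C * t\<^sup>2 \<and>
      norm (g (1 - t) - of_real t) \<le> C * t\<^sup>2)" if g: "tpath tbp0 tbp0 g" for g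
  proof -
    obtain b C where 1: "0 < b" "C > 0" "\<And>t. 0 < t \<Longrightarrow> t < b \<Longrightarrow> norm (g t - of_real t) \<le> C * t\<^sup>2"
      by (rule tpath_start[OF g]) (rule that)
    obtain b' C' where 2: "0 < b'" "C' > 0" "\<And>t. 0 < t \<Longrightarrow> t < b' \<Longrightarrow> norm (g (1 - t) - of_real t) \<le> C' * t\<^sup>2"
      by (rule tpath_end[OF g]) (rule that)
    have m: "C * t\<^sup>2 \<le> max C C' * t\<^sup>2" "C' * t\<^sup>2 \<le> max C C' * t\<^sup>2" for t :: real
      by (intro mult_right_mono; simp)+
    show ?thesis
    proof (rule exI[of _ "min b b'"], rule exI[of _ "max C C'"], intro conjI allI impI)
      fix t assume t: "0 < t \<and> t < min b b'"
      show "norm (g t - of_real t) \<le> max C C' * t\<^sup>2" using t by (intro order.trans[OF 1(3)[of t] m(1)]) auto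
      show "norm (g (1 - t) - of_real t) \<le> max C C' * t\<^sup>2" using t by (intro order.trans[OF 2(3)[of t] m(2)]) auto
    qed (use 1 2 in auto)
  qed
  obtain b1 C1 where 1: "b1 > 0" "C1 > 0" "\<And>t. 0 < t \<Longrightarrow> t < b1 \<Longrightarrow> norm (p t - of_real t) \<le> C1 * t\<^sup>2"
      "\<And>t. 0 < t \<Longrightarrow> t < b1 \<Longrightarrow> norm (p (1 - t) - of_real t) \<le> C1 * t\<^sup>2"
    using near[OF assms(2)] by blast
  obtain b2 C2 where 2: "b2 > 0" "C2 > 0" "\<And>t. 0 < t \<Longrightarrow> t < b2 \<Longrightarrow> norm (q t - of_real t) \<le> C2 * t\<^sup>2"
      "\<And>t. 0 < t \<Longrightarrow> t < b2 \<Longrightarrow> norm (q (1 - t) - of_real t) \<le> C2 * t\<^sup>2"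
    using near[OF assms(3)] by blast
  define b where "b = min b1 b2"
  define C where "C = max C1 C2"
  have m: "C1 * t\<^sup>2 \<le> C * t\<^sup>2" "C2 * t\<^sup>2 \<le> C * t\<^sup>2" for t :: real
    unfolding C_def by (intro mult_right_mono; simp)+
  have bC: "b > 0" "C > 0" using 1 2 by (auto simp: b_def C_def)
  have P: "norm (p t - of_real t) \<le> C * t\<^sup>2" "norm (p (1 - t) - of_real t) \<le> C * t\<^sup>2"
    and Q: "norm (q t - of_real t) \<le> C * t\<^sup>2" "norm (q (1 - t) - of_real t) \<le> C * t\<^sup>2"
    if "0 < t" "t < b" for t
    using order.trans[OF 1(3)[of t] m(1)] order.trans[OF 1(4)[of t] m(1)]
      order.trans[OF 2(3)[of t] m(2)] order.trans[OF 2(4)[of t] m(2)] that by (auto simp: b_def)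
  have l1: "log_poly (length v) (\<lambda>t. transport (p t) (q t) v) (eps v)" for v
    by (rule log_poly_transport_near[OF bC(1) P(1) Q(1) bC(2)])
  have l2: "log_poly (length v) (\<lambda>t. transport (q (1 - t)) (p (1 - t)) v) (eps v)" for v
    by (rule log_poly_transport_near[OF bC(1) Q(2) P(2) bC(2)])
  have l3: "log_poly (length v) (\<lambda>t. conv (word_int q t (1 - t)) (transport (q (1 - t)) (p (1 - t))) v) (M v)" for v
    using log_poly_conv[of 0 "\<lambda>t. word_int q t (1 - t)" M v "\<lambda>t. transport (q (1 - t)) (p (1 - t))" eps] q l2 by simp
  have l4: "log_poly (length u) (\<lambda>t. conv (transport (p t) (q t)) (conv (word_int q t (1 - t)) (transport (q (1 - t)) (p (1 - t)))) u) (M u)"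
    using log_poly_conv[of 0 "\<lambda>t. transport (p t) (q t)" eps u "\<lambda>t. conv (word_int q t (1 - t)) (transport (q (1 - t)) (p (1 - t)))" M] l1 l3
    by simp
  show ?thesis
    by (rule log_poly_cong[OF l4]) (use thomotopic_word_int[OF assms(1) ps] in \<open>eventually_elim, simp\<close>)
qed

section \<open>An explicit representative\<close>

definition clamp01 :: "real \<Rightarrow> real" where "clamp01 x = max 0 (min 1 x)"

text \<open>Polar coordinates around 1, the angle counted in full turns from the direction towards
  0. For \<open>r > 0\<close> a logarithm of \<open>1 - polar r a\<close> is ln r + 2 pi i
  a.\<close>

definition polar :: "real \<Rightarrow> real \<Rightarrow> complex" where
  "polar r a = 1 - of_real r * exp (2 * of_real pi * \<i> * of_real a)"

lemma norm_exp_2pi [simp]: "norm (exp (2 * of_real pi * \<i> * of_real a)) = 1"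
  by (simp add: norm_exp_eq_Re)

lemma polar_0 [simp]: "polar r 0 = of_real (1 - r)" and polar_1 [simp]: "polar r 1 = of_real (1 - r)"
  by (simp_all add: polar_def)

lemma norm_one_minus_polar: "norm (1 - polar r a) = \<bar>r\<bar>"
  by (simp add: polar_def norm_mult)

lemma polar_neq:
  assumes "0 < r" "r < 1"
  shows "polar r a \<notin> {0, 1}"
proof -
  have "norm (1 - polar r a) = r" using assms by (simp add: norm_one_minus_polar)
  then show ?thesis using assms by auto
qed

text \<open>In the coordinate log (1 - z) this is the straight-line homotopy. The angles are
  constant near the ends, so every intermediate path starts and ends on the real axis and the
  direction conditions hold exactly.\<close>

lemma thomotopic_polar:
  assumes cont: "continuous_on {0..1} r" "continuous_on {0..1} a" "continuous_on {0..1} r'" "continuous_on {0..1} a'"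
    and pos: "\<And>t. t \<in> {0..1} \<Longrightarrow> 0 < r t" "\<And>t. t \<in> {0..1} \<Longrightarrow> 0 < r' t"
    and lt: "\<And>t. t \<in> {0<..<1} \<Longrightarrow> r t < 1" "\<And>t. t \<in> {0<..<1} \<Longrightarrow> r' t < 1"
    and r1: "r 0 = 1" "r 1 = 1" "r' 0 = 1" "r' 1 = 1"
    and \<eta>: "0 < \<eta>" "\<eta> < 1 / 2"
    and a0: "\<And>t. t \<in> {0..\<eta>} \<Longrightarrow> a t = 0" "\<And>t. t \<in> {0..\<eta>} \<Longrightarrow> a' t = 0"
    and a1: "\<And>t. t \<in> {1-\<eta>..1} \<Longrightarrow> a t = 1" "\<And>t. t \<in> {1-\<eta>..1} \<Longrightarrow> a' t = 1"
    and p: "\<And>t. t \<in> {0..1} \<Longrightarrow> p t = polar (r t) (a t)"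
    and q: "\<And>t. t \<in> {0..1} \<Longrightarrow> q t = polar (r' t) (a' t)"
  shows "thomotopic tbp0 tbp0 p q"
proof -
  define R where "R s t = exp ((1 - s) * ln (r t) + s * ln (r' t))" for s t
  define A where "A s t = (1 - s) * a t + s * a' t" for s t
  define H where "H x = polar (R (fst x) (snd x)) (A (fst x) (snd x))" for x :: "real \<times> real"
  let ?Q = "{0..1} \<times> {0..1} :: (real \<times> real) set"
  have csnd: "continuous_on ?Q (\<lambda>x. f (snd x))" if "continuous_on {0..1} f" for f :: "real \<Rightarrow> real"
    by (rule continuous_on_compose2[OF that]) (auto intro!: continuous_intros)
  have lnc: "continuous_on {0..1} (\<lambda>t. ln (r t))" "continuous_on {0..1} (\<lambda>t. ln (r' t))"
    by (intro continuous_on_ln cont; use pos in force)+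
  have cR: "continuous_on ?Q (\<lambda>x. R (fst x) (snd x))"
    unfolding R_def by (intro continuous_intros csnd lnc)
  have cA: "continuous_on ?Q (\<lambda>x. A (fst x) (snd x))"
    unfolding A_def by (intro continuous_intros csnd cont)
  have cH: "continuous_on ?Q H"
    unfolding H_def polar_def by (intro continuous_intros cR cA)
  have Rlt: "R s t < 1" if "s \<in> {0..1}" "t \<in> {0<..<1}" for s t
  proof -
    have "ln (r t) < 0" "ln (r' t) < 0" using pos[of t] lt[of t] that by auto
    then have "(1 - s) * ln (r t) + s * ln (r' t) < 0"
      using that by (cases "s = 0") (auto intro!: add_nonpos_neg mult_nonneg_nonpos mult_pos_neg)
    then show ?thesis by (simp add: R_def)
  qed
  have Rpos: "0 < R s t" for s t by (simp add: R_def)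
  have ends: "R s 0 = 1" "R s 1 = 1" for s by (simp_all add: R_def r1)
  have A0: "A s t = 0" if "t \<in> {0..\<eta>}" for s t using a0[OF that] by (simp add: A_def)
  have A1: "A s t = 1" if "t \<in> {1-\<eta>..1}" for s t using a1[OF that] by (simp add: A_def)
  have sgn1: "sgn (of_real x :: complex) = 1" if "x > 0" for x
    using that by (simp add: sgn_of_real)
  show ?thesis
    unfolding thomotopic_def tbp0_def fst_conv snd_conv
  proof (intro exI[of _ H] conjI ballI)
    show "continuous_on ({0..1} \<times> {0..1}) H" by (rule cH)
    fix t :: real assume t: "t \<in> {0..1}"
    show "H (0, t) = p t" using p[OF t] pos(1)[OF t] by (simp add: H_def R_def A_def)
    show "H (1, t) = q t" using q[OF t] pos(2)[OF t] by (simp add: H_def R_def A_def)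
  next
    fix s :: real assume s: "s \<in> {0..1}"
    show "H (s, 0) = 0" using \<eta> by (simp add: H_def ends A0)
    show "H (s, 1) = 0" using \<eta> by (simp add: H_def ends A1)
    fix t :: real assume t: "t \<in> {0<..<1}"
    show "H (s, t) \<notin> {0, 1}" unfolding H_def fst_conv snd_conv by (rule polar_neq[OF Rpos Rlt[OF s t]])
  next
    show "uniform_limit {0..1} (\<lambda>t s. sgn (H (s, t) - 0)) (\<lambda>s. sgn 1) (at_right 0)"
    proof (rule uniform_limitI)
      fix e :: real assume "e > 0"
      have "eventually (\<lambda>t. 0 < t \<and> t < \<eta>) (at_right 0)" by (rule eventually_in_01) fact
      then show "eventually (\<lambda>t. \<forall>s\<in>{0..1}. dist (sgn (H (s, t) - 0)) (sgn 1) < e) (at_right 0)"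
      proof eventually_elim
        case (elim t)
        have "sgn (H (s, t)) = 1" if "s \<in> {0..1}" for s
          unfolding H_def using Rlt[OF that, of t] elim \<eta> by (simp add: A0 sgn1 del: of_real_diff)
        then show ?case using \<open>e > 0\<close> by simp
      qed
    qed
    show "uniform_limit {0..1} (\<lambda>t s. sgn (H (s, t) - 0)) (\<lambda>s. sgn 1) (at_left 1)"
    proof (rule uniform_limitI)
      fix e :: real assume "e > 0"
      have "eventually (\<lambda>t. 0 < t \<and> t < \<eta>) (at_right 0)" by (rule eventually_in_01) fact
      then show "eventually (\<lambda>t. \<forall>s\<in>{0..1}. dist (sgn (H (s, t) - 0)) (sgn 1) < e) (at_left 1)"
        unfolding eventually_at_left_1_iff
      proof eventually_elim
        case (elim t)
        have "sgn (H (s, 1 - t)) = 1" if "s \<in> {0..1}" for s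
          unfolding H_def using Rlt[OF that, of "1 - t"] elim \<eta> by (simp add: A1 sgn1 del: of_real_diff)
        then show ?case using \<open>e > 0\<close> by simp
      qed
    qed
  qed
qed

lemma thomotopic_sym:
  assumes "thomotopic x y p q"
  shows "thomotopic x y q p"
proof -
  obtain H :: "real \<times> real \<Rightarrow> complex" where H: "continuous_on ({0..1} \<times> {0..1}) H"
    "\<forall>t\<in>{0..1}. H (0, t) = p t \<and> H (1, t) = q t"
    "\<forall>s\<in>{0..1}. H (s, 0) = fst x \<and> H (s, 1) = fst y \<and> (\<forall>t\<in>{0<..<1}. H (s, t) \<notin> {0, 1})"
    "uniform_limit {0..1} (\<lambda>t s. sgn (H (s, t) - fst x)) (\<lambda>s. sgn (snd x)) (at_right 0)"
    "uniform_limit {0..1} (\<lambda>t s. sgn (H (s, t) - fst y)) (\<lambda>s. sgn (snd y)) (at_left 1)"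
    using assms unfolding thomotopic_def by (elim exE conjE)
  define K where "K x = H (1 - fst x, snd x)" for x
  have cK: "continuous_on ({0..1} \<times> {0..1}) K"
    unfolding K_def by (rule continuous_on_compose2[OF H(1)]) (auto intro!: continuous_intros)
  have flip: "1 - s \<in> {0..1} \<longleftrightarrow> s \<in> {0..1}" for s :: real by auto
  have flipU: "uniform_limit {0..1} (\<lambda>t s. sgn (K (s, t) - b)) (\<lambda>s. c) F"
    if "uniform_limit {0..1} (\<lambda>t s. sgn (H (s, t) - b)) (\<lambda>s. c) F" for b c F
  proof (rule uniform_limitI)
    fix e :: real assume "e > 0"
    from uniform_limitD[OF that this]
    show "eventually (\<lambda>t. \<forall>s\<in>{0..1}. dist (sgn (K (s, t) - b)) c < e) F"
      by eventually_elim (auto simp: K_def)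
  qed
  show ?thesis
    unfolding thomotopic_def
    by (intro exI[of _ K] conjI cK flipU H(4,5)) (use H(2,3) in \<open>auto simp: K_def\<close>)
qed

lemma thomotopic_trans:
  assumes "thomotopic x y p q" "thomotopic x y q r"
  shows "thomotopic x y p r"
proof -
  obtain H :: "real \<times> real \<Rightarrow> complex" where H: "continuous_on ({0..1} \<times> {0..1}) H"
    "\<forall>t\<in>{0..1}. H (0, t) = p t \<and> H (1, t) = q t"
    "\<forall>s\<in>{0..1}. H (s, 0) = fst x \<and> H (s, 1) = fst y \<and> (\<forall>t\<in>{0<..<1}. H (s, t) \<notin> {0, 1})"
    "uniform_limit {0..1} (\<lambda>t s. sgn (H (s, t) - fst x)) (\<lambda>s. sgn (snd x)) (at_right 0)"
    "uniform_limit {0..1} (\<lambda>t s. sgn (H (s, t) - fst y)) (\<lambda>s. sgn (snd y)) (at_left 1)"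
    using assms(1) unfolding thomotopic_def by (elim exE conjE)
  obtain H' :: "real \<times> real \<Rightarrow> complex" where H': "continuous_on ({0..1} \<times> {0..1}) H'"
    "\<forall>t\<in>{0..1}. H' (0, t) = q t \<and> H' (1, t) = r t"
    "\<forall>s\<in>{0..1}. H' (s, 0) = fst x \<and> H' (s, 1) = fst y \<and> (\<forall>t\<in>{0<..<1}. H' (s, t) \<notin> {0, 1})"
    "uniform_limit {0..1} (\<lambda>t s. sgn (H' (s, t) - fst x)) (\<lambda>s. sgn (snd x)) (at_right 0)"
    "uniform_limit {0..1} (\<lambda>t s. sgn (H' (s, t) - fst y)) (\<lambda>s. sgn (snd y)) (at_left 1)"
    using assms(2) unfolding thomotopic_def by (elim exE conjE)
  define K where "K x = (if fst x \<le> 1/2 then H (2 * fst x, snd x) else H' (2 * fst x - 1, snd x))" for x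
  have K1: "K (s, t) = H (2 * s, t)" if "s \<le> 1/2" for s t using that by (simp add: K_def)
  have K2: "K (s, t) = H' (2 * s - 1, t)" if "s > 1/2" for s t using that by (simp add: K_def)
  have "continuous_on (({0..1/2} \<times> {0..1}) \<union> ({1/2..1} \<times> {0..1}))
      (\<lambda>x. if fst x \<le> 1/2 then H (2 * fst x, snd x) else H' (2 * fst x - 1, snd x))"
  proof (rule continuous_on_cases)
    show "continuous_on ({0..1/2} \<times> {0..1}) (\<lambda>x. H (2 * fst x, snd x))"
      by (rule continuous_on_compose2[OF H(1)]) (auto intro!: continuous_intros)
    show "continuous_on ({1/2..1} \<times> {0..1}) (\<lambda>x. H' (2 * fst x - 1, snd x))"
      by (rule continuous_on_compose2[OF H'(1)]) (auto intro!: continuous_intros)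
    show "\<forall>x. x \<in> {0..1/2} \<times> {0..1} \<and> \<not> fst x \<le> 1/2 \<or> x \<in> {1/2..1} \<times> {0..1} \<and> fst x \<le> 1/2 \<longrightarrow>
        H (2 * fst x, snd x) = H' (2 * fst x - 1, snd x)"
    proof (intro allI impI)
      fix x :: "real \<times> real"
      assume "x \<in> {0..1/2} \<times> {0..1} \<and> \<not> fst x \<le> 1/2 \<or> x \<in> {1/2..1} \<times> {0..1} \<and> fst x \<le> 1/2"
      then have f: "2 * fst x = 1" "2 * fst x - 1 = 0" "snd x \<in> {0..1}" by auto
      show "H (2 * fst x, snd x) = H' (2 * fst x - 1, snd x)"
        unfolding f(2) unfolding f(1) using H(2) H'(2) f(3) by simp
    qed
  qed (auto intro!: closed_Times)
  moreover have "({0..1/2} \<times> {0..1}) \<union> ({1/2..1} \<times> {0..1}) = {0..1::real} \<times> {0..1::real}" by auto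
  ultimately have cK: "continuous_on ({0..1} \<times> {0..1}) K"
    unfolding K_def by (simp only:)
  have U: "uniform_limit {0..1} (\<lambda>t s. sgn (K (s, t) - b)) (\<lambda>s. c) F"
    if "uniform_limit {0..1} (\<lambda>t s. sgn (H (s, t) - b)) (\<lambda>s. c) F"
      "uniform_limit {0..1} (\<lambda>t s. sgn (H' (s, t) - b)) (\<lambda>s. c) F" for b c F
  proof (rule uniform_limitI)
    fix e :: real assume "e > 0"
    from uniform_limitD[OF that(1) this] uniform_limitD[OF that(2) this]
    show "eventually (\<lambda>t. \<forall>s\<in>{0..1}. dist (sgn (K (s, t) - b)) c < e) F"
      by eventually_elim (auto simp: K_def)
  qed
  show ?thesis
    unfolding thomotopic_def
  proof (intro exI[of _ K] conjI cK U H(4,5) H'(4,5) ballI)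
    fix t :: real assume t: "t \<in> {0..1}"
    show "K (0, t) = p t" using H(2) t by (simp add: K1)
    show "K (1, t) = r t" using H'(2) t by (simp add: K2)
  next
    fix s :: real assume s: "s \<in> {0..1}"
    show "K (s, 0) = fst x" "K (s, 1) = fst y"
      using H(3) H'(3) s by (cases "s \<le> 1/2"; simp add: K1 K2)+
    fix t :: real assume t: "t \<in> {0<..<1}"
    show "K (s, t) \<notin> {0, 1}"
    proof (cases "s \<le> 1/2")
      case True
      then have "2 * s \<in> {0..1}" using s by auto
      then show ?thesis using H(3) t True by (simp only: K1) blast
    next
      case False
      then have "2 * s - 1 \<in> {0..1}" "s > 1/2" using s by auto
      then show ?thesis using H'(3) t by (simp only: K2) blast
    qed
  qed
qed

text \<open>A representative of the class of \<open>\<beta>\<close> with unit speed at both ends.\<close>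

definition gref :: "real \<Rightarrow> complex" where
  "gref t = polar (max (2/3) (max (1 - t) t)) (clamp01 (3 * t - 1))"

lemma gref_left: "t \<le> 1/3 \<Longrightarrow> 0 \<le> t \<Longrightarrow> gref t = of_real t"
  and gref_mid: "1/3 \<le> t \<Longrightarrow> t \<le> 2/3 \<Longrightarrow> gref t = polar (2/3) (3 * t - 1)"
  and gref_right: "2/3 \<le> t \<Longrightarrow> t \<le> 1 \<Longrightarrow> gref t = of_real (1 - t)"
proof -
  show "gref t = of_real t" if "t \<le> 1/3" "0 \<le> t"
  proof -
    have "max (2/3) (max (1 - t) t) = 1 - t" "clamp01 (3 * t - 1) = 0" using that by (auto simp: clamp01_def max_def)
    then show ?thesis by (simp only: gref_def) simp
  qed
  show "gref t = polar (2/3) (3 * t - 1)" if "1/3 \<le> t" "t \<le> 2/3"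
  proof -
    have "max (2/3) (max (1 - t) t) = 2/3" "clamp01 (3 * t - 1) = 3 * t - 1" using that by (auto simp: clamp01_def max_def)
    then show ?thesis by (simp only: gref_def)
  qed
  show "gref t = of_real (1 - t)" if "2/3 \<le> t" "t \<le> 1"
  proof -
    have "max (2/3) (max (1 - t) t) = t" "clamp01 (3 * t - 1) = 1" using that by (auto simp: clamp01_def max_def)
    then show ?thesis by (simp only: gref_def polar_1)
  qed
qed

lemma continuous_gref: "continuous_on S gref"
  unfolding gref_def polar_def clamp01_def by (intro continuous_intros)

lemma hvd_const_power_exp:
  fixes c :: complex
  shows "((\<lambda>t. exp (c * of_real t + d)) has_vector_derivative c * exp (c * of_real t + d)) (at t within S)"
proof -
  have "((\<lambda>x. exp (c * x + d)) has_field_derivative exp (c * of_real t + d) * c) (at (of_real t))"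
    by (auto intro!: derivative_eq_intros)
  from field_vector_diff_chain_within[OF of_real_hvd has_field_derivative_at_within[OF this], of S]
  show ?thesis by (simp add: o_def mult.commute)
qed

lemma smooth_affine: "smooth_on_segment (\<lambda>t. c * of_real t + d) a b"
  unfolding smooth_on_segment_def
proof (intro exI[of _ "\<lambda>n t. if n = 0 then c * of_real t + d else if n = 1 then c else 0"] conjI ballI allI)
  fix n :: nat and t :: real
  have "((\<lambda>t. c * of_real t + d) has_vector_derivative c * 1 + 0) (at t within {a..b})"
    by (intro has_vector_derivative_add has_vector_derivative_mult_right of_real_hvd has_vector_derivative_const)
  then show "((\<lambda>t. if n = 0 then c * of_real t + d else if n = 1 then c else 0) has_vector_derivative
      (if Suc n = 0 then c * of_real t + d else if Suc n = 1 then c else 0)) (at t within {a..b})"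
    by (cases "n = 0") (auto simp: has_vector_derivative_const)
qed auto

lemma smooth_exp: "smooth_on_segment (\<lambda>t. 1 - k * exp (c * of_real t + d)) a b"
  unfolding smooth_on_segment_def
proof (intro exI[of _ "\<lambda>n t. (if n = 0 then 1 else 0) - k * c ^ n * exp (c * of_real t + d)"] conjI ballI allI)
  fix n :: nat and t :: real
  have "((\<lambda>t. (if n = 0 then 1 else 0) - k * c ^ n * exp (c * of_real t + d)) has_vector_derivative
      0 - k * c ^ n * (c * exp (c * of_real t + d))) (at t within {a..b})"
    by (intro has_vector_derivative_diff has_vector_derivative_mult_right hvd_const_power_exp has_vector_derivative_const)
  then show "((\<lambda>t. (if n = 0 then 1 else 0) - k * c ^ n * exp (c * of_real t + d)) has_vector_derivative
      (if Suc n = 0 then 1 else 0) - k * c ^ Suc n * exp (c * of_real t + d)) (at t within {a..b})"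
    by (simp add: mult_ac)
qed auto

lemma smooth_on_segment_cong:
  assumes "smooth_on_segment f a b" "\<And>t. t \<in> {a..b} \<Longrightarrow> g t = f t"
  shows "smooth_on_segment g a b"
  using assms unfolding smooth_on_segment_def by metis

lemma piecewise_smooth_gref: "piecewise_smooth gref"
  unfolding piecewise_smooth_def
proof (intro conjI exI[of _ "{0, 1/3, 2/3, 1}"] ballI impI)
  show "path gref" unfolding path_def by (rule continuous_gref)
  have 1: "smooth_on_segment gref 0 (1/3)"
    by (rule smooth_on_segment_cong[OF smooth_affine[of 1 0]]) (simp add: gref_left)
  have 2: "smooth_on_segment gref (1/3) (2/3)"
    by (rule smooth_on_segment_cong[OF smooth_exp[of "2/3" "6 * of_real pi * \<i>" "- 2 * of_real pi * \<i>"]])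
       (simp add: gref_mid polar_def algebra_simps)
  have 3: "smooth_on_segment gref (2/3) 1"
    by (rule smooth_on_segment_cong[OF smooth_affine[of "-1" 1]]) (simp add: gref_right)
  fix a b :: real assume ab: "a \<in> {0, 1/3, 2/3, 1}" "b \<in> {0, 1/3, 2/3, 1}"
    and "a < b \<and> {0, 1/3, 2/3, 1} \<inter> {a<..<b} = {}"
  then have n: "a < b" "1/3 \<notin> {a<..<b}" "2/3 \<notin> {a<..<b}" by blast+
  have "a = 0 \<or> a = 1/3 \<or> a = 2/3 \<or> a = 1" "b = 0 \<or> b = 1/3 \<or> b = 2/3 \<or> b = 1" using ab by simp_all
  with n have "(a = 0 \<and> b = 1/3) \<or> (a = 1/3 \<and> b = 2/3) \<or> (a = 2/3 \<and> b = 1)"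
    by (elim disjE; simp)
  with 1 2 3 show "smooth_on_segment gref a b" by (elim disjE conjE) (simp_all only:)
qed auto

lemma max_gref_bounds:
  assumes "t \<in> {0..1}"
  shows "0 < max (2/3) (max (1 - t) t)" "t \<in> {0<..<1} \<Longrightarrow> max (2/3) (max (1 - t) t) < (1 :: real)"
  by (auto simp: max_def)

lemma tpath_gref: "tpath tbp0 tbp0 gref"
  unfolding tpath_def tbp0_def fst_conv snd_conv
proof (intro conjI ballI)
  show "piecewise_smooth gref" by (rule piecewise_smooth_gref)
  show "gref 0 = 0" "gref 1 = 0" by (simp_all add: gref_left gref_right)
  show "(gref has_vector_derivative 1) (at 0 within {0..1})"
    by (rule has_vector_derivative_transform_within[OF of_real_hvd, of "1/3"]) (auto simp: gref_left dist_real_def)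
  have "((\<lambda>t. 1 - of_real t :: complex) has_vector_derivative 0 - 1) (at 1 within {0..1})"
    by (intro has_vector_derivative_diff of_real_hvd has_vector_derivative_const)
  then have d: "((\<lambda>t. 1 - of_real t :: complex) has_vector_derivative - 1) (at 1 within {0..1})" by simp
  show "(gref has_vector_derivative - 1) (at 1 within {0..1})"
    by (rule has_vector_derivative_transform_within[OF d, of "1/3"]) (auto simp: gref_right dist_real_def)
  fix t :: real assume "t \<in> {0<..<1}"
  then show "gref t \<notin> {0, 1}"
    unfolding gref_def by (intro polar_neq max_gref_bounds) auto
qed

section \<open>The composed path of the class in polar coordinates\<close>

lemma path_tjoin:
  assumes "path p" "path q" "0 \<le> \<epsilon>" "\<epsilon> \<le> 1"
  shows "path (tjoin \<epsilon> p q)"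
  unfolding tjoin_def using assms
  by (intro path_join_imp path_subpath path_linepath) auto

lemma alpha_polar:
  assumes "u \<in> {0..1}"
  shows "alpha u = polar (min (1/3) (min u (1 - u))) (clamp01 (3 * u - 1))"
proof -
  consider "u \<le> 1/3" | "1/3 < u" "u \<le> 2/3" | "2/3 < u" by linarith
  then show ?thesis
  proof cases
    case 1
    then have "min (1/3) (min u (1 - u)) = u" "clamp01 (3 * u - 1) = 0" using assms by (auto simp: clamp01_def)
    then show ?thesis using 1 by (simp add: alpha_def)
  next
    case 2
    then have "min (1/3) (min u (1 - u)) = 1/3" "clamp01 (3 * u - 1) = 3 * u - 1" by (auto simp: clamp01_def)
    then have "polar (min (1/3) (min u (1 - u))) (clamp01 (3 * u - 1)) = polar (1/3) (3 * u - 1)"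
      by (simp only:)
    moreover have "alpha u = polar (1/3) (3 * u - 1)" using 2 by (simp add: alpha_def polar_def)
    ultimately show ?thesis by simp
  next
    case 3
    then have "min (1/3) (min u (1 - u)) = 1 - u" "clamp01 (3 * u - 1) = 1" using assms by (auto simp: clamp01_def)
    then show ?thesis using 3 by (simp add: alpha_def)
  qed
qed

lemma path_alpha: "path alpha"
proof -
  have "continuous_on {0..1} (\<lambda>u. polar (min (1/3) (min u (1 - u))) (clamp01 (3 * u - 1)))"
    unfolding polar_def clamp01_def by (intro continuous_intros)
  then show ?thesis unfolding path_def by (rule continuous_on_eq) (simp add: alpha_polar)
qed

text \<open>The cases are the pieces of \<open>tjoin\<close>: the shortened \<open>dch\<close> up to
  1/2, the connecting segment up to 3/4, which is constant since \<open>dch (1 - \<epsilon>)\<close>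
  and \<open>alpha \<epsilon>\<close> coincide, and the shortened \<open>alpha\<close>. One formula
  for the angle covers all three, because \<open>clamp01\<close> gives 0 on the first two.\<close>

lemma tjoin_dch_alpha:
  assumes "0 < \<epsilon>" "\<epsilon> < 1/20" "0 \<le> x" "x < 1"
  shows "\<exists>r>0. r \<le> 1 \<and> (0 < x \<longrightarrow> r < 1) \<and>
    tjoin \<epsilon> dch alpha x = polar r (clamp01 (3 * (\<epsilon> + (1 - \<epsilon>) * (4 * x - 3)) - 1))"
proof -
  define u where "u = \<epsilon> + (1 - \<epsilon>) * (4 * x - 3)"
  have ae: "alpha \<epsilon> = of_real (1 - \<epsilon>)" "dch (1 - \<epsilon>) = of_real (1 - \<epsilon>)"
    using assms by (simp_all add: alpha_def dch_def linepath_def scaleR_conv_of_real)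
  consider "x \<le> 1/2" | "1/2 < x" "x \<le> 3/4" | "3/4 < x" by linarith
  then show ?thesis
  proof cases
    case 1
    have "(1 - \<epsilon>) * (4 * x - 3) \<le> 0" using 1 assms by (intro mult_nonneg_nonpos) auto
    then have "clamp01 (3 * u - 1) = 0" using assms by (simp add: u_def clamp01_def)
    moreover have "tjoin \<epsilon> dch alpha x = of_real (2 * x * (1 - \<epsilon>))"
      using 1 by (simp add: tjoin_def joinpaths_def subpath_def dch_def linepath_def scaleR_conv_of_real algebra_simps)
    moreover have "2 * x * (1 - \<epsilon>) < 1"
    proof -
      have "2 * x * (1 - \<epsilon>) \<le> 1 * (1 - \<epsilon>)" using 1 assms by (intro mult_right_mono) auto
      then show ?thesis by (rule le_less_trans) (use assms(1) in simp)
    qed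
    moreover have "0 \<le> 2 * x * (1 - \<epsilon>)" "0 < x \<longrightarrow> 0 < 2 * x * (1 - \<epsilon>)" using assms by auto
    ultimately show ?thesis
      unfolding u_def[symmetric] by (intro exI[of _ "1 - 2 * x * (1 - \<epsilon>)"]) auto
  next
    case 2
    have "(1 - \<epsilon>) * (4 * x - 3) \<le> 0" using 2 assms by (intro mult_nonneg_nonpos) auto
    then have "clamp01 (3 * u - 1) = 0" using assms by (simp add: u_def clamp01_def)
    moreover have "tjoin \<epsilon> dch alpha x = of_real (1 - \<epsilon>)"
      using 2 by (simp add: tjoin_def joinpaths_def ae linepath_refl del: of_real_diff)
    ultimately show ?thesis
      unfolding u_def[symmetric] using assms by (intro exI[of _ \<epsilon>]) auto
  next
    case 3
    have pos: "0 < (1 - \<epsilon>) * (4 * x - 3)" using 3 assms by (intro mult_pos_pos) auto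
    have "(1 - \<epsilon>) * (4 * x - 3) < (1 - \<epsilon>) * 1" using 3 assms by (intro mult_strict_left_mono) auto
    then have "u < \<epsilon> + (1 - \<epsilon>) * 1" unfolding u_def by (rule add_strict_left_mono)
    then have u: "0 < u" "u < 1" using add_pos_pos[OF assms(1) pos] by (simp_all add: u_def)
    have "tjoin \<epsilon> dch alpha x = alpha u"
      using 3 by (simp add: tjoin_def joinpaths_def subpath_def u_def algebra_simps)
    also have "\<dots> = polar (min (1/3) (min u (1 - u))) (clamp01 (3 * u - 1))"
      by (rule alpha_polar) (use u in auto)
    finally show ?thesis
      unfolding u_def[symmetric] using u by (intro exI[of _ "min (1/3) (min u (1 - u))"]) auto
  qed
qed

text \<open>The angle on the first half of the composition, used on all of [0, 1]: from 1/2 on it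
  has reached the clamped value 1, which is the angle on the way back.\<close>

definition tjoin_angle :: "real \<Rightarrow> real \<Rightarrow> real" where
  "tjoin_angle \<epsilon> t = clamp01 (3 * (\<epsilon> + (1 - \<epsilon>) * (4 * (2 * t * (1 - \<epsilon>)) - 3)) - 1)"

lemma tjoin_angle_right:
  assumes "0 < \<epsilon>" "\<epsilon> < 1/20" "1/2 \<le> t"
  shows "tjoin_angle \<epsilon> t = 1"
proof -
  have "1 - 4 * \<epsilon> \<le> 4 * (2 * t * (1 - \<epsilon>)) - 3"
    using mult_right_mono[of 1 "2 * t" "1 - \<epsilon>"] assms by (simp add: algebra_simps)
  then have 1: "(1 - \<epsilon>) * (1 - 4 * \<epsilon>) \<le> (1 - \<epsilon>) * (4 * (2 * t * (1 - \<epsilon>)) - 3)"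
    using assms by (intro mult_left_mono) auto
  define Q where "Q = (1 - \<epsilon>) * (4 * (2 * t * (1 - \<epsilon>)) - 3)"
  have "1 - 5 * \<epsilon> \<le> (1 - \<epsilon>) * (1 - 4 * \<epsilon>)" by (simp add: algebra_simps)
  then have "1 - 5 * \<epsilon> \<le> Q" unfolding Q_def using 1 by (rule order.trans)
  \<comment> \<open>The right-hand side is at least \<open>2 - 12 * \<epsilon>\<close>; a bound such
    as 1/20 on \<open>\<epsilon>\<close> leaves room here.\<close>
  then have "1 \<le> 3 * (\<epsilon> + Q) - 1" using assms by argo
  then show ?thesis unfolding tjoin_angle_def Q_def[symmetric] clamp01_def by simp
qed

lemma tjoin_angle_left:
  assumes "0 < \<epsilon>" "\<epsilon> < 1/20" "0 \<le> t" "t \<le> 1/4"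
  shows "tjoin_angle \<epsilon> t = 0"
proof -
  have "2 * t * (1 - \<epsilon>) \<le> 1/2 * 1" using assms by (intro mult_mono) auto
  then have "(1 - \<epsilon>) * (4 * (2 * t * (1 - \<epsilon>)) - 3) \<le> 0" using assms by (intro mult_nonneg_nonpos) auto
  then show ?thesis using assms by (simp add: tjoin_angle_def clamp01_def)
qed

lemma beta_polar:
  assumes "0 < \<epsilon>" "\<epsilon> < 1/20" "t \<in> {0..1}"
  defines "j \<equiv> tjoin \<epsilon> (tjoin \<epsilon> dch alpha) (reversepath dch)"
  shows "\<exists>r>0. r \<le> 1 \<and> (t \<in> {0<..<1} \<longrightarrow> r < 1) \<and> j t = polar r (tjoin_angle \<epsilon> t)"
proof (cases "t \<le> 1/2")
  case True
  have "2 * t * (1 - \<epsilon>) \<le> 1 * (1 - \<epsilon>)" using True assms by (intro mult_right_mono) auto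
  then have x2: "2 * t * (1 - \<epsilon>) < 1" by (rule le_less_trans) (use assms(1) in simp)
  have x1: "0 \<le> 2 * t * (1 - \<epsilon>)" using assms(1-3) by (intro mult_nonneg_nonneg) auto
  note x = x1 x2
  have "j t = tjoin \<epsilon> dch alpha (2 * t * (1 - \<epsilon>))"
    unfolding j_def tjoin_def[of \<epsilon> "tjoin \<epsilon> dch alpha"] using True
    by (simp add: joinpaths_def subpath_def mult_ac)
  moreover have "t \<in> {0<..<1} \<longrightarrow> 0 < 2 * t * (1 - \<epsilon>)" using assms by auto
  ultimately show ?thesis
    using tjoin_dch_alpha[OF assms(1,2) x] unfolding tjoin_angle_def by auto
next
  case False
  have x: "0 \<le> 1 - \<epsilon>" "1 - \<epsilon> < 1" "3/4 < 1 - \<epsilon>" using assms by auto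
  define y where "y = 2 * t - 1"
  have y: "0 < y" "y \<le> 1" using False assms by (auto simp: y_def)
  have A: "tjoin_angle \<epsilon> t = 1" by (rule tjoin_angle_right) (use assms False in auto)
  obtain r0 where r0: "0 < r0" "r0 < 1"
    "tjoin \<epsilon> dch alpha (1 - \<epsilon>) = polar r0 (clamp01 (3 * (\<epsilon> + (1 - \<epsilon>) * (4 * (1 - \<epsilon>) - 3)) - 1))"
    using tjoin_dch_alpha[OF assms(1,2) x(1,2)] x by auto
  have "tjoin_angle \<epsilon> (1/2) = 1" by (rule tjoin_angle_right) (use assms in auto)
  then have r0': "tjoin \<epsilon> dch alpha (1 - \<epsilon>) = of_real (1 - r0)"
    using r0(3) unfolding tjoin_angle_def by simp
  have rv: "reversepath dch z = of_real (1 - z)" for z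
    by (simp add: reversepath_def dch_def linepath_def scaleR_conv_of_real)
  show ?thesis
  proof (cases "y \<le> 1/2")
    case True
    \<comment> \<open>The first factor has completed its turn before it is cut off, so the
      connecting segment lies on the real axis.\<close>
    have "j t = linepath (of_real (1 - r0)) (of_real (1 - \<epsilon>)) (2 * y)"
      unfolding j_def tjoin_def[of \<epsilon> "tjoin \<epsilon> dch alpha"] r0' rv using False True
      by (simp add: joinpaths_def y_def)
    also have "\<dots> = of_real (1 - ((1 - 2 * y) * r0 + 2 * y * \<epsilon>))"
      by (simp add: linepath_def scaleR_conv_of_real algebra_simps)
    finally have jt: "j t = of_real (1 - ((1 - 2 * y) * r0 + 2 * y * \<epsilon>))" .
    have "0 < (1 - 2 * y) * r0 + 2 * y * \<epsilon>" using True y r0 assms by (intro add_nonneg_pos) auto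
    moreover have "(1 - 2 * y) * r0 + 2 * y * \<epsilon> < 1"
    proof -
      have "(1 - 2 * y) * r0 \<le> (1 - 2 * y) * 1" using True r0 by (intro mult_left_mono) auto
      moreover have "2 * y * \<epsilon> < 2 * y * 1" using y assms by (intro mult_strict_left_mono) auto
      ultimately have "(1 - 2 * y) * r0 + 2 * y * \<epsilon> < (1 - 2 * y) * 1 + 2 * y * 1" by (rule add_le_less_mono)
      then show ?thesis by simp
    qed
    ultimately show ?thesis
      using jt by (intro exI[of _ "(1 - 2 * y) * r0 + 2 * y * \<epsilon>"]) (auto simp: A)
  next
    case y2: False
    have "j t = of_real (1 - (\<epsilon> + (1 - \<epsilon>) * (2 * y - 1)))"
      unfolding j_def tjoin_def[of \<epsilon> "tjoin \<epsilon> dch alpha"] using False y2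
      by (simp add: joinpaths_def y_def subpath_def rv algebra_simps)
    moreover define P where "P = (1 - \<epsilon>) * (2 * y - 1)"
    moreover have "0 \<le> P" unfolding P_def using y2 assms by (intro mult_nonneg_nonneg) auto
    moreover have "P \<le> (1 - \<epsilon>) * 1" unfolding P_def using y assms by (intro mult_left_mono) auto
    moreover have "P < (1 - \<epsilon>) * 1" if "t \<in> {0<..<1}"
      unfolding P_def using assms that by (intro mult_strict_left_mono) (auto simp: y_def)
    ultimately show ?thesis
      using assms(1) by (intro exI[of _ "\<epsilon> + P"]) (auto simp: A)
  qed
qed

lemma gref_in_beta_class: "gref \<in> beta_class"
proof -
  have "thomotopic tbp0 tbp0 gref (tjoin \<epsilon> (tjoin \<epsilon> dch alpha) (reversepath dch))"
    if \<epsilon>: "0 < \<epsilon>" "\<epsilon> < 1/20" for \<epsilon>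
  proof -
    define j where "j = tjoin \<epsilon> (tjoin \<epsilon> dch alpha) (reversepath dch)"
    have "path j"
      unfolding j_def dch_def using \<epsilon> path_alpha by (intro path_tjoin path_linepath) auto
    then have cj: "continuous_on {0..1} j" by (simp add: path_def)
    have jp: "\<exists>r>0. r \<le> 1 \<and> (t \<in> {0<..<1} \<longrightarrow> r < 1) \<and> j t = polar r (tjoin_angle \<epsilon> t)" if "t \<in> {0..1}" for t
      unfolding j_def by (rule beta_polar[OF \<epsilon> that])
    \<comment> \<open>The radius is recovered from the path as \<open>norm (1 - j t)\<close>; its
      continuity then needs no case distinction between the pieces.\<close>
    have jr: "0 < norm (1 - j t) \<and> (t \<in> {0<..<1} \<longrightarrow> norm (1 - j t) < 1) \<and> j t = polar (norm (1 - j t)) (tjoin_angle \<epsilon> t)"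
      if t: "t \<in> {0..1}" for t
    proof -
      obtain r where r: "0 < r" "t \<in> {0<..<1} \<longrightarrow> r < 1" "j t = polar r (tjoin_angle \<epsilon> t)" using jp[OF t] by blast
      then have "norm (1 - j t) = r" by (simp add: norm_one_minus_polar)
      then show ?thesis using r by simp
    qed
    have j01: "j 0 = 0" "j 1 = 0"
      unfolding j_def tjoin_def by (simp_all add: joinpaths_def subpath_def dch_def linepath_def reversepath_def)
    show ?thesis
      unfolding j_def[symmetric]
    proof (rule thomotopic_polar[where r = "\<lambda>t. max (2/3) (max (1 - t) t)" and a = "\<lambda>t. clamp01 (3 * t - 1)"
          and r' = "\<lambda>t. norm (1 - j t)" and a' = "tjoin_angle \<epsilon>" and \<eta> = "1/4"])
      show "continuous_on {0..1} (\<lambda>t. norm (1 - j t))" by (intro continuous_intros cj)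
      show "continuous_on {0..1} (tjoin_angle \<epsilon>)"
        unfolding tjoin_angle_def clamp01_def by (intro continuous_intros)
      show "continuous_on {0..1} (\<lambda>t::real. max (2/3) (max (1 - t) t))"
        "continuous_on {0..1} (\<lambda>t. clamp01 (3 * t - 1))"
        unfolding clamp01_def by (intro continuous_intros)+
      show "\<And>t. t \<in> {0..1/4} \<Longrightarrow> tjoin_angle \<epsilon> t = 0" using tjoin_angle_left[OF \<epsilon>] by auto
      show "\<And>t. t \<in> {1 - 1/4..1} \<Longrightarrow> tjoin_angle \<epsilon> t = 1" using tjoin_angle_right[OF \<epsilon>] by auto
    qed (use jr j01 in \<open>auto simp: gref_def clamp01_def max_gref_bounds\<close>)
  qed
  then have "eventually (\<lambda>\<epsilon>. thomotopic tbp0 tbp0 gref (tjoin \<epsilon> (tjoin \<epsilon> dch alpha) (reversepath dch))) (at_right 0)"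
    using eventually_mono[OF eventually_in_01[of "1/20"]] by simp
  then show ?thesis by (simp add: beta_class_def tpath_gref)
qed

lemma beta_class_thomotopic_gref:
  assumes "p \<in> beta_class"
  shows "thomotopic tbp0 tbp0 p gref" "tpath tbp0 tbp0 p"
proof -
  have "eventually (\<lambda>\<epsilon>. thomotopic tbp0 tbp0 p (tjoin \<epsilon> (tjoin \<epsilon> dch alpha) (reversepath dch)) \<and>
     thomotopic tbp0 tbp0 gref (tjoin \<epsilon> (tjoin \<epsilon> dch alpha) (reversepath dch))) (at_right 0)"
    using assms gref_in_beta_class by (simp add: beta_class_def eventually_conj_iff)
  then obtain \<epsilon> where "thomotopic tbp0 tbp0 p (tjoin \<epsilon> (tjoin \<epsilon> dch alpha) (reversepath dch))"
     "thomotopic tbp0 tbp0 gref (tjoin \<epsilon> (tjoin \<epsilon> dch alpha) (reversepath dch))"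
    using eventually_happens'[OF trivial_limit_at_right_real] by blast
  then show "thomotopic tbp0 tbp0 p gref"
    by (blast intro: thomotopic_trans thomotopic_sym)
  show "tpath tbp0 tbp0 p" using assms by (simp add: beta_class_def)
qed

section \<open>The shuffle relation\<close>

text \<open>The transport from 1/3 to \<open>t\<close> is inverse to the one from \<open>t\<close>
  to 1/3. The recursion for an inverse series yields its expansion without a second analysis at the
  upper end.\<close>

lemma log_poly_inverse:
  assumes A: "\<And>u. log_poly (length u) (\<lambda>t. A t u) (MA u)" "\<And>t. A t [] = 1" "\<And>t. B t [] = 1"
    and AB: "eventually (\<lambda>t. conv (A t) (B t) = eps) (at_right 0)"
  shows "\<exists>c. log_poly (length u) (\<lambda>t. B t u) c"
proof (induction "length u" arbitrary: u rule: less_induct)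
  case less
  show ?case
  proof (cases u)
    case Nil
    then show ?thesis using log_poly_const[of 0 1] by (auto simp: A(3))
  next
    case (Cons a v)
    define N where "N x = (SOME c. log_poly (length x) (\<lambda>t. B t x) c)" for x
    have N: "log_poly (length x) (\<lambda>t. B t x) (N x)" if "length x \<le> length v" for x
      unfolding N_def by (rule someI_ex, rule less.hyps) (use that in \<open>simp add: Cons\<close>)
    have "log_poly (1 + length v) (\<lambda>t. conv (\<lambda>x. A t (a # x)) (B t) v) (conv (\<lambda>x. MA (a # x)) N v)"
    proof (rule log_poly_conv[OF _ N])
      show "log_poly (1 + length x) (\<lambda>t. A t (a # x)) (MA (a # x))" for x
        using A(1)[of "a # x"] by simp
    qed
    from log_poly_cmult[OF this, of "-1"]
    have "log_poly (length u) (\<lambda>t. - 1 * conv (\<lambda>x. A t (a # x)) (B t) v) (- 1 * conv (\<lambda>x. MA (a # x)) N v)"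
      by (simp add: Cons)
    moreover have "eventually (\<lambda>t. - 1 * conv (\<lambda>x. A t (a # x)) (B t) v = B t u) (at_right 0)"
      using AB
    proof eventually_elim
      case (elim t)
      have "conv (A t) (B t) (a # v) = 0" by (simp only: elim eps_simps)
      then have "B t (a # v) + conv (\<lambda>x. A t (a # x)) (B t) v = 0" by (simp add: A(2))
      then show ?case
        using minus_unique[of "conv (\<lambda>x. A t (a # x)) (B t) v" "B t (a # v)"] by (simp add: Cons add.commute)
    qed
    ultimately have "log_poly (length u) (\<lambda>t. B t u) (- 1 * conv (\<lambda>x. MA (a # x)) N v)" by (rule log_poly_cong)
    then show ?thesis by blast
  qed
qed

section \<open>Regularized values of the explicit loop\<close>

lemma gref_avoid: "t \<in> {0<..<1} \<Longrightarrow> gref t \<notin> {0, 1}"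
  using tpath_gref by (simp add: tpath_def)

lemma flat_gref:
  assumes "0 < c" "c \<le> d" "d < 1"
  shows "flat gref c d (\<lambda>t. word_int gref t d)"
proof -
  obtain S where S: "finite S" "\<And>t. t \<in> {0<..<1} - S \<Longrightarrow> gref differentiable (at t)"
    by (rule piecewise_smooth_differentiable[OF piecewise_smooth_gref]) (rule that)
  show ?thesis
  proof (rule flat_path[OF continuous_gref _ S(1) assms(2)])
    show "gref ` {c..d} \<inter> {0, 1} = {}"
    proof (rule ccontr)
      assume "gref ` {c..d} \<inter> {0, 1} \<noteq> {}"
      then obtain t where t: "t \<in> {c..d}" "gref t \<in> {0, 1}" by blast
      then have "t \<in> {0<..<1}" using assms by auto
      then show False using gref_avoid t by blast
    qed
    show "\<And>t. t \<in> {c<..<d} - S \<Longrightarrow> gref differentiable at t"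
      by (rule S(2)) (use assms in auto)
  qed
qed

lemma word_int_gref_ends:
  assumes "0 < t" "t \<le> 1/3"
  shows "word_int gref t (1/3) = transport (of_real t) (1/3)" "word_int gref (2/3) (1 - t) = transport (1/3) (of_real t)"
proof -
  obtain S where S: "finite S" "\<And>t. t \<in> {0<..<1} - S \<Longrightarrow> gref differentiable (at t)"
    by (rule piecewise_smooth_differentiable[OF piecewise_smooth_gref]) (rule that)
  have "word_int gref t (1/3) = transport (gref t) (gref (1/3))"
  proof (rule word_int_transport(1)[OF simple_domain_sector _ continuous_gref S(1) assms(2)])
    show "gref ` {t..1/3} \<subseteq> sector"
      using assms by (auto simp: gref_left sector_def)
    show "\<And>x. x \<in> {t<..<1/3} - S \<Longrightarrow> gref differentiable at x"
      by (rule S(2)) (use assms in auto)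
  qed
  then show "word_int gref t (1/3) = transport (of_real t) (1/3)"
    using assms by (simp add: gref_left)
  have "word_int gref (2/3) (1 - t) = transport (gref (2/3)) (gref (1 - t))"
  proof (rule word_int_transport(1)[OF simple_domain_sector _ continuous_gref S(1)])
    show "gref ` {2/3..1 - t} \<subseteq> sector"
    proof clarify
      fix x assume x: "x \<in> {2/3..1 - t}"
      then have "gref x = of_real (1 - x)" using assms by (intro gref_right) auto
      moreover have "norm (of_real (1 - x) :: complex) < 1" unfolding norm_of_real using x assms by simp
      ultimately show "gref x \<in> sector" using x assms by (simp add: sector_def)
    qed
    show "\<And>x. x \<in> {2/3<..<1 - t} - S \<Longrightarrow> gref differentiable at x"
      by (rule S(2)) (use assms in auto)
  qed (use assms in auto)
  moreover have "gref (2/3) = 1/3" "gref (1 - t) = of_real t"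
    using assms gref_right[of "2/3"] gref_right[of "1 - t"] by simp_all
  ultimately show "word_int gref (2/3) (1 - t) = transport (1/3) (of_real t)" by simp
qed

text \<open>Chen's formula at 1/3 and 2/3 leaves two transports with known expansions and a factor
  in the middle that does not depend on \<open>t\<close>.\<close>

lemma log_poly_gref: "\<exists>c. log_poly (length u) (\<lambda>t. word_int gref t (1 - t) u) c"
proof -
  define A where "A t = transport (of_real t) (1/3)" for t :: real
  define B where "B t = transport (1/3) (of_real t)" for t :: real
  define MA where "MA u = (SOME c. log_poly (length u) (\<lambda>t. A t u) c)" for u
  define MB where "MB u = (SOME c. log_poly (length u) (\<lambda>t. B t u) c)" for u
  have A: "log_poly (length u) (\<lambda>t. A t u) (MA u)" for u
    unfolding MA_def by (rule someI_ex) (unfold A_def, rule log_poly_transport_third)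
  have AB: "eventually (\<lambda>t. conv (A t) (B t) = eps) (at_right 0)"
    using eventually_in_01[OF zero_less_one]
  proof eventually_elim
    case (elim t)
    have "1/3 \<in> sector" "of_real t \<in> sector" using elim by (auto simp: sector_def norm_divide)
    then show ?case unfolding A_def B_def by (simp only: transport_conv[OF simple_domain_sector] transport_refl)
  qed
  have "\<exists>c. log_poly (length u) (\<lambda>t. B t u) c" for u
    by (rule log_poly_inverse[OF A _ _ AB]) (simp_all add: A_def B_def)
  then have B: "log_poly (length u) (\<lambda>t. B t u) (MB u)" for u
    unfolding MB_def by (rule someI_ex)
  define J where "J = word_int gref (1/3) (2/3)"
  have 1: "log_poly (length v) (\<lambda>t. conv J (B t) v) (conv J MB v)" for v
    using log_poly_conv[of 0 "\<lambda>t. J" J v B MB] log_poly_const B by simp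
  have 2: "log_poly (length u) (\<lambda>t. conv (A t) (conv J (B t)) u) (conv MA (conv J MB) u)"
    using log_poly_conv[of 0 A MA u "\<lambda>t. conv J (B t)" "conv J MB"] A 1 by simp
  have "eventually (\<lambda>t. conv (A t) (conv J (B t)) u = word_int gref t (1 - t) u) (at_right 0)"
    using eventually_in_01[OF divide_pos_pos[OF zero_less_one zero_less_numeral[of "Num.num.Bit1 Num.num.One"]]]
  proof eventually_elim
    case (elim t)
    have f: "flat gref t (1/3) (\<lambda>x. word_int gref x (1/3))" "flat gref (1/3) (2/3) (\<lambda>x. word_int gref x (2/3))"
      "flat gref (2/3) (1 - t) (\<lambda>x. word_int gref x (1 - t))" "flat gref (1/3) (1 - t) (\<lambda>x. word_int gref x (1 - t))"
      using elim by (auto intro!: flat_gref)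
    have "word_int gref t (1 - t) = conv (word_int gref t (1/3)) (word_int gref (1/3) (1 - t))"
      by (rule word_int_chen[OF f(1,4)]) (use elim in auto)
    also have "word_int gref (1/3) (1 - t) = conv J (word_int gref (2/3) (1 - t))"
      unfolding J_def by (rule word_int_chen[OF f(2,3)]) (use elim in auto)
    finally show ?case using word_int_gref_ends[of t] elim by (simp add: A_def B_def)
  qed
  from log_poly_cong[OF 2 this] show ?thesis by blast
qed

definition reg_value :: "letter list \<Rightarrow> complex" where
  "reg_value u = (SOME c. log_poly (length u) (\<lambda>t. word_int gref t (1 - t) u) c)"

lemma log_poly_reg_value: "log_poly (length u) (\<lambda>t. word_int gref t (1 - t) u) (reg_value u)"
  unfolding reg_value_def by (rule someI_ex) (rule log_poly_gref)

lemma has_reg_value_word_int: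
  "has_reg_value p (map letter_point u) c \<longleftrightarrow> log_poly (length u) (\<lambda>t. word_int p t (1 - t) u) c"
  by (simp add: has_reg_value_iff_log_poly word_int_def)

text \<open>The definite description is meaningful: homotopy to \<open>gref\<close> gives every path
  of the class the same value, and constant terms of expansions are unique.\<close>

lemma reg_int_beta_class: "reg_int beta_class (map letter_point u) = reg_value u"
  unfolding reg_int_def
proof (rule the_equality)
  show "\<forall>g\<in>beta_class. has_reg_value g (map letter_point u) (reg_value u)"
  proof
    fix p assume "p \<in> beta_class"
    from thomotopic_log_poly[OF beta_class_thomotopic_gref[OF this] tpath_gref log_poly_reg_value]
    show "has_reg_value p (map letter_point u) (reg_value u)"
      unfolding has_reg_value_word_int .
  qed
  fix c assume "\<forall>g\<in>beta_class. has_reg_value g (map letter_point u) c"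
  then have "log_poly (length u) (\<lambda>t. word_int gref t (1 - t) u) c"
    using gref_in_beta_class has_reg_value_word_int by blast
  then show "c = reg_value u" using log_poly_unique log_poly_reg_value by blast
qed

section \<open>Linear extension to the free algebra and the shuffle product\<close>

definition linear_ext :: "series \<Rightarrow> ncpoly \<Rightarrow> complex" where
  "linear_ext F p = (\<Sum>u\<in>Poly_Mapping.keys p. of_rat (Poly_Mapping.lookup p u) * F u)"

lemma linear_ext_superset:
  assumes "finite A" "Poly_Mapping.keys p \<subseteq> A"
  shows "linear_ext F p = (\<Sum>u\<in>A. of_rat (Poly_Mapping.lookup p u) * F u)"
  unfolding linear_ext_def by (rule sum.mono_neutral_left) (use assms in \<open>auto simp: in_keys_iff\<close>)

lemma linear_ext_add: "linear_ext F (p + q) = linear_ext F p + linear_ext F q"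
proof -
  let ?A = "Poly_Mapping.keys p \<union> Poly_Mapping.keys q"
  have "linear_ext F (p + q) = (\<Sum>u\<in>?A. of_rat (Poly_Mapping.lookup (p + q) u) * F u)"
    by (rule linear_ext_superset) (simp, rule Poly_Mapping.keys_add)
  also have "\<dots> = (\<Sum>u\<in>?A. of_rat (Poly_Mapping.lookup p u) * F u) + (\<Sum>u\<in>?A. of_rat (Poly_Mapping.lookup q u) * F u)"
    by (simp add: lookup_add of_rat_add algebra_simps sum.distrib)
  also have "\<dots> = linear_ext F p + linear_ext F q"
    by (simp add: linear_ext_superset[of ?A, symmetric])
  finally show ?thesis .
qed

lemma linear_ext_zero [simp]: "linear_ext F 0 = 0"
  by (simp add: linear_ext_def)

lemma linear_ext_single [simp]: "linear_ext F (Poly_Mapping.single u c) = of_rat c * F u"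
  by (cases "c = 0") (simp_all add: linear_ext_def)

lemma linear_ext_sum: "linear_ext F (\<Sum>x\<in>A. f x) = (\<Sum>x\<in>A. linear_ext F (f x))"
  by (induction A rule: infinite_finite_induct) (auto simp: linear_ext_add)

lemma linear_ext_single_mult: "linear_ext F (Poly_Mapping.single v c * p) = of_rat c * linear_ext (\<lambda>u. F (v @ u)) p"
proof (induction p rule: update_induct)
  case const
  show ?case by simp
next
  case (update f a b)
  have "Poly_Mapping.update a b f = f + Poly_Mapping.single a b"
    using update(1)
    by (intro poly_mapping_eqI) (auto simp: lookup_update lookup_add lookup_single in_keys_iff when_def)
  then show ?case
    using update(3) by (simp add: distrib_left linear_ext_add mult_single plus_list_def of_rat_mult)
qed

lemma linear_ext_scal: "linear_ext F (scal c p) = of_rat c * linear_ext F p"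
  by (simp add: scal_def linear_ext_single_mult)

lemma linear_ext_gen_mult: "linear_ext F (gen a * p) = linear_ext (\<lambda>u. F (a # u)) p"
  by (simp add: gen_def linear_ext_single_mult)

lemma linear_ext_scale_fun: "linear_ext (\<lambda>u. c * F u) p = c * linear_ext F p"
  by (simp add: linear_ext_def sum_distrib_left mult_ac)

lemma linear_ext_hvd:
  assumes "\<And>u. ((\<lambda>t. F t u) has_vector_derivative F' u) (at t)"
  shows "((\<lambda>t. linear_ext (F t) p) has_vector_derivative linear_ext F' p) (at t)"
  unfolding linear_ext_def by (intro has_vector_derivative_sum has_vector_derivative_mult_right assms)

text \<open>The recursion of the shuffle product is the product rule: differentiation in the lower
  limit removes the first letter of one of the two factors.\<close>

lemma word_int_shuffle:
  assumes flat: "flat g c d (\<lambda>t. word_int g t d)" and t: "t \<in> {c..d}"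
  shows "linear_ext (word_int g t d) (shuffle_word u v) = word_int g t d u * word_int g t d v"
  using t
proof (induction u v arbitrary: t rule: shuffle_word.induct)
  case (3 a u b v)
  obtain S where S: "finite S" "\<And>t a u. t \<in> {c<..<d} - S \<Longrightarrow>
    ((\<lambda>t. word_int g t d (a # u)) has_vector_derivative - (form g a t * word_int g t d u)) (at t)"
    using flat by (rule flatE) (rule that)
  define f where "f t = linear_ext (\<lambda>w. word_int g t d (a # w)) (shuffle_word u (b # v)) +
      linear_ext (\<lambda>w. word_int g t d (b # w)) (shuffle_word (a # u) v) - word_int g t d (a # u) * word_int g t d (b # v)" for t
  have D: "(f has_vector_derivative 0) (at x)" if x: "x \<in> {c<..<d} - S" for x
  proof -
    have xc: "x \<in> {c..d}" using x by auto
    have e: "linear_ext (\<lambda>w. - (form g a x * word_int g x d w)) p = - (form g a x * linear_ext (word_int g x d) p)" for a p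
      using linear_ext_scale_fun[of "- form g a x" "word_int g x d" p] by simp
    have "(f has_vector_derivative
        linear_ext (\<lambda>w. - (form g a x * word_int g x d w)) (shuffle_word u (b # v)) +
        linear_ext (\<lambda>w. - (form g b x * word_int g x d w)) (shuffle_word (a # u) v) -
        (word_int g x d (a # u) * - (form g b x * word_int g x d v) + - (form g a x * word_int g x d u) * word_int g x d (b # v))) (at x)"
      unfolding f_def
      by (intro has_vector_derivative_add has_vector_derivative_diff has_vector_derivative_mult linear_ext_hvd S(2)[OF x])
    then show ?thesis
      unfolding e using "3.IH"(1)[OF xc] "3.IH"(2)[OF xc] by (simp add: algebra_simps)
  qed
  have cf: "continuous_on {c..d} f"
    unfolding f_def linear_ext_def by (intro continuous_intros flatD_cont[OF flat])
  have "((\<lambda>x. 0) has_integral (f d - f t)) {t..d}"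
    by (rule fundamental_theorem_of_calculus_interior_strong[OF S(1)])
       (use 3 D cf in \<open>auto intro: continuous_on_subset\<close>)
  then have "f d - f t = 0" using has_integral_0_eq by blast
  moreover have "f d = 0" by (simp add: f_def word_int_refl linear_ext_def)
  ultimately have "f t = 0" by simp
  then show ?case by (simp add: f_def linear_ext_add linear_ext_gen_mult)
qed simp_all

lemma log_poly_linear_ext:
  assumes "\<And>u. u \<in> Poly_Mapping.keys p \<Longrightarrow> log_poly n (\<lambda>t. F t u) (M u)"
  shows "log_poly n (\<lambda>t. linear_ext (F t) p) (linear_ext M p)"
proof -
  have *: "log_poly n (\<lambda>t. \<Sum>u\<in>A. of_rat (Poly_Mapping.lookup p u) * F t u) (\<Sum>u\<in>A. of_rat (Poly_Mapping.lookup p u) * M u)"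
    if "finite A" "A \<subseteq> Poly_Mapping.keys p" for A
    using that
  proof (induction A rule: finite_induct)
    case empty
    then show ?case using log_poly_const[of n 0] by simp
  next
    case (insert x A)
    have "log_poly n (\<lambda>t. of_rat (Poly_Mapping.lookup p x) * F t x) (of_rat (Poly_Mapping.lookup p x) * M x)"
      using insert by (intro log_poly_cmult assms) auto
    from log_poly_add[OF this insert.IH] show ?case using insert by simp
  qed
  show ?thesis unfolding linear_ext_def by (rule *[OF finite_keys order_refl])
qed

lemma keys_gen_mult: "x \<in> Poly_Mapping.keys (gen a * p) \<Longrightarrow> \<exists>v\<in>Poly_Mapping.keys p. x = a # v"
  using keys_mult[of "gen a" p] by (auto simp: gen_def plus_list_def)

text \<open>Homogeneity gives all terms expansions of the same logarithmic order, so that they can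
  be added.\<close>

lemma keys_shuffle_word:
  "x \<in> Poly_Mapping.keys (shuffle_word u v) \<Longrightarrow> length x = length u + length v"
proof (induction u v arbitrary: x rule: shuffle_word.induct)
  case (3 a u b v)
  have "x \<in> Poly_Mapping.keys (gen a * shuffle_word u (b # v)) \<or>
      x \<in> Poly_Mapping.keys (gen b * shuffle_word (a # u) v)"
    using "3.prems" Poly_Mapping.keys_add[of "gen a * shuffle_word u (b # v)" "gen b * shuffle_word (a # u) v"]
    by (simp only: shuffle_word.simps) blast
  then show ?case
  proof
    assume "x \<in> Poly_Mapping.keys (gen a * shuffle_word u (b # v))"
    then obtain y where "y \<in> Poly_Mapping.keys (shuffle_word u (b # v))" "x = a # y"
      using keys_gen_mult by blast
    then show ?thesis using "3.IH"(1)[of y] by simp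
  next
    assume "x \<in> Poly_Mapping.keys (gen b * shuffle_word (a # u) v)"
    then obtain y where "y \<in> Poly_Mapping.keys (shuffle_word (a # u) v)" "x = b # y"
      using keys_gen_mult by blast
    then show ?thesis using "3.IH"(2)[of y] by simp
  qed
qed auto

lemma reg_value_shuffle: "linear_ext reg_value (shuffle_word u v) = reg_value u * reg_value v"
proof -
  have 1: "log_poly (length u + length v) (\<lambda>t. linear_ext (word_int gref t (1 - t)) (shuffle_word u v)) (linear_ext reg_value (shuffle_word u v))"
  proof (rule log_poly_linear_ext)
    fix w assume "w \<in> Poly_Mapping.keys (shuffle_word u v)"
    then have "length w = length u + length v" by (rule keys_shuffle_word)
    from log_poly_reg_value[of w, unfolded this]
    show "log_poly (length u + length v) (\<lambda>t. word_int gref t (1 - t) w) (reg_value w)" .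
  qed
  have "eventually (\<lambda>t. linear_ext (word_int gref t (1 - t)) (shuffle_word u v) = word_int gref t (1 - t) u * word_int gref t (1 - t) v) (at_right 0)"
    using eventually_in_01[OF half_gt_zero[OF zero_less_one]]
  proof eventually_elim
    case (elim t)
    then show ?case by (intro word_int_shuffle[OF flat_gref]) auto
  qed
  from log_poly_cong[OF 1 this] log_poly_mult[OF log_poly_reg_value log_poly_reg_value, of u v] show ?thesis
    by (rule log_poly_unique)
qed

lemma Z_RS_linear_ext: "Z_RS p = linear_ext reg_value p / (2 * of_real pi * \<i>)"
  by (simp add: Z_RS_def linear_ext_def reg_int_beta_class sum_divide_distrib)

lemma Z_RS_shuffle: "Z_RS (shuffle_prod p q) = 2 * of_real pi * \<i> * Z_RS p * Z_RS q"
proof -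
  have "linear_ext reg_value (shuffle_prod p q) = linear_ext reg_value p * linear_ext reg_value q"
    unfolding shuffle_prod_def linear_ext_sum linear_ext_scal reg_value_shuffle
    by (simp add: linear_ext_def sum_product of_rat_mult mult_ac)
  then show ?thesis by (simp add: Z_RS_linear_ext)
qed

section \<open>Multiple polylogarithms\<close>

definition left_half :: "complex set" where "left_half = {l. Re l < 0}"

lemma open_left_half: "open left_half" and convex_left_half: "convex left_half"
  unfolding left_half_def by (rule open_halfspace_Re_lt, rule convex_halfspace_Re_lt)

lemma one_minus_exp_nz: "l \<in> left_half \<Longrightarrow> 1 - exp l \<noteq> 0"
  by (metis left_half_def exp_eq_1 mem_Collect_eq order_less_irrefl right_minus_eq)

text \<open>Under z = 1 - exp l the forms become dz / z = - \<open>log_form E0\<close> dl and dz /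
  (z - 1) = \<open>log_form E1\<close> dl.\<close>

definition log_form :: "letter \<Rightarrow> complex \<Rightarrow> complex" where
  "log_form a l = (case a of E0 \<Rightarrow> exp l / (1 - exp l) | E1 \<Rightarrow> 1)"

lemma log_form_simps [simp]: "log_form E0 l = exp l / (1 - exp l)" "log_form E1 l = 1"
  by (simp_all add: log_form_def)

lemma log_form_holomorphic: "log_form a holomorphic_on left_half"
proof (cases a)
  case E0
  have "(\<lambda>l. exp l / (1 - exp l)) holomorphic_on left_half"
    by (intro holomorphic_intros one_minus_exp_nz)
  then show ?thesis by (simp add: E0 log_form_def[abs_def])
next
  case E1
  then show ?thesis by (simp add: log_form_def[abs_def])
qed

text \<open>The coefficients of the power series at 0; for \<open>n = 0\<close> the division by zero gives the correct value 0.\<close>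

fun Li_coeff :: "letter list \<Rightarrow> nat \<Rightarrow> complex" where
  "Li_coeff [] n = (if n = 0 then 1 else 0)"
| "Li_coeff (E0 # v) n = Li_coeff v n / of_nat n"
| "Li_coeff (E1 # v) n = (\<Sum>m<n. Li_coeff v m) / of_nat n"

definition Li :: "letter list \<Rightarrow> complex \<Rightarrow> complex" where
  "Li v z = (suminf (\<lambda>n. Li_coeff v n * z ^ n))"

definition psum :: "letter list \<Rightarrow> nat \<Rightarrow> complex" where
  "psum v n = (\<Sum>m\<le>n. Li_coeff v m)"

text \<open>The words that do not end in \<open>E0\<close>: their polylogarithms have no logarithmic
  singularity at 0.\<close>

inductive admissible :: "letter list \<Rightarrow> bool" where
  admissible_Nil: "admissible []"
| admissible_E1: "admissible v \<Longrightarrow> admissible (E1 # v)"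
| admissible_E0: "admissible v \<Longrightarrow> v \<noteq> [] \<Longrightarrow> admissible (E0 # v)"

lemma Li_coeff_0: "v \<noteq> [] \<Longrightarrow> Li_coeff v 0 = 0"
  by (cases v; cases "hd v"; simp)

lemma norm_Li_coeff_le_1: "norm (Li_coeff v n) \<le> 1"
proof (induction v arbitrary: n)
  case Nil
  then show ?case by simp
next
  case (Cons a v)
  show ?case
  proof (cases "n = 0")
    case True
    then show ?thesis by (cases a) auto
  next
    case False
    show ?thesis
    proof (cases a)
      case E0
      have "norm (Li_coeff v n) \<le> 1 * real n" using Cons[of n] False by (simp add: order.trans[OF Cons])
      then show ?thesis using False by (simp add: E0 norm_divide divide_simps)
    next
      case E1
      have "norm (\<Sum>m<n. Li_coeff v m) \<le> (\<Sum>m<n. 1)"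
        by (rule order.trans[OF norm_sum sum_mono]) (rule Cons)
      then show ?thesis using False by (simp add: E1 norm_divide divide_simps)
    qed
  qed
qed

lemma summable_norm_Li_coeff: "norm z < 1 \<Longrightarrow> summable (\<lambda>n. norm (Li_coeff v n * z ^ n))"
proof (rule summable_comparison_test')
  assume "norm z < 1"
  then show "summable (\<lambda>n. norm z ^ n)" by (simp add: summable_geometric)
  fix n show "norm (norm (Li_coeff v n * z ^ n)) \<le> norm z ^ n"
    using mult_right_mono[OF norm_Li_coeff_le_1, of "norm z ^ n" v n] by (simp add: norm_mult norm_power)
qed

lemma summable_Li_coeff: "norm z < 1 \<Longrightarrow> summable (\<lambda>n. Li_coeff v n * z ^ n)"
  by (rule summable_norm_cancel[OF summable_norm_Li_coeff])

lemma Li_Nil [simp]: "Li [] z = 1"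
proof -
  have "Li [] z = (\<Sum>n\<in>{0}. Li_coeff [] n * z ^ n)"
    unfolding Li_def by (rule suminf_finite) auto
  then show ?thesis by simp
qed

lemma Li_deriv_aux:
  assumes "norm z < 1"
  shows "(Li v has_field_derivative (suminf (\<lambda>n. diffs (Li_coeff v) n * z ^ n))) (at z)"
proof -
  obtain K where K: "norm z < K" "K < 1" using dense[OF assms] by blast
  have "0 \<le> K" by (rule order.trans[OF norm_ge_zero less_imp_le[OF K(1)]])
  then have K': "norm (of_real K :: complex) = K" by simp
  have "norm z < norm (of_real K :: complex)" using K K' by simp
  moreover have "summable (\<lambda>n. Li_coeff v n * of_real K ^ n)"
    by (rule summable_Li_coeff) (use K K' in simp)
  ultimately show ?thesis
    unfolding Li_def[abs_def] by (intro termdiffs_strong)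
qed

text \<open>The coefficients on both sides are the partial sums \<open>psum v n\<close>: division by
  \<open>1 - z\<close> produces them on the right, and differentiation cancels the denominator on
  the left.\<close>

lemma Li_E1_deriv:
  assumes "norm z < 1"
  shows "(Li (E1 # v) has_field_derivative Li v z / (1 - z)) (at z)"
proof -
  have "diffs (Li_coeff (E1 # v)) n = psum v n" for n
    by (simp add: diffs_def psum_def lessThan_Suc_atMost del: of_nat_Suc)
  then have d: "(suminf (\<lambda>n. diffs (Li_coeff (E1 # v)) n * z ^ n)) = (suminf (\<lambda>n. psum v n * z ^ n))" by simp
  have "Li v z * (suminf (\<lambda>n. z ^ n)) = (suminf (\<lambda>k. \<Sum>i\<le>k. (Li_coeff v i * z ^ i) * z ^ (k - i)))"
    unfolding Li_def
    by (rule Cauchy_product[OF summable_norm_Li_coeff[OF assms]])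
       (use assms in \<open>simp add: norm_power summable_geometric\<close>)
  also have "(\<lambda>k. \<Sum>i\<le>k. (Li_coeff v i * z ^ i) * z ^ (k - i)) = (\<lambda>k. psum v k * z ^ k)"
  proof
    fix k
    have "(\<Sum>i\<le>k. (Li_coeff v i * z ^ i) * z ^ (k - i)) = (\<Sum>i\<le>k. Li_coeff v i * z ^ k)"
      by (rule sum.cong) (auto simp: mult.assoc power_add[symmetric])
    then show "(\<Sum>i\<le>k. (Li_coeff v i * z ^ i) * z ^ (k - i)) = psum v k * z ^ k"
      by (simp add: psum_def sum_distrib_right)
  qed
  finally have "(suminf (\<lambda>n. psum v n * z ^ n)) = Li v z / (1 - z)"
    using suminf_geometric[OF assms] by (simp add: divide_inverse)
  then show ?thesis using Li_deriv_aux[OF assms, of "E1 # v"] by (simp add: d)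
qed

lemma Li_E0_deriv:
  assumes "norm z < 1" "z \<noteq> 0" "v \<noteq> []"
  shows "(Li (E0 # v) has_field_derivative Li v z / z) (at z)"
proof -
  have "diffs (Li_coeff (E0 # v)) n = Li_coeff v (Suc n)" for n
    by (simp add: diffs_def del: of_nat_Suc)
  then have d: "(suminf (\<lambda>n. diffs (Li_coeff (E0 # v)) n * z ^ n)) = (suminf (\<lambda>n. Li_coeff v (Suc n) * z ^ n))" by simp
  have "Li v z = (suminf (\<lambda>n. Li_coeff v (Suc n) * z ^ n)) * z"
    unfolding Li_def using powser_split_head(1)[OF summable_Li_coeff[OF assms(1)], of v] Li_coeff_0[OF assms(3)] by simp
  then have "(suminf (\<lambda>n. Li_coeff v (Suc n) * z ^ n)) = Li v z / z" using assms(2) by simp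
  then show ?thesis using Li_deriv_aux[OF assms(1), of "E0 # v"] by (simp add: d)
qed

lemma norm_Li_le:
  assumes "v \<noteq> []" "norm z \<le> 1/2"
  shows "norm (Li v z) \<le> 2 * norm z"
proof -
  have z1: "norm z < 1" using assms(2) by simp
  have "Li v z = (suminf (\<lambda>n. Li_coeff v (Suc n) * z ^ n)) * z"
    unfolding Li_def using powser_split_head(1)[OF summable_Li_coeff[OF z1], of v] Li_coeff_0[OF assms(1)] by simp
  moreover have "norm (suminf (\<lambda>n. Li_coeff v (Suc n) * z ^ n)) \<le> (suminf (\<lambda>n. norm z ^ n))"
  proof (rule norm_suminf_le)
    show "norm (Li_coeff v (Suc n) * z ^ n) \<le> norm z ^ n" for n
      using mult_right_mono[OF norm_Li_coeff_le_1, of "norm z ^ n" v "Suc n"] by (simp add: norm_mult norm_power)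
    show "summable (\<lambda>n. norm z ^ n)" using z1 by (simp add: summable_geometric)
  qed
  moreover have "(suminf (\<lambda>n. norm z ^ n)) = 1 / (1 - norm z)" using z1 by (simp add: suminf_geometric)
  moreover have "1 / (1 - norm z) \<le> 2" using assms(2) by (simp add: field_simps)
  ultimately have "norm (Li v z) \<le> 2 * norm z"
    by (simp add: norm_mult mult_right_mono)
  then show ?thesis .
qed

text \<open>The continuation of \<open>Li v (1 - exp l)\<close> from negative \<open>l\<close> to the half plane, see \<open>Lam_real\<close>.\<close>

fun Lam :: "letter list \<Rightarrow> complex \<Rightarrow> complex" where
  "Lam [] l = 1"
| "Lam (a # v) l = Li (a # v) (1 - exp (-1)) +
     contour_integral (linepath (-1) l) (\<lambda>x. - (Lam v x * log_form a x))"

lemma Lam_holomorphic: "Lam v holomorphic_on left_half"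
  and Lam_deriv: "l \<in> left_half \<Longrightarrow> (Lam (a # v) has_field_derivative - (Lam v l * log_form a l)) (at l)"
proof -
  have m1: "-1 \<in> left_half" by (simp add: left_half_def)
  have D: "(Lam (a # v) has_field_derivative - (Lam v l * log_form a l)) (at l)"
    if "Lam v holomorphic_on left_half" "l \<in> left_half" for a v l
  proof -
    have h: "(\<lambda>x. - (Lam v x * log_form a x)) holomorphic_on left_half"
      by (intro holomorphic_intros that log_form_holomorphic)
    have "((\<lambda>l. Li (a # v) (1 - exp (-1)) + contour_integral (linepath (-1) l) (\<lambda>x. - (Lam v x * log_form a x)))
       has_field_derivative 0 + - (Lam v l * log_form a l)) (at l)"
      by (intro DERIV_add DERIV_const primitive_linepath(2)[OF open_left_half convex_left_half h that(2) m1])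
    then show ?thesis by (simp add: Lam.simps(2)[abs_def] del: Lam.simps)
  qed
  show hol: "Lam v holomorphic_on left_half" for v
  proof (induction v)
    case Nil
    have "Lam [] = (\<lambda>l. 1)" by (rule ext) simp
    then show ?case by simp
  next
    case (Cons a v)
    show ?case
    proof (rule holomorphic_onI)
      fix l assume "l \<in> left_half"
      from has_field_derivative_at_within[OF D[OF Cons this]]
      show "Lam (a # v) field_differentiable (at l within left_half)"
        unfolding field_differentiable_def by blast
    qed
  qed
  show "l \<in> left_half \<Longrightarrow> (Lam (a # v) has_field_derivative - (Lam v l * log_form a l)) (at l)"
    by (rule D[OF hol])
qed

section \<open>Polylogarithms on horizontal lines in the half plane\<close>

lemma hvd_line: "((\<lambda>x. of_real x + c) has_vector_derivative (1::complex)) (at x within S)"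
  using has_vector_derivative_add[OF of_real_hvd has_vector_derivative_const] by simp

lemma hvd_on_line:
  fixes c :: complex
  assumes "(F has_field_derivative F') (at (of_real x + c))"
  shows "((\<lambda>x. F (of_real x + c)) has_vector_derivative F') (at x)"
  using field_vector_diff_chain_at[where f = "\<lambda>x. complex_of_real x + c", OF hvd_line assms] by (simp add: o_def)

lemma norm_one_minus_exp_lt: "x < 0 \<Longrightarrow> norm (1 - exp (of_real x) :: complex) = 1 - exp x"
  and norm_one_minus_exp_lt1: "x < 0 \<Longrightarrow> norm (1 - exp (of_real x) :: complex) < 1"
proof -
  have e: "(1 - exp (of_real x) :: complex) = of_real (1 - exp x)" by (simp add: exp_of_real)
  show 1: "norm (1 - exp (of_real x) :: complex) = 1 - exp x" if "x < 0"
    unfolding e norm_of_real using that by simp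
  show "norm (1 - exp (of_real x) :: complex) < 1" if "x < 0"
    unfolding 1[OF that] by simp
qed

lemma diff_bound_line:
  fixes F :: "real \<Rightarrow> complex"
  assumes "x \<le> y" "\<And>t. x \<le> t \<Longrightarrow> t \<le> y \<Longrightarrow> (F has_vector_derivative F' t) (at t)"
    and "\<And>t. x \<le> t \<Longrightarrow> t \<le> y \<Longrightarrow> (\<phi> has_real_derivative \<phi>' t) (at t)"
    and "\<And>t. x < t \<Longrightarrow> t < y \<Longrightarrow> norm (F' t) \<le> \<phi>' t"
  shows "norm (F y - F x) \<le> \<phi> y - \<phi> x"
proof (cases "x = y")
  case False
  show ?thesis
  proof (rule differentiable_bound_general[of x y F \<phi> F' \<phi>'])
    show "continuous_on {x..y} F"
    proof (rule continuous_at_imp_continuous_on, rule ballI)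
      fix t assume "t \<in> {x..y}"
      then show "isCont F t" by (intro has_vector_derivative_continuous[OF assms(2)]) auto
    qed
    show "continuous_on {x..y} \<phi>"
    proof (rule continuous_at_imp_continuous_on, rule ballI)
      fix t assume "t \<in> {x..y}"
      then show "isCont \<phi> t" by (intro DERIV_isCont[OF assms(3)]) auto
    qed
    show "x < y" using False assms(1) by simp
    fix t assume t: "x < t" "t < y"
    show "(F has_vector_derivative F' t) (at t)" by (rule assms(2)) (use t in auto)
    show "(\<phi> has_vector_derivative \<phi>' t) (at t)"
      unfolding has_real_derivative_iff_has_vector_derivative[symmetric]
      by (rule assms(3)) (use t in auto)
    show "norm (F' t) \<le> \<phi>' t" by (rule assms(4)[OF t])
  qed
qed simp

text \<open>Both sides satisfy the same equation on the negative axis and agree at -1, where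
  \<open>Lam\<close> takes its constants of integration from \<open>Li\<close>.\<close>

lemma Lam_real:
  assumes "admissible v" "x < 0"
  shows "Lam v (of_real x) = Li v (1 - exp (of_real x))"
  using assms
proof (induction v arbitrary: x rule: admissible.induct)
  case admissible_Nil
  then show ?case by simp
next
  \<comment> \<open>One argument for both letters: \<open>\<kappa>\<close> is 1 / (1 - z) for
    \<open>E1\<close> and 1 / z for \<open>E0\<close>.\<close>
  have step: "Lam (a # v) (of_real x) = Li (a # v) (1 - exp (of_real x))"
    if IH: "\<And>x. x < 0 \<Longrightarrow> Lam v (of_real x) = Li v (1 - exp (of_real x))" and x: "x < 0"
      and LiD: "\<And>z. norm z < 1 \<Longrightarrow> z \<noteq> 0 \<Longrightarrow> (Li (a # v) has_field_derivative Li v z * \<kappa> z) (at z)"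
      and \<kappa>: "\<And>l. l \<in> left_half \<Longrightarrow> \<kappa> (1 - exp l) * exp l = log_form a l"
    for a v x and \<kappa> :: "complex \<Rightarrow> complex"
  proof -
    define F where "F x = Lam (a # v) (of_real x + 0) - Li (a # v) (1 - exp (of_real x + 0))" for x :: real
    have D: "(F has_vector_derivative 0) (at y)" if y: "y < 0" for y
    proof -
      have yH: "of_real y + 0 \<in> left_half" using y by (simp add: left_half_def)
      have nz: "1 - exp (of_real y + 0) \<noteq> (0::complex)" by (rule one_minus_exp_nz[OF yH])
      have n1: "norm (1 - exp (of_real y + 0) :: complex) < 1" using norm_one_minus_exp_lt1[OF y] by simp
      have "((\<lambda>l. 1 - exp l) has_field_derivative - exp (of_real y + 0)) (at (of_real y + 0 :: complex))"
        by (auto intro!: derivative_eq_intros)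
      from DERIV_chain2[OF LiD[OF n1 nz] this]
      have 2: "((\<lambda>l. Li (a # v) (1 - exp l)) has_field_derivative
          Li v (1 - exp (of_real y + 0)) * \<kappa> (1 - exp (of_real y + 0)) * - exp (of_real y + 0)) (at (of_real y + 0))" .
      have "((\<lambda>x. Lam (a # v) (of_real x + 0)) has_vector_derivative
          - (Lam v (of_real y + 0) * log_form a (of_real y + 0))) (at y)"
        by (rule hvd_on_line[OF Lam_deriv[OF yH]])
      from has_vector_derivative_diff[OF this hvd_on_line[OF 2]]
      have "(F has_vector_derivative - (Lam v (of_real y + 0) * log_form a (of_real y + 0)) -
          Li v (1 - exp (of_real y + 0)) * \<kappa> (1 - exp (of_real y + 0)) * - exp (of_real y + 0)) (at y)"
        unfolding F_def .
      moreover have "- (Lam v (of_real y + 0) * log_form a (of_real y + 0)) -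
          Li v (1 - exp (of_real y + 0)) * \<kappa> (1 - exp (of_real y + 0)) * - exp (of_real y + 0) = 0"
        using IH[OF y] unfolding \<kappa>[OF yH, symmetric] by (simp add: mult_ac)
      ultimately show ?thesis by simp
    qed
    have c: "F y = F y'" if "y \<le> y'" "y' < 0" for y y'
      using diff_bound_line[of y y' F "\<lambda>_. 0" "\<lambda>_. 0" "\<lambda>_. 0"] D that by simp
    have "F x = F (-1)"
    proof (cases "x \<le> -1")
      case True
      show ?thesis by (rule c) (use True in auto)
    next
      case False
      have "F (-1) = F x" by (rule c) (use False x in auto)
      then show ?thesis by (rule sym)
    qed
    also have "\<dots> = 0" by (simp add: F_def)
    finally have "F x = 0" .
    then show ?thesis by (simp add: F_def del: Lam.simps)
  qed
  {
    case (admissible_E1 v)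
    show ?case
    proof (rule step[of v x E1 "\<lambda>z. 1 / (1 - z)"])
      show "\<And>x. x < 0 \<Longrightarrow> Lam v (of_real x) = Li v (1 - exp (of_real x))" by (rule admissible_E1.IH)
      show "x < 0" by (rule admissible_E1.prems)
      show "\<And>z. norm z < 1 \<Longrightarrow> z \<noteq> 0 \<Longrightarrow> (Li (E1 # v) has_field_derivative Li v z * (1 / (1 - z))) (at z)"
        using Li_E1_deriv by simp
    qed simp
  next
    case (admissible_E0 v)
    show ?case
    proof (rule step[of v x E0 "\<lambda>z. 1 / z"])
      show "\<And>x. x < 0 \<Longrightarrow> Lam v (of_real x) = Li v (1 - exp (of_real x))" by (rule admissible_E0.IH)
      show "x < 0" by (rule admissible_E0.prems)
      show "\<And>z. norm z < 1 \<Longrightarrow> z \<noteq> 0 \<Longrightarrow> (Li (E0 # v) has_field_derivative Li v z * (1 / z)) (at z)"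
        using Li_E0_deriv admissible_E0.hyps by simp
    qed simp
  }
qed

text \<open>For negative \<open>x\<close> both lines are mapped to the interval from 0 to 1;
  \<open>c\<close> selects the sheet before or after the turn around 1.\<close>

lemma exp_line:
  assumes "c = 0 \<or> c = - (2 * of_real pi * \<i>)"
  shows "exp (of_real x + c) = (of_real (exp x) :: complex)"
  using assms by (auto simp: exp_add exp_of_real exp_minus)

lemma line_left_half: "c = 0 \<or> c = - (2 * of_real pi * \<i>) \<Longrightarrow> x < 0 \<Longrightarrow> of_real x + c \<in> left_half"
  by (auto simp: left_half_def)

lemma norm_log_form_line:
  assumes "c = 0 \<or> c = - (2 * of_real pi * \<i>)" "-1 \<le> x" "x < 0"
  shows "norm (log_form a (of_real x + c)) \<le> 1 / (- x)"
proof (cases a)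
  case E1
  then show ?thesis using assms by (simp add: field_simps)
next
  case E0
  have e: "(1 - of_real (exp x) :: complex) = of_real (1 - exp x)" by simp
  have "1 + - x \<le> exp (- x)" by (rule exp_ge_add_one_self)
  then have "(1 - x) * exp x \<le> exp (- x) * exp x" by (intro mult_right_mono) auto
  then have "(1 - x) * exp x \<le> 1" by (simp add: exp_minus)
  then have "exp x / (1 - exp x) \<le> 1 / (- x)" using assms by (simp add: field_simps)
  moreover have "norm (log_form a (of_real x + c)) = exp x / (1 - exp x)"
    unfolding E0 log_form_simps exp_line[OF assms(1)] e norm_divide norm_of_real using assms by simp
  ultimately show ?thesis by simp
qed

text \<open>A crude substitute for powers of the logarithm. The exponent reproduces itself, because
  integrating C (-x)^(-1/2) against 1 / (-x) gives 2 C (-x)^(-1/2), and it is integrable at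
  0.\<close>

lemma Lam_line_bound:
  assumes "c = 0 \<or> c = - (2 * of_real pi * \<i>)"
  shows "\<exists>C>0. \<forall>x\<in>{-1..<0}. norm (Lam v (of_real x + c)) \<le> C / sqrt (- x)"
proof (induction v)
  case Nil
  show ?case by (intro exI[of _ 1]) (auto simp: field_simps)
next
  case (Cons a v)
  then obtain C where C: "C > 0" "\<And>x. x \<in> {-1..<0} \<Longrightarrow> norm (Lam v (of_real x + c)) \<le> C / sqrt (- x)"
    by blast
  define \<phi> where "\<phi> x = 2 * C / sqrt (- x)" for x
  define K where "K = norm (Lam (a # v) (of_real (-1) + c))"
  have \<phi>D: "(\<phi> has_real_derivative C / sqrt (- x) * (1 / (- x))) (at x)" if "x < 0" for x
  proof -
    have "sqrt (- x) * sqrt (- x) = - x" using that by simp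
    then show ?thesis
      unfolding \<phi>_def using that
      by (auto intro!: derivative_eq_intros simp: field_simps)
  qed
  have "norm (Lam (a # v) (of_real x + c)) \<le> (K + 2 * C) / sqrt (- x)" if x: "x \<in> {-1..<0}" for x
  proof -
    have "norm (Lam (a # v) (of_real x + c) - Lam (a # v) (of_real (-1) + c)) \<le> \<phi> x - \<phi> (-1)"
    proof (rule diff_bound_line)
      show "-1 \<le> x" using x by simp
      fix t assume t: "-1 \<le> t" "t \<le> x"
      then have t0: "t < 0" using x by simp
      show "((\<lambda>x. Lam (a # v) (of_real x + c)) has_vector_derivative
          - (Lam v (of_real t + c) * log_form a (of_real t + c))) (at t)"
        by (rule hvd_on_line[OF Lam_deriv[OF line_left_half[OF assms t0]]])
      show "(\<phi> has_real_derivative C / sqrt (- t) * (1 / (- t))) (at t)" by (rule \<phi>D[OF t0])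
    next
      fix t assume t: "-1 < t" "t < x"
      then have t0: "t < 0" using x by simp
      show "norm (- (Lam v (of_real t + c) * log_form a (of_real t + c))) \<le> C / sqrt (- t) * (1 / (- t))"
        unfolding norm_minus_cancel norm_mult
        using C t t0 norm_log_form_line[OF assms, of t a]
        by (intro mult_mono C(2)) (auto intro: order.trans[OF norm_ge_zero C(2)])
    qed
    then have "norm (Lam (a # v) (of_real x + c)) \<le> K + \<phi> x"
      using norm_triangle_sub[of "Lam (a # v) (of_real x + c)" "Lam (a # v) (of_real (-1) + c)"] C(1)
      unfolding K_def \<phi>_def by (simp del: Lam.simps)
    also have "K \<le> K / sqrt (- x)"
    proof -
      have "sqrt (- x) \<le> 1" "0 < sqrt (- x)" using x by auto
      moreover have "0 \<le> K" by (simp add: K_def del: Lam.simps)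
      ultimately show ?thesis using mult_right_le_one_le[of K "sqrt (- x)"] by (simp add: pos_le_divide_eq)
    qed
    finally show ?thesis by (simp add: \<phi>_def add_divide_distrib)
  qed
  moreover have "K + 2 * C > 0" using C(1) by (simp add: K_def add_nonneg_pos del: Lam.simps)
  ultimately show ?case by blast
qed

section \<open>Asymptotics of harmonic sums\<close>

abbreviation ones :: "nat \<Rightarrow> letter list" where "ones j \<equiv> replicate j E1"

text \<open>\<open>expand v f\<close> is the asymptotic expansion of the word \<open>v\<close> in terms of the words \<open>ones j\<close>, with
  \<open>f j\<close> substituted for \<open>ones j\<close>.\<close>

fun expand :: "letter list \<Rightarrow> (nat \<Rightarrow> complex) \<Rightarrow> complex" where
  "expand [] f = f 0"
| "expand (E1 # v) f = suminf (\<lambda>n. Li_coeff (E1 # v) n - expand v (\<lambda>j. Li_coeff (ones (Suc j)) n)) * f 0 + expand v (\<lambda>j. f (Suc j))"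
| "expand (E0 # v) f = suminf (Li_coeff (E0 # v)) * f 0"

text \<open>Linearity in \<open>f\<close> is the point of \<open>expand\<close>: harmonic sums,
  polylogarithms and loop integrals of the words \<open>ones j\<close> can be substituted into the
  same expansion.\<close>

lemma expand_exists: "\<exists>q. \<forall>f. expand v f = (\<Sum>j\<le>length v. q j * f j)"
proof (induction v)
  case Nil
  show ?case by (rule exI[of _ "\<lambda>j. 1"]) simp
next
  case (Cons a v)
  then obtain q where q: "\<And>f. expand v f = (\<Sum>j\<le>length v. q j * f j)" by blast
  show ?case
  proof (cases a)
    case E0
    define c where "c = suminf (Li_coeff (E0 # v))"
    have e: "expand (E0 # v) f = c * f 0" for f by (simp add: c_def)
    show ?thesis
      by (rule exI[of _ "\<lambda>j. case j of 0 \<Rightarrow> c | Suc i \<Rightarrow> 0"])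
         (simp only: E0 e list.size sum.atMost_Suc_shift nat.case add_0_right add_Suc_right, simp)
  next
    case E1
    define c where "c = suminf (\<lambda>n. Li_coeff (E1 # v) n - expand v (\<lambda>j. Li_coeff (ones (Suc j)) n))"
    have e: "expand (E1 # v) f = c * f 0 + expand v (\<lambda>j. f (Suc j))" for f
      by (simp add: c_def)
    show ?thesis
      by (rule exI[of _ "\<lambda>j. case j of 0 \<Rightarrow> c | Suc i \<Rightarrow> q i"])
         (simp only: E1 e q list.size sum.atMost_Suc_shift nat.case add_0_right add_Suc_right, simp)
  qed
qed

definition expand_coeff :: "letter list \<Rightarrow> nat \<Rightarrow> complex" where
  "expand_coeff v = (SOME q. \<forall>f. expand v f = (\<Sum>j\<le>length v. q j * f j))"

lemma expand_sum: "expand v f = (\<Sum>j\<le>length v. expand_coeff v j * f j)"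
  using someI_ex[OF expand_exists] unfolding expand_coeff_def by blast

lemma expand_diff: "expand v (\<lambda>j. f j - g j) = expand v f - expand v g"
  by (simp add: expand_sum algebra_simps sum_subtractf)

lemma expand_cmult: "expand v (\<lambda>j. c * f j) = c * expand v f"
  by (simp add: expand_sum sum_distrib_left mult_ac)

lemma expand_sum_in: "expand v (\<lambda>j. \<Sum>n\<in>A. f n j) = (\<Sum>n\<in>A. expand v (f n))"
  by (simp add: expand_sum sum_distrib_left sum.swap[of _ A])

section \<open>Rates of convergence for nested sums\<close>

lemma sqrt_telescope:
  assumes "1 \<le> m"
  shows "1 / (m * sqrt m) \<le> 6 * (1 / sqrt m - 1 / sqrt (m + 1))"
proof -
  define s where "s = sqrt m"
  define r where "r = sqrt (m + 1)"
  have s: "s \<ge> 1" "s * s = m" using assms by (auto simp: s_def)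
  have r: "r > 0" "r * r = m + 1" using assms by (auto simp: r_def)
  have "r \<le> 2 * s"
  proof (rule power2_le_imp_le)
    show "r\<^sup>2 \<le> (2 * s)\<^sup>2" using s r assms by (simp add: power2_eq_square)
  qed (use s in simp)
  \<comment> \<open>The bound 6 s^2 for r (r + s) is the source of the constant 6.\<close>
  then have "r * (r + s) \<le> (2 * s) * (3 * s)" using s r by (intro mult_mono) auto
  then have le: "s * (r * (r + s)) \<le> s * ((2 * s) * (3 * s))" using s by (intro mult_left_mono) auto
  have "1 / (m * s) = 6 * (1 / (s * ((2 * s) * (3 * s))))" using s(1) by (simp add: s(2)[symmetric] field_simps)
  also have "\<dots> \<le> 6 * (1 / (s * (r * (r + s))))"
    using le s r by (intro mult_left_mono divide_left_mono) auto
  also have "1 / (s * (r * (r + s))) = 1 / s - 1 / r"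
  proof -
    have "(r - s) * (r + s) = 1" using s r by (simp add: algebra_simps)
    then have "r - s = 1 / (r + s)" using s r by (simp add: field_simps)
    then have "1 / s - 1 / r = (1 / (r + s)) / (s * r)" using s r by (simp add: diff_frac_eq)
    then show ?thesis by (simp add: mult_ac)
  qed
  finally show ?thesis by (simp add: s_def r_def)
qed

text \<open>A telescoping majorant yields summability and the bound for the tail at once.\<close>

lemma tail_rate:
  fixes a :: "nat \<Rightarrow> complex"
  assumes C: "C \<ge> 0" "\<And>n. n \<ge> 1 \<Longrightarrow> norm (a n) \<le> C / (real n * sqrt (real n))"
  shows "summable (\<lambda>n. norm (a n))"
    and "norm ((\<Sum>n\<le>N. a n) - suminf a) \<le> 6 * C / sqrt (real N + 1)"
proof -
  define b where "b n = 6 * C / sqrt (real n + 1)" for n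
  have b0: "b \<longlonglongrightarrow> 0" unfolding b_def by real_asymp
  have ab: "norm (a (Suc n)) \<le> b n - b (Suc n)" for n
  proof -
    have "norm (a (Suc n)) \<le> C * (1 / ((real n + 1) * sqrt (real n + 1)))"
      using C(2)[of "Suc n"] by (simp add: add.commute)
    also have "\<dots> \<le> C * (6 * (1 / sqrt (real n + 1) - 1 / sqrt (real n + 1 + 1)))"
      using C(1) by (intro mult_left_mono sqrt_telescope) auto
    finally show ?thesis by (simp add: b_def algebra_simps)
  qed
  have tel: "(\<lambda>n. b (n + N) - b (Suc (n + N))) sums b N" for N
    using telescope_sums'[OF LIMSEQ_ignore_initial_segment[OF b0, of N]] by simp
  have "summable (\<lambda>n. norm (a (Suc n)))"
    by (rule summable_comparison_test'[OF sums_summable[OF tel[of 0]], of 0]) (use ab in simp)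
  then show sm: "summable (\<lambda>n. norm (a n))" by (rule iffD1[OF summable_Suc_iff[of "\<lambda>n. norm (a n)"]])
  have "suminf a = (suminf (\<lambda>n. a (n + Suc N))) + sum a {..<Suc N}"
    by (rule suminf_split_initial_segment[OF summable_norm_cancel[OF sm]])
  then have "norm ((\<Sum>n\<le>N. a n) - suminf a) = norm (suminf (\<lambda>n. a (n + Suc N)))"
    by (simp add: lessThan_Suc_atMost norm_minus_commute[of "sum a _"])
  also have "\<dots> \<le> suminf (\<lambda>n. b (n + N) - b (Suc (n + N)))"
    by (rule norm_suminf_le[OF _ sums_summable[OF tel]]) (use ab in simp)
  also have "\<dots> = b N" by (rule sums_unique[OF tel, symmetric])
  finally show "norm ((\<Sum>n\<le>N. a n) - suminf a) \<le> 6 * C / sqrt (real N + 1)" by (simp add: b_def)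
qed

definition log_bound :: "nat \<Rightarrow> real" where "log_bound N = 1 + (\<Sum>n<N. 1 / real (Suc n))"

lemma log_bound_ge_1: "1 \<le> log_bound N"
  unfolding log_bound_def by (simp add: sum_nonneg)

lemma log_bound_mono: "M \<le> N \<Longrightarrow> log_bound M \<le> log_bound N"
  unfolding log_bound_def by (intro add_left_mono sum_mono2) auto

lemma Li_coeff_Suc_E1: "Li_coeff (E1 # v) (Suc n) = psum v n / of_nat (Suc n)"
  by (simp add: psum_def lessThan_Suc_atMost del: of_nat_Suc)

text \<open>Each \<open>E1\<close> costs at most one factor 1 + 1 + 1/2 + ... + 1/N, and the
  division that comes with \<open>E0\<close> only helps.\<close>

lemma sum_norm_Li_coeff_le: "(\<Sum>m\<le>N. norm (Li_coeff v m)) \<le> log_bound N ^ length v"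
proof (induction v arbitrary: N)
  case Nil
  have "(\<Sum>m\<le>N. norm (Li_coeff [] m)) = (\<Sum>m\<in>{0}. norm (Li_coeff [] m))"
    by (rule sum.mono_neutral_right) auto
  then show ?case by simp
next
  case (Cons a v)
  show ?case
  proof (cases a)
    case E0
    have "norm (Li_coeff (E0 # v) m) \<le> norm (Li_coeff v m)" for m
    proof (cases "m = 0")
      case False
      then have "1 \<le> real m" by simp
      then have "norm (Li_coeff v m) * 1 \<le> norm (Li_coeff v m) * real m" by (intro mult_left_mono) auto
      then show ?thesis using False by (simp add: norm_divide divide_le_eq)
    qed simp
    then have "(\<Sum>m\<le>N. norm (Li_coeff (E0 # v) m)) \<le> (\<Sum>m\<le>N. norm (Li_coeff v m))" by (intro sum_mono)
    also have "\<dots> \<le> log_bound N ^ length v" by (rule Cons)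
    also have "\<dots> \<le> log_bound N ^ Suc (length v)" by (rule power_increasing) (use log_bound_ge_1 in auto)
    finally show ?thesis by (simp add: E0)
  next
    case E1
    have le: "norm (Li_coeff (E1 # v) (Suc k)) \<le> log_bound N ^ length v * (1 / real (Suc k))" if "k < N" for k
    proof -
      have "norm (psum v k) \<le> (\<Sum>m\<le>k. norm (Li_coeff v m))" unfolding psum_def by (rule norm_sum)
      also have "\<dots> \<le> log_bound k ^ length v" by (rule Cons)
      also have "\<dots> \<le> log_bound N ^ length v"
        by (rule power_mono) (use log_bound_mono[of k N] log_bound_ge_1[of k] that in auto)
      finally have "norm (psum v k) / real (Suc k) \<le> log_bound N ^ length v / real (Suc k)"
        by (intro divide_right_mono) auto
      then show ?thesis unfolding Li_coeff_Suc_E1 norm_divide norm_of_nat by simp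
    qed
    have "(\<Sum>m\<le>N. norm (Li_coeff (E1 # v) m)) = norm (Li_coeff (E1 # v) 0) + (\<Sum>k<N. norm (Li_coeff (E1 # v) (Suc k)))"
      by (simp only: sum.atMost_shift)
    also have "\<dots> = (\<Sum>k<N. norm (Li_coeff (E1 # v) (Suc k)))" by (simp add: Li_coeff_0)
    also have "\<dots> \<le> (\<Sum>k<N. log_bound N ^ length v * (1 / real (Suc k)))"
      by (intro sum_mono le) auto
    also have "\<dots> = log_bound N ^ length v * (\<Sum>k<N. 1 / real (Suc k))" by (simp only: sum_distrib_left)
    also have "\<dots> \<le> log_bound N ^ length v * log_bound N"
      using log_bound_ge_1[of N] by (intro mult_left_mono) (auto simp: log_bound_def)
    finally show ?thesis by (simp add: E1 mult.commute)
  qed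
qed

lemma norm_psum_le: "norm (psum v N) \<le> log_bound N ^ length v"
  unfolding psum_def using norm_sum sum_norm_Li_coeff_le by (rule order.trans)

lemma log_bound_le_ln: "log_bound N \<le> 2 + ln (real N + 1)"
proof -
  have "log_bound (Suc N) \<le> 2 + ln (real (Suc N))" for N
  proof (induction N)
    case 0
    then show ?case by (simp add: log_bound_def)
  next
    case (Suc N)
    define x where "x = real (Suc N)"
    have x: "x > 0" by (simp add: x_def)
    have "ln (x / (x + 1)) \<le> x / (x + 1) - 1" using x by (intro ln_le_minus_one) auto
    also have "\<dots> = - (1 / (x + 1))" using x by (simp add: field_simps)
    finally have "1 / (x + 1) \<le> ln (x + 1) - ln x" using x by (simp add: ln_div)
    moreover have "log_bound (Suc (Suc N)) = log_bound (Suc N) + 1 / (x + 1)"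
      by (simp add: log_bound_def x_def)
    ultimately have "log_bound (Suc (Suc N)) \<le> 2 + ln (x + 1)" using Suc unfolding x_def[symmetric] by simp
    then show ?case by (simp add: x_def add.commute)
  qed
  note * = this
  show ?thesis
  proof (cases N)
    case 0
    then show ?thesis by (simp add: log_bound_def)
  next
    case (Suc M)
    have "ln (real (Suc M)) \<le> ln (real N + 1)" using Suc by simp
    from order.trans[OF *[of M] add_left_mono[OF this, of 2]] show ?thesis unfolding Suc by simp
  qed
qed

lemma log_bound_power_le:
  assumes "\<eta> > 0"
  shows "\<exists>C>0. \<forall>N. log_bound N ^ d \<le> C * (real N + 1) powr \<eta>"
proof -
  \<comment> \<open>Chosen so that \<open>d\<close> factors of exponent \<open>\<epsilon>\<close>
    stay below \<open>\<eta>\<close>; the added 1 covers \<open>d = 0\<close>.\<close>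
  define \<epsilon> where "\<epsilon> = \<eta> / (real d + 1)"
  have \<epsilon>: "\<epsilon> > 0" using assms by (simp add: \<epsilon>_def)
  define K where "K = 2 + 1 / \<epsilon>"
  have K: "K > 0" using \<epsilon> by (simp add: K_def add_pos_pos)
  have "log_bound N ^ d \<le> K ^ d * (real N + 1) powr \<eta>" for N
  proof -
    let ?x = "real N + 1"
    have x1: "1 \<le> ?x powr \<epsilon>" using \<epsilon> by (intro ge_one_powr_ge_zero) auto
    have "ln ?x \<le> ?x powr \<epsilon> / \<epsilon>" by (rule ln_powr_bound) (use \<epsilon> in auto)
    then have "log_bound N \<le> K * ?x powr \<epsilon>"
      using log_bound_le_ln[of N] x1 by (simp add: K_def algebra_simps)
    then have "log_bound N ^ d \<le> (K * ?x powr \<epsilon>) ^ d" by (rule power_mono) (use log_bound_ge_1[of N] in simp)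
    also have "\<dots> = K ^ d * ?x powr (\<epsilon> * real d)"
      by (simp add: power_mult_distrib powr_powr[symmetric] powr_realpow)
    also have "\<dots> \<le> K ^ d * ?x powr \<eta>"
    proof (intro mult_left_mono powr_mono)
      show "\<epsilon> * real d \<le> \<eta>" using assms by (simp add: \<epsilon>_def field_simps)
    qed (use K in auto)
    finally show ?thesis .
  qed
  then show ?thesis using K by (intro exI[of _ "K ^ d"]) auto
qed

lemma Li_coeff_rate:
  assumes "admissible v" "v \<noteq> []"
  shows "\<exists>C\<ge>0. \<forall>n\<ge>1. norm (Li_coeff v n) \<le> C / sqrt (real n)"
  using assms
proof (induction rule: admissible.induct)
  case (admissible_E1 v)
  obtain C where C: "C > 0" "\<And>N. log_bound N ^ length v \<le> C * (real N + 1) powr (1/2)"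
    using log_bound_power_le[of "1/2" "length v"] by auto
  have "norm (Li_coeff (E1 # v) n) \<le> C / sqrt (real n)" if n: "n \<ge> 1" for n
  proof -
    obtain k where k: "n = Suc k" using n by (cases n) auto
    have "norm (psum v k) \<le> C * sqrt (real n)"
      using order.trans[OF norm_psum_le[of v k] C(2)[of k]] by (simp add: k powr_half_sqrt add.commute)
    then have "norm (Li_coeff (E1 # v) n) \<le> C * sqrt (real n) / real n"
      unfolding k Li_coeff_Suc_E1 norm_divide norm_of_nat by (intro divide_right_mono) auto
    also have "\<dots> = C / sqrt (real n)"
      using n real_sqrt_mult_self[of "real n"] by (simp add: field_simps)
    finally show ?thesis .
  qed
  then show ?case using C(1) by (intro exI[of _ C]) auto
next
  case (admissible_E0 v)
  then obtain C where C: "C \<ge> 0" "\<And>n. n \<ge> 1 \<Longrightarrow> norm (Li_coeff v n) \<le> C / sqrt (real n)" by blast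
  have "norm (Li_coeff (E0 # v) n) \<le> C / sqrt (real n)" if n: "n \<ge> 1" for n
  proof -
    have "norm (Li_coeff v n) / real n \<le> norm (Li_coeff v n) / 1" using n by (intro divide_left_mono) auto
    then show ?thesis using C(2)[OF n] by (simp add: norm_divide)
  qed
  then show ?case using C(1) by (intro exI[of _ C]) auto
qed simp

text \<open>The absolutely summable part of the coefficients, see \<open>summable_rest\<close>.\<close>

fun rest :: "letter list \<Rightarrow> nat \<Rightarrow> complex" where
  "rest [] n = 0"
| "rest (E1 # v) n = Li_coeff (E1 # v) n - expand v (\<lambda>j. Li_coeff (ones (Suc j)) n)"
| "rest (E0 # v) n = Li_coeff (E0 # v) n"

lemma expand_rest: "expand (E1 # v) f = suminf (rest (E1 # v)) * f 0 + expand v (\<lambda>j. f (Suc j))"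
  "expand (E0 # v) f = suminf (rest (E0 # v)) * f 0"
  by (simp_all add: rest.simps[abs_def] del: Li_coeff.simps)

lemma psum_Nil [simp]: "psum [] N = 1"
  by (simp add: psum_def sum.atMost_shift)

text \<open>The two rates feed each other: the rate for \<open>psum v\<close>, divided by
  \<open>n\<close>, is the rate for \<open>rest (E1 # v)\<close>, and summing the latter gives the
  rate for \<open>psum (E1 # v)\<close>. For \<open>E0\<close> the division by \<open>n\<close>
  alone suffices.\<close>

lemma psum_rate_rest:
  assumes "admissible v"
  shows "(\<exists>C\<ge>0. \<forall>N. norm (psum v N - expand v (\<lambda>j. psum (ones j) N)) \<le> C / sqrt (real N + 1)) \<and>
    (\<exists>C\<ge>0. \<forall>n\<ge>1. norm (rest v n) \<le> C / (real n * sqrt (real n)))"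
  using assms
proof (induction rule: admissible.induct)
  case admissible_Nil
  then show ?case by (auto intro!: exI[of _ 0])
next
  case (admissible_E1 v)
  then obtain C where C: "C \<ge> 0" "\<And>N. norm (psum v N - expand v (\<lambda>j. psum (ones j) N)) \<le> C / sqrt (real N + 1)"
    by blast
  have r: "norm (rest (E1 # v) n) \<le> C / (real n * sqrt (real n))" if n: "n \<ge> 1" for n
  proof -
    obtain k where k: "n = Suc k" using n by (cases n) auto
    have "rest (E1 # v) n = (psum v k - expand v (\<lambda>j. psum (ones j) k)) / of_nat n"
      unfolding rest.simps k replicate_Suc Li_coeff_Suc_E1
      using expand_cmult[of v "1 / of_nat (Suc k)" "\<lambda>j. psum (ones j) k"] by (simp add: diff_divide_distrib)
    then have "norm (rest (E1 # v) n) = norm (psum v k - expand v (\<lambda>j. psum (ones j) k)) / real n"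
      by (simp only: norm_divide norm_of_nat)
    also have "\<dots> \<le> (C / sqrt (real k + 1)) / real n"
      by (intro divide_right_mono C(2)) auto
    also have "\<dots> = C / (real n * sqrt (real n))" by (simp add: k field_simps)
    finally show ?thesis .
  qed
  have "norm (psum (E1 # v) N - expand (E1 # v) (\<lambda>j. psum (ones j) N)) \<le> 6 * C / sqrt (real N + 1)" for N
  proof -
    have "(\<Sum>n\<le>N. rest (E1 # v) n) = psum (E1 # v) N - expand v (\<lambda>j. psum (ones (Suc j)) N)"
      by (simp only: rest.simps sum_subtractf psum_def expand_sum_in[symmetric])
    then have eq: "psum (E1 # v) N - expand (E1 # v) (\<lambda>j. psum (ones j) N) = (\<Sum>n\<le>N. rest (E1 # v) n) - suminf (rest (E1 # v))"
      unfolding expand_rest by (simp del: rest.simps Li_coeff.simps)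
    show ?thesis unfolding eq by (rule tail_rate(2)[OF C(1) r])
  qed
  moreover have "0 \<le> 6 * C" using C by simp
  ultimately show ?case using r C(1) by blast
next
  case (admissible_E0 v)
  obtain C where C: "C \<ge> 0" "\<And>n. n \<ge> 1 \<Longrightarrow> norm (Li_coeff v n) \<le> C / sqrt (real n)"
    using Li_coeff_rate[OF admissible_E0.hyps] by blast
  have r: "norm (rest (E0 # v) n) \<le> C / (real n * sqrt (real n))" if n: "n \<ge> 1" for n
    using divide_right_mono[OF C(2)[OF n], of "real n"] by (simp add: norm_divide mult.commute)
  have "norm (psum (E0 # v) N - expand (E0 # v) (\<lambda>j. psum (ones j) N)) \<le> 6 * C / sqrt (real N + 1)" for N
  proof -
    have "(\<Sum>n\<le>N. rest (E0 # v) n) = psum (E0 # v) N" by (simp only: rest.simps psum_def)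
    then have eq: "psum (E0 # v) N - expand (E0 # v) (\<lambda>j. psum (ones j) N) = (\<Sum>n\<le>N. rest (E0 # v) n) - suminf (rest (E0 # v))"
      unfolding expand_rest by (simp del: rest.simps Li_coeff.simps)
    show ?thesis unfolding eq by (rule tail_rate(2)[OF C(1) r])
  qed
  moreover have "0 \<le> 6 * C" using C by simp
  ultimately show ?case using r C(1) by blast
qed

lemma psum_rate:
  "admissible v \<Longrightarrow> \<exists>C\<ge>0. \<forall>N. norm (psum v N - expand v (\<lambda>j. psum (ones j) N)) \<le> C / sqrt (real N + 1)"
  using psum_rate_rest by blast

lemma summable_rest:
  assumes "admissible v"
  shows "summable (\<lambda>n. norm (rest v n))"
proof -
  obtain C where "C \<ge> 0" "\<And>n. n \<ge> 1 \<Longrightarrow> norm (rest v n) \<le> C / (real n * sqrt (real n))"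
    using psum_rate_rest[OF assms] by blast
  then show ?thesis by (rule tail_rate(1))
qed

text \<open>The constant in the expansion is the value at 1 of the power series with coefficients
  \<open>rest v\<close>. The right-hand side therefore tends to 0 as z approaches 1.\<close>

lemma rest_power_series:
  assumes "norm z < 1" "v \<noteq> []"
  shows "Li v z - expand v (\<lambda>j. Li (ones j) z) = suminf (\<lambda>n. rest v n * z ^ n) - suminf (rest v)"
proof -
  obtain a w where v: "v = a # w" using assms(2) by (cases v) auto
  have s: "(\<lambda>n. Li_coeff u n * z ^ n) sums Li u z" for u
    unfolding Li_def by (rule summable_sums[OF summable_Li_coeff[OF assms(1)]])
  show ?thesis
  proof (cases a)
    case E0
    have "Li (E0 # w) z = suminf (\<lambda>n. rest (E0 # w) n * z ^ n)" by (simp only: Li_def rest.simps)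
    then show ?thesis unfolding v E0 expand_rest by simp
  next
    case E1
    have "(\<lambda>n. expand w (\<lambda>j. Li_coeff (ones (Suc j)) n * z ^ n)) sums expand w (\<lambda>j. Li (ones (Suc j)) z)"
      unfolding expand_sum by (intro sums_sum sums_mult s)
    from sums_diff[OF s[of "E1 # w"] this]
    have "(\<lambda>n. rest (E1 # w) n * z ^ n) sums (Li (E1 # w) z - expand w (\<lambda>j. Li (ones (Suc j)) z))"
      using expand_cmult[of w "z ^ _"] by (simp add: algebra_simps del: Li_coeff.simps)
    from sums_unique[OF this] show ?thesis unfolding v E1 expand_rest by simp
  qed
qed

text \<open>Abel's limit theorem for an absolutely summable series, as an instance of Tannery's
  theorem.\<close>

lemma Li_abel:
  assumes "admissible v"
  shows "((\<lambda>x. Li v (of_real x) - expand v (\<lambda>j. Li (ones j) (of_real x))) \<longlongrightarrow> 0) (at_left 1)"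
proof (cases "v = []")
  case True
  then show ?thesis by simp
next
  case False
  have linear_ext: "eventually (\<lambda>x::real. 0 < x \<and> x < 1) (at_left 1)"
    using eventually_at_left_real[of 0 1] by simp
  have "((\<lambda>x. suminf (\<lambda>n. rest v n * of_real x ^ n)) \<longlongrightarrow> suminf (rest v)) (at_left (1::real))"
  proof -
    have "((\<lambda>x. rest v k * of_real x ^ k) \<longlongrightarrow> rest v k * of_real 1 ^ k) (at_left (1::real))" for k
      by (intro tendsto_intros)
    then have lim: "((\<lambda>x. rest v k * of_real x ^ k) \<longlongrightarrow> rest v k) (at_left (1::real))" for k by simp
    have "eventually (\<lambda>(k, x). norm (rest v k * of_real x ^ k) \<le> norm (rest v k)) (at_top \<times>\<^sub>F at_left (1::real))"
      unfolding eventually_prod_filter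
    proof (intro exI conjI allI impI)
      show "eventually (\<lambda>_. True) (at_top :: nat filter)" by simp
      show "eventually (\<lambda>x::real. 0 < x \<and> x < 1) (at_left 1)" by (rule linear_ext)
      fix k :: nat and x :: real assume "0 < x \<and> x < 1"
      then have "x ^ k \<le> 1" "0 \<le> x ^ k" by (auto intro: power_le_one)
      then have "norm (rest v k) * x ^ k \<le> norm (rest v k)" by (intro mult_right_le_one_le) auto
      then show "case (k, x) of (k, x) \<Rightarrow> norm (rest v k * of_real x ^ k) \<le> norm (rest v k)"
        using \<open>0 < x \<and> x < 1\<close> by (simp add: norm_mult norm_power)
    qed
    from tannerys_theorem[OF lim this summable_rest[OF assms] trivial_limit_at_left_real]
    show ?thesis by blast
  qed
  from tendsto_diff[OF this tendsto_const[of "suminf (rest v)"]]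
  have "((\<lambda>x. suminf (\<lambda>n. rest v n * of_real x ^ n) - suminf (rest v)) \<longlongrightarrow> 0) (at_left (1::real))"
    by simp
  moreover have "eventually (\<lambda>x::real. suminf (\<lambda>n. rest v n * of_real x ^ n) - suminf (rest v) =
      Li v (of_real x) - expand v (\<lambda>j. Li (ones j) (of_real x))) (at_left 1)"
    using linear_ext by eventually_elim (simp add: rest_power_series False)
  ultimately show ?thesis by (rule Lim_transform_eventually)
qed

section \<open>Asymptotics of polylogarithms\<close>

text \<open>The polylogarithm of the word \<open>ones j\<close> in closed form, (- log (1 - z))^j /
  j!; see \<open>Lam_ones\<close>.\<close>

definition exp_term :: "nat \<Rightarrow> complex \<Rightarrow> complex" where "exp_term j l = (- l) ^ j / fact j"

lemma exp_term_0 [simp]: "exp_term 0 l = 1"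
  by (simp add: exp_term_def)

lemma exp_term_deriv: "(exp_term (Suc j) has_field_derivative - exp_term j l) (at l)"
proof -
  have "((\<lambda>l. (- l) ^ Suc j / fact (Suc j)) has_field_derivative
      (of_nat (Suc j) * (- 1 * (- l) ^ (Suc j - Suc 0))) / fact (Suc j)) (at l)"
    by (intro DERIV_cdivide DERIV_power DERIV_minus DERIV_ident)
  moreover have "(of_nat (Suc j) * (- 1 * (- l) ^ (Suc j - Suc 0))) / fact (Suc j) = - exp_term j l"
    by (simp add: exp_term_def fact_Suc del: of_nat_Suc)
  ultimately show ?thesis by (simp only: exp_term_def[abs_def])
qed

lemma admissible_ones: "admissible (ones j)"
  by (induction j) (auto intro: admissible.intros)

lemma Lam_tendsto_0:
  assumes "admissible v" "v \<noteq> []"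
  shows "((\<lambda>x. Lam v (of_real x)) \<longlongrightarrow> 0) (at_left 0)"
proof (rule Lim_null_comparison)
  show "((\<lambda>x::real. 2 * (1 - exp x)) \<longlongrightarrow> 0) (at_left 0)"
    by (auto intro!: tendsto_eq_intros)
  have "eventually (\<lambda>x::real. - 1/2 < x \<and> x < 0) (at_left 0)"
    using eventually_at_left_real[of "-1/2" 0] by simp
  then show "eventually (\<lambda>x. norm (Lam v (of_real x)) \<le> 2 * (1 - exp x)) (at_left 0)"
  proof eventually_elim
    case (elim x)
    have "1/2 \<le> exp x" using exp_ge_add_one_self[of x] elim by argo
    then have "norm (1 - exp (of_real x) :: complex) \<le> 1/2"
      using elim norm_one_minus_exp_lt[of x] by simp
    from norm_Li_le[OF assms(2) this] show ?case
      using elim norm_one_minus_exp_lt[of x] Lam_real[OF assms(1), of x] by simp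
  qed
qed

lemma of_real_in_left_half: "x < 0 \<Longrightarrow> of_real x \<in> left_half"
  by (simp add: left_half_def)

lemma Lam_ones: "l \<in> left_half \<Longrightarrow> Lam (ones j) l = exp_term j l"
proof (induction j arbitrary: l)
  case 0
  then show ?case by simp
next
  case (Suc j)
  define D where "D l = Lam (E1 # ones j) l - exp_term (Suc j) l" for l
  have D': "(D has_field_derivative 0) (at l)" if "l \<in> left_half" for l
  proof -
    have "(D has_field_derivative - (Lam (ones j) l * log_form E1 l) - (- exp_term j l)) (at l)"
      unfolding D_def by (intro DERIV_diff Lam_deriv[OF that] exp_term_deriv)
    then show ?thesis using Suc.IH[OF that] by simp
  qed
  have const: "D l = D l'" if "l \<in> left_half" "l' \<in> left_half" for l l'
    by (rule has_field_derivative_zero_const[OF convex_left_half open_left_half D' that])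
  have "((\<lambda>x. exp_term (Suc j) (of_real x)) \<longlongrightarrow> exp_term (Suc j) (of_real 0)) (at_left (0::real))"
    unfolding exp_term_def by (intro tendsto_intros) (rule fact_nonzero)
  then have "((\<lambda>x. D (of_real x)) \<longlongrightarrow> 0 - 0) (at_left (0::real))"
    unfolding D_def using Lam_tendsto_0[of "E1 # ones j"] admissible_ones[of "Suc j"]
    by (intro tendsto_diff) (simp_all add: exp_term_def del: Lam.simps)
  moreover have "eventually (\<lambda>x. D (of_real x) = D l) (at_left (0::real))"
    using eventually_at_left_real[of "-1" 0]
    by (simp, elim eventually_mono) (rule const, auto intro: of_real_in_left_half Suc.prems)
  then have "((\<lambda>x. D (of_real x)) \<longlongrightarrow> D l) (at_left (0::real))"
    by (rule tendsto_eventually)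
  ultimately have "D l = 0 - 0" by (intro tendsto_unique[OF trivial_limit_at_left_real])
  then show ?case by (simp add: D_def del: Lam.simps)
qed

text \<open>Contains both lines Im l = 0 and Im l = - 2 pi as well as the vertical segments between
  them, while Re l \<le> -1 keeps 1 - exp l away from 0.\<close>

definition strip :: "complex set" where "strip = {l. Re l \<le> -1 \<and> \<bar>Im l\<bar> \<le> 2 * pi}"

lemma strip_left_half: "l \<in> strip \<Longrightarrow> l \<in> left_half"
  by (auto simp: strip_def left_half_def)

lemma vertical_bound:
  assumes W: "\<And>l. l \<in> strip \<Longrightarrow> (W has_field_derivative W' l) (at l)"
    and B: "\<And>l'. l' \<in> strip \<Longrightarrow> Re l' = Re l \<Longrightarrow> norm (W' l') \<le> B"
    and l: "l \<in> strip"
  shows "norm (W l - W (of_real (Re l))) \<le> B * (2 * pi)"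
proof -
  have r: "of_real (Re l) \<in> strip" using l by (simp add: strip_def)
  have seg: "l' \<in> strip \<and> Re l' = Re l" if "l' \<in> closed_segment l (of_real (Re l))" for l'
  proof -
    obtain u where u: "0 \<le> u" "u \<le> 1" "l' = (1 - u) *\<^sub>R l + u *\<^sub>R of_real (Re l)"
      using \<open>l' \<in> closed_segment l (of_real (Re l))\<close> by (auto simp: closed_segment_def)
    have re: "Re l' = Re l" by (simp add: u(3) algebra_simps)
    have "\<bar>Im l'\<bar> = (1 - u) * \<bar>Im l\<bar>" using u by (simp add: abs_mult)
    also have "\<dots> \<le> 1 * \<bar>Im l\<bar>" using u by (intro mult_right_mono) auto
    finally show ?thesis using re l by (simp add: strip_def)
  qed
  have "norm (W l - W (of_real (Re l))) \<le> B * norm (l - of_real (Re l))"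
  proof (rule field_differentiable_bound[of "closed_segment l (of_real (Re l))" W W' B])
    fix z assume z: "z \<in> closed_segment l (of_real (Re l))"
    show "(W has_field_derivative W' z) (at z within closed_segment l (of_real (Re l)))"
      by (rule has_field_derivative_at_within[OF W]) (use seg[OF z] in blast)
    show "norm (W' z) \<le> B" using B seg[OF z] by blast
  qed auto
  also have "norm (l - of_real (Re l)) = \<bar>Im l\<bar>" by (simp add: cmod_def)
  also have "B * \<bar>Im l\<bar> \<le> B * (2 * pi)"
    using l order.trans[OF norm_ge_zero B[OF l refl]] by (intro mult_left_mono) (auto simp: strip_def)
  finally show ?thesis .
qed

text \<open>\<open>W'\<close> is integrated along the real axis from - infinity, where
  \<open>W\<close> vanishes, and then vertically over a distance of at most 2 pi. The two parts give
  the summands 2 C and 2 pi C.\<close>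

lemma strip_limit:
  assumes W: "\<And>l. l \<in> strip \<Longrightarrow> (W has_field_derivative W' l) (at l)"
    and B: "\<And>l. l \<in> strip \<Longrightarrow> norm (W' l) \<le> C * exp (Re l / 2)"
    and lim: "((\<lambda>x. W (of_real x)) \<longlongrightarrow> 0) at_bot"
  shows "\<And>l. l \<in> strip \<Longrightarrow> norm (W l) \<le> (C * (2 * pi) + 2 * C) * exp (Re l / 2)"
proof -
  have real: "norm (W (of_real y)) \<le> 2 * C * exp (y / 2)" if y: "y \<le> -1" for y
  proof -
    have le: "norm (W (of_real y) - W (of_real x)) \<le> 2 * C * exp (y / 2)" if x: "x \<le> y" for x
    proof -
      have s: "of_real t + 0 \<in> strip" if "t \<le> y" for t using that y by (simp add: strip_def)
      have "norm (W (of_real y + 0) - W (of_real x + 0)) \<le> 2 * C * exp (y / 2) - 2 * C * exp (x / 2)"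
      proof (rule diff_bound_line[OF x])
        fix t assume t: "x \<le> t" "t \<le> y"
        show "((\<lambda>x. W (of_real x + 0)) has_vector_derivative W' (of_real t + 0)) (at t)"
          by (rule hvd_on_line[OF W[OF s[OF t(2)]]])
        show "((\<lambda>x. 2 * C * exp (x / 2)) has_real_derivative C * exp (t / 2)) (at t)"
          by (auto intro!: derivative_eq_intros)
      next
        fix t assume t: "x < t" "t < y"
        then show "norm (W' (of_real t + 0)) \<le> C * exp (t / 2)"
          using B[OF s[of t]] by simp
      qed
      moreover have "0 \<le> C"
      proof -
        have "0 \<le> C * exp (y / 2)" using order.trans[OF norm_ge_zero B[OF s[of y]]] by simp
        then show ?thesis by (simp add: zero_le_mult_iff)
      qed
      then have "0 \<le> 2 * C * exp (x / 2)" by simp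
      ultimately have "norm (W (of_real y + 0) - W (of_real x + 0)) \<le> 2 * C * exp (y / 2)" by argo
      then show ?thesis by simp
    qed
    have "((\<lambda>x. norm (W (of_real y) - W (of_real x))) \<longlongrightarrow> norm (W (of_real y) - 0)) at_bot"
      by (intro tendsto_intros lim)
    moreover have "eventually (\<lambda>x. norm (W (of_real y) - W (of_real x)) \<le> 2 * C * exp (y / 2)) at_bot"
      using eventually_le_at_bot[of y] by eventually_elim (rule le)
    ultimately have "norm (W (of_real y) - 0) \<le> 2 * C * exp (y / 2)"
      by (rule tendsto_upperbound) simp
    then show ?thesis by simp
  qed
  fix l assume l: "l \<in> strip"
  have "norm (W l - W (of_real (Re l))) \<le> C * exp (Re l / 2) * (2 * pi)"
  proof (rule vertical_bound[OF W _ l])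
    fix l' assume "l' \<in> strip" "Re l' = Re l"
    then show "norm (W' l') \<le> C * exp (Re l / 2)" using B[of l'] by simp
  qed
  moreover have "norm (W (of_real (Re l))) \<le> 2 * C * exp (Re l / 2)"
    by (rule real) (use l in \<open>simp add: strip_def\<close>)
  moreover have "norm (W l) \<le> norm (W l - W (of_real (Re l))) + norm (W (of_real (Re l)))"
    using norm_triangle_ineq[of "W l - W (of_real (Re l))" "W (of_real (Re l))"] by simp
  ultimately have "norm (W l) \<le> C * exp (Re l / 2) * (2 * pi) + 2 * C * exp (Re l / 2)" by argo
  then show "norm (W l) \<le> (C * (2 * pi) + 2 * C) * exp (Re l / 2)" by (simp add: algebra_simps)
qed

lemma power_div_fact_le_exp:
  fixes x :: real
  assumes "0 \<le> x"
  shows "x ^ j / fact j \<le> exp x"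
proof -
  have "(\<Sum>n\<in>{j}. x ^ n /\<^sub>R fact n) \<le> suminf (\<lambda>n. x ^ n /\<^sub>R fact n)"
    by (rule sum_le_suminf[OF sums_summable[OF exp_converges]]) (use assms in auto)
  also have "\<dots> = exp x" by (rule sums_unique[OF exp_converges, symmetric])
  finally show ?thesis by (simp add: divide_inverse mult.commute)
qed

lemma exp_term_strip_bound:
  assumes "l \<in> strip"
  shows "norm (exp_term j l) \<le> 2 ^ j * exp pi * exp (- Re l / 2)"
proof -
  have "norm l \<le> \<bar>Re l\<bar> + \<bar>Im l\<bar>" by (rule cmod_le)
  then have le: "norm l / 2 \<le> - Re l / 2 + pi" using assms by (simp add: strip_def)
  \<comment> \<open>Splitting off the power of 2 applies the exponential bound to half the modulus;
    the resulting growth exp (- Re l / 2) is beaten by the factor exp l of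
    \<open>log_form E0\<close>.\<close>
  have "norm (exp_term j l) = 2 ^ j * ((norm l / 2) ^ j / fact j)"
    by (simp add: exp_term_def norm_divide norm_power power_divide)
  also have "\<dots> \<le> 2 ^ j * exp (norm l / 2)"
    by (intro mult_left_mono power_div_fact_le_exp) auto
  also have "\<dots> \<le> 2 ^ j * exp (- Re l / 2 + pi)"
    using le by (intro mult_left_mono) auto
  also have "exp (- Re l / 2 + pi) = exp (- Re l / 2) * exp pi" by (rule exp_add)
  finally show ?thesis by (simp only: mult_ac)
qed

lemma log_form_E0_strip:
  assumes "l \<in> strip"
  shows "norm (log_form E0 l) \<le> 2 * exp (Re l)"
proof -
  have "exp (Re l) \<le> exp (-1)" using assms by (simp add: strip_def)
  also have "exp (-1) \<le> (1/2 :: real)"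
    using exp_ge_add_one_self[of 1] by (simp add: exp_minus field_simps)
  finally have e: "exp (Re l) \<le> 1/2" .
  have "norm (1 :: complex) - norm (exp l) \<le> norm (1 - exp l)" by (rule norm_triangle_ineq2)
  then have n: "1/2 \<le> norm (1 - exp l)" using e by simp
  have "exp (Re l) / norm (1 - exp l) \<le> exp (Re l) / (1/2)"
    using n by (intro divide_left_mono) auto
  then show ?thesis by (simp add: norm_divide)
qed

lemma expand_exp_term_deriv:
  "((\<lambda>l. expand v (\<lambda>j. exp_term (Suc j) l)) has_field_derivative - expand v (\<lambda>j. exp_term j l)) (at l)"
proof -
  have "((\<lambda>l. \<Sum>j\<le>length v. expand_coeff v j * exp_term (Suc j) l) has_field_derivative
      (\<Sum>j\<le>length v. expand_coeff v j * - exp_term j l)) (at l)"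
    by (intro DERIV_sum DERIV_cmult exp_term_deriv)
  then show ?thesis by (simp add: expand_sum sum_negf)
qed

lemma exp_at_bot_left_1: "filterlim (\<lambda>x::real. 1 - exp x) (at_left 1) at_bot"
proof -
  have "((\<lambda>x::real. 1 - exp x) \<longlongrightarrow> 1) at_bot" by real_asymp
  then show ?thesis
    by (auto simp: filterlim_at intro: always_eventually)
qed

text \<open>Abel's theorem at z = 1 - exp x, which tends to 1 from below.\<close>

lemma Lam_asymp_real:
  assumes "admissible v"
  shows "((\<lambda>x. Lam v (of_real x) - expand v (\<lambda>j. exp_term j (of_real x))) \<longlongrightarrow> 0) at_bot"
proof -
  from filterlim_compose[OF Li_abel[OF assms] exp_at_bot_left_1]
  have "((\<lambda>x. Li v (of_real (1 - exp x)) - expand v (\<lambda>j. Li (ones j) (of_real (1 - exp x)))) \<longlongrightarrow> 0) at_bot" .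
  moreover have "eventually (\<lambda>x::real. Li v (of_real (1 - exp x)) - expand v (\<lambda>j. Li (ones j) (of_real (1 - exp x))) =
      Lam v (of_real x) - expand v (\<lambda>j. exp_term j (of_real x))) at_bot"
    using eventually_le_at_bot[of "-1"]
  proof eventually_elim
    case (elim x)
    then have x: "x < 0" by simp
    have e: "of_real (1 - exp x) = (1 - exp (of_real x) :: complex)" by (simp add: exp_of_real)
    have "Li (ones j) (1 - exp (of_real x)) = exp_term j (of_real x)" for j
      using Lam_real[OF admissible_ones x, of j] Lam_ones[OF of_real_in_left_half[OF x], of j] by simp
    then show ?case unfolding e using Lam_real[OF assms x] by simp
  qed
  ultimately show ?thesis by (rule Lim_transform_eventually)
qed

text \<open>Differentiation removes the first letter of the difference. For \<open>E1\<close> this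
  leaves the difference for \<open>v\<close>; for \<open>E0\<close> it leaves \<open>Lam v\<close>
  times a form that decays like exp (Re l). The limit along the real axis fixes the constant of
  integration as 0.\<close>

lemma Lam_asymp:
  assumes "admissible v"
  shows "\<exists>C\<ge>0. \<forall>l\<in>strip. norm (Lam v l - expand v (\<lambda>j. exp_term j l)) \<le> C * exp (Re l / 2)"
  using assms
proof (induction rule: admissible.induct)
  case admissible_Nil
  then show ?case by (intro exI[of _ 0]) simp
next
  case (admissible_E1 v)
  then obtain C where C: "C \<ge> 0" "\<And>l. l \<in> strip \<Longrightarrow> norm (Lam v l - expand v (\<lambda>j. exp_term j l)) \<le> C * exp (Re l / 2)"
    by blast
  define W where "W l = Lam (E1 # v) l - expand (E1 # v) (\<lambda>j. exp_term j l)" for l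
  have W': "(W has_field_derivative - (Lam v l - expand v (\<lambda>j. exp_term j l))) (at l)" if l: "l \<in> strip" for l
  proof -
    have "(W has_field_derivative - (Lam v l * log_form E1 l) - (0 + - expand v (\<lambda>j. exp_term j l))) (at l)"
      unfolding W_def expand_rest exp_term_0
      by (intro DERIV_diff DERIV_add DERIV_const Lam_deriv strip_left_half l expand_exp_term_deriv)
    then show ?thesis by simp
  qed
  have "norm (W l) \<le> (C * (2 * pi) + 2 * C) * exp (Re l / 2)" if "l \<in> strip" for l
  proof (rule strip_limit[OF W' _ _ that])
    show "\<And>l. l \<in> strip \<Longrightarrow> norm (- (Lam v l - expand v (\<lambda>j. exp_term j l))) \<le> C * exp (Re l / 2)"
      unfolding norm_minus_cancel by (rule C(2))
    show "((\<lambda>x. W (of_real x)) \<longlongrightarrow> 0) at_bot"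
      unfolding W_def by (rule Lam_asymp_real) (rule admissible.admissible_E1[OF admissible_E1.hyps])
  qed
  moreover have "0 \<le> C * (2 * pi) + 2 * C" using C(1) by simp
  ultimately show ?case unfolding W_def by blast
next
  case (admissible_E0 v)
  then obtain C where C: "C \<ge> 0" "\<And>l. l \<in> strip \<Longrightarrow> norm (Lam v l - expand v (\<lambda>j. exp_term j l)) \<le> C * exp (Re l / 2)"
    by blast
  define K where "K = C + (\<Sum>j\<le>length v. norm (expand_coeff v j) * (2 ^ j * exp pi))"
  have Lb: "norm (Lam v l) \<le> K * exp (- Re l / 2)" if l: "l \<in> strip" for l
  proof -
    have "norm (expand v (\<lambda>j. exp_term j l)) \<le> (\<Sum>j\<le>length v. norm (expand_coeff v j * exp_term j l))"
      unfolding expand_sum by (rule norm_sum)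
    also have "\<dots> \<le> (\<Sum>j\<le>length v. norm (expand_coeff v j) * (2 ^ j * exp pi * exp (- Re l / 2)))"
      unfolding norm_mult by (intro sum_mono mult_left_mono exp_term_strip_bound l) auto
    also have "\<dots> = (\<Sum>j\<le>length v. norm (expand_coeff v j) * (2 ^ j * exp pi)) * exp (- Re l / 2)"
      by (simp only: sum_distrib_right mult.assoc)
    finally have 1: "norm (expand v (\<lambda>j. exp_term j l)) \<le> (\<Sum>j\<le>length v. norm (expand_coeff v j) * (2 ^ j * exp pi)) * exp (- Re l / 2)" .
    have "exp (Re l / 2) \<le> exp (- Re l / 2)" using l by (simp add: strip_def)
    then have "C * exp (Re l / 2) \<le> C * exp (- Re l / 2)" using C(1) by (rule mult_left_mono)
    then have 2: "norm (Lam v l - expand v (\<lambda>j. exp_term j l)) \<le> C * exp (- Re l / 2)" using C(2)[OF l] by (rule order.trans[rotated])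
    have "norm (Lam v l) \<le> norm (Lam v l - expand v (\<lambda>j. exp_term j l)) + norm (expand v (\<lambda>j. exp_term j l))"
      using norm_triangle_ineq[of "Lam v l - expand v (\<lambda>j. exp_term j l)" "expand v (\<lambda>j. exp_term j l)"] by simp
    also have "\<dots> \<le> K * exp (- Re l / 2)" using add_mono[OF 2 1] by (simp add: K_def distrib_right)
    finally show ?thesis .
  qed
  define W where "W l = Lam (E0 # v) l - expand (E0 # v) (\<lambda>j. exp_term j l)" for l
  have W': "(W has_field_derivative - (Lam v l * log_form E0 l)) (at l)" if l: "l \<in> strip" for l
  proof -
    have "(W has_field_derivative - (Lam v l * log_form E0 l) - 0) (at l)"
      unfolding W_def expand_rest exp_term_0
      by (intro DERIV_diff DERIV_const Lam_deriv strip_left_half l)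
    then show ?thesis by simp
  qed
  have K0: "0 \<le> K" unfolding K_def using C(1) by (intro add_nonneg_nonneg sum_nonneg) auto
  have "norm (W l) \<le> ((2 * K) * (2 * pi) + 2 * (2 * K)) * exp (Re l / 2)" if "l \<in> strip" for l
  proof (rule strip_limit[OF W' _ _ that])
    fix l assume l: "l \<in> strip"
    have "norm (Lam v l) * norm (log_form E0 l) \<le> (K * exp (- Re l / 2)) * (2 * exp (Re l))"
      using K0 by (intro mult_mono Lb log_form_E0_strip l) auto
    also have "\<dots> = 2 * K * (exp (- Re l / 2) * exp (Re l))" by simp
    also have "exp (- Re l / 2) * exp (Re l) = exp (Re l / 2)" by (simp add: exp_add[symmetric])
    finally show "norm (- (Lam v l * log_form E0 l)) \<le> 2 * K * exp (Re l / 2)"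
      unfolding norm_minus_cancel norm_mult .
  next
    show "((\<lambda>x. W (of_real x)) \<longlongrightarrow> 0) at_bot"
      unfolding W_def by (rule Lam_asymp_real) (rule admissible.admissible_E0[OF admissible_E0.hyps])
  qed
  moreover have "0 \<le> (2 * K) * (2 * pi) + 2 * (2 * K)" using K0 by simp
  ultimately show ?case unfolding W_def by blast
qed

section \<open>Loop integrals\<close>

abbreviation tau :: complex where "tau \<equiv> - (2 * of_real pi * \<i>)"

text \<open>\<open>has_loop_int f c\<close>: the integral of \<open>f\<close> in the half plane from \<open>0\<close> to \<open>tau\<close> is \<open>c\<close>. The map
  \<open>l \<mapsto> 1 - exp l\<close> sends such a path to a loop at \<open>0\<close> around \<open>1\<close>.\<close>

definition has_loop_int :: "(complex \<Rightarrow> complex) \<Rightarrow> complex \<Rightarrow> bool" where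
  "has_loop_int f c \<longleftrightarrow> (\<exists>Y. (\<forall>l\<in>left_half. (Y has_field_derivative f l) (at l)) \<and>
     ((\<lambda>x. Y (of_real x + tau) - Y (of_real x + 0)) \<longlongrightarrow> c) (at_left 0))"

lemma has_loop_intI:
  "(\<And>l. l \<in> left_half \<Longrightarrow> (Y has_field_derivative f l) (at l)) \<Longrightarrow>
   ((\<lambda>x. Y (of_real x + tau) - Y (of_real x + 0)) \<longlongrightarrow> c) (at_left 0) \<Longrightarrow> has_loop_int f c"
  unfolding has_loop_int_def by blast

lemma has_loop_intE:
  assumes "has_loop_int f c"
  obtains Y where "\<And>l. l \<in> left_half \<Longrightarrow> (Y has_field_derivative f l) (at l)"
    "((\<lambda>x. Y (of_real x + tau) - Y (of_real x + 0)) \<longlongrightarrow> c) (at_left 0)"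
proof -
  obtain Y where Y: "\<forall>l\<in>left_half. (Y has_field_derivative f l) (at l)"
    "((\<lambda>x. Y (of_real x + tau) - Y (of_real x + 0)) \<longlongrightarrow> c) (at_left 0)"
    using assms unfolding has_loop_int_def by (elim exE conjE)
  show ?thesis by (rule that[of Y]) (use Y in auto)
qed

lemma tau_line: "0 = (0::complex) \<or> 0 = tau" "tau = 0 \<or> tau = tau"
  by simp_all

lemma eventually_neg: "b < 0 \<Longrightarrow> eventually (\<lambda>x::real. b < x \<and> x < 0) (at_left 0)"
  using eventually_at_left_real[of b 0] by simp

lemma has_loop_int_unique:
  assumes "has_loop_int f c" "has_loop_int f d"
  shows "c = d"
proof -
  obtain Y where Y: "\<And>l. l \<in> left_half \<Longrightarrow> (Y has_field_derivative f l) (at l)"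
    "((\<lambda>x. Y (of_real x + tau) - Y (of_real x + 0)) \<longlongrightarrow> c) (at_left 0)"
    using assms(1) by (rule has_loop_intE) (rule that)
  obtain Z where Z: "\<And>l. l \<in> left_half \<Longrightarrow> (Z has_field_derivative f l) (at l)"
    "((\<lambda>x. Z (of_real x + tau) - Z (of_real x + 0)) \<longlongrightarrow> d) (at_left 0)"
    using assms(2) by (rule has_loop_intE) (rule that)
  have D: "((\<lambda>l. Y l - Z l) has_field_derivative 0) (at l)" if "l \<in> left_half" for l
    using DERIV_diff[OF Y(1)[OF that] Z(1)[OF that]] by simp
  have "eventually (\<lambda>x::real. Z (of_real x + tau) - Z (of_real x + 0) = Y (of_real x + tau) - Y (of_real x + 0)) (at_left 0)"
    using eventually_neg[of "-1", simplified]
  proof eventually_elim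
    case (elim x)
    have "Y (of_real x + tau) - Z (of_real x + tau) = Y (of_real x + 0) - Z (of_real x + 0)"
      by (rule has_field_derivative_zero_const[OF convex_left_half open_left_half D line_left_half[OF tau_line(2)] line_left_half[OF tau_line(1)]])
         (use elim in auto)
    then show ?case by (simp add: algebra_simps)
  qed
  from Lim_transform_eventually[OF Z(2) this] Y(2) show ?thesis
    using tendsto_unique[OF trivial_limit_at_left_real] by blast
qed

lemma has_loop_int_cong:
  assumes "has_loop_int f c" "\<And>l. l \<in> left_half \<Longrightarrow> g l = f l"
  shows "has_loop_int g c"
proof -
  obtain Y where Y: "\<And>l. l \<in> left_half \<Longrightarrow> (Y has_field_derivative f l) (at l)"
    "((\<lambda>x. Y (of_real x + tau) - Y (of_real x + 0)) \<longlongrightarrow> c) (at_left 0)"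
    using assms(1) by (rule has_loop_intE) (rule that)
  show ?thesis by (rule has_loop_intI[OF _ Y(2)]) (simp add: assms(2) Y(1))
qed

lemma has_loop_int_add:
  assumes "has_loop_int f c" "has_loop_int g d"
  shows "has_loop_int (\<lambda>l. f l + g l) (c + d)"
proof -
  obtain Y where Y: "\<And>l. l \<in> left_half \<Longrightarrow> (Y has_field_derivative f l) (at l)"
    "((\<lambda>x. Y (of_real x + tau) - Y (of_real x + 0)) \<longlongrightarrow> c) (at_left 0)"
    using assms(1) by (rule has_loop_intE) (rule that)
  obtain Z where Z: "\<And>l. l \<in> left_half \<Longrightarrow> (Z has_field_derivative g l) (at l)"
    "((\<lambda>x. Z (of_real x + tau) - Z (of_real x + 0)) \<longlongrightarrow> d) (at_left 0)"
    using assms(2) by (rule has_loop_intE) (rule that)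
  show ?thesis
  proof (rule has_loop_intI[where Y = "\<lambda>l. Y l + Z l"])
    show "\<And>l. l \<in> left_half \<Longrightarrow> ((\<lambda>l. Y l + Z l) has_field_derivative f l + g l) (at l)"
      by (rule DERIV_add[OF Y(1) Z(1)])
    show "((\<lambda>x. Y (of_real x + tau) + Z (of_real x + tau) - (Y (of_real x + 0) + Z (of_real x + 0))) \<longlongrightarrow> c + d) (at_left 0)"
      using tendsto_add[OF Y(2) Z(2)] by (simp add: algebra_simps)
  qed
qed

lemma has_loop_int_cmult:
  assumes "has_loop_int f c"
  shows "has_loop_int (\<lambda>l. a * f l) (a * c)"
proof -
  obtain Y where Y: "\<And>l. l \<in> left_half \<Longrightarrow> (Y has_field_derivative f l) (at l)"
    "((\<lambda>x. Y (of_real x + tau) - Y (of_real x + 0)) \<longlongrightarrow> c) (at_left 0)"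
    using assms(1) by (rule has_loop_intE) (rule that)
  show ?thesis
  proof (rule has_loop_intI[where Y = "\<lambda>l. a * Y l"])
    show "\<And>l. l \<in> left_half \<Longrightarrow> ((\<lambda>l. a * Y l) has_field_derivative a * f l) (at l)"
      by (rule DERIV_cmult[OF Y(1)])
    show "((\<lambda>x. a * Y (of_real x + tau) - a * Y (of_real x + 0)) \<longlongrightarrow> a * c) (at_left 0)"
      using tendsto_mult[OF tendsto_const Y(2), of a] by (simp add: right_diff_distrib)
  qed
qed

lemma has_loop_int_zero: "has_loop_int (\<lambda>l. 0) 0"
  by (rule has_loop_intI[where Y = "\<lambda>l. 0"]) auto

lemma has_loop_int_sum:
  assumes "\<And>j. j \<in> A \<Longrightarrow> has_loop_int (f j) (c j)"
  shows "has_loop_int (\<lambda>l. \<Sum>j\<in>A. f j l) (\<Sum>j\<in>A. c j)"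
  using assms
  by (induction A rule: infinite_finite_induct) (auto intro: has_loop_int_zero has_loop_int_add)

lemma sqrt_deriv:
  assumes "x < 0"
  shows "((\<lambda>x. - 2 * C * sqrt (- x)) has_real_derivative C / sqrt (- x)) (at x)"
  using assms by (auto intro!: derivative_eq_intros simp: field_simps)

text \<open>The bound is integrable at 0, so a primitive satisfies the Cauchy criterion at both ends
  of the path.\<close>

lemma has_loop_int_exists:
  assumes hol: "f holomorphic_on left_half" and C: "C > 0"
    and b: "\<And>c x. c = 0 \<or> c = tau \<Longrightarrow> x \<in> {-1..<0} \<Longrightarrow> norm (f (of_real x + c)) \<le> C / sqrt (- x)"
  shows "\<exists>c. has_loop_int f c"
proof -
  obtain Y where "\<And>l. l \<in> left_half \<Longrightarrow> (Y has_field_derivative f l) (at l within left_half)"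
    by (rule holomorphic_convex_primitive'[OF convex_left_half open_left_half hol]) (rule that)
  then have Y: "(Y has_field_derivative f l) (at l)" if "l \<in> left_half" for l
    using that at_within_open[OF that open_left_half] by metis
  have ex: "\<exists>d. ((\<lambda>x. Y (of_real x + c)) \<longlongrightarrow> d) (at_left 0)" if c: "c = 0 \<or> c = tau" for c
  proof -
    have le: "dist (Y (of_real y + c)) (Y (of_real x + c)) \<le> 2 * C * sqrt (- x)"
      if xy: "-1 < x" "x \<le> y" "y < 0" for x y
    proof -
      have "norm (Y (of_real y + c) - Y (of_real x + c)) \<le> - 2 * C * sqrt (- y) - (- 2 * C * sqrt (- x))"
      proof (rule diff_bound_line[OF xy(2)])
        fix t assume t: "x \<le> t" "t \<le> y"
        then have t0: "t < 0" using xy by simp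
        show "((\<lambda>x. Y (of_real x + c)) has_vector_derivative f (of_real t + c)) (at t)"
          by (rule hvd_on_line[OF Y[OF line_left_half[OF c t0]]])
        show "((\<lambda>x. - 2 * C * sqrt (- x)) has_real_derivative C / sqrt (- t)) (at t)"
          by (rule sqrt_deriv[OF t0])
      next
        fix t assume "x < t" "t < y"
        then show "norm (f (of_real t + c)) \<le> C / sqrt (- t)"
          using xy by (intro b[OF c]) auto
      qed
      moreover have "0 \<le> 2 * C * sqrt (- y)" using C xy by simp
      ultimately have "norm (Y (of_real y + c) - Y (of_real x + c)) \<le> 2 * C * sqrt (- x)" by argo
      then show ?thesis by (simp add: dist_norm)
    qed
    obtain d where "((\<lambda>x. Y (of_real x + c)) \<longlongrightarrow> d) (at_left 0)"
    proof (rule cauchy_lim[of "at_left (0::real)" "\<lambda>x. Y (of_real x + c)" "\<lambda>x. 2 * C * sqrt (- x)"])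
      show "eventually (\<lambda>x. eventually (\<lambda>y. dist (Y (of_real y + c)) (Y (of_real x + c)) \<le> 2 * C * sqrt (- x)) (at_left 0)) (at_left 0)"
        using eventually_neg[of "-1", simplified]
      proof eventually_elim
        case (elim x)
        then have "eventually (\<lambda>y. x < y \<and> y < 0) (at_left 0)" by (intro eventually_neg) auto
        then show ?case by eventually_elim (rule le, use elim in auto)
      qed
      show "((\<lambda>x. 2 * C * sqrt (- x)) \<longlongrightarrow> 0) (at_left (0::real))"
        by (auto intro!: tendsto_eq_intros)
    qed (auto intro: that)
    then show ?thesis by blast
  qed
  obtain d1 d2 where "((\<lambda>x. Y (of_real x + 0)) \<longlongrightarrow> d1) (at_left 0)" "((\<lambda>x. Y (of_real x + tau)) \<longlongrightarrow> d2) (at_left 0)"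
    using ex[OF tau_line(1)] ex[OF tau_line(2)] by blast
  from has_loop_intI[OF Y tendsto_diff[OF this(2,1)]] have "has_loop_int f (d2 - d1)" .
  then show ?thesis by blast
qed

lemma norm_z_line:
  assumes "c = 0 \<or> c = tau" "x < 0"
  shows "norm (1 - exp (of_real x + c)) = 1 - exp x" "norm (exp (of_real x + c)) = exp x"
    "1 - exp x \<le> - x" "0 < 1 - exp x" "1 - exp x < 1"
proof -
  show "norm (1 - exp (of_real x + c)) = 1 - exp x"
    unfolding exp_line[OF assms(1)] using norm_one_minus_exp_lt[OF assms(2)] by (simp add: exp_of_real)
  show "norm (exp (of_real x + c)) = exp x"
    unfolding exp_line[OF assms(1)] by simp
  show "1 - exp x \<le> - x" using exp_ge_add_one_self[of x] by argo
  show "0 < 1 - exp x" "1 - exp x < 1" using assms(2) by simp_all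
qed

lemma has_loop_int_Lam_exists: "\<exists>c. has_loop_int (\<lambda>l. Lam v l * exp l ^ i * (1 - exp l) ^ N) c"
proof -
  obtain C1 where C1: "C1 > 0" "\<And>x. x \<in> {-1..<0} \<Longrightarrow> norm (Lam v (of_real x + 0)) \<le> C1 / sqrt (- x)"
    using Lam_line_bound[OF tau_line(1), of v] by blast
  obtain C2 where C2: "C2 > 0" "\<And>x. x \<in> {-1..<0} \<Longrightarrow> norm (Lam v (of_real x + tau)) \<le> C2 / sqrt (- x)"
    using Lam_line_bound[OF tau_line(2), of v] by blast
  show ?thesis
  proof (rule has_loop_int_exists[where C = "C1 + C2"])
    show "(\<lambda>l. Lam v l * exp l ^ i * (1 - exp l) ^ N) holomorphic_on left_half"
      by (intro holomorphic_intros Lam_holomorphic)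
    show "C1 + C2 > 0" using C1 C2 by simp
    fix c x assume c: "c = 0 \<or> c = tau" and x: "x \<in> {-1..<(0::real)}"
    then have x0: "x < 0" by simp
    have le: "norm (Lam v (of_real x + c)) \<le> (C1 + C2) / sqrt (- x)"
    proof -
      have "norm (Lam v (of_real x + c)) \<le> C1 / sqrt (- x) \<or> norm (Lam v (of_real x + c)) \<le> C2 / sqrt (- x)"
        using c C1(2)[OF x] C2(2)[OF x] by blast
      moreover have "0 \<le> C1 / sqrt (- x)" "0 \<le> C2 / sqrt (- x)" using C1(1) C2(1) x0 by simp_all
      ultimately show ?thesis unfolding add_divide_distrib by argo
    qed
    have p: "exp x ^ i \<le> 1" "(1 - exp x) ^ N \<le> 1" "0 \<le> exp x ^ i" "0 \<le> (1 - exp x) ^ N"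
      using norm_z_line[OF c x0] x0 by (auto intro!: power_le_one)
    have "norm (Lam v (of_real x + c) * exp (of_real x + c) ^ i * (1 - exp (of_real x + c)) ^ N) =
        norm (Lam v (of_real x + c)) * (exp x ^ i * (1 - exp x) ^ N)"
      unfolding norm_mult norm_power norm_z_line[OF c x0] by simp
    also have "\<dots> \<le> norm (Lam v (of_real x + c)) * (1 * 1)"
      using p by (intro mult_left_mono mult_mono) auto
    finally show "norm (Lam v (of_real x + c) * exp (of_real x + c) ^ i * (1 - exp (of_real x + c)) ^ N) \<le> (C1 + C2) / sqrt (- x)"
      using le by simp
  qed
qed

section \<open>Integration by parts\<close>

definition loop_int :: "letter list \<Rightarrow> nat \<Rightarrow> complex" where
  "loop_int v N = (SOME c. has_loop_int (\<lambda>l. Lam v l * (1 - exp l) ^ N) c)"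

text \<open>The additional factor exp l makes the power of \<open>1 - exp l\<close> a derivative up
  to a constant.\<close>

definition loop_int_exp :: "letter list \<Rightarrow> nat \<Rightarrow> complex" where
  "loop_int_exp v N = (SOME c. has_loop_int (\<lambda>l. Lam v l * exp l * (1 - exp l) ^ N) c)"

lemma loop_int_has_loop_int: "has_loop_int (\<lambda>l. Lam v l * (1 - exp l) ^ N) (loop_int v N)"
proof -
  have "(\<lambda>l. Lam v l * (1 - exp l) ^ N) = (\<lambda>l. Lam v l * exp l ^ 0 * (1 - exp l) ^ N)"
    by (rule ext) (simp only: power_0 mult_1_right)
  then have "\<exists>c. has_loop_int (\<lambda>l. Lam v l * (1 - exp l) ^ N) c" by (simp only: has_loop_int_Lam_exists)
  then show ?thesis unfolding loop_int_def by (rule someI_ex)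
qed

lemma loop_int_exp_has_loop_int: "has_loop_int (\<lambda>l. Lam v l * exp l * (1 - exp l) ^ N) (loop_int_exp v N)"
proof -
  have "(\<lambda>l. Lam v l * exp l * (1 - exp l) ^ N) = (\<lambda>l. Lam v l * exp l ^ 1 * (1 - exp l) ^ N)"
    by (rule ext) (simp only: power_one_right)
  then have "\<exists>c. has_loop_int (\<lambda>l. Lam v l * exp l * (1 - exp l) ^ N) c" by (simp only: has_loop_int_Lam_exists)
  then show ?thesis unfolding loop_int_exp_def by (rule someI_ex)
qed

lemma loop_int_Suc: "loop_int v (Suc N) = loop_int v N - loop_int_exp v N"
proof (rule has_loop_int_unique[OF loop_int_has_loop_int])
  have "has_loop_int (\<lambda>l. Lam v l * (1 - exp l) ^ N + - 1 * (Lam v l * exp l * (1 - exp l) ^ N)) (loop_int v N + - 1 * loop_int_exp v N)"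
    by (intro has_loop_int_add has_loop_int_cmult loop_int_has_loop_int loop_int_exp_has_loop_int)
  then show "has_loop_int (\<lambda>l. Lam v l * (1 - exp l) ^ Suc N) (loop_int v N - loop_int_exp v N)"
    by (simp add: algebra_simps del: Lam.simps)
qed

text \<open>The integrand is the derivative of \<open>Lam v l * (1 - exp l) ^ Suc N\<close>. The
  boundary terms vanish, because one factor \<open>1 - exp l\<close> has modulus at most - x while
  \<open>Lam v\<close> is only O(1 / sqrt (- x)).\<close>

lemma has_loop_int_boundary:
  assumes "\<And>l. l \<in> left_half \<Longrightarrow> (Lam v has_field_derivative D l) (at l)"
  shows "has_loop_int (\<lambda>l. D l * (1 - exp l) ^ Suc N - of_nat (Suc N) * (Lam v l * exp l * (1 - exp l) ^ N)) 0"
proof (rule has_loop_intI[where Y = "\<lambda>l. Lam v l * (1 - exp l) ^ Suc N"])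
  fix l assume l: "l \<in> left_half"
  have "((\<lambda>l. (1 - exp l) ^ Suc N) has_field_derivative of_nat (Suc N) * ((0 - exp l) * (1 - exp l) ^ (Suc N - Suc 0))) (at l)"
    by (intro DERIV_power DERIV_diff DERIV_const DERIV_exp)
  from DERIV_mult[OF assms[OF l] this]
  show "((\<lambda>l. Lam v l * (1 - exp l) ^ Suc N) has_field_derivative
     D l * (1 - exp l) ^ Suc N - of_nat (Suc N) * (Lam v l * exp l * (1 - exp l) ^ N)) (at l)"
    by (simp add: algebra_simps del: Lam.simps of_nat_Suc power_Suc)
next
  have z: "((\<lambda>x. Lam v (of_real x + c) * (1 - exp (of_real x + c)) ^ Suc N) \<longlongrightarrow> 0) (at_left 0)"
    if c: "c = 0 \<or> c = tau" for c
  proof -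
    obtain C where C: "C > 0" "\<And>x. x \<in> {-1..<0} \<Longrightarrow> norm (Lam v (of_real x + c)) \<le> C / sqrt (- x)"
      using Lam_line_bound[OF c, of v] by blast
    show ?thesis
    proof (rule Lim_null_comparison)
      show "((\<lambda>x. C * sqrt (- x)) \<longlongrightarrow> 0) (at_left (0::real))" by (auto intro!: tendsto_eq_intros)
      show "eventually (\<lambda>x. norm (Lam v (of_real x + c) * (1 - exp (of_real x + c)) ^ Suc N) \<le> C * sqrt (- x)) (at_left 0)"
        using eventually_neg[of "-1", simplified]
      proof eventually_elim
        case (elim x)
        then have x0: "x < 0" by simp
        note zl = norm_z_line[OF c x0]
        have "(1 - exp x) ^ Suc N \<le> (1 - exp x) ^ 1" using zl by (intro power_decreasing) auto
        also have "\<dots> \<le> - x" using zl by simp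
        finally have "norm (Lam v (of_real x + c)) * (1 - exp x) ^ Suc N \<le> (C / sqrt (- x)) * (- x)"
          using elim zl C by (intro mult_mono) (auto intro!: divide_nonneg_nonneg)
        also have "\<dots> = C * sqrt (- x)"
          using x0 real_sqrt_mult_self[of "- x"] by (simp add: field_simps)
        finally show ?case unfolding norm_mult norm_power zl .
      qed
    qed
  qed
  show "((\<lambda>x. Lam v (of_real x + tau) * (1 - exp (of_real x + tau)) ^ Suc N -
      Lam v (of_real x + 0) * (1 - exp (of_real x + 0)) ^ Suc N) \<longlongrightarrow> 0) (at_left 0)"
    using tendsto_diff[OF z[OF tau_line(2)] z[OF tau_line(1)]] by simp
qed

lemma loop_int_exp_Nil: "loop_int_exp [] N = 0"
proof -
  have "has_loop_int (\<lambda>l. 0 * (1 - exp l) ^ Suc N - of_nat (Suc N) * (Lam [] l * exp l * (1 - exp l) ^ N)) 0"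
    by (rule has_loop_int_boundary) (simp add: Lam.simps(1)[abs_def])
  note 1 = has_loop_int_cmult[OF this, of "- 1 / of_nat (Suc N)"]
  have "has_loop_int (\<lambda>l. Lam [] l * exp l * (1 - exp l) ^ N) (- 1 / of_nat (Suc N) * 0)"
    by (rule has_loop_int_cong[OF 1]) (simp del: of_nat_Suc)
  from has_loop_int_unique[OF loop_int_exp_has_loop_int this] show ?thesis by simp
qed

lemma loop_int_exp_E1: "loop_int_exp (E1 # v) N = - loop_int v (Suc N) / of_nat (Suc N)"
proof -
  let ?s = "of_nat (Suc N) :: complex"
  have s: "?s \<noteq> 0" by (simp del: of_nat_Suc)
  have 1: "has_loop_int (\<lambda>l. - (Lam v l * log_form E1 l) * (1 - exp l) ^ Suc N - ?s * (Lam (E1 # v) l * exp l * (1 - exp l) ^ N)) 0"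
    by (rule has_loop_int_boundary[OF Lam_deriv])
  have "has_loop_int (\<lambda>l. (- (Lam v l * log_form E1 l) * (1 - exp l) ^ Suc N - ?s * (Lam (E1 # v) l * exp l * (1 - exp l) ^ N)) +
     ?s * (Lam (E1 # v) l * exp l * (1 - exp l) ^ N)) (0 + ?s * loop_int_exp (E1 # v) N)"
    by (intro has_loop_int_add has_loop_int_cmult 1 loop_int_exp_has_loop_int)
  then have "has_loop_int (\<lambda>l. - 1 * (Lam v l * (1 - exp l) ^ Suc N)) (?s * loop_int_exp (E1 # v) N)"
    by (simp del: of_nat_Suc Lam.simps power_Suc)
  from has_loop_int_unique[OF this has_loop_int_cmult[OF loop_int_has_loop_int]]
  show ?thesis using s by (simp add: field_simps del: of_nat_Suc)
qed

text \<open>The denominator of \<open>log_form E0\<close> takes up one factor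
  \<open>1 - exp l\<close>, so \<open>N\<close> stays the same. Repetition for successive letters
  \<open>E0\<close> builds up the power of - 1 / (N + 1).\<close>

lemma loop_int_exp_E0: "loop_int_exp (E0 # v) N = - loop_int_exp v N / of_nat (Suc N)"
proof -
  let ?s = "of_nat (Suc N) :: complex"
  have s: "?s \<noteq> 0" by (simp del: of_nat_Suc)
  have 1: "has_loop_int (\<lambda>l. - (Lam v l * log_form E0 l) * (1 - exp l) ^ Suc N - ?s * (Lam (E0 # v) l * exp l * (1 - exp l) ^ N)) 0"
    by (rule has_loop_int_boundary[OF Lam_deriv])
  have "has_loop_int (\<lambda>l. (- (Lam v l * log_form E0 l) * (1 - exp l) ^ Suc N - ?s * (Lam (E0 # v) l * exp l * (1 - exp l) ^ N)) +
     ?s * (Lam (E0 # v) l * exp l * (1 - exp l) ^ N)) (0 + ?s * loop_int_exp (E0 # v) N)"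
    by (intro has_loop_int_add has_loop_int_cmult 1 loop_int_exp_has_loop_int)
  then have 2: "has_loop_int (\<lambda>l. - (Lam v l * log_form E0 l) * (1 - exp l) ^ Suc N) (?s * loop_int_exp (E0 # v) N)"
    by (simp del: of_nat_Suc Lam.simps power_Suc log_form_simps)
  have "has_loop_int (\<lambda>l. - 1 * (Lam v l * exp l * (1 - exp l) ^ N)) (?s * loop_int_exp (E0 # v) N)"
  proof (rule has_loop_int_cong[OF 2])
    fix l assume "l \<in> left_half"
    then show "- 1 * (Lam v l * exp l * (1 - exp l) ^ N) = - (Lam v l * log_form E0 l) * (1 - exp l) ^ Suc N"
      using one_minus_exp_nz[of l] by (simp del: Lam.simps)
  qed
  from has_loop_int_unique[OF this has_loop_int_cmult[OF loop_int_exp_has_loop_int]]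
  show ?thesis using s by (simp add: field_simps del: of_nat_Suc)
qed

lemma tau_nz: "tau \<noteq> 0"
  by simp

lemma loop_int_ones_0: "loop_int (ones j) 0 = - ((- tau) ^ Suc j) / fact (Suc j)"
proof (rule has_loop_int_unique[OF loop_int_has_loop_int])
  have "has_loop_int (\<lambda>l. exp_term j l) (- ((- tau) ^ Suc j) / fact (Suc j))"
  proof (rule has_loop_intI[where Y = "\<lambda>l. - exp_term (Suc j) l"])
    show "\<And>l. ((\<lambda>l. - exp_term (Suc j) l) has_field_derivative exp_term j l) (at l)"
      using DERIV_minus[OF exp_term_deriv] by simp
    have "((\<lambda>x. - exp_term (Suc j) (of_real x + tau) - - exp_term (Suc j) (of_real x + 0)) \<longlongrightarrow>
       - exp_term (Suc j) (of_real 0 + tau) - - exp_term (Suc j) (of_real 0 + 0)) (at_left (0::real))"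
      unfolding exp_term_def by (intro tendsto_intros) (rule fact_nonzero)+
    moreover have "- exp_term (Suc j) (of_real 0 + tau) - - exp_term (Suc j) (of_real 0 + 0) = - ((- tau) ^ Suc j) / fact (Suc j)"
      by (simp add: exp_term_def del: fact_Suc)
    ultimately show "((\<lambda>x. - exp_term (Suc j) (of_real x + tau) - - exp_term (Suc j) (of_real x + 0)) \<longlongrightarrow>
       - ((- tau) ^ Suc j) / fact (Suc j)) (at_left 0)" by (simp only:)
  qed
  then show "has_loop_int (\<lambda>l. Lam (ones j) l * (1 - exp l) ^ 0) (- ((- tau) ^ Suc j) / fact (Suc j))"
    by (rule has_loop_int_cong) (simp add: Lam_ones)
qed

lemma loop_int_Nil: "loop_int [] N = tau"
proof (induction N)
  case 0
  show ?case using loop_int_ones_0[of 0] by simp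
next
  case (Suc N)
  then show ?case by (simp add: loop_int_Suc loop_int_exp_Nil)
qed

section \<open>Decay of loop integrals for large \<open>N\<close>\<close>

lemma power_one_minus_le:
  fixes u :: real
  assumes "0 \<le> u" "u \<le> 1"
  shows "(real M + 1) * (u * (1 - u) ^ M) \<le> 1"
proof -
  \<comment> \<open>Bernoulli's inequality is paired with (1 + u) (1 - u) \<le> 1.\<close>
  have "1 + real M * u \<le> (1 + u) ^ M" by (rule Bernoulli_inequality) (use assms in simp)
  then have "(1 + real M * u) * (1 - u) ^ M \<le> (1 + u) ^ M * (1 - u) ^ M"
    using assms by (intro mult_right_mono) auto
  also have "\<dots> = (1 - u * u) ^ M" by (simp add: power_mult_distrib[symmetric] algebra_simps)
  also have "\<dots> \<le> 1" using assms by (intro power_le_one) (auto simp: mult_le_one)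
  finally have 1: "(1 + real M * u) * (1 - u) ^ M \<le> 1" .
  have "(real M + 1) * u \<le> 1 + real M * u" using assms by (simp add: algebra_simps)
  then have "((real M + 1) * u) * (1 - u) ^ M \<le> (1 + real M * u) * (1 - u) ^ M"
    using assms by (intro mult_right_mono) auto
  then show ?thesis using 1 by (simp add: mult.assoc)
qed

text \<open>Trades decay in \<open>x\<close> for decay in \<open>M\<close>: with u = exp x the
  fourth power of the left-hand side is at most u (1 - u)^M.\<close>

lemma exp_quarter_le:
  assumes "x < 0"
  shows "exp (x / 4) * (1 - exp x) ^ M \<le> (real M + 1) powr (- 1 / 4)"
proof (rule power_le_imp_le_base[where n = 3])
  define u where "u = exp x"
  have u: "0 \<le> u" "u \<le> 1" using assms by (simp_all add: u_def)
  have e: "exp (x / 4) ^ 4 = u" unfolding u_def exp_of_nat_mult[symmetric] by simp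
  have "((1 - u) ^ M) ^ 4 \<le> ((1 - u) ^ M) ^ 1"
    using u by (intro power_decreasing) (auto intro: power_le_one)
  then have "u * ((1 - u) ^ M) ^ 4 \<le> u * (1 - u) ^ M" using u by (intro mult_left_mono) auto
  also have "\<dots> \<le> 1 / (real M + 1)"
    using power_one_minus_le[OF u, of M] by (simp add: field_simps)
  also have "\<dots> = ((real M + 1) powr (- 1 / 4)) ^ 4"
  proof -
    have "((real M + 1) powr (- 1 / 4)) ^ 4 = ((real M + 1) powr (- 1 / 4)) powr real 4"
      by (rule powr_realpow[symmetric]) simp
    also have "\<dots> = (real M + 1) powr (- 1)" by (simp add: powr_powr)
    also have "\<dots> = 1 / (real M + 1)" by (simp add: powr_minus_divide)
    finally show ?thesis by simp
  qed
  finally show "(exp (x / 4) * (1 - exp x) ^ M) ^ Suc 3 \<le> ((real M + 1) powr (- 1 / 4)) ^ Suc 3"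
    unfolding power_mult_distrib using e by (simp add: u_def)
qed simp

lemma has_loop_int_decay:
  assumes C: "C > 0" and strip: "\<And>l. l \<in> strip \<Longrightarrow> norm (f l) \<le> C * exp (Re l / 2)"
    and line: "\<And>c x. c = 0 \<or> c = tau \<Longrightarrow> x \<in> {-1..<0} \<Longrightarrow> norm (f (of_real x + c)) \<le> C / sqrt (- x)"
    and J: "has_loop_int (\<lambda>l. f l * (1 - exp l) ^ Suc M) d"
  shows "norm d \<le> 8 * (C * exp 1) * (real M + 1) powr (- 1 / 4)"
proof -
  obtain Y where Y: "\<And>l. l \<in> left_half \<Longrightarrow> (Y has_field_derivative f l * (1 - exp l) ^ Suc M) (at l)"
    "((\<lambda>x. Y (of_real x + tau) - Y (of_real x + 0)) \<longlongrightarrow> d) (at_left 0)"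
    using J by (rule has_loop_intE) (rule that)
  define B where "B = C * exp 1 * (real M + 1) powr (- 1 / 4)"
  have f1: "norm (f (of_real x + c)) * (1 - exp x) \<le> C * exp 1 * exp (x / 2)"
    if c: "c = 0 \<or> c = tau" and x: "x < 0" for c x
  proof (cases "x \<le> -1")
    case True
    have "of_real x + c \<in> strip" using c True by (auto simp: strip_def)
    from strip[OF this] have "norm (f (of_real x + c)) \<le> C * exp (x / 2)" using c by auto
    then have "norm (f (of_real x + c)) * (1 - exp x) \<le> (C * exp (x / 2)) * 1"
      using norm_z_line[OF c x] C by (intro mult_mono) auto
    also have "\<dots> \<le> (C * exp (x / 2)) * exp 1"
      using C by (intro mult_left_mono) auto
    finally show ?thesis by (simp add: mult_ac)
  next
    case False
    then have "norm (f (of_real x + c)) * (1 - exp x) \<le> (C / sqrt (- x)) * (- x)"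
      using norm_z_line[OF c x] C x by (intro mult_mono line[OF c]) (auto intro!: divide_nonneg_nonneg)
    also have "\<dots> = C * sqrt (- x)" using x real_sqrt_mult_self[of "- x"] by (simp add: field_simps)
    \<comment> \<open>The factor exp 1 lets one bound serve on both sides of x = -1.\<close>
    also have "\<dots> \<le> C * exp (1 + x / 2)"
    proof (intro mult_left_mono)
      have "sqrt (- x) \<le> 1" using False by simp
      also have "1 \<le> exp (1 + x / 2)" using False by simp
      finally show "sqrt (- x) \<le> exp (1 + x / 2)" .
    qed (use C in simp)
    finally show ?thesis by (simp add: exp_add mult.assoc)
  qed
  have f2: "norm (f (of_real x + c) * (1 - exp (of_real x + c)) ^ Suc M) \<le> B * exp (x / 4)"
    if c: "c = 0 \<or> c = tau" and x: "x < 0" for c x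
  proof -
    have "norm (f (of_real x + c) * (1 - exp (of_real x + c)) ^ Suc M) =
        (norm (f (of_real x + c)) * (1 - exp x)) * (1 - exp x) ^ M"
      unfolding norm_mult norm_power norm_z_line[OF c x] by simp
    also have "\<dots> \<le> (C * exp 1 * exp (x / 2)) * (1 - exp x) ^ M"
      using norm_z_line[OF c x] by (intro mult_right_mono f1 c x) auto
    also have "\<dots> = C * exp 1 * exp (x / 4) * (exp (x / 4) * (1 - exp x) ^ M)"
    proof -
      have "exp (x / 2) = exp (x / 4) * exp (x / 4)" by (simp add: exp_add[symmetric])
      then show ?thesis by (simp only: mult.assoc)
    qed
    also have "\<dots> \<le> C * exp 1 * exp (x / 4) * (real M + 1) powr (- 1 / 4)"
      using C by (intro mult_left_mono exp_quarter_le x) auto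
    finally show ?thesis by (simp only: B_def mult_ac)
  qed
  have horiz: "norm (Y (of_real x + c) - Y (of_real r + c)) \<le> 4 * B"
    if c: "c = 0 \<or> c = tau" and x: "r \<le> x" "x < 0" for c x r
  proof -
    have "norm (Y (of_real x + c) - Y (of_real r + c)) \<le> 4 * B * exp (x / 4) - 4 * B * exp (r / 4)"
    proof (rule diff_bound_line[OF x(1)])
      fix t assume t: "r \<le> t" "t \<le> x"
      then have t0: "t < 0" using x by simp
      show "((\<lambda>x. Y (of_real x + c)) has_vector_derivative
          f (of_real t + c) * (1 - exp (of_real t + c)) ^ Suc M) (at t)"
        by (rule hvd_on_line[OF Y(1)[OF line_left_half[OF c t0]]])
      show "((\<lambda>x. 4 * B * exp (x / 4)) has_real_derivative B * exp (t / 4)) (at t)"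
        by (auto intro!: derivative_eq_intros)
    next
      fix t assume "r < t" "t < x"
      then show "norm (f (of_real t + c) * (1 - exp (of_real t + c)) ^ Suc M) \<le> B * exp (t / 4)"
        using x by (intro f2 c) auto
    qed
    moreover have B0: "0 \<le> B" using C by (simp add: B_def)
    then have "0 \<le> 4 * B * exp (r / 4)" by simp
    moreover have "4 * B * exp (x / 4) \<le> 4 * B * 1" using B0 x by (intro mult_left_mono) auto
    ultimately show ?thesis by argo
  qed
  \<comment> \<open>The crude factor 2 ^ Suc M is harmless, since \<open>r\<close> tends to -
    infinity while \<open>M\<close> is fixed.\<close>
  have vert: "norm (Y (of_real r + tau) - Y (of_real r + 0)) \<le> C * 2 ^ Suc M * (2 * pi) * exp (r / 2)" if r: "r \<le> -1" for r
  proof -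
    have s: "of_real r + tau \<in> strip" using r by (simp add: strip_def)
    have "norm (Y (of_real r + tau) - Y (of_real (Re (of_real r + tau)))) \<le> (C * exp (r / 2) * 2 ^ Suc M) * (2 * pi)"
    proof (rule vertical_bound[OF Y(1)[OF strip_left_half] _ s])
      fix l assume l: "l \<in> strip" "Re l = Re (of_real r + tau)"
      then have re: "Re l = r" by simp
      have "norm (1 - exp l) \<le> norm (1::complex) + norm (exp l)" by (rule norm_triangle_ineq4)
      also have "\<dots> \<le> 2" using re r by simp
      finally have "norm (1 - exp l) ^ Suc M \<le> 2 ^ Suc M" by (intro power_mono) auto
      moreover have "norm (f l) \<le> C * exp (r / 2)" using strip[OF l(1)] re by simp
      ultimately show "norm (f l * (1 - exp l) ^ Suc M) \<le> C * exp (r / 2) * 2 ^ Suc M"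
        unfolding norm_mult norm_power using C by (intro mult_mono) auto
    qed
    then show ?thesis by (simp add: mult_ac)
  qed
  have all: "norm (Y (of_real x + tau) - Y (of_real x + 0)) \<le> 8 * B" if x: "-1 < x" "x < 0" for x
  proof -
    have "norm (Y (of_real x + tau) - Y (of_real x + 0)) \<le> 8 * B + C * 2 ^ Suc M * (2 * pi) * exp (r / 2)"
      if r: "r \<le> -1" for r
    proof -
      have e: "Y (of_real x + tau) - Y (of_real x + 0) = (Y (of_real x + tau) - Y (of_real r + tau)) +
          (Y (of_real r + tau) - Y (of_real r + 0)) - (Y (of_real x + 0) - Y (of_real r + 0))" by simp
      have "norm (Y (of_real x + tau) - Y (of_real x + 0)) \<le> norm (Y (of_real x + tau) - Y (of_real r + tau)) +
          norm (Y (of_real r + tau) - Y (of_real r + 0)) + norm (Y (of_real x + 0) - Y (of_real r + 0))"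
        unfolding e by (rule order.trans[OF norm_triangle_ineq4 add_right_mono[OF norm_triangle_ineq]])
      moreover have "norm (Y (of_real x + tau) - Y (of_real r + tau)) \<le> 4 * B"
        by (rule horiz[OF tau_line(2)]) (use r x in auto)
      moreover have "norm (Y (of_real x + 0) - Y (of_real r + 0)) \<le> 4 * B"
        by (rule horiz[OF tau_line(1)]) (use r x in auto)
      moreover note vert[OF r]
      ultimately show ?thesis by argo
    qed
    then have "eventually (\<lambda>r. norm (Y (of_real x + tau) - Y (of_real x + 0)) \<le> 8 * B + C * 2 ^ Suc M * (2 * pi) * exp (r / 2)) at_bot"
      by (intro eventually_mono[OF eventually_le_at_bot[of "-1"]])
    moreover have "((\<lambda>r::real. 8 * B + C * 2 ^ Suc M * (2 * pi) * exp (r / 2)) \<longlongrightarrow> 8 * B + C * 2 ^ Suc M * (2 * pi) * 0) at_bot"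
      by (intro tendsto_intros) real_asymp
    ultimately have "norm (Y (of_real x + tau) - Y (of_real x + 0)) \<le> 8 * B + C * 2 ^ Suc M * (2 * pi) * 0"
      by (intro tendsto_lowerbound) auto
    then show ?thesis by simp
  qed
  have "norm d \<le> 8 * B"
  proof (rule tendsto_upperbound[OF tendsto_norm[OF Y(2)]])
    show "eventually (\<lambda>x. norm (Y (of_real x + tau) - Y (of_real x + 0)) \<le> 8 * B) (at_left 0)"
      using eventually_neg[of "-1", simplified] by eventually_elim (rule all, auto)
  qed simp
  then show ?thesis by (simp add: B_def mult.assoc)
qed

text \<open>The decay estimate is applied to the difference between \<open>Lam v\<close> and its
  expansion; by \<open>Lam_ones\<close> the terms of the expansion are themselves integrands of loop
  integrals.\<close>

lemma loop_int_asymp: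
  assumes "admissible v"
  shows "\<exists>K>0. \<forall>M. norm (loop_int v (Suc M) - expand v (\<lambda>j. loop_int (ones j) (Suc M))) \<le> K * (real M + 1) powr (- 1 / 4)"
proof -
  define E where "E l = Lam v l - expand v (\<lambda>j. exp_term j l)" for l
  obtain C0 where C0: "C0 \<ge> 0" "\<And>l. l \<in> strip \<Longrightarrow> norm (E l) \<le> C0 * exp (Re l / 2)"
    using Lam_asymp[OF assms] unfolding E_def by blast
  have lb: "\<exists>C>0. \<forall>c x. (c = 0 \<or> c = tau) \<longrightarrow> x \<in> {-1..<0} \<longrightarrow> norm (Lam u (of_real x + c)) \<le> C / sqrt (- x)" for u
  proof -
    obtain C1 where C1: "C1 > 0" "\<And>x. x \<in> {-1..<0} \<Longrightarrow> norm (Lam u (of_real x + 0)) \<le> C1 / sqrt (- x)"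
      using Lam_line_bound[OF tau_line(1), of u] by blast
    obtain C2 where C2: "C2 > 0" "\<And>x. x \<in> {-1..<0} \<Longrightarrow> norm (Lam u (of_real x + tau)) \<le> C2 / sqrt (- x)"
      using Lam_line_bound[OF tau_line(2), of u] by blast
    show ?thesis
    proof (intro exI[of _ "C1 + C2"] conjI allI impI)
      show "C1 + C2 > 0" using C1 C2 by simp
      fix c x assume c: "c = 0 \<or> c = tau" and x: "x \<in> {-1..<(0::real)}"
      have "norm (Lam u (of_real x + c)) \<le> C1 / sqrt (- x) \<or> norm (Lam u (of_real x + c)) \<le> C2 / sqrt (- x)"
        using c C1(2)[OF x] C2(2)[OF x] by blast
      moreover have "0 \<le> C1 / sqrt (- x)" "0 \<le> C2 / sqrt (- x)" using C1(1) C2(1) x by simp_all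
      ultimately show "norm (Lam u (of_real x + c)) \<le> (C1 + C2) / sqrt (- x)" unfolding add_divide_distrib by argo
    qed
  qed
  define CC where "CC u = (SOME C. C > 0 \<and> (\<forall>c x. (c = 0 \<or> c = tau) \<longrightarrow> x \<in> {-1..<0} \<longrightarrow> norm (Lam u (of_real x + c)) \<le> C / sqrt (- x)))" for u
  have CC: "CC u > 0 \<and> (\<forall>c x. (c = 0 \<or> c = tau) \<longrightarrow> x \<in> {-1..<0} \<longrightarrow> norm (Lam u (of_real x + c)) \<le> CC u / sqrt (- x))" for u
    unfolding CC_def by (rule someI_ex[OF lb])
  define S where "S = (\<Sum>j\<le>length v. norm (expand_coeff v j) * CC (ones j))"
  have S0: "S \<ge> 0" unfolding S_def using CC by (intro sum_nonneg mult_nonneg_nonneg) (auto intro: less_imp_le)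
  define C where "C = C0 + CC v + S"
  have C: "C > 0" "C0 \<le> C" unfolding C_def using C0(1) CC[of v] S0 by auto
  have Eline: "norm (E (of_real x + c)) \<le> C / sqrt (- x)" if c: "c = 0 \<or> c = tau" and x: "x \<in> {-1..<0}" for c x
  proof -
    have HPx: "of_real x + c \<in> left_half" by (rule line_left_half[OF c]) (use x in simp)
    have ffb: "norm (exp_term j (of_real x + c)) \<le> CC (ones j) / sqrt (- x)" for j
      using CC[of "ones j"] c x unfolding Lam_ones[OF HPx, symmetric] by blast
    have "norm (expand v (\<lambda>j. exp_term j (of_real x + c))) \<le> (\<Sum>j\<le>length v. norm (expand_coeff v j * exp_term j (of_real x + c)))"
      unfolding expand_sum by (rule norm_sum)
    also have "\<dots> \<le> (\<Sum>j\<le>length v. norm (expand_coeff v j) * (CC (ones j) / sqrt (- x)))"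
      unfolding norm_mult by (intro sum_mono mult_left_mono ffb) auto
    also have "\<dots> = S / sqrt (- x)" by (simp add: S_def sum_divide_distrib)
    finally have 1: "norm (expand v (\<lambda>j. exp_term j (of_real x + c))) \<le> S / sqrt (- x)" .
    have 2: "norm (Lam v (of_real x + c)) \<le> CC v / sqrt (- x)" using CC[of v] c x by blast
    have "norm (E (of_real x + c)) \<le> CC v / sqrt (- x) + S / sqrt (- x)"
      unfolding E_def by (rule order.trans[OF norm_triangle_ineq4 add_mono[OF 2 1]])
    moreover have "0 \<le> C0 / sqrt (- x)" using C0(1) x by simp
    ultimately show ?thesis unfolding C_def add_divide_distrib by argo
  qed
  have Estrip: "norm (E l) \<le> C * exp (Re l / 2)" if "l \<in> strip" for l
    by (rule order.trans[OF C0(2)[OF that] mult_right_mono[OF C(2)]]) simp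
  have "norm (loop_int v (Suc M) - expand v (\<lambda>j. loop_int (ones j) (Suc M))) \<le> 8 * (C * exp 1) * (real M + 1) powr (- 1 / 4)" for M
  proof (rule has_loop_int_decay[OF C(1) Estrip Eline])
    have 1: "has_loop_int (\<lambda>l. \<Sum>j\<le>length v. expand_coeff v j * (Lam (ones j) l * (1 - exp l) ^ Suc M))
        (\<Sum>j\<le>length v. expand_coeff v j * loop_int (ones j) (Suc M))"
      by (intro has_loop_int_sum has_loop_int_cmult loop_int_has_loop_int)
    from has_loop_int_add[OF loop_int_has_loop_int has_loop_int_cmult[OF this, of "-1"]]
    have 2: "has_loop_int (\<lambda>l. Lam v l * (1 - exp l) ^ Suc M + - 1 * (\<Sum>j\<le>length v. expand_coeff v j * (Lam (ones j) l * (1 - exp l) ^ Suc M)))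
        (loop_int v (Suc M) + - 1 * (\<Sum>j\<le>length v. expand_coeff v j * loop_int (ones j) (Suc M)))" .
    have 3: "has_loop_int (\<lambda>l. E l * (1 - exp l) ^ Suc M) (loop_int v (Suc M) + - 1 * (\<Sum>j\<le>length v. expand_coeff v j * loop_int (ones j) (Suc M)))"
    proof (rule has_loop_int_cong[OF 2])
      fix l assume "l \<in> left_half"
      then show "E l * (1 - exp l) ^ Suc M = Lam v l * (1 - exp l) ^ Suc M +
          - 1 * (\<Sum>j\<le>length v. expand_coeff v j * (Lam (ones j) l * (1 - exp l) ^ Suc M))"
        by (simp add: E_def expand_sum Lam_ones left_diff_distrib sum_distrib_right mult.assoc del: power_Suc)
    qed
    then show "has_loop_int (\<lambda>l. E l * (1 - exp l) ^ Suc M) (loop_int v (Suc M) - expand v (\<lambda>j. loop_int (ones j) (Suc M)))"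
      by (simp add: expand_sum)
  qed
  moreover have "8 * (C * exp 1) > 0" using C by simp
  ultimately show ?thesis by blast
qed

section \<open>The indices (1, ..., 1) and the sine product\<close>

definition growth :: "real \<Rightarrow> nat \<Rightarrow> complex" where "growth a N = of_real (real N powr a)"

lemma growth_mult: "growth a N * growth b N = growth (a + b) N"
  by (simp add: growth_def powr_add)

lemma growth_bigo: "a \<le> b \<Longrightarrow> growth a \<in> O(growth b)"
proof (rule bigoI[where c = 1])
  assume "a \<le> b"
  show "eventually (\<lambda>N. norm (growth a N) \<le> 1 * norm (growth b N)) at_top"
    using eventually_ge_at_top[of 1]
  proof eventually_elim
    case (elim N)
    then show ?case using \<open>a \<le> b\<close> by (simp add: growth_def powr_mono)
  qed
qed

lemma growth_bigo_mult:
  assumes "f \<in> O(growth a)" "g \<in> O(growth b)" "a + b \<le> c"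
  shows "(\<lambda>N. f N * g N) \<in> O(growth c)"
proof -
  have "(\<lambda>N. f N * g N) \<in> O(\<lambda>N. growth a N * growth b N)" by (rule landau_o.big.mult[OF assms(1,2)])
  then have "(\<lambda>N. f N * g N) \<in> O(growth (a + b))" by (simp only: growth_mult)
  then show ?thesis by (rule landau_o.big_trans[OF _ growth_bigo[OF assms(3)]])
qed

lemma growth_bigo_cmult:
  assumes "f \<in> O(growth a)"
  shows "(\<lambda>N. c * f N) \<in> O(growth a)"
  using assms by (cases "c = 0") simp_all

lemma sqrt_rate_bigo:
  assumes "\<And>N. norm (f N) \<le> C / sqrt (real N + 1)" "C \<ge> 0"
  shows "f \<in> O(growth (- 1 / 2))"
proof (rule bigoI[where c = C])
  show "eventually (\<lambda>N. norm (f N) \<le> C * norm (growth (- 1 / 2) N)) at_top"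
    using eventually_ge_at_top[of 1]
  proof eventually_elim
    case (elim N)
    have "C / sqrt (real N + 1) \<le> C / sqrt (real N)"
      using elim assms(2) by (intro divide_left_mono) auto
    also have "\<dots> = C * norm (growth (- 1 / 2) N)"
      unfolding growth_def norm_of_real using elim by (simp add: powr_minus_divide powr_half_sqrt)
    finally show ?case using assms(1)[of N] by simp
  qed
qed

text \<open>The partial products for sin (pi z) / (pi z), kept as polynomials because their
  coefficients are needed.\<close>

primrec sine_poly :: "nat \<Rightarrow> complex poly" where
  "sine_poly 0 = 1"
| "sine_poly (Suc N) = sine_poly N - monom (1 / of_nat (Suc N) ^ 2) 2 * sine_poly N"

lemma poly_sine_poly: "poly (sine_poly N) z = (\<Prod>k=1..N. 1 - z ^ 2 / of_nat k ^ 2)"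
proof (induction N)
  case (Suc N)
  have "poly (sine_poly (Suc N)) z = poly (sine_poly N) z * (1 - z ^ 2 / of_nat (Suc N) ^ 2)"
    by (simp add: poly_monom algebra_simps del: of_nat_Suc)
  then show ?case unfolding Suc by (simp add: prod.cl_ivl_Suc del: of_nat_Suc sine_poly.simps)
qed simp

lemma coeff_sine_poly_Suc:
  "coeff (sine_poly (Suc N)) i = coeff (sine_poly N) i - (if 2 \<le> i then coeff (sine_poly N) (i - 2) / of_nat (Suc N) ^ 2 else 0)"
  by (simp add: coeff_monom_mult del: of_nat_Suc)

text \<open>The constant bound 4 is not inductive. The increasing bound 4 n / (n + 1) with n = M + 1
  has room for the relative increment 1 / n^2 of the next step.\<close>

lemma norm_coeff_sine_poly_Suc:
  "norm (coeff (sine_poly (Suc M)) i) \<le> 4 * (real M + 1) / (real M + 2)"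
proof (induction M arbitrary: i)
  case 0
  have "norm (coeff (sine_poly (Suc 0)) i) \<le> norm (coeff (1 :: complex poly) i) + norm (if 2 \<le> i then coeff (1 :: complex poly) (i - 2) / of_nat (Suc 0) ^ 2 else 0)"
    unfolding coeff_sine_poly_Suc sine_poly.simps(1) by (rule norm_triangle_ineq4)
  also have "\<dots> \<le> 1 + 1" by (intro add_mono) auto
  finally show ?case by simp
next
  case (Suc M)
  define n where "n = real M + 2"
  have n: "n \<ge> 2" by (simp add: n_def)
  define b where "b = 4 * (real M + 1) / (real M + 2)"
  have b: "b \<ge> 0" by (simp add: b_def)
  have "norm (coeff (sine_poly (Suc (Suc M))) i) \<le> norm (coeff (sine_poly (Suc M)) i) +
      norm (if 2 \<le> i then coeff (sine_poly (Suc M)) (i - 2) / of_nat (Suc (Suc M)) ^ 2 else 0)"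
    unfolding coeff_sine_poly_Suc[of "Suc M"] by (rule norm_triangle_ineq4)
  also have "\<dots> \<le> b + b / n ^ 2"
  proof (intro add_mono)
    show "norm (coeff (sine_poly (Suc M)) i) \<le> b" unfolding b_def by (rule Suc.IH)
    have "norm (of_nat (Suc (Suc M)) :: complex) = n" unfolding norm_of_nat by (simp add: n_def)
    then show "norm (if 2 \<le> i then coeff (sine_poly (Suc M)) (i - 2) / of_nat (Suc (Suc M)) ^ 2 else 0) \<le> b / n ^ 2"
      using Suc.IH[of "i - 2"] b unfolding b_def[symmetric]
      by (auto simp: norm_divide norm_power divide_right_mono simp del: of_nat_Suc)
  qed
  also have "b + b / n ^ 2 \<le> 4 * n / (n + 1)"
  proof -
    have bn: "b = 4 * (n - 1) / n" by (simp add: b_def n_def)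
    \<comment> \<open>The left-hand side is n^4 - 1.\<close>
    have "(n - 1) * (n * n + 1) * (n + 1) \<le> n * (n * (n * n))" using n by (simp add: algebra_simps)
    then have "4 * ((n - 1) * (n * n + 1)) * (n + 1) \<le> 4 * n * (n * (n * n))" by (simp add: algebra_simps)
    then have "4 * ((n - 1) * (n * n + 1)) / (n * (n * n)) \<le> 4 * n / (n + 1)"
      using n by (intro frac_le_eq[THEN iffD2] divide_le_eq[THEN iffD2]) (simp_all add: divide_le_eq pos_le_divide_eq)
    moreover have "b + b / n ^ 2 = 4 * ((n - 1) * (n * n + 1)) / (n * (n * n))"
      using n unfolding bn by (simp add: field_simps power2_eq_square)
    ultimately show ?thesis by simp
  qed
  finally show ?case by (simp add: n_def add.commute)
qed

lemma norm_coeff_sine_poly: "norm (coeff (sine_poly N) i) \<le> 4"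
proof (cases N)
  case 0
  then show ?thesis by auto
next
  case (Suc M)
  have "4 * (real M + 1) / (real M + 2) \<le> 4" by (simp add: divide_le_eq)
  then show ?thesis unfolding Suc by (rule order.trans[OF norm_coeff_sine_poly_Suc])
qed

text \<open>Increments in the number of factors, so that convergence of a coefficient becomes that
  of a series and \<open>tail_rate\<close> supplies the speed.\<close>

definition sine_poly_inc :: "nat \<Rightarrow> nat \<Rightarrow> complex" where
  "sine_poly_inc i n = (case n of 0 \<Rightarrow> coeff (sine_poly 0) i | Suc m \<Rightarrow> coeff (sine_poly (Suc m)) i - coeff (sine_poly m) i)"

definition sine_coeff :: "nat \<Rightarrow> complex" where "sine_coeff i = suminf (sine_poly_inc i)"

lemma sum_sine_poly_inc: "(\<Sum>n\<le>N. sine_poly_inc i n) = coeff (sine_poly N) i"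
  by (induction N) (simp_all add: sine_poly_inc_def del: sine_poly.simps)

lemma norm_sine_poly_inc:
  assumes "n \<ge> 1"
  shows "norm (sine_poly_inc i n) \<le> 4 / (real n * sqrt (real n))"
proof -
  obtain m where m: "n = Suc m" using assms by (cases n) auto
  have "norm (sine_poly_inc i n) = norm (if 2 \<le> i then coeff (sine_poly m) (i - 2) / of_nat n ^ 2 else 0)"
    unfolding m sine_poly_inc_def nat.case coeff_sine_poly_Suc by simp
  also have "\<dots> \<le> 4 / (real n * real n)"
  proof (cases "2 \<le> i")
    case True
    have "norm (coeff (sine_poly m) (i - 2) / of_nat n ^ 2) \<le> 4 / (real n * real n)"
      unfolding norm_divide power2_eq_square norm_mult norm_of_nat
      by (intro divide_right_mono norm_coeff_sine_poly) simp
    then show ?thesis by (simp add: True)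
  qed simp
  also have "\<dots> \<le> 4 / (real n * sqrt (real n))"
  proof (intro divide_left_mono mult_left_mono)
    show "sqrt (real n) \<le> real n" using assms by (simp add: real_le_lsqrt real_sqrt_le_iff sqrt_le_D power2_eq_square)
  qed (use assms in auto)
  finally show ?thesis .
qed

lemma coeff_sine_poly_rate: "norm (coeff (sine_poly N) i - sine_coeff i) \<le> 24 / sqrt (real N + 1)"
  using tail_rate(2)[of 4 "sine_poly_inc i" N] norm_sine_poly_inc[of _ i] by (simp add: sum_sine_poly_inc sine_coeff_def)

lemma coeff_sine_poly_bigo: "(\<lambda>N. coeff (sine_poly N) i - sine_coeff i) \<in> O(growth (- 1 / 2))"
  by (rule sqrt_rate_bigo[OF coeff_sine_poly_rate]) simp

lemma coeff_sine_poly_tendsto: "(\<lambda>N. coeff (sine_poly N) i) \<longlonglongrightarrow> sine_coeff i"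
proof -
  have "(\<lambda>N. coeff (sine_poly N) i - sine_coeff i) \<longlonglongrightarrow> 0"
  proof (rule Lim_null_comparison)
    show "eventually (\<lambda>N. norm (coeff (sine_poly N) i - sine_coeff i) \<le> 24 / sqrt (real N + 1)) sequentially"
      by (intro always_eventually allI coeff_sine_poly_rate)
    show "(\<lambda>N. 24 / sqrt (real N + 1)) \<longlonglongrightarrow> 0" by real_asymp
  qed
  then show ?thesis by (simp only: LIM_zero_iff)
qed

lemma norm_sine_coeff: "norm (sine_coeff i) \<le> 4"
  by (rule tendsto_upperbound[OF tendsto_norm[OF coeff_sine_poly_tendsto]])
     (auto intro!: always_eventually norm_coeff_sine_poly)

text \<open>Tannery's theorem exchanges the limit over the products with the sum over the degrees;
  the uniform bound 4 on the coefficients and the radius 1/2 give the summable majorant.\<close>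

lemma sine_coeff_sin:
  assumes "norm z \<le> 1/2"
  shows "of_real pi * z * suminf (\<lambda>i. sine_coeff i * z ^ i) = sin (of_real pi * z)"
proof -
  have zi: "norm z ^ i \<le> (1/2) ^ i" for i using assms by (intro power_mono) auto
  have t1: "(\<lambda>N. coeff (sine_poly N) i * z ^ i) \<longlonglongrightarrow> sine_coeff i * z ^ i" for i
    by (intro tendsto_mult coeff_sine_poly_tendsto tendsto_const)
  have t2: "eventually (\<lambda>(i, N). norm (coeff (sine_poly N) i * z ^ i) \<le> 4 * (1/2) ^ i) (at_top \<times>\<^sub>F sequentially)"
  proof (rule always_eventually, clarify)
    fix i N
    show "norm (coeff (sine_poly N) i * z ^ i) \<le> 4 * (1/2) ^ i"
      unfolding norm_mult norm_power using zi by (intro mult_mono norm_coeff_sine_poly) auto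
  qed
  have t3: "summable (\<lambda>i. 4 * (1/2 :: real) ^ i)" by (intro summable_mult summable_geometric) simp
  have "(\<lambda>N. suminf (\<lambda>i. coeff (sine_poly N) i * z ^ i)) \<longlonglongrightarrow> suminf (\<lambda>i. sine_coeff i * z ^ i)"
    by (rule tannerys_theorem[OF t1 t2 t3 sequentially_bot, THEN conjunct2, THEN conjunct2])
  moreover have "suminf (\<lambda>i. coeff (sine_poly N) i * z ^ i) = poly (sine_poly N) z" for N
    unfolding poly_altdef by (rule suminf_finite) (auto simp: coeff_eq_0)
  ultimately have "(\<lambda>N. poly (sine_poly N) z) \<longlonglongrightarrow> suminf (\<lambda>i. sine_coeff i * z ^ i)" by simp
  then have "(\<lambda>N. of_real pi * z * poly (sine_poly N) z) \<longlonglongrightarrow> of_real pi * z * suminf (\<lambda>i. sine_coeff i * z ^ i)"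
    by (intro tendsto_mult tendsto_const)
  moreover have "(\<lambda>N. of_real pi * z * poly (sine_poly N) z) \<longlonglongrightarrow> sin (of_real pi * z)"
    unfolding poly_sine_poly by (rule sin_product_formula_complex)
  ultimately show ?thesis by (rule LIMSEQ_unique)
qed

definition sine_series :: "complex fps" where "sine_series = Abs_fps sine_coeff"

text \<open>Carries the product formula from functions near 0 over to formal power series, in which
  the generating functions below are compared.\<close>

lemma sine_series_sin: "fps_const (of_real pi) * fps_X * sine_series = fps_sin (of_real pi)"
proof -
  define f where "f z = suminf (\<lambda>i. sine_coeff i * z ^ i)" for z :: complex
  have "summable (\<lambda>i. sine_coeff i * (1/2) ^ i)"
  proof (rule summable_comparison_test')
    show "summable (\<lambda>i. 4 * (1/2 :: real) ^ i)" by (intro summable_mult summable_geometric) simp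
    show "norm (sine_coeff i * (1/2) ^ i) \<le> 4 * (1/2) ^ i" for i
      unfolding norm_mult norm_power using norm_sine_coeff[of i] by (intro mult_mono) (auto simp: norm_divide)
  qed
  then have "ereal (norm (1/2 :: complex)) \<le> conv_radius sine_coeff" by (rule conv_radius_geI)
  then have "0 < conv_radius sine_coeff"
    by (rule less_le_trans[rotated]) simp
  then have "f has_fps_expansion sine_series"
    unfolding has_fps_expansion_def fps_conv_radius_def sine_series_def eval_fps_def f_def by simp
  then have 1: "(\<lambda>z. of_real pi * z * f z) has_fps_expansion fps_const (of_real pi) * fps_X * sine_series"
    by (intro fps_expansion_intros)
  have "eventually (\<lambda>z::complex. norm z < 1/2) (nhds 0)"
    using eventually_nhds_in_open[of "ball (0::complex) (1/2)" 0] by simp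
  then have "eventually (\<lambda>z. of_real pi * z * f z = sin (of_real pi * z)) (nhds (0::complex))"
    by eventually_elim (simp add: f_def sine_coeff_sin)
  then have 2: "(\<lambda>z. sin (of_real pi * z)) has_fps_expansion fps_const (of_real pi) * fps_X * sine_series"
    using 1 by (simp add: has_fps_expansion_cong)
  show ?thesis
    by (rule fps_expansion_unique_complex[OF 2 has_fps_expansion_sin])
qed

definition pii :: complex where "pii = of_real pi * \<i>"

text \<open>The generating functions \<open>A N\<close>, \<open>B N\<close> of \<open>a N\<close>, \<open>b N\<close> satisfy \<open>A N * V N = S * B N\<close>, where \<open>S\<close> is the
  normalized sine and \<open>V N\<close> the partial product of its factors.\<close>

lemma ones_asymp:
  fixes a b :: "nat \<Rightarrow> nat \<Rightarrow> complex"
  assumes a0: "\<And>N. a N 0 = 1" and aS: "\<And>N j. a (Suc N) (Suc j) = a N (Suc j) + a (Suc N) j / of_nat (Suc N)"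
    and ai: "\<And>j. a 0 j = (2 * pii) ^ j / fact (Suc j)"
    and b0: "\<And>N. b N 0 = 1" and bS: "\<And>N j. b (Suc N) (Suc j) = b N (Suc j) + b N j / of_nat (Suc N)"
    and bi: "\<And>j. b 0 j = pii ^ j / fact j"
    and bg: "\<And>j. (\<lambda>N. b N j) \<in> O(growth (1 / 8))"
  shows "(\<lambda>N. a N j - b N j) \<in> O(growth (- 1 / 4))"
proof -
  define A where "A N = Abs_fps (a N)" for N
  define B where "B N = Abs_fps (b N)" for N
  define V where "V N = Abs_fps (coeff (sine_poly N))" for N
  define t :: "nat \<Rightarrow> complex fps" where "t N = fps_const (1 / of_nat (Suc N)) * fps_X" for N
  have VS: "V (Suc N) = V N * ((1 - t N) * (1 + t N))" for N
  proof -
    have "(1 - t N) * (1 + t N) = 1 - fps_const (1 / of_nat (Suc N) ^ 2) * fps_X ^ 2"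
      by (simp add: t_def algebra_simps power2_eq_square fps_const_mult[symmetric] del: of_nat_Suc fps_const_mult)
    then have "V N * ((1 - t N) * (1 + t N)) = V N - fps_const (1 / of_nat (Suc N) ^ 2) * (fps_X ^ 2 * V N)"
      by (simp add: algebra_simps)
    also have "\<dots> = V (Suc N)"
      unfolding V_def by (rule fps_ext) (simp add: fps_X_power_mult_nth coeff_sine_poly_Suc del: sine_poly.simps of_nat_Suc)
    finally show ?thesis by simp
  qed
  have AS: "A (Suc N) * (1 - t N) = A N" for N
  proof (rule fps_ext)
    fix j
    have "fps_nth (A (Suc N) * (1 - t N)) j = a (Suc N) j - 1 / of_nat (Suc N) * fps_nth (fps_X * A (Suc N)) j"
      by (simp add: t_def A_def algebra_simps del: of_nat_Suc)
    then show "fps_nth (A (Suc N) * (1 - t N)) j = fps_nth (A N) j"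
      by (cases j) (simp_all add: A_def a0 aS del: of_nat_Suc)
  qed
  have BS: "B (Suc N) = B N * (1 + t N)" for N
  proof (rule fps_ext)
    fix j
    have "fps_nth (B N * (1 + t N)) j = b N j + 1 / of_nat (Suc N) * fps_nth (fps_X * B N) j"
      by (simp add: t_def B_def algebra_simps del: of_nat_Suc)
    then show "fps_nth (B (Suc N)) j = fps_nth (B N * (1 + t N)) j"
      by (cases j) (simp_all add: B_def b0 bS del: of_nat_Suc)
  qed
  have B0: "B 0 = fps_exp pii" by (rule fps_ext) (simp add: B_def bi)
  \<comment> \<open>The origin of the exponential factor: exp (2 pi i z) - 1 = 2 i sin (pi z) exp
    (pi i z).\<close>
  have A0: "A 0 = sine_series * B 0"
  proof -
    let ?X = "fps_const (2 * pii) * fps_X"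
    have "?X * A 0 = fps_exp (2 * pii) - 1"
    proof (rule fps_ext)
      fix j show "fps_nth (?X * A 0) j = fps_nth (fps_exp (2 * pii) - 1) j"
        by (cases j) (simp_all add: A_def ai mult.assoc del: fact_Suc)
    qed
    moreover have "?X * (sine_series * B 0) = fps_exp (2 * pii) - 1"
    proof -
      have "?X = fps_const (2 * \<i>) * (fps_const (of_real pi) * fps_X)"
        by (simp add: pii_def fps_const_mult[symmetric] mult_ac del: fps_const_mult)
      then have "?X * (sine_series * B 0) = fps_const (2 * \<i>) * fps_sin (of_real pi) * fps_exp pii"
        by (simp add: sine_series_sin[symmetric] B0 mult_ac)
      also have "fps_const (2 * \<i>) * fps_sin (of_real pi) = fps_exp pii - fps_exp (- pii)"
      proof -
        have "fps_const (2 * \<i>) * ((fps_exp pii - fps_exp (- pii)) / fps_const (2 * \<i>)) = fps_exp pii - fps_exp (- pii)"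
          by (simp add: fps_divide_unit fps_const_inverse[symmetric] mult.assoc[symmetric] fps_const_mult mult.commute)
        moreover have "\<i> * of_real pi = pii" "- \<i> * of_real pi = - pii" by (simp_all add: pii_def)
        ultimately show ?thesis unfolding fps_sin_fps_exp_ii by simp
      qed
      also have "(fps_exp pii - fps_exp (- pii)) * fps_exp pii = fps_exp (2 * pii) - 1"
        using fps_exp_add_mult[of pii pii] fps_exp_add_mult[of "- pii" pii]
        by (simp add: left_diff_distrib)
      finally show ?thesis .
    qed
    moreover have "?X \<noteq> 0" by (simp add: pii_def)
    ultimately show ?thesis by (metis mult_cancel_left)
  qed
  \<comment> \<open>From \<open>N\<close> to \<open>N + 1\<close> the series \<open>A\<close> is
    divided by \<open>1 - t N\<close>, \<open>B\<close> is multiplied by \<open>1 + t N\<close>, and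
    \<open>V\<close> by both factors.\<close>
  have main: "A N * V N = sine_series * B N" for N
  proof (induction N)
    case 0
    have "V 0 = 1" by (rule fps_ext) (simp add: V_def)
    then show ?case by (simp add: A0)
  next
    case (Suc N)
    have "A (Suc N) * V (Suc N) = (A (Suc N) * (1 - t N)) * V N * (1 + t N)"
      unfolding VS by (simp only: mult_ac)
    also have "\<dots> = sine_series * B N * (1 + t N)" unfolding AS Suc ..
    finally show ?case unfolding BS by (simp only: mult.assoc)
  qed
  define D where "D N i = a N i - b N i" for N i
  \<comment> \<open>\<open>V N\<close> has constant term 1, so the coefficients of
    \<open>A N - B N\<close> can be solved for one after another in terms of those of
    \<open>sine_series - V N\<close>, which tend to 0.\<close>
  have DV: "(A N - B N) * V N = (sine_series - V N) * B N" for N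
    using main[of N] by (simp add: algebra_simps)
  have "(\<lambda>N. D N j) \<in> O(growth (- 1 / 4))" for j
  proof (induction j rule: less_induct)
    case (less j)
    have V0: "coeff (sine_poly N) 0 = 1" for N by (induction N) (simp_all add: coeff_sine_poly_Suc del: sine_poly.simps(2))
    have eq: "D N j = (\<Sum>i\<le>j. (sine_coeff i - coeff (sine_poly N) i) * b N (j - i)) - (\<Sum>i<j. D N i * coeff (sine_poly N) (j - i))" for N
    proof -
      have "(\<Sum>i\<le>j. D N i * coeff (sine_poly N) (j - i)) = fps_nth ((A N - B N) * V N) j"
        by (simp add: fps_mult_nth A_def B_def V_def D_def atLeast0AtMost)
      also have "\<dots> = (\<Sum>i\<le>j. (sine_coeff i - coeff (sine_poly N) i) * b N (j - i))"
        unfolding DV by (simp add: fps_mult_nth B_def V_def sine_series_def atLeast0AtMost)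
      finally show ?thesis by (simp add: lessThan_Suc_atMost[symmetric] V0 eq_diff_eq add.commute)
    qed
    have "(\<lambda>N. sine_coeff i - coeff (sine_poly N) i) \<in> O(growth (- 1 / 2))" for i
      using growth_bigo_cmult[OF coeff_sine_poly_bigo, of "-1" i] by simp
    \<comment> \<open>- 1/2 + 1/8 \<le> - 1/4: the growth of \<open>b\<close> uses up only part of
      the rate.\<close>
    then have 1: "(\<lambda>N. (sine_coeff i - coeff (sine_poly N) i) * b N (j - i)) \<in> O(growth (- 1 / 4))" for i
      by (rule growth_bigo_mult[OF _ bg]) simp
    have "(\<lambda>N. coeff (sine_poly N) i) \<in> O(growth 0)" for i
    proof (rule bigoI[where c = 4])
      show "eventually (\<lambda>N. norm (coeff (sine_poly N) i) \<le> 4 * norm (growth 0 N)) at_top"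
        using eventually_ge_at_top[of 1] by eventually_elim (simp add: growth_def norm_coeff_sine_poly)
    qed
    then have 2: "(\<lambda>N. D N i * coeff (sine_poly N) (j - i)) \<in> O(growth (- 1 / 4))" if "i < j" for i
      by (rule growth_bigo_mult[OF less.IH[OF that]]) simp
    show ?case unfolding eq
      by (intro sum_in_bigo big_sum_in_bigo 1 2) simp
  qed
  then show ?thesis unfolding D_def .
qed

section \<open>The harmonic relation\<close>

text \<open>\<open>index_word\<close> without its first letter \<open>E1\<close>. That letter is the
  outermost integration dl, which \<open>loop_int\<close> carries out.\<close>

fun index_tail :: "nat list \<Rightarrow> letter list" where
  "index_tail [] = []"
| "index_tail (k # ks) = replicate (k - 1) E0 @ E1 # index_tail ks"

lemma admissible_index_tail: "admissible (index_tail ks)"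
proof (induction ks)
  case (Cons k ks)
  have "admissible (replicate m E0 @ E1 # index_tail ks)" for m
    by (induction m) (auto intro: admissible_E1 admissible_E0 Cons)
  then show ?case by simp
qed (simp add: admissible_Nil)

lemma index_word_index_tail: "index_word ks = E1 # index_tail ks"
  by (induction ks) (simp_all add: index_word_def)

lemma index_tail_ones: "index_tail (replicate j 1) = ones j"
  by (induction j) simp_all

text \<open>For an index, the sum of n_1^(-k_1) ... n_d^(-k_d) over N \<ge> n_1 > ... > n_d \<ge>
  1.\<close>

definition harm_sum :: "nat \<Rightarrow> nat list \<Rightarrow> complex" where "harm_sum N ks = psum (index_tail ks) N"

text \<open>Division by \<open>tau\<close> normalizes the value at the empty index to 1, as
  multiplicativity requires.\<close>

definition loop_coeff :: "nat \<Rightarrow> nat list \<Rightarrow> complex" where "loop_coeff N ks = loop_int (index_tail ks) N / tau"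

lemma harm_sum_Nil: "harm_sum N [] = 1"
  by (simp add: harm_sum_def)

lemma loop_coeff_Nil: "loop_coeff N [] = 1"
  using tau_nz by (simp add: loop_coeff_def loop_int_Nil)

lemma harm_sum_0: "harm_sum 0 (k # ks) = 0"
proof -
  have "Li_coeff (index_tail (k # ks)) 0 = 0" by (rule Li_coeff_0) simp
  then show ?thesis by (simp add: harm_sum_def psum_def)
qed

lemma harm_sum_Suc:
  assumes "1 \<le> k"
  shows "harm_sum (Suc N) (k # ks) = harm_sum N (k # ks) + 1 / of_nat (Suc N) ^ k * harm_sum N ks"
proof -
  have "Li_coeff (replicate m E0 @ E1 # v) (Suc N) = psum v N / of_nat (Suc N) ^ Suc m" for m v
    by (induction m) (simp_all add: Li_coeff_Suc_E1 del: of_nat_Suc Li_coeff.simps(3))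
  from this[of "k - 1" "index_tail ks"] have "Li_coeff (index_tail (k # ks)) (Suc N) = psum (index_tail ks) N / of_nat (Suc N) ^ k"
    using assms by (simp del: of_nat_Suc power_Suc)
  then show ?thesis by (simp add: harm_sum_def psum_def del: index_tail.simps of_nat_Suc)
qed

lemma loop_coeff_Suc:
  assumes "1 \<le> k"
  shows "loop_coeff N (k # ks) = loop_coeff (Suc N) (k # ks) + (- 1 / of_nat (Suc N)) ^ k * loop_coeff (Suc N) ks"
proof -
  have "loop_int_exp (replicate m E0 @ E1 # v) N = (- 1 / of_nat (Suc N)) ^ Suc m * loop_int v (Suc N)" for m v
    by (induction m) (simp_all add: loop_int_exp_E0 loop_int_exp_E1 del: of_nat_Suc)
  from this[of "k - 1" "index_tail ks"] have "loop_int_exp (index_tail (k # ks)) N = (- 1 / of_nat (Suc N)) ^ k * loop_int (index_tail ks) (Suc N)"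
    using assms by (simp del: of_nat_Suc power_Suc)
  then have "loop_int (index_tail (k # ks)) N = loop_int (index_tail (k # ks)) (Suc N) + (- 1 / of_nat (Suc N)) ^ k * loop_int (index_tail ks) (Suc N)"
    using loop_int_Suc[of "index_tail (k # ks)" N] by (simp del: index_tail.simps of_nat_Suc)
  then show ?thesis unfolding loop_coeff_def by (simp only: add_divide_distrib times_divide_eq_right)
qed

section \<open>Quasi-shuffle products and their multiplicative functionals\<close>

fun quasi_shuffle :: "nat list \<Rightarrow> nat list \<Rightarrow> nat list list" where
  "quasi_shuffle [] ls = [ls]"
| "quasi_shuffle (k # ks) [] = [k # ks]"
| "quasi_shuffle (k # ks) (l # ls) = map ((#) k) (quasi_shuffle ks (l # ls)) @ map ((#) l) (quasi_shuffle (k # ks) ls) @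
     map ((#) (k + l)) (quasi_shuffle ks ls)"

lemma is_index_Cons: "is_index (k # ks) \<longleftrightarrow> 1 \<le> k \<and> is_index ks"
  by (simp add: is_index_def)

lemma quasi_shuffle_index: "is_index ks \<Longrightarrow> is_index ls \<Longrightarrow> m \<in> set (quasi_shuffle ks ls) \<Longrightarrow> is_index m"
proof (induction ks ls arbitrary: m rule: quasi_shuffle.induct)
  case (3 k ks l ls)
  have i: "1 \<le> k" "1 \<le> l" "is_index ks" "is_index ls" using 3(4,5) by (simp_all add: is_index_Cons)
  consider m' where "m = k # m'" "m' \<in> set (quasi_shuffle ks (l # ls))" | m' where "m = l # m'" "m' \<in> set (quasi_shuffle (k # ks) ls)"
    | m' where "m = (k + l) # m'" "m' \<in> set (quasi_shuffle ks ls)"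
    using 3(6) unfolding quasi_shuffle.simps set_append set_map Un_iff image_iff by blast
  then show ?case
  proof cases
    case 1
    then show ?thesis using 3(1)[OF i(3) 3(5)] i by (simp add: is_index_Cons)
  next
    case 2
    then show ?thesis using 3(2)[OF 3(4) i(4)] i by (simp add: is_index_Cons)
  next
    case 3
    then show ?thesis using "3.IH"(3)[OF i(3,4)] i by (simp add: is_index_Cons)
  qed
qed simp_all

lemma quasi_shuffle_weight: "m \<in> set (quasi_shuffle ks ls) \<Longrightarrow> sum_list m = sum_list ks + sum_list ls"
proof (induction ks ls arbitrary: m rule: quasi_shuffle.induct)
  case (3 k ks l ls)
  consider m' where "m = k # m'" "m' \<in> set (quasi_shuffle ks (l # ls))" | m' where "m = l # m'" "m' \<in> set (quasi_shuffle (k # ks) ls)"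
    | m' where "m = (k + l) # m'" "m' \<in> set (quasi_shuffle ks ls)"
    using 3(4) unfolding quasi_shuffle.simps set_append set_map Un_iff image_iff by blast
  then show ?case
  proof cases
    case 1
    then show ?thesis using 3(1)[of m'] by simp
  next
    case 2
    then show ?thesis using 3(2)[of m'] by simp
  next
    case 3
    then show ?thesis using "3.IH"(3)[of m'] by simp
  qed
qed simp_all

definition defect :: "(nat list \<Rightarrow> complex) \<Rightarrow> nat list \<Rightarrow> nat list \<Rightarrow> complex" where
  "defect F ks ls = F ks * F ls - (\<Sum>m\<leftarrow>quasi_shuffle ks ls. F m)"

lemma defect_Nil: "F [] = 1 \<Longrightarrow> defect F [] ls = 0" "F [] = 1 \<Longrightarrow> defect F ks [] = 0"
  by (simp_all add: defect_def) (cases ks; simp)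

text \<open>The step from \<open>G\<close> to \<open>F\<close> respects the product because the
  weights multiply correctly: r ^ k times r ^ l is the weight r ^ (k + l) of the merged
  entry.\<close>

lemma defect_step:
  assumes F: "\<And>k ks. 1 \<le> k \<Longrightarrow> F (k # ks) = G (k # ks) + r ^ k * G ks"
    and kl: "1 \<le> k" "1 \<le> l"
  shows "defect F (k # ks) (l # ls) = defect G (k # ks) (l # ls) + r ^ k * defect G ks (l # ls) +
    r ^ l * defect G (k # ks) ls + r ^ (k + l) * defect G ks ls"
proof -
  have m: "(\<Sum>m\<leftarrow>map ((#) k) xs. F m) = (\<Sum>m\<leftarrow>map ((#) k) xs. G m) + r ^ k * (\<Sum>m\<leftarrow>xs. G m)"
    if "1 \<le> k" for k xs
    by (induction xs) (simp_all add: F[OF that] algebra_simps)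
  have "1 \<le> k + l" using kl by simp
  then show ?thesis
    unfolding defect_def quasi_shuffle.simps map_append sum_list_append m[OF kl(1)] m[OF kl(2)] m[OF \<open>1 \<le> k + l\<close>] F[OF kl(1)] F[OF kl(2)]
    by (simp add: algebra_simps power_add)
qed

text \<open>Induction from \<open>N = 0\<close>, where all sums with nonempty index vanish.\<close>

lemma harm_sum_mult: "is_index ks \<Longrightarrow> is_index ls \<Longrightarrow> defect (harm_sum N) ks ls = 0"
proof (induction N arbitrary: ks ls)
  case 0
  show ?case
  proof (cases "ks = [] \<or> ls = []")
    case True
    then show ?thesis using defect_Nil[of "harm_sum 0"] harm_sum_Nil by blast
  next
    case False
    then obtain k ks' l ls' where kl: "ks = k # ks'" "ls = l # ls'" by (cases ks; cases ls) auto
    have "(\<Sum>m\<leftarrow>map ((#) k) xs. harm_sum 0 m) = 0" for k xs by (induction xs) (simp_all add: harm_sum_0)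
    then show ?thesis unfolding kl defect_def by (simp add: harm_sum_0)
  qed
next
  case (Suc N)
  show ?case
  proof (cases "ks = [] \<or> ls = []")
    case True
    then show ?thesis using defect_Nil[of "harm_sum (Suc N)"] harm_sum_Nil by blast
  next
    case False
    then obtain k ks' l ls' where kl: "ks = k # ks'" "ls = l # ls'" by (cases ks; cases ls) auto
    have i: "1 \<le> k" "1 \<le> l" "is_index ks'" "is_index ls'"
      using Suc.prems by (simp_all add: kl is_index_Cons)
    have F: "harm_sum (Suc N) (k # ks) = harm_sum N (k # ks) + (1 / of_nat (Suc N)) ^ k * harm_sum N ks" if "1 \<le> k" for k ks
      using harm_sum_Suc[OF that] by (simp add: power_one_over del: of_nat_Suc)
    have "defect (harm_sum (Suc N)) (k # ks') (l # ls') = defect (harm_sum N) (k # ks') (l # ls') +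
      (1 / of_nat (Suc N)) ^ k * defect (harm_sum N) ks' (l # ls') + (1 / of_nat (Suc N)) ^ l * defect (harm_sum N) (k # ks') ls' +
      (1 / of_nat (Suc N)) ^ (k + l) * defect (harm_sum N) ks' ls'"
      by (rule defect_step) (use F i in blast)+
    also have "\<dots> = 0" using i by (simp add: Suc.IH is_index_Cons)
    finally have "defect (harm_sum (Suc N)) (k # ks') (l # ls') = 0" .
    then show ?thesis by (simp only: kl)
  qed
qed

text \<open>This is \<open>\<Sum>j. c ^ (i + j) / fact (i + j) * F (d ^ j ks)\<close>, where the operator \<open>d\<close> removes a
  leading entry 1 and kills all other nonempty indices.\<close>

fun shift_exp :: "(nat list \<Rightarrow> complex) \<Rightarrow> nat \<Rightarrow> complex \<Rightarrow> nat list \<Rightarrow> complex" where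
  "shift_exp F i c [] = c ^ i / fact i * F []"
| "shift_exp F i c (k # ks) = c ^ i / fact i * F (k # ks) + (if k = 1 then shift_exp F (Suc i) c ks else 0)"

lemma shift_exp_deriv_Suc: "((\<lambda>c. shift_exp F (Suc i) c ks) has_field_derivative shift_exp F i c ks) (at c)"
proof (induction ks arbitrary: i)
  have p: "((\<lambda>c::complex. c ^ Suc i / fact (Suc i) * a) has_field_derivative c ^ i / fact i * a) (at c)" for i a
  proof -
    have "((\<lambda>c::complex. c ^ Suc i) has_field_derivative of_nat (Suc i) * c ^ i) (at c)"
      using DERIV_power[OF DERIV_ident, of "Suc i" c UNIV] by (simp del: of_nat_Suc power_Suc)
    then have "((\<lambda>c::complex. c ^ Suc i / fact (Suc i) * a) has_field_derivative
        of_nat (Suc i) * c ^ i / fact (Suc i) * a) (at c)"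
      by (intro DERIV_cmult_right DERIV_cdivide)
    moreover have "of_nat (Suc i) * c ^ i / fact (Suc i) * a = c ^ i / fact i * a"
      unfolding fact_Suc by (simp del: of_nat_Suc)
    ultimately show ?thesis by (simp only:)
  qed
  {
    case Nil
    show ?case unfolding shift_exp.simps by (rule p)
  next
    case (Cons k ks)
    show ?case
    proof (cases "k = 1")
      case True
      show ?thesis unfolding shift_exp.simps if_P[OF True] by (intro DERIV_add p Cons)
    next
      case False
      show ?thesis unfolding shift_exp.simps if_not_P[OF False] by (intro DERIV_add p DERIV_const)
    qed
  }
qed

text \<open>For \<open>i = 0\<close> the functional is F composed with exp (c d), and
  differentiation in \<open>c\<close> applies \<open>d\<close> once more.\<close>

lemma shift_exp_deriv_0:
  "((\<lambda>c. shift_exp F 0 c (k # ks)) has_field_derivative (if k = 1 then shift_exp F 0 c ks else 0)) (at c)"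
proof (cases "k = 1")
  case True
  have "((\<lambda>c. F (k # ks) + shift_exp F (Suc 0) c ks) has_field_derivative (0 + shift_exp F 0 c ks)) (at c)"
    by (intro DERIV_add DERIV_const shift_exp_deriv_Suc)
  then show ?thesis using True by simp
next
  case False
  then show ?thesis by simp
qed

lemma shift_exp_at_0: "shift_exp F 0 0 ks = F ks"
proof -
  have "shift_exp F (Suc i) 0 ks = 0" for i ks by (induction ks arbitrary: i) simp_all
  then show ?thesis by (cases ks) simp_all
qed

text \<open>The exponential of a derivation is an automorphism. By induction on the indices the
  defect has derivative 0 in \<open>c\<close>, and at \<open>c = 0\<close> it is the defect of
  \<open>F\<close>.\<close>

lemma shift_exp_mult:
  assumes F: "F [] = 1" "\<And>ks ls. is_index ks \<Longrightarrow> is_index ls \<Longrightarrow> defect F ks ls = 0"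
  shows "is_index ks \<Longrightarrow> is_index ls \<Longrightarrow> defect (shift_exp F 0 c) ks ls = 0"
proof (induction ks ls arbitrary: c rule: quasi_shuffle.induct)
  case (1 ls)
  show ?case by (rule defect_Nil) (simp add: F)
next
  case (2 k ks)
  show ?case by (rule defect_Nil) (simp add: F)
next
  case (3 k ks l ls)
  have i: "1 \<le> k" "1 \<le> l" "is_index ks" "is_index ls" using 3(4,5) by (simp_all add: is_index_Cons)
  let ?B = "\<lambda>c. shift_exp F 0 c"
  have m: "((\<lambda>c. \<Sum>m\<leftarrow>map ((#) k) xs. ?B c m) has_field_derivative
     (if k = 1 then \<Sum>m\<leftarrow>xs. ?B c m else 0)) (at c)" for k c and xs :: "nat list list"
  proof (induction xs)
    case (Cons x xs)
    have "((\<lambda>c. ?B c (k # x) + (\<Sum>m\<leftarrow>map ((#) k) xs. ?B c m)) has_field_derivative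
      (if k = 1 then ?B c x else 0) + (if k = 1 then \<Sum>m\<leftarrow>xs. ?B c m else 0)) (at c)"
      by (intro DERIV_add shift_exp_deriv_0 Cons)
    then show ?case by (simp split: if_splits)
  qed simp
  have "((\<lambda>c. defect (?B c) (k # ks) (l # ls)) has_field_derivative 0) (at c)" for c
  proof -
    have "((\<lambda>c. defect (?B c) (k # ks) (l # ls)) has_field_derivative
       (if k = 1 then ?B c ks else 0) * ?B c (l # ls) + (if l = 1 then ?B c ls else 0) * ?B c (k # ks)
       - ((if k = 1 then \<Sum>m\<leftarrow>quasi_shuffle ks (l # ls). ?B c m else 0) +
         ((if l = 1 then \<Sum>m\<leftarrow>quasi_shuffle (k # ks) ls. ?B c m else 0) +
          (if k + l = 1 then \<Sum>m\<leftarrow>quasi_shuffle ks ls. ?B c m else 0)))) (at c)"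
      unfolding defect_def quasi_shuffle.simps map_append sum_list_append
      by (intro DERIV_diff DERIV_add DERIV_mult shift_exp_deriv_0 m)
    \<comment> \<open>A merged entry is at least 2 and is killed by \<open>d\<close>; with this the
      three groups of terms follow the product rule.\<close>
    moreover have "k + l \<noteq> 1" using i by simp
    moreover have "?B c ks * ?B c (l # ls) = (\<Sum>m\<leftarrow>quasi_shuffle ks (l # ls). ?B c m)"
      using 3(1)[of c] 3(5) i by (simp only: defect_def) (simp add: is_index_Cons)
    moreover have "?B c ls * ?B c (k # ks) = (\<Sum>m\<leftarrow>quasi_shuffle (k # ks) ls. ?B c m)"
      using 3(2)[of c] 3(4) i by (simp only: defect_def) (simp add: is_index_Cons mult.commute)
    ultimately show ?thesis by (simp split: if_splits)
  qed
  then obtain d where d: "\<And>c. defect (?B c) (k # ks) (l # ls) = d"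
    using has_field_derivative_zero_constant[of UNIV "\<lambda>c. defect (?B c) (k # ks) (l # ls)"]
    by (metis convex_UNIV UNIV_I)
  have B0: "shift_exp F 0 0 = F" by (rule ext) (rule shift_exp_at_0)
  have "d = defect F (k # ks) (l # ls)" unfolding d[of 0, symmetric] B0 ..
  also have "\<dots> = 0" by (rule F(2)[OF 3(4,5)])
  finally show ?case unfolding d .
qed

lemma shift_exp_ones_Suc:
  "shift_exp (harm_sum (Suc N)) i c (replicate (Suc j) 1) =
   shift_exp (harm_sum N) i c (replicate (Suc j) 1) + shift_exp (harm_sum N) i c (replicate j 1) / of_nat (Suc N)"
proof (induction j arbitrary: i)
  case 0
  show ?case using harm_sum_Suc[of 1 N "[]"] by (simp add: harm_sum_Nil algebra_simps del: of_nat_Suc fact_Suc)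
next
  case (Suc j)
  have "shift_exp (harm_sum (Suc N)) i c (replicate (Suc (Suc j)) 1) =
      c ^ i / fact i * harm_sum (Suc N) (1 # replicate (Suc j) 1) + shift_exp (harm_sum (Suc N)) (Suc i) c (replicate (Suc j) 1)"
    by simp
  also have "harm_sum (Suc N) (1 # replicate (Suc j) 1) = harm_sum N (1 # replicate (Suc j) 1) + harm_sum N (replicate (Suc j) 1) / of_nat (Suc N)"
    using harm_sum_Suc[of 1 N "replicate (Suc j) 1"] by (simp del: of_nat_Suc)
  also have "shift_exp (harm_sum (Suc N)) (Suc i) c (replicate (Suc j) 1) =
     shift_exp (harm_sum N) (Suc i) c (replicate (Suc j) 1) + shift_exp (harm_sum N) (Suc i) c (replicate j 1) / of_nat (Suc N)" by (rule Suc)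
  finally show ?case by (simp add: algebra_simps add_divide_distrib del: of_nat_Suc fact_Suc)
qed

text \<open>Only the term in which all entries have been removed survives at
  \<open>N = 0\<close>.\<close>

lemma shift_exp_ones_init: "shift_exp (harm_sum 0) i c (replicate j 1) = c ^ (i + j) / fact (i + j)"
  by (induction j arbitrary: i) (simp_all add: harm_sum_Nil harm_sum_0 del: fact_Suc)

lemma harm_sum_bigo: "(\<lambda>N. harm_sum N ks) \<in> O(growth (1 / 8))"
proof -
  obtain C where C: "C > 0" "\<And>N. log_bound N ^ length (index_tail ks) \<le> C * (real N + 1) powr (1/8)"
    using log_bound_power_le[of "1/8" "length (index_tail ks)"] by auto
  show ?thesis
  proof (rule bigoI[where c = "C * 2"])
    show "eventually (\<lambda>N. norm (harm_sum N ks) \<le> C * 2 * norm (growth (1 / 8) N)) at_top"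
      using eventually_ge_at_top[of 1]
    proof eventually_elim
      case (elim N)
      have 1: "norm (harm_sum N ks) \<le> C * (real N + 1) powr (1/8)"
        unfolding harm_sum_def by (rule order.trans[OF norm_psum_le C(2)])
      have "(real N + 1) powr (1/8) \<le> (2 * real N) powr (1/8)"
        using elim by (intro powr_mono2) auto
      also have "\<dots> = 2 powr (1/8) * real N powr (1/8)" by (simp add: powr_mult)
      also have "\<dots> \<le> 2 powr 1 * real N powr (1/8)" by (intro mult_right_mono powr_mono) auto
      finally have "C * (real N + 1) powr (1/8) \<le> C * (2 powr 1 * real N powr (1/8))"
        using C(1) by (intro mult_left_mono) auto
      with 1 show ?case by (simp add: growth_def mult_ac)
    qed
  qed
qed

lemma shift_exp_bigo: "(\<lambda>N. shift_exp (harm_sum N) i c ks) \<in> O(growth (1 / 8))"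
proof (induction ks arbitrary: i)
  case Nil
  show ?case unfolding shift_exp.simps by (intro growth_bigo_cmult harm_sum_bigo)
next
  case (Cons k ks)
  have 1: "(\<lambda>N. c ^ i / fact i * harm_sum N (k # ks)) \<in> O(growth (1 / 8))"
    by (intro growth_bigo_cmult harm_sum_bigo)
  show ?case
  proof (cases "k = 1")
    case True
    show ?thesis unfolding shift_exp.simps if_P[OF True] by (rule sum_in_bigo(1)[OF 1 Cons])
  next
    case False
    show ?thesis unfolding shift_exp.simps if_not_P[OF False] add_0_right by (rule 1)
  qed
qed

lemma harm_sum_expand: "(\<lambda>N. harm_sum N ks - expand (index_tail ks) (\<lambda>j. psum (ones j) N)) \<in> O(growth (- 1 / 2))"
proof -
  obtain C where "C \<ge> 0" "\<And>N. norm (psum (index_tail ks) N - expand (index_tail ks) (\<lambda>j. psum (ones j) N)) \<le> C / sqrt (real N + 1)"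
    using psum_rate[OF admissible_index_tail] by blast
  then show ?thesis unfolding harm_sum_def by (intro sqrt_rate_bigo)
qed

text \<open>The operator \<open>d\<close> is compatible with the expansion: a leading entry 1 is
  removed on one side, while on the other \<open>expand\<close> shifts \<open>j\<close>. If the
  leading entry is larger, \<open>d\<close> gives 0 and the expansion is a constant.\<close>

lemma shift_exp_expand:
  assumes "is_index ks"
  shows "(\<lambda>N. shift_exp (harm_sum N) i c ks - expand (index_tail ks) (\<lambda>j. shift_exp (harm_sum N) i c (replicate j 1))) \<in> O(growth (- 1 / 2))"
  using assms
proof (induction ks arbitrary: i)
  case Nil
  show ?case by simp
next
  case (Cons k ks)
  let ?a = "c ^ i / fact i"
  let ?d = "\<lambda>N. harm_sum N (k # ks) - expand (index_tail (k # ks)) (\<lambda>j. psum (ones j) N)"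
  have k: "1 \<le> k" "is_index ks" using Cons.prems by (simp_all add: is_index_Cons)
  have 1: "(\<lambda>N. ?a * ?d N) \<in> O(growth (- 1 / 2))" by (intro growth_bigo_cmult harm_sum_expand)
  show ?case
  proof (cases "k = 1")
    case True
    have "shift_exp (harm_sum N) i c (k # ks) - expand (index_tail (k # ks)) (\<lambda>j. shift_exp (harm_sum N) i c (replicate j 1)) =
      ?a * ?d N + (shift_exp (harm_sum N) (Suc i) c ks - expand (index_tail ks) (\<lambda>j. shift_exp (harm_sum N) (Suc i) c (replicate j 1)))" for N
    proof -
      \<comment> \<open>The sum is written as a difference with the factor - 1 to fit
        \<open>expand_diff\<close> and \<open>expand_cmult\<close>.\<close>
      have "expand (index_tail ks) (\<lambda>j. shift_exp (harm_sum N) i c (replicate (Suc j) 1)) =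
        expand (index_tail ks) (\<lambda>j. ?a * psum (ones (Suc j)) N - (- 1) * shift_exp (harm_sum N) (Suc i) c (replicate j 1))"
        using index_tail_ones by (simp add: harm_sum_def[symmetric] del: fact_Suc) (simp add: harm_sum_def del: fact_Suc)
      also have "\<dots> = ?a * expand (index_tail ks) (\<lambda>j. psum (ones (Suc j)) N) + expand (index_tail ks) (\<lambda>j. shift_exp (harm_sum N) (Suc i) c (replicate j 1))"
        unfolding expand_diff expand_cmult by (simp del: fact_Suc)
      finally show ?thesis unfolding True by (simp add: harm_sum_Nil algebra_simps del: fact_Suc replicate_Suc)
    qed
    then show ?thesis using sum_in_bigo(1)[OF 1 Cons.IH[OF k(2), of "Suc i"]] by simp
  next
    case False
    then obtain m where m: "k = Suc (Suc m)" using k(1) by (metis One_nat_def Suc_le_D le_0_eq not0_implies_Suc)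
    have "shift_exp (harm_sum N) i c (k # ks) - expand (index_tail (k # ks)) (\<lambda>j. shift_exp (harm_sum N) i c (replicate j 1)) = ?a * ?d N" for N
      unfolding m by (simp add: harm_sum_Nil algebra_simps)
    then show ?thesis using 1 by simp
  qed
qed

lemma loop_coeff_expand: "(\<lambda>N. loop_coeff N ks - expand (index_tail ks) (\<lambda>j. loop_coeff N (replicate j 1))) \<in> O(growth (- 1 / 4))"
proof -
  obtain K where K: "K > 0" "\<And>M. norm (loop_int (index_tail ks) (Suc M) - expand (index_tail ks) (\<lambda>j. loop_int (ones j) (Suc M))) \<le> K * (real M + 1) powr (- 1 / 4)"
    using loop_int_asymp[OF admissible_index_tail] by blast
  have "(\<lambda>N. loop_int (index_tail ks) N - expand (index_tail ks) (\<lambda>j. loop_int (ones j) N)) \<in> O(growth (- 1 / 4))"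
  proof (rule bigoI[where c = K])
    show "eventually (\<lambda>N. norm (loop_int (index_tail ks) N - expand (index_tail ks) (\<lambda>j. loop_int (ones j) N)) \<le> K * norm (growth (- 1 / 4) N)) at_top"
      using eventually_ge_at_top[of 1]
    proof eventually_elim
      case (elim N)
      then obtain M where M: "N = Suc M" by (metis Suc_le_D One_nat_def)
      have "norm (growth (- 1 / 4) N) = (real M + 1) powr (- 1 / 4)"
        unfolding growth_def norm_of_real M by (simp add: add.commute)
      then show ?case using K(2)[of M] unfolding M by simp
    qed
  qed
  from growth_bigo_cmult[OF this, of "1 / tau"]
  have "(\<lambda>N. 1 / tau * loop_int (index_tail ks) N - 1 / tau * expand (index_tail ks) (\<lambda>j. loop_int (ones j) N)) \<in> O(growth (- 1 / 4))"
    by (simp only: right_diff_distrib)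
  then have *: "(\<lambda>N. 1 / tau * loop_int (index_tail ks) N - expand (index_tail ks) (\<lambda>j. 1 / tau * loop_int (ones j) N)) \<in> O(growth (- 1 / 4))"
    unfolding expand_cmult .
  have e: "loop_coeff N m = 1 / tau * loop_int (index_tail m) N" for N m by (simp add: loop_coeff_def)
  show ?thesis unfolding e index_tail_ones by (rule *)
qed

lemma loop_coeff_ones: "(\<lambda>N. loop_coeff N (replicate j 1) - shift_exp (harm_sum N) 0 pii (replicate j 1)) \<in> O(growth (- 1 / 4))"
proof (rule ones_asymp[where a = "\<lambda>N j. loop_coeff N (replicate j 1)" and b = "\<lambda>N j. shift_exp (harm_sum N) 0 pii (replicate j 1)"])
  show "loop_coeff N (replicate 0 1) = 1" for N by (simp add: loop_coeff_Nil)
  show "loop_coeff (Suc N) (replicate (Suc j) 1) = loop_coeff N (replicate (Suc j) 1) + loop_coeff (Suc N) (replicate j 1) / of_nat (Suc N)" for N j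
    using loop_coeff_Suc[of 1 N "replicate j 1"] by (simp del: of_nat_Suc)
  show "loop_coeff 0 (replicate j 1) = (2 * pii) ^ j / fact (Suc j)" for j
  proof -
    have p: "2 * pii = - tau" by (simp add: pii_def)
    have "loop_coeff 0 (replicate j 1) = (- tau) ^ j * ((- tau) / (- tau)) / fact (Suc j)"
      unfolding loop_coeff_def index_tail_ones loop_int_ones_0 by (simp add: field_simps del: fact_Suc)
    then show ?thesis unfolding p using tau_nz by (simp del: fact_Suc)
  qed
  show "shift_exp (harm_sum N) 0 pii (replicate 0 1) = 1" for N by (simp add: harm_sum_Nil)
  show "shift_exp (harm_sum (Suc N)) 0 pii (replicate (Suc j) 1) =
      shift_exp (harm_sum N) 0 pii (replicate (Suc j) 1) + shift_exp (harm_sum N) 0 pii (replicate j 1) / of_nat (Suc N)" for N j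
    by (rule shift_exp_ones_Suc)
  show "shift_exp (harm_sum 0) 0 pii (replicate j 1) = pii ^ j / fact j" for j
    unfolding shift_exp_ones_init by simp
  show "(\<lambda>N. shift_exp (harm_sum N) 0 pii (replicate j 1)) \<in> O(growth (1 / 8))" for j by (rule shift_exp_bigo)
qed

text \<open>Both sides are replaced by their expansions, which have the same coefficients; linearity
  of \<open>expand\<close> then reduces the comparison to the words \<open>ones j\<close>.\<close>

lemma loop_coeff_shift_exp:
  assumes "is_index ks"
  shows "(\<lambda>N. loop_coeff N ks - shift_exp (harm_sum N) 0 pii ks) \<in> O(growth (- 1 / 4))"
proof -
  let ?v = "index_tail ks"
  let ?b = "\<lambda>N. shift_exp (harm_sum N) 0 pii"
  have 1: "(\<lambda>N. expand ?v (\<lambda>j. loop_coeff N (replicate j 1) - ?b N (replicate j 1))) \<in> O(growth (- 1 / 4))"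
    unfolding expand_sum by (intro big_sum_in_bigo growth_bigo_cmult loop_coeff_ones)
  have 2: "(\<lambda>N. ?b N ks - expand ?v (\<lambda>j. ?b N (replicate j 1))) \<in> O(growth (- 1 / 4))"
    by (rule landau_o.big_trans[OF shift_exp_expand[OF assms] growth_bigo]) simp
  have eq: "loop_coeff N ks - ?b N ks = (loop_coeff N ks - expand ?v (\<lambda>j. loop_coeff N (replicate j 1))) +
    expand ?v (\<lambda>j. loop_coeff N (replicate j 1) - ?b N (replicate j 1)) - (?b N ks - expand ?v (\<lambda>j. ?b N (replicate j 1)))" for N
    unfolding expand_diff by simp
  show ?thesis unfolding eq by (rule sum_in_bigo(2)[OF sum_in_bigo(1)[OF loop_coeff_expand 1] 2])
qed

text \<open>The main term has defect 0. Every other term contains a difference of order - 1/4,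
  multiplied by at most one factor of order 1/8.\<close>

lemma loop_coeff_defect_bigo:
  assumes "is_index ks" "is_index ls"
  shows "(\<lambda>N. defect (loop_coeff N) ks ls) \<in> O(growth (- 1 / 8))"
proof -
  let ?b = "\<lambda>N. shift_exp (harm_sum N) 0 pii"
  let ?d = "\<lambda>m N. loop_coeff N m - ?b N m"
  have d: "?d m \<in> O(growth (- 1 / 4))" if "is_index m" for m by (rule loop_coeff_shift_exp[OF that])
  have b: "(\<lambda>N. ?b N m) \<in> O(growth (1 / 8))" for m by (rule shift_exp_bigo)
  have a: "(\<lambda>N. loop_coeff N m) \<in> O(growth (1 / 8))" if "is_index m" for m
  proof -
    have "(\<lambda>N. ?b N m + ?d m N) \<in> O(growth (1 / 8))"
      by (rule sum_in_bigo(1)[OF b]) (rule landau_o.big_trans[OF d[OF that] growth_bigo], simp)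
    then show ?thesis by simp
  qed
  have B: "defect (?b N) ks ls = 0" for N
    by (rule shift_exp_mult[OF _ _ assms]) (simp_all add: harm_sum_Nil harm_sum_mult)
  have 1: "(\<lambda>N. ?d ks N * loop_coeff N ls) \<in> O(growth (- 1 / 8))"
    by (rule growth_bigo_mult[OF d[OF assms(1)] a[OF assms(2)]]) simp
  have 2: "(\<lambda>N. ?b N ks * ?d ls N) \<in> O(growth (- 1 / 8))"
    by (rule growth_bigo_mult[OF b d[OF assms(2)]]) simp
  have "(\<lambda>N. \<Sum>m\<leftarrow>xs. ?d m N) \<in> O(growth (- 1 / 8))" if "\<forall>m\<in>set xs. is_index m" for xs
    using that
  proof (induction xs)
    case (Cons m xs)
    have "?d m \<in> O(growth (- 1 / 8))"
      by (rule landau_o.big_trans[OF d growth_bigo]) (use Cons.prems in simp_all)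
    moreover have "(\<lambda>N. \<Sum>m\<leftarrow>xs. ?d m N) \<in> O(growth (- 1 / 8))" by (rule Cons.IH) (use Cons.prems in simp)
    ultimately have "(\<lambda>N. ?d m N + (\<Sum>m\<leftarrow>xs. ?d m N)) \<in> O(growth (- 1 / 8))" by (rule sum_in_bigo(1))
    then show ?case by simp
  qed simp
  then have 3: "(\<lambda>N. \<Sum>m\<leftarrow>quasi_shuffle ks ls. ?d m N) \<in> O(growth (- 1 / 8))"
    using quasi_shuffle_index[OF assms] by blast
  have eq: "defect (loop_coeff N) ks ls = ?d ks N * loop_coeff N ls + ?b N ks * ?d ls N - (\<Sum>m\<leftarrow>quasi_shuffle ks ls. ?d m N)" for N
    using B[of N] by (simp add: defect_def sum_list_subtractf algebra_simps)
  show ?thesis unfolding eq by (rule sum_in_bigo(2)[OF sum_in_bigo(1)[OF 1 2] 3])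
qed

text \<open>Induction over both indices: the lower defects in \<open>defect_step\<close> vanish,
  which makes the defect constant in \<open>N\<close>, and its decay forces it to be 0.\<close>

lemma loop_coeff_mult: "is_index ks \<Longrightarrow> is_index ls \<Longrightarrow> defect (loop_coeff N) ks ls = 0"
proof (induction ks ls arbitrary: N rule: quasi_shuffle.induct)
  case (1 ls)
  show ?case by (rule defect_Nil(1)) (rule loop_coeff_Nil)
next
  case (2 k ks)
  show ?case by (rule defect_Nil(2)) (rule loop_coeff_Nil)
next
  case (3 k ks l ls)
  have i: "1 \<le> k" "1 \<le> l" "is_index ks" "is_index ls" using 3(4,5) by (simp_all add: is_index_Cons)
  have "defect (loop_coeff N) (k # ks) (l # ls) = defect (loop_coeff (Suc N)) (k # ks) (l # ls)" for N
  proof -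
    have "defect (loop_coeff N) (k # ks) (l # ls) = defect (loop_coeff (Suc N)) (k # ks) (l # ls) +
      (- 1 / of_nat (Suc N)) ^ k * defect (loop_coeff (Suc N)) ks (l # ls) + (- 1 / of_nat (Suc N)) ^ l * defect (loop_coeff (Suc N)) (k # ks) ls +
      (- 1 / of_nat (Suc N)) ^ (k + l) * defect (loop_coeff (Suc N)) ks ls"
      by (rule defect_step[OF _ i(1,2)]) (rule loop_coeff_Suc)
    then show ?thesis
      using 3(1)[of "Suc N"] 3(2)[of "Suc N"] 3(3)[of "Suc N"] 3(4,5) i(3,4) by (simp del: of_nat_Suc)
  qed
  then have c: "defect (loop_coeff N) (k # ks) (l # ls) = defect (loop_coeff 0) (k # ks) (l # ls)" for N
    by (induction N) simp_all
  obtain C where C: "eventually (\<lambda>N. norm (defect (loop_coeff N) (k # ks) (l # ls)) \<le> C * norm (growth (- 1 / 8) N)) at_top"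
    using loop_coeff_defect_bigo[OF 3(4,5)] by (rule landau_o.bigE)
  have "(\<lambda>N. defect (loop_coeff N) (k # ks) (l # ls)) \<longlonglongrightarrow> 0"
  proof (rule Lim_null_comparison[OF C])
    have "(\<lambda>N. C * real N powr (- 1 / 8)) \<longlonglongrightarrow> 0" by real_asymp
    then show "(\<lambda>N. C * norm (growth (- 1 / 8) N)) \<longlonglongrightarrow> 0" unfolding growth_def norm_of_real by simp
  qed
  moreover have "(\<lambda>N. defect (loop_coeff N) (k # ks) (l # ls)) = (\<lambda>N. defect (loop_coeff 0) (k # ks) (l # ls))"
    by (rule ext) (rule c)
  ultimately have "(\<lambda>N::nat. defect (loop_coeff 0) (k # ks) (l # ls)) \<longlonglongrightarrow> 0" by (simp only:)
  then have "defect (loop_coeff 0) (k # ks) (l # ls) = 0" by (rule LIMSEQ_unique[OF tendsto_const])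
  then show ?case by (simp only: c[of N])
qed

section \<open>From loop integrals back to regularized values\<close>

lemma Lam_E1_tau: "((\<lambda>x. Lam (E1 # index_tail ks) (of_real x + tau)) \<longlongrightarrow> - loop_int (index_tail ks) 0) (at_left 0)"
proof -
  let ?v = "index_tail ks"
  obtain Y where Y: "\<And>l. l \<in> left_half \<Longrightarrow> (Y has_field_derivative Lam ?v l * (1 - exp l) ^ 0) (at l)"
    "((\<lambda>x. Y (of_real x + tau) - Y (of_real x + 0)) \<longlongrightarrow> loop_int ?v 0) (at_left 0)"
    by (rule has_loop_intE[OF loop_int_has_loop_int[of ?v 0]]) (rule that)
  \<comment> \<open>\<open>- Lam (E1 # ?v)\<close> is another primitive of the integrand, one that
    tends to 0 at the end l = 0.\<close>
  have "((\<lambda>l. Y l + Lam (E1 # ?v) l) has_field_derivative 0) (at l within left_half)" if "l \<in> left_half" for l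
  proof -
    have "((\<lambda>l. Y l + Lam (E1 # ?v) l) has_field_derivative Lam ?v l * (1 - exp l) ^ 0 + - (Lam ?v l * log_form E1 l)) (at l)"
      by (intro DERIV_add Y(1) Lam_deriv that)
    then show ?thesis by (simp del: Lam.simps add: has_field_derivative_at_within)
  qed
  then obtain d where d: "\<And>l. l \<in> left_half \<Longrightarrow> Y l + Lam (E1 # ?v) l = d"
    using has_field_derivative_zero_constant[OF convex_left_half, of "\<lambda>l. Y l + Lam (E1 # ?v) l"] by blast
  have lim: "((\<lambda>x. Lam (E1 # ?v) (of_real x) - (Y (of_real x + tau) - Y (of_real x + 0))) \<longlongrightarrow> 0 - loop_int ?v 0) (at_left 0)"
    by (intro tendsto_diff Y(2) Lam_tendsto_0) (simp_all add: admissible_index_tail admissible_E1)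
  show ?thesis
  proof (rule Lim_transform_eventually[OF lim[unfolded diff_0]])
    show "eventually (\<lambda>x. Lam (E1 # ?v) (of_real x) - (Y (of_real x + tau) - Y (of_real x + 0)) = Lam (E1 # ?v) (of_real x + tau)) (at_left 0)"
      using eventually_neg[of "-1", simplified]
    proof eventually_elim
      case (elim x)
      have "of_real x + tau \<in> left_half" "of_real x + 0 \<in> left_half"
        using elim by (auto intro: line_left_half simp: left_half_def)
      then have "Y (of_real x + tau) + Lam (E1 # ?v) (of_real x + tau) = d" "Y (of_real x + 0) + Lam (E1 # ?v) (of_real x + 0) = d"
        by (auto simp only: d)
      then show ?case by (simp add: algebra_simps del: Lam.simps)
    qed
  qed
qed

text \<open>A logarithm of \<open>1 - gref t\<close>.\<close>

definition lref :: "real \<Rightarrow> complex" where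
  "lref t = of_real (ln (max (2/3) (max (1 - t) t))) + 2 * of_real pi * \<i> * of_real (clamp01 (3 * t - 1)) + tau"

lemma gref_lref: "gref t = 1 - exp (lref t)"
proof -
  have "exp tau = 1" by (simp add: exp_minus)
  moreover have "exp (of_real (ln (max (2/3) (max (1 - t) t))) :: complex) = of_real (max (2/3) (max (1 - t) t))"
    unfolding exp_of_real by (subst exp_ln) (simp_all add: less_max_iff_disj)
  ultimately show ?thesis by (simp only: gref_def polar_def lref_def exp_add mult_1_right)
qed

lemma lref_left_half:
  assumes "t \<in> {0<..<1}"
  shows "lref t \<in> left_half"
proof -
  have "ln (max (2/3) (max (1 - t) t)) < 0" using assms by (intro ln_less_zero) (auto simp: less_max_iff_disj)
  then show ?thesis by (simp add: lref_def left_half_def)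
qed

lemma lref_left: "0 \<le> t \<Longrightarrow> t \<le> 1/3 \<Longrightarrow> lref t = of_real (ln (1 - t)) + tau"
  and lref_mid: "1/3 \<le> t \<Longrightarrow> t \<le> 2/3 \<Longrightarrow> lref t = of_real (ln (2/3)) + 2 * of_real pi * \<i> * of_real (3 * t - 1) + tau"
  and lref_right: "2/3 \<le> t \<Longrightarrow> t \<le> 1 \<Longrightarrow> lref t = of_real (ln t)"
proof -
  show "lref t = of_real (ln (1 - t)) + tau" if "0 \<le> t" "t \<le> 1/3"
  proof -
    have "max (2/3) (max (1 - t) t) = 1 - t" "clamp01 (3 * t - 1) = 0" using that by (auto simp: clamp01_def max_def)
    then show ?thesis by (simp only: lref_def) simp
  qed
  show "lref t = of_real (ln (2/3)) + 2 * of_real pi * \<i> * of_real (3 * t - 1) + tau" if "1/3 \<le> t" "t \<le> 2/3"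
  proof -
    have "max (2/3) (max (1 - t) t) = 2/3" "clamp01 (3 * t - 1) = 3 * t - 1" using that by (auto simp: clamp01_def max_def)
    then show ?thesis by (simp only: lref_def)
  qed
  show "lref t = of_real (ln t)" if "2/3 \<le> t" "t \<le> 1"
  proof -
    have "max (2/3) (max (1 - t) t) = t" "clamp01 (3 * t - 1) = 1" using that by (auto simp: clamp01_def max_def)
    then show ?thesis by (simp only: lref_def) simp
  qed
qed

lemma continuous_lref: "continuous_on S lref"
  unfolding lref_def clamp01_def by (intro continuous_intros) (auto simp: max_def)

lemma hvd_ln:
  assumes "0 < t"
  shows "((\<lambda>t. of_real (ln t) :: complex) has_vector_derivative of_real (1 / t)) (at t)"
  by (rule has_vector_derivative_of_real)
     (use assms in \<open>auto intro!: derivative_eq_intros simp: has_real_derivative_iff_has_vector_derivative[symmetric]\<close>)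

lemma lref_differentiable:
  assumes "t \<in> {0<..<1} - {1/3, 2/3}"
  shows "\<exists>D. (lref has_vector_derivative D) (at t)"
proof -
  have l: "((\<lambda>t. of_real (ln (1 - t)) + tau) has_vector_derivative of_real (- 1 / (1 - t)) + 0) (at t)"
    by (intro has_vector_derivative_add has_vector_derivative_const has_vector_derivative_of_real)
       (use assms in \<open>auto intro!: derivative_eq_intros simp: has_real_derivative_iff_has_vector_derivative[symmetric]\<close>)
  have m: "((\<lambda>t. of_real (ln (2/3)) + 2 * of_real pi * \<i> * of_real (3 * t - 1) + tau)
      has_vector_derivative 2 * of_real pi * \<i> * 3) (at t)"
    by (auto intro!: derivative_eq_intros)
  have r: "((\<lambda>t. of_real (ln t) :: complex) has_vector_derivative of_real (1 / t)) (at t)"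
    by (rule hvd_ln) (use assms in simp)
  consider "t \<in> {0<..<1/3}" | "t \<in> {1/3<..<2/3}" | "t \<in> {2/3<..<1}" using assms by force
  then show ?thesis
  proof cases
    case 1
    have "(lref has_vector_derivative of_real (- 1 / (1 - t)) + 0) (at t)"
      by (rule has_vector_derivative_transform_within_open[OF l open_greaterThanLessThan 1])
         (use lref_left in auto)
    then show ?thesis by blast
  next
    case 2
    have "(lref has_vector_derivative 2 * of_real pi * \<i> * 3) (at t)"
      by (rule has_vector_derivative_transform_within_open[OF m open_greaterThanLessThan 2])
         (use lref_mid in auto)
    then show ?thesis by blast
  next
    case 3
    have "(lref has_vector_derivative of_real (1 / t)) (at t)"
      by (rule has_vector_derivative_transform_within_open[OF r open_greaterThanLessThan 3])
         (use lref_right in auto)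
    then show ?thesis by blast
  qed
qed

text \<open>The sign for each \<open>E0\<close> comes from dz / z = - \<open>log_form E0\<close> dl.
  The chosen branch \<open>lref\<close> ends at 0, where \<open>Lam\<close> is given by the power
  series.\<close>

definition loop_Lam :: "real \<Rightarrow> series" where
  "loop_Lam t v = (- 1) ^ count_list v E0 * Lam v (lref t)"

lemma flat_loop_Lam:
  assumes "0 < c" "c \<le> d" "d < 1"
  shows "flat gref c d loop_Lam"
  unfolding flat_def
proof (intro conjI allI ballI exI[of _ "{1/3, 2/3}"])
  fix u
  have "continuous_on left_half (Lam u)" by (rule holomorphic_on_imp_continuous_on[OF Lam_holomorphic])
  moreover have "lref ` {c..d} \<subseteq> left_half" by (rule image_subsetI, rule lref_left_half) (use assms in auto)
  ultimately have "continuous_on {c..d} (\<lambda>t. Lam u (lref t))"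
    by (rule continuous_on_compose2[OF _ continuous_lref])
  then show "continuous_on {c..d} (\<lambda>t. loop_Lam t u)"
    unfolding loop_Lam_def by (intro continuous_intros)
next
  fix t show "loop_Lam t [] = loop_Lam d []" by (simp add: loop_Lam_def)
next
  fix t a u assume t: "t \<in> {c<..<d} - {1/3, 2/3}"
  then have t01: "t \<in> {0<..<1}" "t \<in> {0<..<1} - {1/3, 2/3}" using assms by auto
  obtain D where D: "(lref has_vector_derivative D) (at t)" using lref_differentiable[OF t01(2)] by blast
  have l: "lref t \<in> left_half" by (rule lref_left_half[OF t01(1)])
  have "((\<lambda>t. exp (lref t)) has_vector_derivative (D * exp (lref t))) (at t)"
    using field_vector_diff_chain_at[OF D DERIV_exp] by (simp add: o_def)
  then have "((\<lambda>t. 1 - exp (lref t)) has_vector_derivative (0 - D * exp (lref t))) (at t)"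
    by (intro has_vector_derivative_diff has_vector_derivative_const)
  then have g: "vector_derivative gref (at t) = - (D * exp (lref t))"
    unfolding gref_lref[abs_def] by (intro vector_derivative_at) simp
  have "((\<lambda>t. Lam (a # u) (lref t)) has_vector_derivative D * - (Lam u (lref t) * log_form a (lref t))) (at t)"
    using field_vector_diff_chain_at[OF D Lam_deriv[OF l]] by (simp add: o_def del: Lam.simps)
  then have "((\<lambda>t. (- 1) ^ count_list (a # u) E0 * Lam (a # u) (lref t)) has_vector_derivative
      (- 1) ^ count_list (a # u) E0 * (D * - (Lam u (lref t) * log_form a (lref t)))) (at t)"
    by (rule has_vector_derivative_mult_right)
  moreover have "(- 1) ^ count_list (a # u) E0 * (D * - (Lam u (lref t) * log_form a (lref t))) = - (form gref a t * loop_Lam t u)"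
    using one_minus_exp_nz[OF l]
    by (cases a) (simp_all add: form_def g loop_Lam_def gref_lref divide_simps del: Lam.simps)
  ultimately show "((\<lambda>t. loop_Lam t (a # u)) has_vector_derivative - (form gref a t * loop_Lam t u)) (at t)"
    unfolding loop_Lam_def[of _ "a # u"] by (simp only:)
qed simp

text \<open>Suffixes of admissible words are admissible, and \<open>conv\<close> evaluates its right
  factor on suffixes only.\<close>

lemma conv_cong_admissible:
  assumes "\<And>v. admissible v \<Longrightarrow> G v = G' v"
  shows "admissible u \<Longrightarrow> conv F G u = conv F G' u"
proof (induction u arbitrary: F)
  case Nil
  then show ?case using assms by simp
next
  case (Cons a u)
  have "admissible u" using Cons.prems by cases
  then show ?case using Cons.IH[of "\<lambda>v. F (a # v)"] assms[OF Cons.prems] by simp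
qed

text \<open>\<open>loop_Lam t\<close> is the iterated integral from \<open>t\<close> to
  \<open>1 - t\<close> convolved with \<open>loop_Lam (1 - t)\<close>, and on admissible words the
  latter is \<open>eps\<close> up to O(t). The constant term at the start is therefore the
  regularized integral.\<close>

lemma log_poly_loop_Lam:
  assumes "admissible u"
  shows "log_poly (length u) (\<lambda>t. loop_Lam t u) (reg_value u)"
proof -
  \<comment> \<open>On other words nothing is known about the limit at the upper end; 0 is a
    placeholder that does not affect the entry at \<open>u\<close>.\<close>
  define G where "G t v = (if admissible v then loop_Lam (1 - t) v else 0)" for t v
  have G: "log_poly (length v) (\<lambda>t. G t v) (eps v)" for v
  proof (cases "admissible v \<and> v \<noteq> []")
    case True
    have "(\<lambda>t. G t v) \<in> O[at_right 0](\<lambda>t. of_real t)"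
    proof (rule bigoI[where c = 2])
      show "eventually (\<lambda>t. norm (G t v) \<le> 2 * norm (of_real t :: complex)) (at_right 0)"
        using eventually_in_01[OF divide_pos_pos[OF zero_less_one zero_less_numeral[of "Num.num.Bit1 Num.num.One"]]]
      proof eventually_elim
        case (elim t)
        have "lref (1 - t) = of_real (ln (1 - t))" by (rule lref_right) (use elim in auto)
        moreover have "Lam v (of_real (ln (1 - t))) = Li v (1 - exp (of_real (ln (1 - t))))"
          by (rule Lam_real) (use True elim in auto)
        moreover have "1 - exp (of_real (ln (1 - t))) = (of_real t :: complex)"
          unfolding exp_of_real using elim by (simp add: exp_ln)
        moreover have "norm (Li v (of_real t)) \<le> 2 * norm (of_real t :: complex)"
          by (rule norm_Li_le) (use True elim in auto)
        ultimately show ?case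
          using True by (simp add: G_def loop_Lam_def norm_mult norm_power del: Lam.simps)
      qed
    qed
    then have "log_poly (length v) (\<lambda>t. G t v) 0" by (rule log_poly_bigo)
    then show ?thesis using True by (simp add: eps_def)
  next
    case False
    then have "G t v = eps v" for t
      by (cases "v = []") (auto simp: G_def loop_Lam_def eps_def intro: admissible_Nil)
    then show ?thesis using log_poly_const by simp
  qed
  have "log_poly (0 + length u) (\<lambda>t. conv (word_int gref t (1 - t)) (G t) u) (conv reg_value eps u)"
    by (rule log_poly_conv) (simp_all add: log_poly_reg_value G)
  then have "log_poly (length u) (\<lambda>t. conv (word_int gref t (1 - t)) (G t) u) (reg_value u)" by simp
  then show ?thesis
  proof (rule log_poly_cong)
    show "eventually (\<lambda>t. conv (word_int gref t (1 - t)) (G t) u = loop_Lam t u) (at_right 0)"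
      using eventually_in_01[OF divide_pos_pos[OF zero_less_one zero_less_numeral[of "Num.num.Bit0 Num.num.One"]]]
    proof eventually_elim
      case (elim t)
      have "conv (word_int gref t (1 - t)) (G t) u = conv (word_int gref t (1 - t)) (loop_Lam (1 - t)) u"
        by (rule conv_cong_admissible[OF _ assms]) (simp add: G_def)
      also have "\<dots> = loop_Lam t u"
        by (subst flat_eq_conv_word_int[OF flat_gref flat_loop_Lam, of t "1 - t" t]) (use elim in auto)
      finally show ?case .
    qed
  qed
qed

text \<open>A polynomial in ln t that converges is constant.\<close>

lemma log_poly_tendsto:
  assumes "log_poly n f c" "(f \<longlongrightarrow> L) (at_right 0)"
  shows "c = L"
proof -
  obtain p where p: "coeff p 0 = c" "(\<lambda>t. f t - poly p (of_real (ln t))) \<in> O[at_right 0](\<lambda>t. of_real (t * ln t ^ (n + 1)))"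
    using assms(1) unfolding log_poly_def by blast
  obtain C where C: "eventually (\<lambda>t. norm (f t - poly p (of_real (ln t))) \<le> C * norm (of_real (t * ln t ^ (n + 1)) :: complex)) (at_right 0)"
    using p(2) by (rule landau_o.bigE)
  have "((\<lambda>t. f t - poly p (of_real (ln t))) \<longlongrightarrow> 0) (at_right 0)"
  proof (rule Lim_null_comparison[OF C])
    have "((\<lambda>t::real. t * ln t ^ (n + 1)) \<longlongrightarrow> 0) (at_right 0)" by real_asymp
    then have "((\<lambda>t::real. C * \<bar>t * ln t ^ (n + 1)\<bar>) \<longlongrightarrow> 0) (at_right 0)"
      by (intro tendsto_mult_right_zero tendsto_rabs_zero)
    then show "((\<lambda>t. C * norm (of_real (t * ln t ^ (n + 1)) :: complex)) \<longlongrightarrow> 0) (at_right 0)"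
      unfolding norm_of_real .
  qed
  from tendsto_diff[OF assms(2) this]
  have "((\<lambda>t. poly p (of_real (ln t)) - L) \<longlongrightarrow> 0) (at_right 0)"
    by (simp add: LIM_zero)
  then have "((\<lambda>t. poly (p - [:L:]) (of_real (ln t))) \<longlongrightarrow> 0) (at_right 0)" by simp
  then have "p - [:L:] = 0" by (rule poly_tendsto_0_imp_0)
  then have "p = [:L:]" by simp
  then show ?thesis using p(1) by simp
qed

lemma count_index_tail: "is_index ks \<Longrightarrow> count_list (index_tail ks) E0 + length ks = sum_list ks"
proof (induction ks)
  case (Cons k ks)
  have "count_list (replicate m E0 @ v) E0 = m + count_list v E0" for m v by (induction m) simp_all
  then show ?case using Cons by (simp add: is_index_Cons)
qed simp

text \<open>\<open>loop_int\<close> runs from 0 to \<open>tau\<close> but \<open>lref\<close> from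
  \<open>tau\<close> to 0, which accounts for the leading minus sign.\<close>

lemma reg_value_index_word: "reg_value (index_word ks) = - ((- 1) ^ count_list (index_tail ks) E0 * loop_int (index_tail ks) 0)"
proof (rule log_poly_tendsto)
  let ?u = "E1 # index_tail ks"
  let ?s = "(- 1) ^ count_list (index_tail ks) E0 :: complex"
  show "log_poly (length ?u) (\<lambda>t. loop_Lam t ?u) (reg_value (index_word ks))"
    unfolding index_word_index_tail by (rule log_poly_loop_Lam) (rule admissible_E1[OF admissible_index_tail])
  have "filterlim (\<lambda>t::real. ln (1 - t)) (at_left 0) (at_right 0)" by real_asymp
  from filterlim_compose[OF Lam_E1_tau this]
  have "((\<lambda>t. ?s * Lam ?u (of_real (ln (1 - t)) + tau)) \<longlongrightarrow> ?s * - loop_int (index_tail ks) 0) (at_right 0)"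
    by (intro tendsto_mult tendsto_const)
  moreover have "eventually (\<lambda>t. ?s * Lam ?u (of_real (ln (1 - t)) + tau) = loop_Lam t ?u) (at_right 0)"
    using eventually_in_01[OF divide_pos_pos[OF zero_less_one zero_less_numeral[of "Num.num.Bit1 Num.num.One"]]]
    by eventually_elim (simp add: loop_Lam_def lref_left del: Lam.simps)
  ultimately have "((\<lambda>t. loop_Lam t ?u) \<longlongrightarrow> ?s * - loop_int (index_tail ks) 0) (at_right 0)" by (rule Lim_transform_eventually)
  then show "((\<lambda>t. loop_Lam t ?u) \<longlongrightarrow> - (?s * loop_int (index_tail ks) 0)) (at_right 0)" by (simp only: mult_minus_right)
qed

text \<open>The signs of \<open>w\<close>, of the letters \<open>E0\<close> and of the orientation
  combine to the parity of the weight, which quasi-shuffles preserve.\<close>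

lemma Z_RS_w:
  assumes "is_index ks"
  shows "Z_RS (w ks) = (- 1) ^ sum_list ks * loop_coeff 0 ks"
proof -
  have "Z_RS (w ks) = (- 1) ^ length ks * reg_value (index_word ks) / (2 * of_real pi * \<i>)"
    by (simp add: Z_RS_linear_ext w_eq_scal linear_ext_scal of_rat_power of_rat_minus)
  also have "\<dots> = (- 1) ^ (count_list (index_tail ks) E0 + length ks) * (loop_int (index_tail ks) 0 / tau)"
    unfolding reg_value_index_word by (simp add: power_add)
  finally show ?thesis unfolding count_index_tail[OF assms] loop_coeff_def .
qed

lemma w_Cons: "w (k # ks) = - (gen E1 * gen E0 ^ (k - 1) * w ks)"
proof -
  have "(- 1) ^ n * (x * y) = x * ((- 1) ^ n * y)" for n and x y :: ncpoly
    by (cases "even n") simp_all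
  then show ?thesis by (simp add: w_def mult.assoc)
qed

text \<open>Prefixing an entry to \<open>w\<close> changes the sign, which turns the three minus
  signs of \<open>harmonic_index\<close> into plus signs.\<close>

lemma harmonic_index_quasi_shuffle: "harmonic_index ks ls = (\<Sum>m\<leftarrow>quasi_shuffle ks ls. w m)"
proof (induction ks ls rule: quasi_shuffle.induct)
  case (3 k ks l ls)
  have "(\<Sum>m\<leftarrow>map ((#) k) xs. w m) = - (gen E1 * gen E0 ^ (k - 1) * (\<Sum>m\<leftarrow>xs. w m))" for k xs
    by (induction xs) (simp_all add: w_Cons algebra_simps)
  then show ?case by (simp add: 3 algebra_simps)
qed simp_all

lemma Z_RS_harmonic_index:
  assumes "is_index ks" "is_index ls"
  shows "Z_RS (harmonic_index ks ls) = Z_RS (w ks) * Z_RS (w ls)"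
proof -
  have add: "Z_RS (p + q) = Z_RS p + Z_RS q" for p q by (simp add: Z_RS_linear_ext linear_ext_add add_divide_distrib)
  have "Z_RS (\<Sum>m\<leftarrow>xs. w m) = (- 1) ^ n * (\<Sum>m\<leftarrow>xs. loop_coeff 0 m)"
    if "\<forall>m\<in>set xs. is_index m \<and> sum_list m = n" for xs n
    using that
  proof (induction xs)
    case Nil
    show ?case by (simp add: Z_RS_linear_ext)
  next
    case (Cons m xs)
    then show ?case by (simp add: add Z_RS_w distrib_left)
  qed
  then have "Z_RS (harmonic_index ks ls) = (- 1) ^ (sum_list ks + sum_list ls) * (\<Sum>m\<leftarrow>quasi_shuffle ks ls. loop_coeff 0 m)"
    unfolding harmonic_index_quasi_shuffle using quasi_shuffle_index[OF assms] quasi_shuffle_weight by blast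
  also have "(\<Sum>m\<leftarrow>quasi_shuffle ks ls. loop_coeff 0 m) = loop_coeff 0 ks * loop_coeff 0 ls"
    using loop_coeff_mult[OF assms, of 0] by (simp add: defect_def)
  finally show ?thesis using assms by (simp add: Z_RS_w power_add)
qed

lemma Z_RS_hh0:
  assumes "u \<in> hh0"
  shows "Z_RS u = (\<Sum>ks\<in>index_support u. of_rat (index_coeff u ks) * Z_RS (w ks))"
proof -
  have im: "Poly_Mapping.keys u = index_word ` index_support u"
    using keys_hh0[OF assms] unfolding index_support_def by blast
  have inj: "inj_on index_word (index_support u)"
    by (rule inj_onI) (auto simp: index_support_def intro: index_word_inj)
  have "Z_RS u = (\<Sum>ks\<in>index_support u. of_rat (Poly_Mapping.lookup u (index_word ks)) * reg_value (index_word ks)) / (2 * of_real pi * \<i>)"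
    unfolding Z_RS_linear_ext linear_ext_def im sum.reindex[OF inj] by simp
  also have "\<dots> = (\<Sum>ks\<in>index_support u. of_rat (index_coeff u ks) * Z_RS (w ks))"
    unfolding sum_divide_distrib
  proof (rule sum.cong[OF refl])
    fix ks :: "nat list"
    have "(- 1) ^ length ks * ((- 1) ^ length ks :: complex) = 1" by (simp flip: power_mult_distrib)
    then show "of_rat (Poly_Mapping.lookup u (index_word ks)) * reg_value (index_word ks) / (2 * of_real pi * \<i>)
      = of_rat (index_coeff u ks) * Z_RS (w ks)"
      by (simp add: Z_RS_linear_ext w_eq_scal linear_ext_scal index_coeff_def of_rat_power of_rat_minus of_rat_mult mult_ac)
  qed
  finally show ?thesis .
qed

lemma Z_RS_harmonic:
  assumes "u \<in> hh0" "v \<in> hh0"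
  shows "Z_RS (harmonic_prod u v) = Z_RS u * Z_RS v"
proof -
  have "Z_RS (harmonic_prod u v) =
    (\<Sum>ks\<in>index_support u. \<Sum>ls\<in>index_support v. of_rat (index_coeff u ks * index_coeff v ls) * Z_RS (harmonic_index ks ls))"
    unfolding Z_RS_linear_ext harmonic_prod_def linear_ext_sum linear_ext_scal by (simp add: sum_divide_distrib)
  also have "\<dots> = (\<Sum>ks\<in>index_support u. \<Sum>ls\<in>index_support v.
     (of_rat (index_coeff u ks) * Z_RS (w ks)) * (of_rat (index_coeff v ls) * Z_RS (w ls)))"
  proof (intro sum.cong refl)
    fix ks ls assume "ks \<in> index_support u" "ls \<in> index_support v"
    then have "is_index ks" "is_index ls" by (simp_all add: index_support_def)
    then show "of_rat (index_coeff u ks * index_coeff v ls) * Z_RS (harmonic_index ks ls) =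
      (of_rat (index_coeff u ks) * Z_RS (w ks)) * (of_rat (index_coeff v ls) * Z_RS (w ls))"
      by (simp add: Z_RS_harmonic_index of_rat_mult mult_ac)
  qed
  finally show ?thesis unfolding Z_RS_hh0[OF assms(1)] Z_RS_hh0[OF assms(2)] sum_product .
qed

theorem theorem3p1:
  shows "(\<forall>u\<in>hh. \<forall>v\<in>hh. Z_RS (shuffle_prod u v) = 2 * of_real pi * \<i> * Z_RS u * Z_RS v) \<and>
         (\<forall>u\<in>hh0. \<forall>v\<in>hh0. Z_RS (harmonic_prod u v) = Z_RS u * Z_RS v)"
  using Z_RS_shuffle Z_RS_harmonic by simp

end
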